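(* There exists a $C^2$-neighborhood $\mathcal{B}$ of the unit ball $B$ in $\mathcal{A}$ such that for any $A$ in $\mathcal{B}$ and any $n$-normalized symplectic capacity $c$ on $(\mathbb{C}^n,\omega_0)$ the following facts hold: (i) There exist an ellipsoid $E$ with $c(E)=c(A)$ and a symplectomorphism $\phi:\mathbb{C}^n\to\mathbb{C}^n$ such that $\phi(E)\subset A$. (ii) There exists a symplectomorphism $\psi:\mathbb{C}^n\to\mathbb{C}^n$ mapping $A$ into the ball $B'$ (centered at the origin) such that $c(B')=c(A)$. In particular, all $n$-normalized symplectic capacities coincide on $\mathcal{B}$.
   Context: $\mathbb{C}^n$ has coordinates $z_j=x_j+iy_j$ and symplectic form $\omega_0=\sum_j dx_j\wedge dy_j$. A symplectomorphism is a diffeomorphism preserving $\omega_0$. $B$ is the open unit ball and $Z=\{|z_1|<1\}$. A symplectic capacity is a function $c$ from open subsets of $\mathbb{C}^n$ to $[0,+\infty]$ such that: (monotonicity) if there is a symplectomorphism $\phi:\mathbb{C}^n\to\mathbb{C}^n$ with $\phi(A)\subset A'$ then $c(A)\le c(A')$; (conformality) $c(rA)=r^2c(A)$ for all $r>0$; (non-triviality) $c(B)>0$ and $c(Z)<\infty$. For $a_1,\dots,a_n>0$ let $E(a_1,\dots,a_n)=\{z\in\mathbb{C}^n:\sum_{j=1}^n\frac{\pi}{a_j}|z_j|^2<1\}$. Every (open, full-dimensional) ellipsoid in $\mathbb{C}^n$ is linearly symplectically equivalent to some $E(a_1,\dots,a_n)$. For an ellipsoid $E$ linearly symplectically equivalent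 to $E(a_1,\dots,a_n)$ let $\widehat{c}_k(E)$ be the $k$-th element in the sequence obtained by ordering the list $(ha_j)_{h\in\mathbb{N},\,j=1,\dots,n}$ ($\mathbb{N}=\{1,2,\dots\}$) in increasing order, allowing repetitions. (This is the common value on $E$ of the $k$-th Ekeland--Hofer and Gutt--Hutchings capacities.) A symplectic capacity $c$ is $k$-normalized if $c(E)=\widehat{c}_k(E)$ for every ellipsoid $E$. $\mathcal{A}$ is the set of bounded open neighborhoods of the origin in $\mathbb{C}^n$ whose boundary is smooth and transverse to the radial direction, equivalently the sets $A_f=\{rz: z\in S^{2n-1},\ 0\le r<f(z)\}$ with $f$ a smooth positive function on $S^{2n-1}$. The $C^k$-distance between $A_f$ and $A_g$ is the $C^k$-distance between $f$ and $g$; $B=A_1$. *)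

theory Defs
  imports "HOL-Analysis.Analysis"
begin

section \<open>Smooth maps\<close>

fun iter_deriv ::
  "'a::real_normed_vector list \<Rightarrow> ('a \<Rightarrow> 'b::real_normed_vector) \<Rightarrow> 'a \<Rightarrow> 'b" where
  "iter_deriv [] f = f"
| "iter_deriv (v # vs) f = (\<lambda>x. frechet_derivative (iter_deriv vs f) (at x) v)"

text \<open>For open \<open>S\<close> in finite dimension this is \<open>C\<^sup>\<infinity>\<close>: differentiability of all
  iterated directional derivatives makes all of them continuous.\<close>

definition smooth_on :: "'a::euclidean_space set \<Rightarrow> ('a \<Rightarrow> 'b::euclidean_space) \<Rightarrow> bool" where
  "smooth_on S f \<longleftrightarrow> (\<forall>vs. \<forall>x\<in>S. iter_deriv vs f differentiable (at x))"

definition diffeomorphism :: "('a::euclidean_space \<Rightarrow> 'b::euclidean_space) \<Rightarrow> bool" where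
  "diffeomorphism \<phi> \<longleftrightarrow> bij \<phi> \<and> smooth_on UNIV \<phi> \<and> smooth_on UNIV (inv \<phi>)"


section \<open>Symplectic geometry of complex n-space\<close>

definition omega0 :: "complex^'n \<Rightarrow> complex^'n \<Rightarrow> real" where
  "omega0 v w = (\<Sum>j\<in>UNIV. Re (v $ j) * Im (w $ j) - Im (v $ j) * Re (w $ j))"

definition symplectomorphism :: "(complex^'n \<Rightarrow> complex^'n) \<Rightarrow> bool" where
  "symplectomorphism \<phi> \<longleftrightarrow> diffeomorphism \<phi> \<and>
     (\<forall>z v w. omega0 (frechet_derivative \<phi> (at z) v) (frechet_derivative \<phi> (at z) w) = omega0 v w)"

definition linear_symplectic :: "(complex^'n \<Rightarrow> complex^'n) \<Rightarrow> bool" where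
  "linear_symplectic L \<longleftrightarrow> linear L \<and> (\<forall>v w. omega0 (L v) (L w) = omega0 v w)"

definition cylinder :: "'n \<Rightarrow> (complex^'n) set" where
  "cylinder j = {z. cmod (z $ j) < 1}"

text \<open>A capacity is a function on open sets; its values on other sets are irrelevant and
  unconstrained. The index type carries no distinguished first element. Permutations of the
  coordinates are symplectic, so by monotonicity finiteness on one of the cylinders
  \<open>{z. cmod (z $ j) < 1}\<close> is the same as finiteness on all of them.\<close>

definition symplectic_capacity :: "((complex^'n) set \<Rightarrow> ennreal) \<Rightarrow> bool" where
  "symplectic_capacity c \<longleftrightarrow>
     (\<forall>A A' \<phi>. open A \<and> open A' \<and> symplectomorphism \<phi> \<and> \<phi> ` A \<subseteq> A' \<longrightarrow> c A \<le> c A') \<and>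
     (\<forall>A r. open A \<and> r > 0 \<longrightarrow> c ((\<lambda>z. r *\<^sub>R z) ` A) = ennreal (r\<^sup>2) * c A) \<and>
     c (ball 0 1) > 0 \<and> (\<exists>j. c (cylinder j) < \<infinity>)"


section \<open>Ellipsoids and normalized capacities\<close>

text \<open>Ellipsoids are open, full-dimensional and centered at the origin.\<close>

definition ellipsoid :: "(complex^'n) set \<Rightarrow> bool" where
  "ellipsoid E \<longleftrightarrow> (\<exists>L :: complex^'n \<Rightarrow> complex^'n. linear L \<and> bij L \<and> E = L ` ball 0 1)"

definition std_ellipsoid :: "('n \<Rightarrow> real) \<Rightarrow> (complex^'n) set" where
  "std_ellipsoid a = {z. (\<Sum>j\<in>UNIV. pi / a j * (cmod (z $ j))\<^sup>2) < 1}"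

definition linearly_symplectically_equivalent ::
  "(complex^'n) set \<Rightarrow> (complex^'n) set \<Rightarrow> bool" where
  "linearly_symplectically_equivalent E E' \<longleftrightarrow> (\<exists>L. linear_symplectic L \<and> L ` E = E')"

text \<open>The sequence \<open>s 1, s 2, \<dots>\<close> lists the numbers \<open>h * a j\<close>, with \<open>h \<ge> 1\<close>, in increasing
  order, each value as often as it occurs. The entry \<open>s 0\<close> is not used. For positive \<open>a\<close>
  the sequence exists and \<open>s k\<close> is determined by \<open>a\<close> for every \<open>k \<ge> 1\<close>.\<close>

definition ordered_multiples :: "('n::finite \<Rightarrow> real) \<Rightarrow> (nat \<Rightarrow> real) \<Rightarrow> bool" where
  "ordered_multiples a s \<longleftrightarrow> mono_on {1..} s \<and>
     (\<exists>e. bij_betw e {1..} ({1..} \<times> UNIV) \<and> (\<forall>k\<ge>1. s k = real (fst (e k)) * a (snd (e k))))"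

text \<open>\<open>ellipsoid_value k E v\<close> says that \<open>v\<close> is the \<open>k\<close>-th capacity value of the ellipsoid \<open>E\<close>.
  It is kept as a relation, since its being a function of \<open>E\<close> is Williamson's theorem.\<close>

definition ellipsoid_value :: "nat \<Rightarrow> (complex^'n) set \<Rightarrow> real \<Rightarrow> bool" where
  "ellipsoid_value k E v \<longleftrightarrow>
     (\<exists>a s. (\<forall>j. a j > 0) \<and> linearly_symplectically_equivalent E (std_ellipsoid a) \<and>
            ordered_multiples a s \<and> v = s k)"

definition normalized :: "nat \<Rightarrow> ((complex^'n) set \<Rightarrow> ennreal) \<Rightarrow> bool" where
  "normalized k c \<longleftrightarrow> (\<forall>E v. ellipsoid E \<and> ellipsoid_value k E v \<longrightarrow> c E = ennreal v)"


section \<open>Smooth star-shaped domains\<close>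

text \<open>Only the values of \<open>f\<close> on the unit sphere matter below. A function on the sphere is smooth
  iff its extension to the punctured space that is constant along rays is smooth.\<close>

definition radial_ext :: "('a::euclidean_space \<Rightarrow> real) \<Rightarrow> 'a \<Rightarrow> real" where
  "radial_ext f x = f (x /\<^sub>R norm x)"

definition smooth_positive_on_sphere :: "('a::euclidean_space \<Rightarrow> real) \<Rightarrow> bool" where
  "smooth_positive_on_sphere f \<longleftrightarrow>
     smooth_on (- {0}) (radial_ext f) \<and> (\<forall>z\<in>sphere 0 1. f z > 0)"

definition radial_domain :: "('a::euclidean_space \<Rightarrow> real) \<Rightarrow> 'a set" where
  "radial_domain f = {r *\<^sub>R z | r z. z \<in> sphere 0 1 \<and> 0 \<le> r \<and> r < f z}"

definition smooth_star_domains :: "'a::euclidean_space set set" where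
  "smooth_star_domains = {radial_domain f | f. smooth_positive_on_sphere f}"

text \<open>The \<open>C\<^sup>k\<close>-norm of \<open>f - g\<close> on the sphere, read off from all partial derivatives of order at
  most \<open>k\<close> of the radial extension. The supremum is finite for smooth \<open>f\<close> and \<open>g\<close>. On the compact
  sphere all the usual \<open>C\<^sup>k\<close>-norms are equivalent, so they define the same neighborhoods.\<close>

definition Ck_dist :: "nat \<Rightarrow> ('a::euclidean_space \<Rightarrow> real) \<Rightarrow> ('a \<Rightarrow> real) \<Rightarrow> real" where
  "Ck_dist k f g =
     (SUP (vs, z) \<in> {vs. set vs \<subseteq> Basis \<and> length vs \<le> k} \<times> sphere 0 1.
        \<bar>iter_deriv vs (radial_ext (\<lambda>x. f x - g x)) z\<bar>)"

definition Ck_neighborhood :: "nat \<Rightarrow> 'a::euclidean_space set \<Rightarrow> 'a set set \<Rightarrow> bool" where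
  "Ck_neighborhood k A \<B> \<longleftrightarrow> \<B> \<subseteq> smooth_star_domains \<and>
     (\<exists>f. smooth_positive_on_sphere f \<and> A = radial_domain f \<and>
        (\<exists>\<delta>>0. \<forall>g. smooth_positive_on_sphere g \<and> Ck_dist k f g < \<delta> \<longrightarrow> radial_domain g \<in> \<B>))"

end

theory Submission
  imports Defs
begin

text \<open>A domain close to the ball is \<open>{N < 1/2}\<close> for a 2-homogeneous \<open>N\<close> close to \<open>\<bar>x\<bar>\<^sup>2/2\<close>. Let \<open>H\<close> be
  \<open>c N\<close> near the unit sphere, cut off to \<open>\<bar>x\<bar>\<^sup>2/2\<close> away from it, so that the Hamiltonian flow of \<open>H\<close> is
  close to the Hopf flow \<open>R\<close>. Averaging \<open>R (-s) \<circ> \<phi> s\<close> over a period gives a diffeomorphism with inverse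
  \<open>r\<close>, in whose coordinates the Hamiltonian vector field is \<open>J y + \<delta>' y\<close>. Let \<open>\<Gamma> y\<close> be the average of
  \<open>H \<circ> r\<close> over the Hopf circle of \<open>y\<close> minus the action of the loop \<open>r (R s y)\<close>. The gradient of \<open>\<Gamma>\<close> is
  \<open>-J \<delta>'\<close> up to a relatively small error, hence \<open>\<bar>\<delta>'\<bar>\<^sup>2\<close> is controlled by \<open>\<Gamma>\<close> as soon as \<open>\<Gamma> \<ge> 0\<close>. The
  intermediate value theorem provides a \<open>c\<close> for which the minimum of \<open>\<Gamma>\<close> on the unit sphere is \<open>0\<close>; then
  \<open>\<Gamma>\<close> and \<open>\<delta>'\<close> vanish on the complex line through a minimum point.

  Moser's method first deforms the pulled back symplectic form into its average over the Hopf flow, while \<open>H\<close>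
  changes by an amount comparable to \<open>\<Gamma>\<close>, and then into the standard form. This yields a
  symplectomorphism \<open>F\<close> with \<open>\<bar>y\<bar>\<^sup>2/2 \<le> c N (F y) \<le> \<bar>y\<bar>\<^sup>2/2 + \<bar>p y\<bar>\<^sup>2/2\<close>, where \<open>p\<close> is the projection onto
  the orthogonal complement of the line. So \<open>F\<close> maps the ellipsoid \<open>\<bar>y\<bar>\<^sup>2 + \<bar>p y\<bar>\<^sup>2 < c\<close> into the domain and \<open>F\<^sup>-\<^sup>1\<close> maps the domain
  into the ball of radius \<open>sqrt c\<close>. The \<open>n\<close>-th value of both is \<open>pi c\<close>, since the only multiples below \<open>pi c\<close>
  are the \<open>n - 1\<close> weights \<open>pi c/2\<close> of the ellipsoid.\<close>

section \<open>Maps of class \<open>C\<^sup>k\<close>\<close>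

text \<open>Only two derivatives of the boundary are small, so the perturbation of the vector field
  is small only in the Lipschitz sense. All estimates on \<open>\<zeta>\<close>, \<open>u\<close>,
  \<open>r\<close> and \<open>\<delta>'\<close> are therefore Lipschitz estimates; higher smoothness
  is carried along without constants. The cutoff is there because a 2-homogeneous function is in
  general not \<open>C\<^sup>2\<close> at the origin. The lower bound for \<open>c N\<close> is
  sharp, so errors that are merely small are useless: they must be dominated by
  \<open>\<Gamma>\<close>. The isotopy raises the energy at rate \<open>\<Gamma>\<close> up to an
  error quadratic in \<open>\<delta>'\<close>, and a nonnegative function whose gradient is about
  \<open>\<delta>'\<close> in length and varies with Lipschitz constant about
  \<open>\<kappa>\<close> dominates that square with a factor of order \<open>1/\<kappa>\<close>.
  The zero of \<open>\<Gamma>\<close> serves the upper bound: off its complex line the excess is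
  quadratic in the distance, with a factor of order \<open>\<kappa>\<close>. The capacities tolerate
  much more, since the weights transverse to the line may drop to half of \<open>pi c\<close> before
  a second multiple falls below \<open>pi c\<close>. The numerical constants only leave
  room.\<close>

primrec Ck :: "nat \<Rightarrow> 'a::euclidean_space set \<Rightarrow> ('a \<Rightarrow> 'b::real_normed_vector) \<Rightarrow> bool" where
  "Ck 0 S f \<longleftrightarrow> continuous_on S f"
| "Ck (Suc k) S f \<longleftrightarrow> (\<forall>x\<in>S. f differentiable (at x)) \<and>
     (\<forall>v. Ck k S (\<lambda>x. frechet_derivative f (at x) v))"

text \<open>\<open>smooth_on\<close> asks for a Euclidean codomain, whereas the maps below also take
  values in spaces of bounded linear maps. As \<open>Ck\<close> differentiates in fixed directions,
  every derivative keeps the type of the function and no multilinear maps occur.\<close>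

definition Cinf :: "'a::euclidean_space set \<Rightarrow> ('a \<Rightarrow> 'b::real_normed_vector) \<Rightarrow> bool" where
  "Cinf S f \<longleftrightarrow> (\<forall>k. Ck k S f)"

abbreviation dd :: "('a::euclidean_space \<Rightarrow> 'b::real_normed_vector) \<Rightarrow> 'a \<Rightarrow> 'a \<Rightarrow> 'b" where
  "dd f x v \<equiv> frechet_derivative f (at x) v"

lemma Ck_cong:
  assumes "open S" "\<And>x. x \<in> S \<Longrightarrow> f x = g x" "Ck k S f"
  shows "Ck k S g"
  using assms(2,3)
proof (induction k arbitrary: f g)
  case 0
  then show ?case by (metis Ck.simps(1) continuous_on_cong)
next
  case (Suc k)
  have d: "g differentiable (at x)" "dd f x = dd g x" if "x \<in> S" for x
  proof -
    have 1: "(f has_derivative dd f x) (at x)"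
      using Suc.prems(2) that frechet_derivative_works by auto
    have 2: "(g has_derivative dd f x) (at x)"
      by (rule has_derivative_transform_within_open[OF 1 assms(1) that]) (use Suc.prems(1) in auto)
    show "g differentiable (at x)" using 2 by (auto simp: differentiable_def)
    show "dd f x = dd g x" using 2 by (simp add: frechet_derivative_at)
  qed
  show ?case
    unfolding Ck.simps
  proof (intro conjI ballI allI)
    fix v
    show "Ck k S (\<lambda>x. dd g x v)"
      by (rule Suc.IH[of "\<lambda>x. dd f x v"]) (use d Suc.prems in auto)
  qed (use d in auto)
qed

lemma Ck_SucD:
  assumes "Ck (Suc k) S f" "x \<in> S"
  shows "(f has_derivative dd f x) (at x)"
  using assms frechet_derivative_works by auto

lemma Ck_SucI:
  assumes "open S" "\<And>x. x \<in> S \<Longrightarrow> (f has_derivative f' x) (at x)"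
    "\<And>v. Ck k S (\<lambda>x. f' x v)"
  shows "Ck (Suc k) S f"
  unfolding Ck.simps
proof (intro conjI ballI allI)
  fix v
  show "Ck k S (\<lambda>x. dd f x v)"
    by (rule Ck_cong[OF assms(1) _ assms(3)[of v]]) (metis assms(2) frechet_derivative_at)
qed (use assms(2) in \<open>auto simp: differentiable_def\<close>)

lemma Ck_Suc_imp: "Ck (Suc k) S f \<Longrightarrow> Ck k S f"
proof (induction k arbitrary: f)
  case 0
  then have "\<forall>x\<in>S. f differentiable (at x)" by auto
  then show ?case
    by (simp add: continuous_at_imp_continuous_on differentiable_imp_continuous_within)
next
  case (Suc k)
  then show ?case by (metis Ck.simps(2))
qed

lemma Ck_le: "Ck k S f \<Longrightarrow> j \<le> k \<Longrightarrow> Ck j S f"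
proof (induction k)
  case (Suc k)
  then show ?case using Ck_Suc_imp le_SucE by metis
qed simp

lemma Ck_continuous: "Ck k S f \<Longrightarrow> continuous_on S f"
  using Ck_le[of k S f 0] by simp

lemma Ck_subset: "Ck k S f \<Longrightarrow> T \<subseteq> S \<Longrightarrow> Ck k T f"
  by (induction k arbitrary: f) (auto intro: continuous_on_subset)

lemma Ck_local:
  assumes "\<And>x. x \<in> S \<Longrightarrow> \<exists>U. open U \<and> x \<in> U \<and> Ck k U f"
  shows "Ck k S f"
  using assms
proof (induction k arbitrary: f)
  case 0
  have "continuous (at x) f" if x: "x \<in> S" for x
    using 0[OF x] by (auto simp: continuous_on_eq_continuous_at)
  then show ?case by (simp add: continuous_at_imp_continuous_on)
next
  case (Suc k)
  show ?case
    unfolding Ck.simps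
  proof (intro conjI ballI allI)
    show "f differentiable at x" if "x \<in> S" for x using Suc.prems[OF that] by auto
    show "Ck k S (\<lambda>x. dd f x v)" for v
    proof (rule Suc.IH)
      fix x assume "x \<in> S"
      with Suc.prems obtain U where "open U" "x \<in> U" "Ck (Suc k) U f" by blast
      then show "\<exists>U. open U \<and> x \<in> U \<and> Ck k U (\<lambda>x. dd f x v)" by (intro exI[of _ U]) simp
    qed
  qed
qed

lemma Ck_const [simp]: "Ck k S (\<lambda>x. c)"
  by (induction k arbitrary: c) auto

lemma Ck_bounded_linear:
  assumes "bounded_linear h" "open S" "Ck k S f"
  shows "Ck k S (\<lambda>x. h (f x))"
  using assms(3)
proof (induction k arbitrary: f)
  case 0
  then show ?case using assms(1) by (simp add: bounded_linear.continuous_on)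
next
  case (Suc k)
  show ?case
  proof (rule Ck_SucI[OF assms(2)])
    fix x assume "x \<in> S"
    show "((\<lambda>x. h (f x)) has_derivative (\<lambda>v. h (dd f x v))) (at x)"
      by (rule bounded_linear.has_derivative[OF assms(1) Ck_SucD[OF Suc.prems \<open>x \<in> S\<close>]])
  next
    fix v show "Ck k S (\<lambda>x. h (dd f x v))" using Suc by auto
  qed
qed

lemma Ck_ident: "open S \<Longrightarrow> Ck k S (\<lambda>x. x)"
proof (cases k)
  case (Suc j)
  assume "open S"
  then show ?thesis unfolding Suc
    by (rule Ck_SucI[where f' = "\<lambda>x v. v"]) (auto intro!: derivative_eq_intros)
qed auto

lemma Ck_linear: "bounded_linear h \<Longrightarrow> open S \<Longrightarrow> Ck k S h"
  using Ck_bounded_linear[of h S k "\<lambda>x. x"] Ck_ident by auto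

lemma Ck_add:
  assumes "open S" "Ck k S f" "Ck k S g"
  shows "Ck k S (\<lambda>x. f x + g x)"
  using assms(2,3)
proof (induction k arbitrary: f g)
  case 0
  then show ?case by (simp add: continuous_on_add)
next
  case (Suc k)
  show ?case
  proof (rule Ck_SucI[OF assms(1)])
    fix x assume x: "x \<in> S"
    show "((\<lambda>x. f x + g x) has_derivative (\<lambda>v. dd f x v + dd g x v)) (at x)"
      by (rule has_derivative_add[OF Ck_SucD[OF Suc.prems(1) x] Ck_SucD[OF Suc.prems(2) x]])
  next
    fix v show "Ck k S (\<lambda>x. dd f x v + dd g x v)" using Suc by simp
  qed
qed

lemma Ck_sum:
  assumes "open S" "\<And>i. i \<in> I \<Longrightarrow> Ck k S (f i)"
  shows "Ck k S (\<lambda>x. \<Sum>i\<in>I. f i x)"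
  using assms(2) by (induction I rule: infinite_finite_induct) (auto intro: Ck_add[OF assms(1)])

lemma Ck_bilinear:
  assumes "bounded_bilinear h" "open S" "Ck k S f" "Ck k S g"
  shows "Ck k S (\<lambda>x. h (f x) (g x))"
  using assms(3,4)
proof (induction k arbitrary: f g)
  case 0
  then show ?case using bounded_bilinear.continuous_on[OF assms(1)] by simp
next
  case (Suc k)
  show ?case
  proof (rule Ck_SucI[OF assms(2)])
    fix x assume x: "x \<in> S"
    show "((\<lambda>x. h (f x) (g x)) has_derivative (\<lambda>v. h (f x) (dd g x v) + h (dd f x v) (g x))) (at x)"
      by (rule bounded_bilinear.FDERIV[OF assms(1) Ck_SucD[OF Suc.prems(1) x] Ck_SucD[OF Suc.prems(2) x]])
  next
    fix v
    have "Ck k S f" "Ck k S g" using Suc.prems Ck_Suc_imp by blast+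
    then show "Ck k S (\<lambda>x. h (f x) (dd g x v) + h (dd f x v) (g x))"
      using Suc by (intro Ck_add[OF assms(2)]) auto
  qed
qed

lemma Ck_compose:
  fixes f :: "'b::euclidean_space \<Rightarrow> 'c::real_normed_vector" and g :: "'a::euclidean_space \<Rightarrow> 'b"
  assumes "open S" "open T" "Ck k T f" "Ck k S g" "g ` S \<subseteq> T"
  shows "Ck k S (\<lambda>x. f (g x))"
  using assms(3,4)
proof (induction k arbitrary: f)
  case 0
  then show ?case using assms(5) by (auto intro: continuous_on_compose2)
next
  case (Suc k)
  show ?case
  proof (rule Ck_SucI[OF assms(1)])
    fix x assume x: "x \<in> S"
    then have "g x \<in> T" using assms(5) by auto
    then show "((\<lambda>x. f (g x)) has_derivative (\<lambda>v. dd f (g x) (dd g x v))) (at x)"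
      using has_derivative_compose[OF Ck_SucD[OF Suc.prems(2) x] Ck_SucD[OF Suc.prems(1)]] by auto
  next
    fix v
    have g: "Ck k S g" using Suc.prems(2) by (rule Ck_Suc_imp)
    \<comment> \<open>The direction \<open>dd g x v\<close> moves with \<open>x\<close>. Expanding
      it in the basis leaves derivatives of \<open>f\<close> in fixed directions, to which the
      induction hypothesis applies.\<close>
    have "Ck k S (\<lambda>x. \<Sum>b\<in>Basis. (dd g x v \<bullet> b) *\<^sub>R dd f (g x) b)"
    proof (intro Ck_sum[OF assms(1)] Ck_bilinear[OF bounded_bilinear_scaleR assms(1)])
      fix b :: 'b assume "b \<in> Basis"
      show "Ck k S (\<lambda>x. dd g x v \<bullet> b)"
        by (rule Ck_bounded_linear[OF bounded_linear_inner_left assms(1)]) (use Suc.prems(2) in auto)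
      show "Ck k S (\<lambda>x. dd f (g x) b)" using Suc.IH[OF _ g] Suc.prems(1) by auto
    qed
    moreover have "dd f (g x) (dd g x v) = (\<Sum>b\<in>Basis. (dd g x v \<bullet> b) *\<^sub>R dd f (g x) b)"
      if "x \<in> S" for x
    proof -
      have "linear (dd f (g x))"
        using Suc.prems(1) assms(5) that by (intro linear_frechet_derivative) auto
      then have "dd f (g x) (\<Sum>b\<in>Basis. (dd g x v \<bullet> b) *\<^sub>R b) = (\<Sum>b\<in>Basis. (dd g x v \<bullet> b) *\<^sub>R dd f (g x) b)"
        by (simp add: linear_sum linear_scale)
      then show ?thesis by (simp add: euclidean_representation)
    qed
    ultimately show "Ck k S (\<lambda>x. dd f (g x) (dd g x v))"
      by (elim Ck_cong[OF assms(1), rotated]) simp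
  qed
qed

lemma smooth_on_iff_Cinf:
  assumes "open S"
  shows "smooth_on S f \<longleftrightarrow> Cinf S f"
proof
  \<comment> \<open>The head of the list is the outermost derivative, while \<open>Ck\<close> peels
    off the innermost one first; so a derivative of \<open>f\<close> itself corresponds to appending
    at the end.\<close>
  have app: "iter_deriv vs (\<lambda>x. dd f x v) = iter_deriv (vs @ [v]) f" for f :: "'a \<Rightarrow> 'b" and vs v
    by (induction vs) auto
  assume s: "smooth_on S f"
  have "Ck k S f" for k
    using s
  proof (induction k arbitrary: f)
    case 0
    then have "\<forall>x\<in>S. f differentiable (at x)" unfolding smooth_on_def by (metis iter_deriv.simps(1))
    then show ?case
      by (simp add: continuous_at_imp_continuous_on differentiable_imp_continuous_within)
  next
    case (Suc k)
    then have "\<forall>x\<in>S. f differentiable (at x)" unfolding smooth_on_def by (metis iter_deriv.simps(1))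
    moreover have "smooth_on S (\<lambda>x. dd f x v)" for v
      using Suc.prems unfolding smooth_on_def app by blast
    ultimately show ?case using Suc.IH by simp
  qed
  then show "Cinf S f" by (simp add: Cinf_def)
next
  assume s: "Cinf S f"
  have "Cinf S (iter_deriv vs f)" for vs
  proof (induction vs)
    case (Cons v vs)
    show ?case unfolding Cinf_def
    proof
      fix k
      have "Ck (Suc k) S (iter_deriv vs f)" using Cons unfolding Cinf_def by blast
      then show "Ck k S (iter_deriv (v # vs) f)" by simp
    qed
  qed (use s in simp)
  then have "Ck (Suc 0) S (iter_deriv vs f)" for vs unfolding Cinf_def by blast
  then show "smooth_on S f" unfolding smooth_on_def by simp
qed

lemma Cinf_cong: "open S \<Longrightarrow> (\<And>x. x \<in> S \<Longrightarrow> f x = g x) \<Longrightarrow> Cinf S f \<Longrightarrow> Cinf S g"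
  unfolding Cinf_def using Ck_cong by metis

lemma Cinf_subset: "Cinf S f \<Longrightarrow> T \<subseteq> S \<Longrightarrow> Cinf T f"
  unfolding Cinf_def using Ck_subset by metis

lemma Cinf_local: "(\<And>x. x \<in> S \<Longrightarrow> \<exists>U. open U \<and> x \<in> U \<and> Cinf U f) \<Longrightarrow> Cinf S f"
  unfolding Cinf_def using Ck_local[of S _ f] by meson

lemma Cinf_continuous: "Cinf S f \<Longrightarrow> continuous_on S f"
  unfolding Cinf_def by (metis Ck_continuous)

lemma Cinf_has_derivative: "Cinf S f \<Longrightarrow> x \<in> S \<Longrightarrow> (f has_derivative dd f x) (at x)"
  unfolding Cinf_def using Ck_SucD by blast

lemma Cinf_differentiable: "Cinf S f \<Longrightarrow> x \<in> S \<Longrightarrow> f differentiable (at x)"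
  using Cinf_has_derivative differentiable_def by blast

lemma Cinf_dd_linear: "Cinf S f \<Longrightarrow> x \<in> S \<Longrightarrow> bounded_linear (dd f x)"
  using Cinf_has_derivative has_derivative_bounded_linear by blast

lemma Cinf_dd: "Cinf S f \<Longrightarrow> Cinf S (\<lambda>x. dd f x v)"
  unfolding Cinf_def using Ck.simps(2) by blast

lemma Cinf_const: "Cinf S (\<lambda>x. c)"
  by (simp add: Cinf_def)

lemma Cinf_ident: "open S \<Longrightarrow> Cinf S (\<lambda>x. x)"
  by (simp add: Cinf_def Ck_ident)

lemma Cinf_bounded_linear: "bounded_linear h \<Longrightarrow> open S \<Longrightarrow> Cinf S f \<Longrightarrow> Cinf S (\<lambda>x. h (f x))"
  by (simp add: Cinf_def Ck_bounded_linear)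

lemma Cinf_linear: "bounded_linear h \<Longrightarrow> open S \<Longrightarrow> Cinf S h"
  by (simp add: Cinf_def Ck_linear)

lemma Cinf_bilinear:
  "bounded_bilinear h \<Longrightarrow> open S \<Longrightarrow> Cinf S f \<Longrightarrow> Cinf S g \<Longrightarrow> Cinf S (\<lambda>x. h (f x) (g x))"
  by (simp add: Cinf_def Ck_bilinear)

lemma Cinf_add: "open S \<Longrightarrow> Cinf S f \<Longrightarrow> Cinf S g \<Longrightarrow> Cinf S (\<lambda>x. f x + g x)"
  by (simp add: Cinf_def Ck_add)

lemma Cinf_minus: "open S \<Longrightarrow> Cinf S f \<Longrightarrow> Cinf S (\<lambda>x. - f x)"
  by (rule Cinf_bounded_linear[of uminus]) (rule bounded_linear_minus[OF bounded_linear_ident])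

lemma Cinf_diff: "open S \<Longrightarrow> Cinf S f \<Longrightarrow> Cinf S g \<Longrightarrow> Cinf S (\<lambda>x. f x - g x)"
  using Cinf_add[of S f "\<lambda>x. - g x"] Cinf_minus[of S g] by simp

lemma Cinf_sum: "open S \<Longrightarrow> (\<And>i. i \<in> I \<Longrightarrow> Cinf S (f i)) \<Longrightarrow> Cinf S (\<lambda>x. \<Sum>i\<in>I. f i x)"
  by (simp add: Cinf_def Ck_sum)

lemma Cinf_compose:
  "open S \<Longrightarrow> open T \<Longrightarrow> Cinf T f \<Longrightarrow> Cinf S g \<Longrightarrow> g ` S \<subseteq> T \<Longrightarrow> Cinf S (\<lambda>x. f (g x))"
  by (simp add: Cinf_def Ck_compose)

lemma Cinf_compose_UNIV: "open S \<Longrightarrow> Cinf UNIV f \<Longrightarrow> Cinf S g \<Longrightarrow> Cinf S (\<lambda>x. f (g x))"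
  by (rule Cinf_compose[of S UNIV]) auto

lemmas Cinf_scaleR = Cinf_bilinear[OF bounded_bilinear_scaleR]
lemmas Cinf_mult = Cinf_bilinear[OF bounded_bilinear_mult]
lemmas Cinf_inner = Cinf_bilinear[OF bounded_bilinear_inner]
lemmas Cinf_blinfun_apply = Cinf_bilinear[OF bounded_bilinear_blinfun_apply]

lemma Cinf_Pair:
  fixes f :: "'a::euclidean_space \<Rightarrow> 'b::real_normed_vector" and g :: "'a \<Rightarrow> 'c::real_normed_vector"
  assumes "open S" "Cinf S f" "Cinf S g" 
  shows "Cinf S (\<lambda>x. (f x, g x))"
proof -
  have "bounded_linear (\<lambda>x. (x :: 'b, 0 :: 'c))" "bounded_linear (\<lambda>x. (0 :: 'b, x :: 'c))"
    by (rule bounded_linear_Pair[OF bounded_linear_ident bounded_linear_zero]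
        bounded_linear_Pair[OF bounded_linear_zero bounded_linear_ident])+
  then have "Cinf S (\<lambda>x. (f x, 0) + (0, g x))"
    using assms by (intro Cinf_add Cinf_bounded_linear[where h="\<lambda>x. (x, 0)"]
        Cinf_bounded_linear[where h="\<lambda>x. (0, x)"])
  then show ?thesis by simp
qed

lemma Cinf_fst: "open S \<Longrightarrow> Cinf S f \<Longrightarrow> Cinf S (\<lambda>x. fst (f x))"
  by (rule Cinf_bounded_linear[OF bounded_linear_fst])

lemma Cinf_snd: "open S \<Longrightarrow> Cinf S f \<Longrightarrow> Cinf S (\<lambda>x. snd (f x))"
  by (rule Cinf_bounded_linear[OF bounded_linear_snd])

lemma Cinf_power: "open S \<Longrightarrow> Cinf S f \<Longrightarrow> Cinf S (\<lambda>x. (f x :: real) ^ n)"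
  by (induction n) (auto intro: Cinf_const Cinf_mult)

lemma Ck_inverse: "Ck k (- {0}) (inverse :: real \<Rightarrow> real)"
proof (induction k)
  case 0
  then show ?case by (simp add: continuous_on_inverse)
next
  case (Suc k)
  have o: "open (- {0::real})" by auto
  show ?case
  proof (rule Ck_SucI[OF o])
    fix x :: real assume "x \<in> - {0}"
    then show "(inverse has_derivative (\<lambda>v. (- inverse x * v) * inverse x)) (at x)"
      by (auto intro!: derivative_eq_intros)
  next
    fix v :: real
    have "Ck k (- {0}) (\<lambda>x::real. inverse x * inverse x)"
      by (rule Ck_bilinear[OF bounded_bilinear_mult o Suc Suc])
    from Ck_bounded_linear[OF bounded_linear_mult_right[of "-v"] o this]
    show "Ck k (- {0}) (\<lambda>x. (- inverse x * v) * inverse x)"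
      by (rule Ck_cong[OF o, rotated]) auto
  qed
qed

lemma Cinf_inverse:
  assumes "open S" "Cinf S f" "\<And>x. x \<in> S \<Longrightarrow> f x \<noteq> (0::real)"
  shows "Cinf S (\<lambda>x. inverse (f x))"
proof (rule Cinf_compose[OF assms(1) _ _ assms(2), of "- {0}"])
  show "Cinf (- {0}) (inverse :: real \<Rightarrow> real)" by (simp add: Cinf_def Ck_inverse)
qed (use assms(3) in auto)

lemma Ck_sin_cos: "Ck k UNIV (sin :: real \<Rightarrow> real) \<and> Ck k UNIV (cos :: real \<Rightarrow> real)"
proof (induction k)
  case 0
  then show ?case by (auto intro!: continuous_intros)
next
  case (Suc k)
  note m = Ck_bounded_linear[OF bounded_linear_mult_left open_UNIV]
  have "Ck (Suc k) UNIV (sin :: real \<Rightarrow> real)"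
  proof (rule Ck_SucI[where f' = "\<lambda>x v. cos x * v"])
    show "Ck k UNIV (\<lambda>x. cos x * v)" for v :: real using m Suc by blast
  qed (auto intro!: derivative_eq_intros)
  moreover have "Ck (Suc k) UNIV (cos :: real \<Rightarrow> real)"
  proof (rule Ck_SucI[where f' = "\<lambda>x v. sin x * - v"])
    show "Ck k UNIV (\<lambda>x. sin x * - v)" for v :: real using m Suc by blast
  qed (auto intro!: derivative_eq_intros)
  ultimately show ?case by blast
qed

lemma Cinf_sin: "open S \<Longrightarrow> Cinf S f \<Longrightarrow> Cinf S (\<lambda>x. sin (f x :: real))"
  and Cinf_cos: "open S \<Longrightarrow> Cinf S f \<Longrightarrow> Cinf S (\<lambda>x. cos (f x :: real))"
  by (rule Cinf_compose_UNIV; simp add: Cinf_def Ck_sin_cos)+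

lemma Ck_exp: "Ck k UNIV (exp :: real \<Rightarrow> real)"
proof (induction k)
  case 0
  then show ?case by (auto intro!: continuous_intros)
next
  case (Suc k)
  show ?case
  proof (rule Ck_SucI[where f' = "\<lambda>x v. exp x * v"])
    show "Ck k UNIV (\<lambda>x. exp x * v)" for v :: real
      using Ck_bounded_linear[OF bounded_linear_mult_left open_UNIV] Suc by blast
  qed (auto intro!: derivative_eq_intros)
qed

lemma Cinf_exp: "open S \<Longrightarrow> Cinf S f \<Longrightarrow> Cinf S (\<lambda>x. exp (f x :: real))"
  by (rule Cinf_compose_UNIV; simp add: Cinf_def Ck_exp)

lemma Cinf_dd_compose:
  fixes f :: "'b::euclidean_space \<Rightarrow> 'c::real_normed_vector" and g :: "'a::euclidean_space \<Rightarrow> 'b"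
  assumes "open S" "open T" "Cinf T f" "Cinf S g" "g ` S \<subseteq> T" "Cinf S h"
  shows "Cinf S (\<lambda>x. dd f (g x) (h x))"
proof -
  have "Cinf S (\<lambda>x. \<Sum>b\<in>Basis. (h x \<bullet> b) *\<^sub>R dd f (g x) b)"
    by (intro Cinf_sum Cinf_scaleR Cinf_inner Cinf_const assms
        Cinf_compose[OF assms(1,2) Cinf_dd[OF assms(3)] assms(4,5)])
  moreover have "dd f (g x) (h x) = (\<Sum>b\<in>Basis. (h x \<bullet> b) *\<^sub>R dd f (g x) b)" if "x \<in> S" for x
  proof -
    have "linear (dd f (g x))"
      using Cinf_dd_linear[OF assms(3)] assms(5) that by (auto intro: bounded_linear.linear)
    then have "dd f (g x) (\<Sum>b\<in>Basis. (h x \<bullet> b) *\<^sub>R b) = (\<Sum>b\<in>Basis. (h x \<bullet> b) *\<^sub>R dd f (g x) b)"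
      by (simp add: linear_sum linear_scale)
    then show ?thesis by (simp add: euclidean_representation)
  qed
  ultimately show ?thesis
    by (elim Cinf_cong[OF assms(1), rotated]) simp
qed

text \<open>Assembled from its values on the basis, the derivative is a fixed linear expression in
  finitely many directional derivatives and inherits their smoothness.\<close>

definition bd :: "('a::euclidean_space \<Rightarrow> 'b::real_normed_vector) \<Rightarrow> 'a \<Rightarrow> 'a \<Rightarrow>\<^sub>L 'b" where
  "bd f x = (\<Sum>b\<in>Basis. blinfun_scaleR_left (dd f x b) o\<^sub>L blinfun_inner_left b)"

lemma bd_apply:
  assumes "f differentiable (at x)"
  shows "blinfun_apply (bd f x) = dd f x"
proof
  fix v
  have "linear (dd f x)" using assms by (rule linear_frechet_derivative)
  then have "dd f x (\<Sum>b\<in>Basis. (v \<bullet> b) *\<^sub>R b) = (\<Sum>b\<in>Basis. (v \<bullet> b) *\<^sub>R dd f x b)"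
    by (simp add: linear_sum linear_scale)
  then show "blinfun_apply (bd f x) v = dd f x v"
    by (simp add: bd_def euclidean_representation blinfun.sum_left)
qed

lemma bd_has_derivative:
  "f differentiable (at x) \<Longrightarrow> (f has_derivative blinfun_apply (bd f x)) (at x)"
  by (simp add: bd_apply frechet_derivative_works[symmetric])

lemma Ck_bd:
  assumes "open S" "Ck (Suc k) S f"
  shows "Ck k S (bd f)"
proof -
  have "bounded_linear (\<lambda>y. blinfun_scaleR_left y o\<^sub>L blinfun_inner_left b)" for b :: 'a
    by (rule bounded_linear_compose[OF bounded_bilinear.bounded_linear_left[OF bounded_bilinear_blinfun_compose]
        bounded_linear_blinfun_scaleR_left])
  then have "Ck k S (\<lambda>x. \<Sum>b\<in>Basis. blinfun_scaleR_left (dd f x b) o\<^sub>L blinfun_inner_left b)"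
    using assms by (intro Ck_sum Ck_bounded_linear[where h="\<lambda>y. blinfun_scaleR_left y o\<^sub>L blinfun_inner_left _"]) auto
  then show ?thesis unfolding bd_def .
qed

lemma Cinf_bd: "open S \<Longrightarrow> Cinf S f \<Longrightarrow> Cinf S (bd f)"
  unfolding Cinf_def using Ck_bd by blast

lemmas Cinf_intros = Cinf_const Cinf_ident Cinf_add Cinf_diff Cinf_minus Cinf_sum Cinf_scaleR Cinf_mult
  Cinf_inner Cinf_Pair Cinf_fst Cinf_snd Cinf_power Cinf_sin Cinf_cos Cinf_exp Cinf_blinfun_apply

section \<open>Cutoff functions\<close>

text \<open>The powers of \<open>1/x\<close> are included because the derivative of a member of this
  family is a combination of two other members; smoothness of all of them is then one
  induction.\<close>

definition flat :: "nat \<Rightarrow> real \<Rightarrow> real" where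
  "flat n x = (if x > 0 then inverse x ^ n * exp (- inverse x) else 0)"

lemma flat_nonneg: "0 \<le> flat n x"
  by (simp add: flat_def)

lemma power_le_fact_exp:
  assumes "0 \<le> (y::real)" shows "y ^ m \<le> fact m * exp y"
proof -
  have "(\<Sum>i\<in>{m}. y ^ i /\<^sub>R fact i) \<le> (\<Sum>i. y ^ i /\<^sub>R fact i)"
    by (rule sum_le_suminf) (use assms summable_exp_generic[of y] in auto)
  then show ?thesis by (simp add: exp_def divide_simps mult.commute)
qed

text \<open>A quadratic bound forces the derivative at the origin to be 0, the only point where the
  two formulas meet.\<close>

lemma flat_le: "flat n x \<le> fact (n + 2) * x\<^sup>2"
proof (cases "x > 0")
  case True
  define y where "y = inverse x"
  have y: "y > 0" using True by (simp add: y_def)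
  have "y ^ n * y\<^sup>2 \<le> fact (n + 2) * exp y"
    using power_le_fact_exp[of y "n + 2"] y by (simp only: power_add less_imp_le)
  then have "y ^ n * exp (- y) \<le> fact (n + 2) * inverse (y\<^sup>2)"
    using y by (simp add: exp_minus divide_simps mult.commute)
  then show ?thesis using True by (simp add: flat_def y_def power_inverse)
qed (simp add: flat_def)

lemma flat_has_derivative:
  "(flat n has_derivative (\<lambda>v. (flat (n + 2) x - n * flat (n + 1) x) * v)) (at x)"
proof -
  consider "x > 0" | "x < 0" | "x = 0" by linarith
  then show ?thesis
  proof cases
    case 1
    have "((\<lambda>x. inverse x ^ n * exp (- inverse x)) has_real_derivative
        (inverse x ^ (n+2) * exp (- inverse x) - n * (inverse x ^ (n+1) * exp (- inverse x)))) (at x)"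
    proof -
      have "((\<lambda>x. inverse x ^ n) has_real_derivative - (n * inverse x ^ (n+1))) (at x)"
      proof (cases n)
        case (Suc m)
        have "(inverse has_real_derivative - (inverse x ^ Suc (Suc 0))) (at x)"
          using 1 by (intro DERIV_inverse) auto
        from DERIV_power_Suc[OF this, of m] show ?thesis by (simp add: Suc algebra_simps)
      qed simp
      moreover have "((\<lambda>x. exp (- inverse x)) has_real_derivative exp (- inverse x) * inverse x ^ 2) (at x)"
        using 1 by (auto intro!: derivative_eq_intros simp: power2_eq_square)
      ultimately show ?thesis
        by (rule DERIV_mult[THEN DERIV_cong]) (simp add: algebra_simps power2_eq_square)
    qed
    then have "((\<lambda>x. inverse x ^ n * exp (- inverse x)) has_derivative
        (\<lambda>v. (flat (n + 2) x - n * flat (n + 1) x) * v)) (at x)"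
      using 1 by (simp add: has_field_derivative_def flat_def)
    then show ?thesis
      by (rule has_derivative_transform_within_open[OF _ open_greaterThan[of 0]]) (use 1 in \<open>auto simp: flat_def\<close>)
  next
    case 2
    have "((\<lambda>x. 0) has_derivative (\<lambda>v. (flat (n + 2) x - n * flat (n + 1) x) * v)) (at x)"
      using 2 by (simp add: flat_def)
    then show ?thesis
      by (rule has_derivative_transform_within_open[OF _ open_lessThan[of 0]]) (use 2 in \<open>auto simp: flat_def\<close>)
  next
    case 3
    have "(flat n has_derivative (\<lambda>v. 0)) (at 0)"
    proof (rule has_derivativeI_sandwich[where e = 1 and H = "\<lambda>y. fact (n + 2) * \<bar>y\<bar>"])
      fix y :: real assume "y \<noteq> 0"
      then show "norm (flat n y - flat n 0 - 0) / norm (y - 0) \<le> fact (n + 2) * \<bar>y\<bar>"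
        using flat_le[of n y] flat_nonneg[of n y]
        by (simp add: flat_def[of n 0] divide_simps power2_eq_square abs_if)
    qed (auto intro!: tendsto_eq_intros)
    then show ?thesis using 3 by (simp add: flat_def)
  qed
qed

lemma Cinf_flat: "Cinf UNIV (flat n)"
proof -
  have "Ck k UNIV (flat n)" for k
  proof (induction k arbitrary: n)
    case 0
    have "continuous_on UNIV (flat n)"
      by (rule has_derivative_continuous_on) (rule flat_has_derivative)
    then show ?case by simp
  next
    case (Suc k)
    have 1: "Ck k UNIV (\<lambda>x. flat (n + 2) x + (- real n) * flat (n + 1) x)"
      by (intro Ck_add Ck_bounded_linear[OF bounded_linear_mult_right] Suc) auto
    have "Ck k UNIV (\<lambda>x. (flat (n + 2) x + (- real n) * flat (n + 1) x) * v)" for v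
      by (rule Ck_bounded_linear[OF bounded_linear_mult_left _ 1]) auto
    then show ?case
      by (intro Ck_SucI[OF _ flat_has_derivative]) auto
  qed
  then show ?thesis by (simp add: Cinf_def)
qed

lemma smooth_step:
  assumes "a < (b::real)"
  obtains \<beta> :: "real \<Rightarrow> real" where "Cinf UNIV \<beta>" "\<And>x. x \<le> a \<Longrightarrow> \<beta> x = 1" "\<And>x. x \<ge> b \<Longrightarrow> \<beta> x = 0"
    "\<And>x. 0 \<le> \<beta> x" "\<And>x. \<beta> x \<le> 1"
proof
  define \<beta> where "\<beta> x = flat 0 (b - x) * inverse (flat 0 (b - x) + flat 0 (x - a))" for x
  have "exp u + exp v \<noteq> 0" for u v :: real
    by (metis add_pos_pos exp_gt_zero less_irrefl)
  then have pos: "flat 0 (b - x) + flat 0 (x - a) \<noteq> 0" for x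
    using assms by (auto simp: flat_def)
  have 1: "Cinf UNIV (\<lambda>x. flat 0 (b - x))" "Cinf UNIV (\<lambda>x. flat 0 (x - a))"
    by (rule Cinf_compose_UNIV[OF open_UNIV Cinf_flat Cinf_diff];
        rule open_UNIV Cinf_const Cinf_ident[OF open_UNIV])+
  show "Cinf UNIV \<beta>" unfolding \<beta>_def
    by (rule Cinf_mult[OF open_UNIV 1(1) Cinf_inverse[OF open_UNIV Cinf_add[OF open_UNIV 1]]]) (rule pos)
  show "\<beta> x = 1" if "x \<le> a" for x using that assms pos[of x] by (auto simp: \<beta>_def flat_def)
  show "\<beta> x = 0" if "x \<ge> b" for x using that by (auto simp: \<beta>_def flat_def)
  show "0 \<le> \<beta> x" for x by (simp add: \<beta>_def flat_nonneg)
  have "flat 0 (b - x) + flat 0 (x - a) > 0" for x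
    using pos[of x] flat_nonneg[of 0 "b - x"] flat_nonneg[of 0 "x - a"] by linarith
  then show "\<beta> x \<le> 1" for x
    using flat_nonneg[of 0 "x - a"] by (simp add: \<beta>_def divide_simps inverse_eq_divide)
qed

section \<open>Smooth dependence of integrals on a parameter\<close>

lemma integral_param_has_derivative:
  fixes F :: "'a::euclidean_space \<Rightarrow> real \<Rightarrow> 'b::banach"
  assumes "Ck (Suc 0) UNIV (\<lambda>(x,t). F x t)"
  shows "((\<lambda>x. integral {a..b} (F x)) has_derivative
    (\<lambda>v. integral {a..b} (\<lambda>t. dd (\<lambda>(x,t). F x t) (x,t) (v,0)))) (at x)"
proof -
  let ?F = "\<lambda>(x,t). F x t"
  define P :: "'a \<Rightarrow>\<^sub>L ('a \<times> real)" where "P = Blinfun (\<lambda>v. (v, 0))"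
  have P: "blinfun_apply P v = (v, 0)" for v
    unfolding P_def
    by (subst bounded_linear_Blinfun_apply) (rule bounded_linear_Pair[OF bounded_linear_ident bounded_linear_zero], simp)
  define G where "G x t = bd ?F (x, t) o\<^sub>L P" for x t
  have d: "(?F has_derivative blinfun_apply (bd ?F z)) (at z)" for z
    using assms bd_has_derivative unfolding Ck.simps by blast
  have dF: "((\<lambda>x. F x t) has_derivative blinfun_apply (G x t)) (at x)" for x t
  proof -
    have "((\<lambda>x. (x, t)) has_derivative (\<lambda>v. (v, 0))) (at x)"
      by (auto intro!: derivative_eq_intros)
    note has_derivative_compose[OF this d[of "(x, t)"]]
    moreover have "blinfun_apply (G x t) = (\<lambda>v. bd ?F (x, t) (v, 0))" by (rule ext) (simp add: G_def P)
    ultimately show ?thesis by simp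
  qed
  have c: "continuous_on UNIV (\<lambda>z. bd ?F z)"
    using Ck_bd[OF open_UNIV assms] by simp
  have cF: "continuous_on UNIV ?F" using Ck_continuous[OF assms] .
  have cG: "continuous_on S (\<lambda>z. G (fst z) (snd z))" for S
    unfolding G_def prod.collapse
    by (intro bounded_bilinear.continuous_on[OF bounded_bilinear_blinfun_compose] continuous_on_const
        continuous_on_subset[OF c]) auto
  have cP: "continuous_on {a..b} (\<lambda>t. (x, t))" for x :: 'a
    by (rule continuous_on_Pair[OF continuous_on_const continuous_on_id])
  have cGt: "continuous_on {a..b} (G x)" for x
    using continuous_on_compose2[OF cG[of UNIV] cP[of x]] by simp
  have "((\<lambda>x. integral (cbox a b) (F x)) has_derivative blinfun_apply (integral (cbox a b) (G x))) (at x within UNIV)"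
  proof (rule leibniz_rule)
    show "F x integrable_on cbox a b" for x
    proof (rule integrable_continuous)
      show "continuous_on (cbox a b) (F x)"
        using continuous_on_compose2[OF cF cP[of x]] by simp
    qed
    show "continuous_on (UNIV \<times> cbox a b) (\<lambda>(x, t). G x t)"
      using cG by (simp add: split_beta')
  qed (use dF in auto)
  moreover have "blinfun_apply (integral (cbox a b) (G x)) = (\<lambda>v. integral {a..b} (\<lambda>t. dd ?F (x,t) (v,0)))"
  proof
    fix v
    have "blinfun_apply (integral {a..b} (G x)) v = integral {a..b} (\<lambda>t. blinfun_apply (G x t) v)"
      by (rule blinfun_apply_integral) (rule integrable_continuous_real[OF cGt])
    moreover have "blinfun_apply (G x t) v = dd ?F (x,t) (v,0)" for t
      using assms by (simp add: G_def P bd_apply)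
    ultimately show "blinfun_apply (integral (cbox a b) (G x)) v = integral {a..b} (\<lambda>t. dd ?F (x,t) (v,0))"
      by simp
  qed
  ultimately show ?thesis by simp
qed

lemma Ck_integral:
  fixes F :: "'a::euclidean_space \<Rightarrow> real \<Rightarrow> 'b::banach"
  assumes "Ck k UNIV (\<lambda>(x,t). F x t)"
  shows "Ck k UNIV (\<lambda>x. integral {a..b} (F x))"
  using assms
proof (induction k arbitrary: F)
  case 0
  have "continuous_on UNIV (\<lambda>x. integral (cbox a b) (F x))"
    by (rule integral_continuous_on_param) (use 0 in \<open>auto intro: continuous_on_subset\<close>)
  then show ?case by simp
next
  case (Suc k)
  show ?case
  proof (rule Ck_SucI[OF open_UNIV integral_param_has_derivative])
    show "Ck (Suc 0) UNIV (\<lambda>(x, t). F x t)" by (rule Ck_le[OF Suc.prems]) simp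
    fix v
    show "Ck k UNIV (\<lambda>x. integral {a..b} (\<lambda>t. dd (\<lambda>(x,t). F x t) (x,t) (v,0)))"
    proof (rule Suc.IH)
      have "Ck k UNIV (\<lambda>z. dd (\<lambda>(x,t). F x t) z (v,0))" using Suc.prems by simp
      then show "Ck k UNIV (\<lambda>(x,t). dd (\<lambda>(x,t). F x t) (x,t) (v,0))"
        by (simp add: split_def)
    qed
  qed
qed

lemma Cinf_integral:
  fixes F :: "'a::euclidean_space \<Rightarrow> real \<Rightarrow> 'b::banach"
  assumes "Cinf UNIV (\<lambda>(x,t). F x t)"
  shows "Cinf UNIV (\<lambda>x. integral {a..b} (F x))"
  using assms Ck_integral unfolding Cinf_def by blast

lemma Cinf_along_curve:
  assumes f: "Cinf UNIV f" and g: "(g has_vector_derivative g') (at s)"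
  shows "((\<lambda>s. f (g s)) has_vector_derivative dd f (g s) g') (at s)"
proof -
  have l: "linear (dd f (g s))" using Cinf_dd_linear[OF f UNIV_I] by (rule bounded_linear.linear)
  show ?thesis
    using has_derivative_compose[OF g[unfolded has_vector_derivative_def] Cinf_has_derivative[OF f UNIV_I]]
    unfolding has_vector_derivative_def linear_scale[OF l] .
qed

lemma dd_line:
  fixes f :: "'a::euclidean_space \<Rightarrow> 'b::real_normed_vector"
  assumes "f differentiable (at (x + t *\<^sub>R w))"
  shows "((\<lambda>s. f (x + s *\<^sub>R w)) has_vector_derivative dd f (x + t *\<^sub>R w) w) (at t)"
proof -
  have 1: "((\<lambda>s. x + s *\<^sub>R w) has_derivative (\<lambda>s. s *\<^sub>R w)) (at t)"
    by (auto intro!: derivative_eq_intros)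
  have "(f has_derivative dd f (x + t *\<^sub>R w)) (at (x + t *\<^sub>R w))"
    using assms frechet_derivative_works by blast
  from has_derivative_compose[OF 1 this]
  show ?thesis
    using linear_frechet_derivative[OF assms]
    by (simp add: has_vector_derivative_def linear_scale)
qed

text \<open>Differentiate \<open>f (x + t w) - f x = \<integral>\<^sub>0\<^sup>t \<partial>\<^sub>w f (x + \<tau> w) d\<tau>\<close> first in the direction \<open>v\<close>,
  then in \<open>t\<close>.\<close>

lemma dd_commute:
  fixes f :: "'a::euclidean_space \<Rightarrow> 'b::banach"
  assumes f: "Cinf UNIV f"
  shows "dd (\<lambda>x. dd f x v) x w = dd (\<lambda>x. dd f x w) x v"
proof -
  let ?g = "\<lambda>x. dd f x w"
  have g: "Cinf UNIV ?g" using f by (rule Cinf_dd)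
  define F where "F x \<tau> = ?g (x + \<tau> *\<^sub>R w)" for x and \<tau> :: real
  have F': "(\<lambda>(x,\<tau>). F x \<tau>) = (\<lambda>z. ?g (fst z + snd z *\<^sub>R w))" by (auto simp: F_def)
  have F: "Cinf UNIV (\<lambda>(x,\<tau>). F x \<tau>)"
    unfolding F' by (intro Cinf_compose_UNIV[OF _ g] Cinf_intros) auto
  have ddF: "dd (\<lambda>(x,\<tau>). F x \<tau>) (x,\<tau>) (v,0) = dd ?g (x + \<tau> *\<^sub>R w) v" for x \<tau>
  proof -
    have 1: "((\<lambda>z. fst z + snd z *\<^sub>R w) has_derivative (\<lambda>z. fst z + snd z *\<^sub>R w)) (at (x, \<tau>))"
      by (auto intro!: derivative_eq_intros)
    have "(?g has_derivative dd ?g (x + \<tau> *\<^sub>R w)) (at (fst (x,\<tau>) + snd (x,\<tau>) *\<^sub>R w))"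
      using Cinf_has_derivative[OF g] by simp
    from has_derivative_compose[OF 1 this]
    show ?thesis unfolding F' by (simp add: frechet_derivative_at[symmetric])
  qed
  have int: "f (x + t *\<^sub>R w) - f x = integral {0..t} (F x)" if "t \<ge> 0" for x t
  proof -
    have "(F x has_integral (f (x + t *\<^sub>R w) - f (x + 0 *\<^sub>R w))) {0..t}"
      unfolding F_def using Cinf_differentiable[OF f]
      by (intro fundamental_theorem_of_calculus that)
        (auto intro!: has_vector_derivative_at_within dd_line)
    then show ?thesis by (auto simp: integral_unique)
  qed
  have D: "dd f (x + t *\<^sub>R w) v - dd f x v = integral {0..t} (\<lambda>\<tau>. dd ?g (x + \<tau> *\<^sub>R w) v)"
    if "t \<ge> 0" for t
  proof -
    have "((\<lambda>x. f (x + t *\<^sub>R w)) has_derivative dd f (x + t *\<^sub>R w)) (at x)"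
    proof -
      have "((\<lambda>x. x + t *\<^sub>R w) has_derivative (\<lambda>v. v)) (at x)" by (auto intro!: derivative_eq_intros)
      from has_derivative_compose[OF this Cinf_has_derivative[OF f UNIV_I]] show ?thesis .
    qed
    then have 1: "((\<lambda>x. f (x + t *\<^sub>R w) - f x) has_derivative (\<lambda>v. dd f (x + t *\<^sub>R w) v - dd f x v)) (at x)"
      using Cinf_has_derivative[OF f] by (intro has_derivative_diff) auto
    have 2: "((\<lambda>x. f (x + t *\<^sub>R w) - f x) has_derivative
        (\<lambda>v. integral {0..t} (\<lambda>\<tau>. dd (\<lambda>(x,\<tau>). F x \<tau>) (x,\<tau>) (v,0)))) (at x)"
      unfolding int[OF that] by (rule integral_param_has_derivative) (use F in \<open>simp only: Cinf_def\<close>)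
    show ?thesis
      using fun_cong[OF has_derivative_unique[OF 1 2], of v] by (simp add: ddF)
  qed
  have cont: "continuous_on {0..1::real} (\<lambda>\<tau>. dd ?g (x + \<tau> *\<^sub>R w) v)"
    by (rule continuous_on_compose2[OF Cinf_continuous[OF Cinf_dd[OF g]]]) (auto intro!: continuous_intros)
  have "((\<lambda>t. integral {0..t} (\<lambda>\<tau>. dd ?g (x + \<tau> *\<^sub>R w) v)) has_vector_derivative dd ?g x v)
      (at 0 within {0..1})"
    using integral_has_vector_derivative[OF cont, of 0] by simp
  then have 1: "((\<lambda>t. dd f (x + t *\<^sub>R w) v - dd f x v) has_vector_derivative dd ?g x v) (at 0 within {0..1})"
    by (rule has_vector_derivative_transform[rotated 2]) (use D in auto)
  have "((\<lambda>s. dd f (x + s *\<^sub>R w) v) has_vector_derivative dd (\<lambda>x. dd f x v) (x + 0 *\<^sub>R w) w) (at 0)"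
    using Cinf_differentiable[OF Cinf_dd[OF f]] by (intro dd_line[of "\<lambda>x. dd f x v"]) auto
  then have "((\<lambda>s. dd f (x + s *\<^sub>R w) v - dd f x v) has_vector_derivative dd (\<lambda>x. dd f x v) x w) (at 0 within {0..1})"
    by (auto intro!: derivative_eq_intros dest: has_vector_derivative_at_within)
  with 1 show ?thesis
    by (intro vector_derivative_unique_within[where f = "\<lambda>s. dd f (x + s *\<^sub>R w) v - dd f x v"])
      (auto simp: at_within_Icc_at_right)
qed

section \<open>Smoothness of inverses\<close>

definition blinv :: "('a::euclidean_space \<Rightarrow>\<^sub>L 'a) \<Rightarrow> ('a \<Rightarrow>\<^sub>L 'a)" where
  "blinv A = Blinfun (inv (blinfun_apply A))"

lemma blinv:
  fixes A :: "'a::euclidean_space \<Rightarrow>\<^sub>L 'a"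
  assumes K: "\<And>v. norm v \<le> K * norm (A v)"
  shows "A (blinv A v) = v" "blinv A (A v) = v" "norm (blinv A v) \<le> K * norm v"
    "blinfun_apply (blinv A) = inv (blinfun_apply A)"
proof -
  have lin: "linear (blinfun_apply A)" by (simp add: blinfun.bounded_linear_right bounded_linear.linear)
  have inj: "inj (blinfun_apply A)"
  proof (rule injI)
    fix x y assume "A x = A y"
    then have "A (x - y) = 0" by (simp add: blinfun.diff_right)
    then show "x = y" using K[of "x - y"] by simp
  qed
  have bij: "bij (blinfun_apply A)"
    using linear_injective_imp_surjective[OF lin inj] inj by (simp add: bij_def)
  have "linear (inv (blinfun_apply A))"
    using inj_linear_imp_inv_linear[OF lin inj] .
  then have "bounded_linear (inv (blinfun_apply A))" by (simp add: linear_conv_bounded_linear)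
  then show e: "blinfun_apply (blinv A) = inv (blinfun_apply A)"
    unfolding blinv_def by (rule bounded_linear_Blinfun_apply)
  show 1: "A (blinv A v) = v" "blinv A (A v) = v"
    using bij by (simp_all add: e bij_is_surj surj_f_inv_f inj inv_f_f)
  show "norm (blinv A v) \<le> K * norm v" using K[of "blinv A v"] 1 by simp
qed

text \<open>Everything follows from the resolvent identity \<open>diff\<close>. It gives continuity,
  and then the derivative, which is again built from \<open>blinv (A p)\<close> and a derivative of
  \<open>A\<close>; so each order of smoothness of the inverse yields the next one.\<close>

lemma Ck_blinv:
  fixes A :: "'p::euclidean_space \<Rightarrow> ('a::euclidean_space \<Rightarrow>\<^sub>L 'a)"
  assumes S: "open S" and K: "\<And>p v. p \<in> S \<Longrightarrow> norm v \<le> K * norm (A p v)" "K \<ge> 0" and A: "Ck k S A"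
  shows "Ck k S (\<lambda>p. blinv (A p))"
  using A
proof (induction k)
  note b = blinv[OF K(1)]
  note cmp = bounded_bilinear_blinfun_compose
  have nB: "norm (blinv (A p)) \<le> K" if "p \<in> S" for p
    using b(3)[OF that] K(2) by (intro norm_blinfun_bound) auto
  have diff: "blinv (A q) - blinv (A p) = - (blinv (A q) o\<^sub>L (A q - A p) o\<^sub>L blinv (A p))"
    if "p \<in> S" "q \<in> S" for p q
    by (intro blinfun_eqI)
      (simp add: blinfun.diff_left blinfun.diff_right blinfun.minus_left b(1)[OF that(1)] b(2)[OF that(2)])
  {
    case 0
    have "continuous (at p) (\<lambda>p. blinv (A p))" if p: "p \<in> S" for p
    proof -
      have cA: "isCont A p" using 0 S p by (simp add: continuous_on_eq_continuous_at)
      have "((\<lambda>q. blinv (A q) - blinv (A p)) \<longlongrightarrow> 0) (at p)"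
      proof (rule tendsto_0_le[where K = "K * K"])
        show "((\<lambda>q. A q - A p) \<longlongrightarrow> 0) (at p)" using cA by (simp add: isCont_def LIM_zero)
        have "\<forall>\<^sub>F q in at p. q \<in> S" using S p by (simp add: eventually_at_topological) blast
        then show "\<forall>\<^sub>F q in at p. norm (blinv (A q) - blinv (A p)) \<le> norm (A q - A p) * (K * K)"
        proof eventually_elim
          case (elim q)
          have "norm (blinv (A q) o\<^sub>L (A q - A p) o\<^sub>L blinv (A p)) \<le> norm (blinv (A q)) * norm (A q - A p) * norm (blinv (A p))"
            by (meson norm_blinfun_compose mult_right_mono norm_ge_zero order_trans)
          also have "\<dots> \<le> K * norm (A q - A p) * K"
            by (intro mult_mono nB elim p order_refl) (auto simp: K(2))
          finally show ?case by (simp add: diff[OF p elim] algebra_simps)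
        qed
      qed
      then show ?thesis by (simp add: isCont_def LIM_zero_iff)
    qed
    then show ?case by (simp add: continuous_at_imp_continuous_on)
  next
    case (Suc k)
    have B: "Ck k S (\<lambda>p. blinv (A p))" using Suc Ck_Suc_imp by blast
    show ?case
    proof (rule Ck_SucI[OF S])
      fix p assume p: "p \<in> S"
      let ?B = "blinv (A p)"
      note dA = Ck_SucD[OF Suc.prems p]
      have cB: "((\<lambda>q. blinv (A q)) \<longlongrightarrow> ?B) (at p)"
        using Ck_continuous[OF B] S p by (simp add: continuous_on_eq_continuous_at isCont_def)
      have bl: "bounded_linear (\<lambda>v. - (?B o\<^sub>L dd A p v o\<^sub>L ?B))"
        by (intro bounded_linear_minus bounded_linear_compose[OF bounded_bilinear.bounded_linear_left[OF cmp]]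
            bounded_linear_compose[OF bounded_bilinear.bounded_linear_right[OF cmp]]
            has_derivative_bounded_linear[OF dA])
      obtain C where C: "\<And>v. norm (dd A p v) \<le> norm v * C"
        using bounded_linear.bounded[OF has_derivative_bounded_linear[OF dA]] by blast
      obtain e where e: "e > 0" "\<And>q. dist q p < e \<Longrightarrow> q \<in> S" using S p by (auto simp: open_dist)
      let ?R = "\<lambda>q. norm (A q - A p - dd A p (q - p)) / norm (q - p)"
      show "((\<lambda>p. blinv (A p)) has_derivative (\<lambda>v. - (?B o\<^sub>L dd A p v o\<^sub>L ?B))) (at p)"
      proof (rule has_derivativeI_sandwich[OF e(1) bl,
            where H = "\<lambda>q. K * ?R q * K + norm (blinv (A q) - ?B) * C * K"])
        fix q assume q: "q \<noteq> p" "dist q p < e"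
        then have qS: "q \<in> S" using e by simp
        have np: "norm (q - p) > 0" using q by simp
        have "blinv (A q) - ?B - - (?B o\<^sub>L dd A p (q - p) o\<^sub>L ?B) =
          - (blinv (A q) o\<^sub>L (A q - A p - dd A p (q - p)) o\<^sub>L ?B) - ((blinv (A q) - ?B) o\<^sub>L dd A p (q - p) o\<^sub>L ?B)"
          unfolding diff[OF p qS] by (intro blinfun_eqI)
            (simp add: blinfun.diff_left blinfun.diff_right blinfun.minus_left
              b(1)[OF p] b(2)[OF p] b(1)[OF qS] b(2)[OF qS])
        also have "norm \<dots> \<le> norm (blinv (A q) o\<^sub>L (A q - A p - dd A p (q - p)) o\<^sub>L ?B)
            + norm ((blinv (A q) - ?B) o\<^sub>L dd A p (q - p) o\<^sub>L ?B)"
          by (metis norm_minus_cancel norm_triangle_ineq4)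
        also have "\<dots> \<le> norm (blinv (A q)) * norm (A q - A p - dd A p (q - p)) * norm ?B
            + norm (blinv (A q) - ?B) * norm (dd A p (q - p)) * norm ?B"
          by (intro add_mono order_trans[OF norm_blinfun_compose] mult_right_mono norm_blinfun_compose norm_ge_zero)
        also have "\<dots> \<le> K * norm (A q - A p - dd A p (q - p)) * K
            + norm (blinv (A q) - ?B) * (norm (q - p) * C) * K"
          by (intro add_mono mult_mono nB qS p order_refl C mult_nonneg_nonneg norm_ge_zero K(2)
              order_trans[OF norm_ge_zero C])
        finally show "norm (blinv (A q) - ?B - - (?B o\<^sub>L dd A p (q - p) o\<^sub>L ?B)) / norm (q - p)
            \<le> K * ?R q * K + norm (blinv (A q) - ?B) * C * K"
          using np by (simp add: divide_simps) (simp add: algebra_simps)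
      next
        have 1: "(?R \<longlongrightarrow> 0) (at p)" using dA by (simp add: has_derivative_iff_norm)
        have 2: "((\<lambda>q. norm (blinv (A q) - ?B)) \<longlongrightarrow> 0) (at p)"
          using cB by (simp add: tendsto_norm_zero_iff LIM_zero_iff)
        show "((\<lambda>q. K * ?R q * K + norm (blinv (A q) - ?B) * C * K) \<longlongrightarrow> 0) (at p)"
          using tendsto_add[OF tendsto_mult_left[OF tendsto_mult_right[OF 1, of K], of K]
              tendsto_mult_right[OF tendsto_mult_right[OF 2, of C], of K]] by (simp add: mult.assoc mult.left_commute)
      qed
    next
      fix v
      have "Ck k S (\<lambda>p. blinv (A p) o\<^sub>L dd A p v o\<^sub>L blinv (A p))"
        using Suc.prems by (intro Ck_bilinear[OF cmp S] B) auto
      then show "Ck k S (\<lambda>p. - (blinv (A p) o\<^sub>L dd A p v o\<^sub>L blinv (A p)))"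
        by (rule Ck_bounded_linear[OF bounded_linear_minus[OF bounded_linear_ident] S])
    qed
  }
qed

lemma Cinf_blinv:
  fixes A :: "'p::euclidean_space \<Rightarrow> ('a::euclidean_space \<Rightarrow>\<^sub>L 'a)"
  assumes "open S" "\<And>p v. p \<in> S \<Longrightarrow> norm v \<le> K * norm (A p v)" "K \<ge> 0" "Cinf S A"
  shows "Cinf S (\<lambda>p. blinv (A p))"
  unfolding Cinf_def
proof
  fix k show "Ck k S (\<lambda>p. blinv (A p))"
    by (rule Ck_blinv[OF assms(1,2,3)]) (use assms(4) in \<open>auto simp: Cinf_def\<close>)
qed

text \<open>The derivative of \<open>r\<close> at \<open>y\<close> is the inverse of
  \<open>bd u\<close> at \<open>r y\<close>. Hence if \<open>r\<close> is of class
  \<open>C\<^sup>k\<close>, so is its derivative, and the class improves by one at each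
  step.\<close>

lemma Cinf_inverse_map:
  fixes u r :: "'a::euclidean_space \<Rightarrow> 'a"
  assumes u: "Cinf UNIV u" and K: "\<And>x v. norm v \<le> K * norm (dd u x v)" "K \<ge> 0"
    and ur: "\<And>y. u (r y) = y" and r: "continuous_on UNIV r"
  shows "Cinf UNIV r" "\<And>y. (r has_derivative (\<lambda>v. blinv (bd u (r y)) v)) (at y)"
proof -
  have du: "blinfun_apply (bd u x) = dd u x" for x
    using Cinf_differentiable[OF u] by (simp add: bd_apply)
  have b: "bd u x (blinv (bd u x) v) = v" "blinv (bd u x) (bd u x v) = v" for x v
    using blinv[of K "bd u x"] K by (simp_all add: du)
  show d: "(r has_derivative (\<lambda>v. blinv (bd u (r y)) v)) (at y)" for y
  proof (rule has_derivative_inverse_basic[where f = u and f' = "bd u (r y)" and T = UNIV])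
    show "(u has_derivative blinfun_apply (bd u (r y))) (at (r y))"
      using Cinf_has_derivative[OF u] by (simp add: du)
    show "continuous (at y) r" using r by (simp add: continuous_on_eq_continuous_at)
    show "blinfun_apply (blinv (bd u (r y))) \<circ> blinfun_apply (bd u (r y)) = id"
      by (rule ext) (simp add: b)
  qed (simp_all add: ur blinfun.bounded_linear_right)
  have cB: "Cinf UNIV (\<lambda>x. blinv (bd u x))"
    by (rule Cinf_blinv[OF open_UNIV _ K(2)]) (use K du Cinf_bd[OF open_UNIV u] in auto)
  have "Ck k UNIV r" for k
  proof (induction k)
    case (Suc k)
    have "Ck k UNIV (\<lambda>x. blinv (bd u x))" using cB by (simp add: Cinf_def)
    from Ck_compose[OF open_UNIV open_UNIV this Suc] have "Ck k UNIV (\<lambda>y. blinv (bd u (r y)))" by simp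
    then have "Ck k UNIV (\<lambda>y. blinv (bd u (r y)) v)" for v
      by (rule Ck_bounded_linear[OF bounded_bilinear.bounded_linear_left[OF bounded_bilinear_blinfun_apply] open_UNIV])
    then show ?case by (rule Ck_SucI[OF open_UNIV d])
  qed (use r in simp)
  then show "Cinf UNIV r" by (simp add: Cinf_def)
qed

section \<open>Ordinary differential equations\<close>

text \<open>The square of the norm times \<open>exp (- 2 * L * s)\<close> is nonincreasing. Working
  with the square avoids differentiating the norm at zeros of \<open>y\<close>.\<close>

lemma gronwall:
  fixes y :: "real \<Rightarrow> 'a::real_inner"
  assumes t: "0 \<le> t"
    and y: "\<And>s. 0 \<le> s \<Longrightarrow> s \<le> t \<Longrightarrow> (y has_vector_derivative y' s) (at s)"
    and le: "\<And>s. 0 \<le> s \<Longrightarrow> s \<le> t \<Longrightarrow> norm (y' s) \<le> L * norm (y s)"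
  shows "norm (y t) \<le> exp (L * t) * norm (y 0)"
proof -
  let ?g = "\<lambda>s. (y s \<bullet> y s) * exp (- 2 * L * s)"
  let ?g' = "\<lambda>s. 2 * ((y s \<bullet> y' s) - L * (y s \<bullet> y s)) * exp (- 2 * L * s)"
  have "(?g has_real_derivative ?g' s) (at s)" if "0 \<le> s" "s \<le> t" for s
  proof -
    have "((\<lambda>s. y s \<bullet> y s) has_derivative (\<lambda>h. y s \<bullet> (h *\<^sub>R y' s) + (h *\<^sub>R y' s) \<bullet> y s)) (at s)"
      using y[OF that] unfolding has_vector_derivative_def by (intro has_derivative_inner)
    then have "((\<lambda>s. y s \<bullet> y s) has_real_derivative 2 * (y s \<bullet> y' s)) (at s)"
      unfolding has_field_derivative_def
      by (rule has_derivative_eq_rhs) (auto simp: fun_eq_iff inner_commute)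
    moreover have "((\<lambda>s. exp (- 2 * L * s)) has_real_derivative exp (- 2 * L * s) * (- 2 * L)) (at s)"
      by (auto intro!: derivative_eq_intros)
    ultimately show ?thesis by (rule DERIV_mult[THEN DERIV_cong]) (simp add: algebra_simps)
  qed
  moreover have "?g' s \<le> 0" if "0 \<le> s" "s \<le> t" for s
  proof -
    have "y s \<bullet> y' s \<le> norm (y s) * norm (y' s)" by (rule norm_cauchy_schwarz)
    also have "\<dots> \<le> norm (y s) * (L * norm (y s))" by (intro mult_left_mono le that) auto
    also have "\<dots> = L * (y s \<bullet> y s)" by (simp add: power2_norm_eq_inner[symmetric] power2_eq_square)
    finally show ?thesis by (simp add: mult_nonpos_nonneg)
  qed
  ultimately have "?g t \<le> ?g 0"
    by (intro DERIV_nonpos_imp_nonincreasing[OF t]) blast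
  moreover have "(norm (y t))\<^sup>2 = ?g t * (exp (L * t))\<^sup>2"
    by (simp add: power2_norm_eq_inner exp_double[symmetric] mult.assoc exp_add[symmetric])
  ultimately have "(norm (y t))\<^sup>2 \<le> ?g 0 * (exp (L * t))\<^sup>2"
    by (simp add: mult_right_mono)
  then have "(norm (y t))\<^sup>2 \<le> (exp (L * t) * norm (y 0))\<^sup>2"
    by (simp add: power_mult_distrib power2_norm_eq_inner mult.commute)
  then show ?thesis by (rule power2_le_imp_le) simp
qed

lemma gronwall_zero:
  fixes y :: "real \<Rightarrow> 'a::real_inner"
  assumes y: "\<And>s. \<bar>s\<bar> \<le> \<bar>t\<bar> \<Longrightarrow> (y has_vector_derivative y' s) (at s)"
    and le: "\<And>s. \<bar>s\<bar> \<le> \<bar>t\<bar> \<Longrightarrow> norm (y' s) \<le> L * norm (y s)" and "y 0 = 0"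
  shows "y t = 0"
proof (cases "t \<ge> 0")
  case True
  then show ?thesis using gronwall[OF True, of y y' L] y le assms(3) by auto
next
  case False
  have "((\<lambda>s. y (- s)) has_vector_derivative - y' (- s)) (at s)" if "0 \<le> s" "s \<le> - t" for s
  proof -
    have "(y has_vector_derivative y' (- s)) (at (- s))" using y[of "- s"] that by simp
    then have "((y \<circ> uminus) has_vector_derivative (- 1) *\<^sub>R y' (- s)) (at s)"
      by (intro vector_diff_chain_at) (auto intro!: derivative_eq_intros)
    then show ?thesis by (simp add: o_def)
  qed
  from gronwall[OF _ this, of "- t" L] show ?thesis using False le assms(3) by auto
qed

text \<open>The oriented integral from 0 to \<open>t\<close>, also for \<open>t < 0\<close>. After
  rescaling, the interval of integration is fixed, so joint continuity in \<open>t\<close> and in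
  parameters reduces to an integral over one interval.\<close>

definition tint :: "real \<Rightarrow> (real \<Rightarrow> 'b::banach) \<Rightarrow> 'b" where
  "tint t f = t *\<^sub>R integral {0..1} (\<lambda>\<tau>. f (\<tau> * t))"

lemma tint_has_derivative:
  fixes f :: "real \<Rightarrow> 'b::banach"
  assumes f: "continuous_on UNIV f"
  shows "((\<lambda>t. tint t f) has_vector_derivative f t) (at t)"
proof -
  define T where "T = \<bar>t\<bar> + 1"
  define G where "G t = integral {- T..t} f" for t
  have cf: "continuous_on S f" for S using f by (rule continuous_on_subset) auto
  have G: "(G has_vector_derivative f s) (at s)" if "\<bar>s\<bar> < T" for s
  proof -
    have "(G has_vector_derivative f s) (at s within {- T..T})"
      unfolding G_def by (rule integral_has_vector_derivative[OF cf]) (use that in auto)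
    then show ?thesis using that by (simp add: at_within_Icc_at)
  qed
  have eq: "tint s f = G s - G 0" if "\<bar>s\<bar> < T" for s
  proof -
    have "((\<lambda>\<tau>. G (\<tau> * s)) has_vector_derivative s *\<^sub>R f (\<tau> * s)) (at \<tau> within {0..1})" if "\<tau> \<in> {0..1}" for \<tau>
    proof -
      have "\<bar>\<tau> * s\<bar> \<le> 1 * \<bar>s\<bar>" unfolding abs_mult using that by (intro mult_right_mono) auto
      then have "(G has_vector_derivative f (\<tau> * s)) (at (\<tau> * s))" using G \<open>\<bar>s\<bar> < T\<close> by simp
      then have "((G \<circ> (\<lambda>\<tau>. \<tau> * s)) has_vector_derivative s *\<^sub>R f (\<tau> * s)) (at \<tau>)"
        by (intro vector_diff_chain_at) (auto intro!: derivative_eq_intros)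
      then show ?thesis by (auto simp: o_def intro: has_vector_derivative_at_within)
    qed
    from fundamental_theorem_of_calculus[OF _ this]
    have "((\<lambda>\<tau>. s *\<^sub>R f (\<tau> * s)) has_integral (G s - G 0)) {0..1}" by auto
    then show ?thesis by (simp add: tint_def integral_unique integral_cmul[symmetric] del: integral_cmul)
  qed
  have t: "\<bar>t\<bar> < T" by (simp add: T_def)
  have "((\<lambda>s. G s - G 0) has_vector_derivative f t) (at t)"
    using G[OF t] by (auto intro!: derivative_eq_intros)
  then show ?thesis
    by (rule has_vector_derivative_transform_within_open[where S = "{- T<..<T}"]) (use t eq in auto)
qed

lemma tint_bound:
  fixes f :: "real \<Rightarrow> 'b::banach"
  assumes f: "continuous_on UNIV f" and le: "\<And>s. \<bar>s\<bar> \<le> \<bar>t\<bar> \<Longrightarrow> norm (f s) \<le> C * \<bar>s\<bar> ^ n"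
  shows "norm (tint t f) \<le> C * \<bar>t\<bar> ^ Suc n / Suc n"
proof -
  have "((\<lambda>\<tau>::real. \<tau> ^ n) has_integral (1 ^ Suc n / Suc n - 0 ^ Suc n / Suc n)) {0..1}"
    by (intro fundamental_theorem_of_calculus)
      (auto intro!: derivative_eq_intros simp: has_real_derivative_iff_has_vector_derivative[symmetric] simp del: power_Suc)
  then have 1: "((\<lambda>\<tau>. (C * \<bar>t\<bar> ^ n) * \<tau> ^ n) has_integral (C * \<bar>t\<bar> ^ n) * (1 / Suc n)) {0..1::real}"
    by (intro has_integral_mult_right) simp
  have "norm (integral {0..1} (\<lambda>\<tau>. f (\<tau> * t))) \<le> integral {0..1} (\<lambda>\<tau>. (C * \<bar>t\<bar> ^ n) * \<tau> ^ n)"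
  proof (rule integral_norm_bound_integral)
    show "(\<lambda>\<tau>. f (\<tau> * t)) integrable_on {0..1}"
      by (intro integrable_continuous_real continuous_on_compose2[OF f]) (auto intro!: continuous_intros)
    show "(\<lambda>\<tau>. (C * \<bar>t\<bar> ^ n) * \<tau> ^ n) integrable_on {0..1::real}" using 1 by blast
    fix \<tau> :: real assume \<tau>: "\<tau> \<in> {0..1}"
    then have "\<bar>\<tau> * t\<bar> \<le> \<bar>t\<bar>" by (simp add: abs_mult mult_left_le_one_le)
    from le[OF this] show "norm (f (\<tau> * t)) \<le> (C * \<bar>t\<bar> ^ n) * \<tau> ^ n"
      using \<tau> by (simp add: abs_mult power_mult_distrib mult_ac)
  qed
  also have "\<dots> = C * \<bar>t\<bar> ^ n / Suc n" using integral_unique[OF 1] by simp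
  finally have "\<bar>t\<bar> * norm (integral {0..1} (\<lambda>\<tau>. f (\<tau> * t))) \<le> \<bar>t\<bar> * (C * \<bar>t\<bar> ^ n / Suc n)"
    by (rule mult_left_mono) simp
  then show ?thesis by (simp add: tint_def mult_ac)
qed

lemma tint_diff:
  fixes f :: "real \<Rightarrow> 'b::banach"
  assumes "continuous_on UNIV f" "continuous_on UNIV g"
  shows "tint t (\<lambda>s. f s - g s) = tint t f - tint t g"
proof -
  have "(\<lambda>\<tau>. h (\<tau> * t)) integrable_on {0..1}" if "continuous_on UNIV h" for h :: "real \<Rightarrow> 'b"
    by (intro integrable_continuous_real continuous_on_compose2[OF that]) (auto intro!: continuous_intros)
  then show ?thesis using assms by (simp add: tint_def integral_diff scaleR_diff_right)
qed

primrec pic :: "(real \<Rightarrow> 'p \<Rightarrow> 'b::banach \<Rightarrow> 'b) \<Rightarrow> ('p \<Rightarrow> 'b) \<Rightarrow> nat \<Rightarrow> real \<Rightarrow> 'p \<Rightarrow> 'b" where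
  "pic F y0 0 t p = y0 p"
| "pic F y0 (Suc n) t p = y0 p + tint t (\<lambda>s. F s p (pic F y0 n s p))"

text \<open>The Lipschitz bound is global, so the iterates converge uniformly on boxes in time and
  parameter, dominated by an exponential series. Uniformity in \<open>p\<close> is the point:
  difference quotients of solutions will themselves be solutions with parameters and must be
  continuous in them.\<close>

lemma picard:
  fixes F :: "real \<Rightarrow> 'p::euclidean_space \<Rightarrow> 'b::banach \<Rightarrow> 'b"
  assumes F: "continuous_on UNIV (\<lambda>(t,p,y). F t p y)"
    and L: "\<And>t p y z. norm (F t p y - F t p z) \<le> L * norm (y - z)" "L \<ge> 0"
    and y0: "continuous_on UNIV y0"
  obtains y where "continuous_on UNIV (\<lambda>(t,p). y t p)" "\<And>p. y 0 p = y0 p"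
    "\<And>t p. ((\<lambda>t. y t p) has_vector_derivative F t p (y t p)) (at t)"
proof -
  let ?P = "pic F y0"
  have Fc: "continuous_on S (\<lambda>x. F (a x) (b x) (c x))"
    if "continuous_on S a" "continuous_on S b" "continuous_on S c" for S :: "'z::topological_space set" and a b c
    using continuous_on_compose2[OF F continuous_on_Pair[OF that(1) continuous_on_Pair[OF that(2,3)]]] by simp
  have cy0: "continuous_on S (\<lambda>z. y0 (snd z))" for S :: "('z::topological_space \<times> 'p) set"
    by (rule continuous_on_compose2[OF y0 continuous_on_snd[OF continuous_on_id]]) auto
  have cP: "continuous_on UNIV (\<lambda>z. ?P n (fst z) (snd z))" for n
  proof (induction n)
    case 0
    then show ?case by (simp add: cy0)
  next
    case (Suc n)
    have "continuous_on UNIV (\<lambda>z. integral (cbox 0 1) (\<lambda>\<tau>. F (\<tau> * fst z) (snd z) (?P n (\<tau> * fst z) (snd z))))"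
    proof (rule integral_continuous_on_param)
      have "continuous_on (UNIV \<times> cbox 0 1) (\<lambda>w. ?P n (snd w * fst (fst w)) (snd (fst w)))"
      proof -
        have "continuous_on (UNIV \<times> cbox 0 1) (\<lambda>w :: (real \<times> 'p) \<times> real. (snd w * fst (fst w), snd (fst w)))"
          by (intro continuous_intros)
        from continuous_on_compose2[OF Suc this] show ?thesis by simp
      qed
      then have "continuous_on (UNIV \<times> cbox 0 1)
          (\<lambda>w. F (snd w * fst (fst w)) (snd (fst w)) (?P n (snd w * fst (fst w)) (snd (fst w))))"
        by (intro Fc continuous_intros)
      then show "continuous_on (UNIV \<times> cbox 0 1)
          (\<lambda>(z, \<tau>). F (\<tau> * fst z) (snd z) (?P n (\<tau> * fst z) (snd z)))"
        by (simp add: split_def)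
    qed
    then show ?case
      by (auto simp: tint_def intro!: continuous_intros cy0)
  qed
  have cPt: "continuous_on UNIV (\<lambda>s. ?P n s p)" for n p
    using continuous_on_compose2[OF cP continuous_on_Pair[OF continuous_on_id continuous_on_const]] by simp
  have cFP: "continuous_on UNIV (\<lambda>s. F s p (?P n s p))" for n p
    by (intro Fc continuous_intros cPt)
  \<comment> \<open>The factorial is one less than optimal; in this form the bound is a multiple of
    the exponential series in \<open>L * T\<close>.\<close>
  have step: "norm (?P (Suc n) t p - ?P n t p) \<le> M * L ^ n * \<bar>t\<bar> ^ Suc n / fact n"
    if M: "\<And>s. \<bar>s\<bar> \<le> T \<Longrightarrow> norm (F s p (y0 p)) \<le> M" and t: "\<bar>t\<bar> \<le> T" for n t p M T
    using t
  proof (induction n arbitrary: t)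
    case 0
    have "norm (tint t (\<lambda>s. F s p (y0 p))) \<le> M * \<bar>t\<bar> ^ Suc 0 / Suc 0"
      using M 0 by (intro tint_bound Fc continuous_intros) auto
    then show ?case by simp
  next
    case (Suc n)
    have M0: "M \<ge> 0" using M[OF Suc.prems] norm_ge_zero order_trans by blast
    have "norm (tint t (\<lambda>s. F s p (?P (Suc n) s p) - F s p (?P n s p))) \<le>
       (L * (M * L ^ n / fact n)) * \<bar>t\<bar> ^ Suc (Suc n) / Suc (Suc n)"
    proof (rule tint_bound)
      show "continuous_on UNIV (\<lambda>s. F s p (?P (Suc n) s p) - F s p (?P n s p))"
        by (rule continuous_on_diff[OF cFP cFP])
      fix s assume s: "\<bar>s\<bar> \<le> \<bar>t\<bar>"
      have "norm (F s p (?P (Suc n) s p) - F s p (?P n s p)) \<le> L * norm (?P (Suc n) s p - ?P n s p)"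
        by (rule L(1))
      also have "\<dots> \<le> L * (M * L ^ n * \<bar>s\<bar> ^ Suc n / fact n)"
        using s Suc.prems by (intro mult_left_mono Suc.IH L(2)) auto
      finally show "norm (F s p (?P (Suc n) s p) - F s p (?P n s p)) \<le> L * (M * L ^ n / fact n) * \<bar>s\<bar> ^ Suc n"
        by (simp add: mult_ac)
    qed
    also have "\<dots> = M * L ^ Suc n * \<bar>t\<bar> ^ Suc (Suc n) / (fact n * real (Suc (Suc n)))"
      by (simp add: mult_ac del: of_nat_Suc)
    also have "\<dots> \<le> M * L ^ Suc n * \<bar>t\<bar> ^ Suc (Suc n) / fact (Suc n)"
    proof (rule divide_left_mono)
      show "fact (Suc n) \<le> fact n * real (Suc (Suc n))" by (simp add: algebra_simps)
      show "0 \<le> M * L ^ Suc n * \<bar>t\<bar> ^ Suc (Suc n)" using M0 L(2) by simp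
    qed simp
    finally show ?case
      using tint_diff[OF cFP[of p "Suc n"] cFP[of p n], of t] by (simp only: pic.simps) simp
  qed
  define y where "y t p = lim (\<lambda>n. ?P n t p)" for t p
  have ul: "uniform_limit ({- T..T} \<times> cball p0 1) (\<lambda>n z. ?P n (fst z) (snd z)) (\<lambda>z. y (fst z) (snd z)) sequentially"
    if T: "T \<ge> 0" for T p0
  proof -
    let ?K = "{- T..T} \<times> cball p0 1"
    have "compact ?K" by (intro compact_Times compact_Icc compact_cball)
    moreover have "continuous_on ?K (\<lambda>z. F (fst z) (snd z) (y0 (snd z)))"
      by (intro Fc continuous_intros cy0)
    ultimately have "bounded ((\<lambda>z. F (fst z) (snd z) (y0 (snd z))) ` ?K)"
      by (intro compact_imp_bounded compact_continuous_image)
    then obtain M where M: "\<And>s p. \<bar>s\<bar> \<le> T \<Longrightarrow> p \<in> cball p0 1 \<Longrightarrow> norm (F s p (y0 p)) \<le> M"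
      unfolding bounded_iff by force
    have "norm (F 0 p0 (y0 p0)) \<le> M" using M[of 0 p0] T by simp
    then have M0: "M \<ge> 0" using norm_ge_zero order_trans by blast
    let ?d = "\<lambda>i z. ?P (Suc i) (fst z) (snd z) - ?P i (fst z) (snd z)"
    have "norm (?d i z) \<le> M * T * ((L * T) ^ i / fact i)" if "z \<in> ?K" for i z
    proof -
      have z: "\<bar>fst z\<bar> \<le> T" "snd z \<in> cball p0 1" using that by auto
      have "norm (?d i z) \<le> M * L ^ i * \<bar>fst z\<bar> ^ Suc i / fact i"
        by (rule step[of T]) (use z M in auto)
      also have "\<dots> \<le> M * L ^ i * T ^ Suc i / fact i"
        using z M0 L(2) by (intro divide_right_mono mult_left_mono power_mono) auto
      finally show ?thesis by (simp add: power_mult_distrib mult_ac)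
    qed
    moreover have "summable (\<lambda>i. M * T * ((L * T) ^ i / fact i))"
      using summable_exp_generic[of "L * T"] by (intro summable_mult) (simp add: divide_inverse mult.commute)
    ultimately have "uniform_limit ?K (\<lambda>n z. \<Sum>i<n. ?d i z) (\<lambda>z. suminf (\<lambda>i. ?d i z)) sequentially"
      by (intro Weierstrass_m_test) auto
    then have "uniform_limit ?K (\<lambda>n z. (\<Sum>i<n. ?d i z) + y0 (snd z)) (\<lambda>z. suminf (\<lambda>i. ?d i z) + y0 (snd z)) sequentially"
      by (intro uniform_limit_add) (auto intro: uniform_limit_const)
    moreover have "(\<Sum>i<n. ?d i z) + y0 (snd z) = ?P n (fst z) (snd z)" for n z
      by (subst sum_lessThan_telescope) simp
    ultimately have u: "uniform_limit ?K (\<lambda>n z. ?P n (fst z) (snd z)) (\<lambda>z. suminf (\<lambda>i. ?d i z) + y0 (snd z)) sequentially"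
      by simp
    have "y (fst z) (snd z) = suminf (\<lambda>i. ?d i z) + y0 (snd z)" if "z \<in> ?K" for z
      unfolding y_def by (rule limI) (rule tendsto_uniform_limitI[OF u that])
    then show ?thesis using u by (subst uniform_limit_cong'[where g = "\<lambda>n z. ?P n (fst z) (snd z)"]) auto
  qed
  have cyz: "continuous_on UNIV (\<lambda>z. y (fst z) (snd z))"
  proof -
    have "isCont (\<lambda>z. y (fst z) (snd z)) (t, p)" for t p
    proof -
      have "continuous_on ({- (\<bar>t\<bar> + 1)..\<bar>t\<bar> + 1} \<times> cball p 1) (\<lambda>z. y (fst z) (snd z))"
        by (rule uniform_limit_theorem[OF _ ul]) (auto intro: always_eventually continuous_on_subset[OF cP])
      then have "continuous_on ({- (\<bar>t\<bar> + 1)<..<\<bar>t\<bar> + 1} \<times> ball p 1) (\<lambda>z. y (fst z) (snd z))"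
        by (rule continuous_on_subset) auto
      then show ?thesis
      proof (subst (asm) continuous_on_eq_continuous_at)
        have "(t, p) \<in> {- (\<bar>t\<bar> + 1)<..<\<bar>t\<bar> + 1} \<times> ball p 1" by (simp, linarith)
        then show "isCont (\<lambda>z. y (fst z) (snd z)) (t, p)"
          if "\<forall>x\<in>{- (\<bar>t\<bar> + 1)<..<\<bar>t\<bar> + 1} \<times> ball p 1. isCont (\<lambda>z. y (fst z) (snd z)) x"
          using that by blast
      qed (auto intro: open_Times)
    qed
    then show ?thesis by (auto simp: continuous_on_eq_continuous_at)
  qed
  have cy: "continuous_on UNIV (\<lambda>s. y s p)" for p
    using continuous_on_compose2[OF cyz continuous_on_Pair[OF continuous_on_id continuous_on_const]] by simp
  have cFy: "continuous_on UNIV (\<lambda>s. F s p (y s p))" for p by (intro Fc continuous_intros cy)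
  have lim: "(\<lambda>n. ?P n t p) \<longlonglongrightarrow> y t p" for t p
  proof -
    have "(t, p) \<in> {- \<bar>t\<bar>..\<bar>t\<bar>} \<times> cball p 1" by (simp, linarith)
    from tendsto_uniform_limitI[OF ul this] show ?thesis by simp
  qed
  have eq: "y t p = y0 p + tint t (\<lambda>s. F s p (y s p))" for t p
  proof -
    have "(\<lambda>n. tint t (\<lambda>s. F s p (?P n s p))) \<longlonglongrightarrow> tint t (\<lambda>s. F s p (y s p))"
    proof (rule LIMSEQ_I)
      fix e :: real assume e: "e > 0"
      define e' where "e' = e / ((L + 1) * (\<bar>t\<bar> + 1))"
      have e': "e' > 0" using e L(2) by (simp add: e'_def)
      obtain N where N: "\<And>n z. n \<ge> N \<Longrightarrow> z \<in> {- \<bar>t\<bar>..\<bar>t\<bar>} \<times> cball p 1 \<Longrightarrow> dist (?P n (fst z) (snd z)) (y (fst z) (snd z)) < e'"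
        using uniform_limitD[OF ul[of "\<bar>t\<bar>" p, OF abs_ge_zero] e'] unfolding eventually_sequentially by blast
      have "norm (tint t (\<lambda>s. F s p (?P n s p)) - tint t (\<lambda>s. F s p (y s p))) < e" if n: "n \<ge> N" for n
      proof -
        have "norm (tint t (\<lambda>s. F s p (?P n s p) - F s p (y s p))) \<le> (L * e') * \<bar>t\<bar> ^ Suc 0 / Suc 0"
        proof (rule tint_bound)
          show "continuous_on UNIV (\<lambda>s. F s p (?P n s p) - F s p (y s p))"
            by (rule continuous_on_diff[OF cFP cFy])
          fix s assume s: "\<bar>s\<bar> \<le> \<bar>t\<bar>"
          have "norm (F s p (?P n s p) - F s p (y s p)) \<le> L * norm (?P n s p - y s p)" by (rule L(1))
          also have "\<dots> \<le> L * e'"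
          proof (rule mult_left_mono[OF _ L(2)])
            have "- \<bar>t\<bar> \<le> s" "s \<le> \<bar>t\<bar>" using s by linarith+
            then show "norm (?P n s p - y s p) \<le> e'" using N[OF n, of "(s, p)"] by (simp add: dist_norm)
          qed
          finally show "norm (F s p (?P n s p) - F s p (y s p)) \<le> L * e' * \<bar>s\<bar> ^ 0" by simp
        qed
        also have "\<dots> = e * (L * \<bar>t\<bar> / ((L + 1) * (\<bar>t\<bar> + 1)))" by (simp add: e'_def)
        also have "\<dots> < e * 1"
          using e L(2) by (intro mult_strict_left_mono) (auto simp: divide_simps algebra_simps add_pos_nonneg)
        finally show ?thesis by (simp add: tint_diff[OF cFP cFy])
      qed
      then show "\<exists>N. \<forall>n\<ge>N. norm (tint t (\<lambda>s. F s p (?P n s p)) - tint t (\<lambda>s. F s p (y s p))) < e" by blast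
    qed
    then have "(\<lambda>n. ?P (Suc n) t p) \<longlonglongrightarrow> y0 p + tint t (\<lambda>s. F s p (y s p))"
      unfolding pic.simps by (intro tendsto_add tendsto_const)
    with LIMSEQ_Suc[OF lim] show ?thesis by (rule LIMSEQ_unique)
  qed
  show thesis
  proof (rule that)
    show "continuous_on UNIV (\<lambda>(t, p). y t p)" using cyz by (simp add: split_def)
    show "y 0 p = y0 p" for p using eq[of 0 p] by (simp add: tint_def)
    show "((\<lambda>t. y t p) has_vector_derivative F t p (y t p)) (at t)" for t p
      by (subst eq[abs_def]) (auto intro!: derivative_eq_intros tint_has_derivative cFy)
  qed
qed

text \<open>The \<open>q b t (p, v)\<close> are coefficients of an exact expansion of the
  difference. Being continuous up to \<open>v = 0\<close>, they are the partial derivatives there.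
  The exact expansion replaces an estimate of a remainder term.\<close>

lemma joint_derivative:
  fixes y :: "real \<Rightarrow> 'p::euclidean_space \<Rightarrow> 'b::real_normed_vector"
  assumes T: "\<And>t p. ((\<lambda>t. y t p) has_vector_derivative D t p) (at t)"
    and H: "\<And>t p v. y t (p + v) - y t p = (\<Sum>b\<in>Basis. (v \<bullet> b) *\<^sub>R q b t (p, v))"
    and c: "\<And>b. b \<in> Basis \<Longrightarrow> continuous_on UNIV (\<lambda>(t, p). q b t p)"
  shows "((\<lambda>(t, p). y t p) has_derivative
    (\<lambda>(\<tau>, e). \<tau> *\<^sub>R D t p + (\<Sum>b\<in>Basis. (e \<bullet> b) *\<^sub>R q b t (p, 0)))) (at (t, p))"
proof -
  define Q where "Q t p = (\<Sum>b\<in>Basis. blinfun_scaleR_left (q b t (p, 0)) o\<^sub>L blinfun_inner_left b)" for t p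
  have Q: "Q t p e = (\<Sum>b\<in>Basis. (e \<bullet> b) *\<^sub>R q b t (p, 0))" for t p e
    by (simp add: Q_def blinfun.sum_left)
  have cq: "continuous_on S (\<lambda>x. q b (f x) (g x))"
    if "b \<in> Basis" "continuous_on S f" "continuous_on S g" for S :: "'z::topological_space set" and b f g
    using continuous_on_compose2[OF c[OF that(1)] continuous_on_Pair[OF that(2,3)]] by simp
  have der: "((\<lambda>p. y t p) has_derivative blinfun_apply (Q t p)) (at p)" for t p
  proof (rule has_derivativeI_sandwich[where e = 1 and H = "\<lambda>z. \<Sum>b\<in>Basis. norm (q b t (p, z - p) - q b t (p, 0))"])
    fix z :: 'p assume "z \<noteq> p"
    let ?v = "z - p"
    have "y t z - y t p - Q t p ?v = (\<Sum>b\<in>Basis. (?v \<bullet> b) *\<^sub>R (q b t (p, ?v) - q b t (p, 0)))"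
      using H[of t p ?v] by (simp add: Q scaleR_diff_right sum_subtractf)
    also have "norm \<dots> \<le> (\<Sum>b\<in>Basis. norm ((?v \<bullet> b) *\<^sub>R (q b t (p, ?v) - q b t (p, 0))))"
      by (rule norm_sum)
    also have "\<dots> \<le> (\<Sum>b\<in>Basis. norm ?v * norm (q b t (p, ?v) - q b t (p, 0)))"
    proof (rule sum_mono)
      fix b :: 'p assume b: "b \<in> Basis"
      show "norm ((?v \<bullet> b) *\<^sub>R (q b t (p, ?v) - q b t (p, 0))) \<le> norm ?v * norm (q b t (p, ?v) - q b t (p, 0))"
        unfolding norm_scaleR by (rule mult_right_mono[OF Basis_le_norm[OF b] norm_ge_zero])
    qed
    finally show "norm (y t z - y t p - Q t p ?v) / norm ?v \<le> (\<Sum>b\<in>Basis. norm (q b t (p, ?v) - q b t (p, 0)))"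
      using \<open>z \<noteq> p\<close> by (simp add: sum_distrib_left[symmetric] divide_le_eq mult.commute)
  next
    have "continuous_on UNIV (\<lambda>z. \<Sum>b\<in>Basis. norm (q b t (p, z - p) - q b t (p, 0)))"
      by (intro continuous_intros cq)
    then have "isCont (\<lambda>z. \<Sum>b\<in>Basis. norm (q b t (p, z - p) - q b t (p, 0))) p"
      by (simp add: continuous_on_eq_continuous_at)
    then show "((\<lambda>z. \<Sum>b\<in>Basis. norm (q b t (p, z - p) - q b t (p, 0))) \<longlongrightarrow> 0) (at p)"
      by (simp add: isCont_def)
  qed (auto simp: blinfun.bounded_linear_right)
  have cQ: "continuous_on UNIV (\<lambda>(t, p). Q t p)"
    unfolding Q_def split_def
    by (intro continuous_on_sum bounded_bilinear.continuous_on[OF bounded_bilinear_blinfun_compose]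
        bounded_linear.continuous_on[OF bounded_linear_blinfun_scaleR_left] continuous_intros cq)
  have "((\<lambda>(t, p). y t p) has_derivative (\<lambda>(\<tau>, e). \<tau> *\<^sub>R D t p + Q t p e)) (at (t, p) within UNIV \<times> UNIV)"
  proof (rule has_derivative_partialsI)
    show "((\<lambda>t. y t p) has_derivative (\<lambda>\<tau>. \<tau> *\<^sub>R D t p)) (at t within UNIV)"
      using T by (simp add: has_vector_derivative_def)
    show "continuous (at (t, p) within UNIV \<times> UNIV) (\<lambda>(t, p). Q t p)"
      using cQ by (simp add: continuous_on_eq_continuous_at)
  qed (use der in auto)
  then show ?thesis by (simp add: Q)
qed

text \<open>The derivative averaged over the segment from \<open>x\<close> to \<open>y\<close>. It
  writes a difference of values as a linear expression in \<open>y - x\<close> with continuous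
  coefficients, so that the difference of two solutions of an equation solves a linear
  equation.\<close>

definition hadamard :: "('a::euclidean_space \<Rightarrow> 'b::banach) \<Rightarrow> 'a \<Rightarrow> 'a \<Rightarrow> 'a \<Rightarrow>\<^sub>L 'b" where
  "hadamard f x y = integral {0..1} (\<lambda>\<sigma>. bd f (x + \<sigma> *\<^sub>R (y - x)))"

lemma
  fixes f :: "'a::euclidean_space \<Rightarrow> 'b::banach"
  assumes f: "Ck (Suc 0) UNIV f"
  shows hadamard: "f y - f x = hadamard f x y (y - x)"
    and hadamard_same: "hadamard f x x = bd f x"
    and hadamard_bound: "(\<And>x. norm (bd f x) \<le> L) \<Longrightarrow> norm (hadamard f x y) \<le> L"
    and continuous_hadamard: "\<And>S g h. continuous_on S g \<Longrightarrow> continuous_on S h \<Longrightarrow>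
      continuous_on (S :: 'z::topological_space set) (\<lambda>z. hadamard f (g z) (h z))"
proof -
  have d: "f differentiable (at x)" for x using f by simp
  have cb: "continuous_on UNIV (bd f)" using Ck_bd[OF open_UNIV f] by simp
  have ci: "continuous_on {0..1} (\<lambda>\<sigma>. bd f (x + \<sigma> *\<^sub>R (y - x)))" for x y
    by (intro continuous_on_compose2[OF cb] continuous_intros) auto
  have "((\<lambda>\<sigma>. f (x + \<sigma> *\<^sub>R (y - x))) has_vector_derivative dd f (x + \<sigma> *\<^sub>R (y - x)) (y - x))
      (at \<sigma> within {0..1})" for \<sigma>
    by (rule has_vector_derivative_at_within[OF dd_line[OF d]])
  from fundamental_theorem_of_calculus[OF zero_le_one this]
  have "f y - f x = integral {0..1} (\<lambda>\<sigma>. bd f (x + \<sigma> *\<^sub>R (y - x)) (y - x))"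
    by (simp add: bd_apply[OF d] integral_unique)
  also have "\<dots> = hadamard f x y (y - x)"
    unfolding hadamard_def by (rule blinfun_apply_integral[symmetric]) (rule integrable_continuous_real[OF ci])
  finally show "f y - f x = hadamard f x y (y - x)" .
  show "hadamard f x x = bd f x" by (simp add: hadamard_def)
  show "norm (hadamard f x y) \<le> L" if "\<And>x. norm (bd f x) \<le> L"
    unfolding hadamard_def using integral_bound[OF _ ci[of x y], of L] that by simp
  show "continuous_on S (\<lambda>z. hadamard f (g z) (h z))" if "continuous_on S g" "continuous_on S h"
    for S :: "'z set" and g h
  proof -
    have "continuous_on S (\<lambda>z. integral (cbox 0 1) (\<lambda>\<sigma>. bd f (g z + \<sigma> *\<^sub>R (h z - g z))))"
    proof (rule integral_continuous_on_param)
      have "continuous_on (S \<times> cbox 0 1) (\<lambda>w. bd f (g (fst w) + snd w *\<^sub>R (h (fst w) - g (fst w))))"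
        by (intro continuous_on_compose2[OF cb] continuous_intros
            continuous_on_compose2[OF that(1)] continuous_on_compose2[OF that(2)]) auto
      then show "continuous_on (S \<times> cbox 0 1) (\<lambda>(z, \<sigma>). bd f (g z + \<sigma> *\<^sub>R (h z - g z)))"
        by (simp add: split_def)
    qed
    then show ?thesis by (simp add: hadamard_def)
  qed
qed

lemma hadamard_snd:
  fixes f :: "real \<times> 'p::euclidean_space \<Rightarrow> 'b::banach"
  assumes f: "Ck (Suc 0) UNIV f"
  shows "f (t, p + v) - f (t, p) = (\<Sum>b\<in>Basis. (v \<bullet> b) *\<^sub>R hadamard f (t, p) (t, p + v) (0, b))"
proof -
  have "(0 :: real, v) = (\<Sum>b\<in>Basis. (v \<bullet> b) *\<^sub>R (0, b))"
    by (simp add: prod_eq_iff fst_sum snd_sum euclidean_representation)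
  then have "blinfun_apply h (0, v) = (\<Sum>b\<in>Basis. (v \<bullet> b) *\<^sub>R blinfun_apply h (0, b))" for h :: "(real \<times> 'p) \<Rightarrow>\<^sub>L 'b"
    by (simp only: blinfun.sum_right blinfun.scaleR_right)
  then show ?thesis using hadamard[OF f, of "(t, p + v)" "(t, p)"] by simp
qed

text \<open>Induction on \<open>k\<close>. The expansion coefficients of
  \<open>y t (p + v) - y t p\<close> solve a linear equation with parameter \<open>(p, v)\<close>;
  \<open>picard\<close> produces continuous solutions and uniqueness identifies them. At
  \<open>v = 0\<close> this is the differentiated equation, whose coefficients have one derivative
  less, so the induction hypothesis applies to it.\<close>

lemma linear_ode_Ck:
  fixes A :: "real \<times> 'p::euclidean_space \<Rightarrow> ('b::euclidean_space \<Rightarrow>\<^sub>L 'b)"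
  assumes A: "Ck k UNIV A" "\<And>z. norm (A z) \<le> L" and B: "Ck k UNIV B"
    and y: "\<And>t p. ((\<lambda>t. y t p) has_vector_derivative A (t, p) (y t p) + B (t, p)) (at t)"
    and y0: "\<And>p. y 0 p = c"
  shows "Ck k UNIV (\<lambda>(t, p). y t p)"
  using A(1) B y y0
proof (induction k arbitrary: B y c)
  case 0
  have L: "L \<ge> 0" using A(2) norm_ge_zero order_trans by blast
  have Al: "norm (A z x - A z x') \<le> L * norm (x - x')" for z x x'
    by (simp add: blinfun.diff_right[symmetric])
      (meson A(2) mult_right_mono norm_blinfun norm_ge_zero order_trans)
  have cA: "continuous_on UNIV A" and cB: "continuous_on UNIV B" using 0 by simp_all
  have c: "continuous_on UNIV (\<lambda>(t, p, x). A (t, p) x + B (t, p))"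
    unfolding split_def
    by (intro continuous_on_add bounded_bilinear.continuous_on[OF bounded_bilinear_blinfun_apply]
        continuous_on_compose2[OF cA] continuous_on_compose2[OF cB] continuous_intros) auto
  have lip: "norm (A (t, p) x + B (t, p) - (A (t, p) x' + B (t, p))) \<le> L * norm (x - x')" for t p x x'
    using Al by simp
  \<comment> \<open>The solution \<open>y\<close> is given for each \<open>p\<close> separately; its
    continuity in \<open>p\<close> comes from comparison with the Picard solution.\<close>
  obtain z where z: "continuous_on UNIV (\<lambda>(t, p). z t p)" "\<And>p. z 0 p = c"
    "\<And>t p. ((\<lambda>t. z t p) has_vector_derivative A (t, p) (z t p) + B (t, p)) (at t)"
    by (rule picard[OF c lip L continuous_on_const[of UNIV c]]) (rule that)
  have "y t p - z t p = 0" for t p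
  proof (rule gronwall_zero)
    show "((\<lambda>t. y t p - z t p) has_vector_derivative A (s, p) (y s p) - A (s, p) (z s p)) (at s)" for s
      using has_vector_derivative_diff[OF "0.prems"(3)[of p s] z(3)[of p s]] by simp
    show "norm (A (s, p) (y s p) - A (s, p) (z s p)) \<le> L * norm (y s p - z s p)" for s by (rule Al)
  qed (use 0 z in simp)
  then have "y = z" by (simp add: fun_eq_iff)
  then show ?case using z by simp
next
  case (Suc k)
  have L: "L \<ge> 0" using A(2) norm_ge_zero order_trans by blast
  have A1: "Ck (Suc 0) UNIV A" and B1: "Ck (Suc 0) UNIV B" using Ck_le Suc.prems(1,2) by blast+
  have Ak: "Ck k UNIV A" and Bk: "Ck k UNIV B" using Ck_Suc_imp Suc.prems(1,2) by blast+
  have yk: "Ck k UNIV (\<lambda>(t, p). y t p)" by (rule Suc.IH[OF Ak Bk Suc.prems(3,4)])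
  have cA: "continuous_on UNIV A" by (rule Ck_continuous[OF Ak])
  have cy: "continuous_on UNIV (\<lambda>(t, p). y t p)" by (rule Ck_continuous[OF yk])
  define R where "R b t p v = hadamard A (t, p) (t, p + v) (0, b) (y t p) + hadamard B (t, p) (t, p + v) (0, b)" for b t p v
  have "\<exists>q. continuous_on UNIV (\<lambda>(t, p). q t p) \<and> (\<forall>p. q 0 p = 0) \<and>
    (\<forall>t p. ((\<lambda>t. q t p) has_vector_derivative A (t, fst p + snd p) (q t p) + R b t (fst p) (snd p)) (at t))" for b
  proof -
    have c1: "continuous_on UNIV (\<lambda>z :: real \<times> ('p \<times> 'p) \<times> 'b. y (fst z) (fst (fst (snd z))))"
    proof -
      have "continuous_on UNIV (\<lambda>z :: real \<times> ('p \<times> 'p) \<times> 'b. (fst z, fst (fst (snd z))))"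
        by (intro continuous_intros)
      from continuous_on_compose2[OF cy this] show ?thesis by simp
    qed
    have c: "continuous_on UNIV (\<lambda>(t, p, x). A (t, fst p + snd p) x + R b t (fst p) (snd p))"
      unfolding split_def R_def
      by (intro continuous_on_add bounded_bilinear.continuous_on[OF bounded_bilinear_blinfun_apply]
          continuous_hadamard[OF A1] continuous_hadamard[OF B1] c1
          continuous_on_compose2[OF cA] continuous_intros) auto
    have lip: "norm (A (t, fst p + snd p) x + R b t (fst p) (snd p) -
        (A (t, fst p + snd p) x' + R b t (fst p) (snd p))) \<le> L * norm (x - x')" for t p x x'
      by (simp add: blinfun.diff_right[symmetric])
        (meson A(2) mult_right_mono norm_blinfun norm_ge_zero order_trans)
    show ?thesis
      by (rule picard[OF c lip L continuous_on_const[of UNIV 0]]) blast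
  qed
  then obtain q where q: "\<And>b. continuous_on UNIV (\<lambda>(t, p). q b t p)" "\<And>b p. q b 0 p = 0"
    "\<And>b t p. ((\<lambda>t. q b t p) has_vector_derivative A (t, fst p + snd p) (q b t p) + R b t (fst p) (snd p)) (at t)"
    by metis
  have H: "y t (p + v) - y t p = (\<Sum>b\<in>Basis. (v \<bullet> b) *\<^sub>R q b t (p, v))" for t p v
  proof -
    let ?d = "\<lambda>t. y t (p + v) - y t p - (\<Sum>b\<in>Basis. (v \<bullet> b) *\<^sub>R q b t (p, v))"
    have "?d t = 0"
    proof (rule gronwall_zero)
      fix s
      have "((\<lambda>t. (v \<bullet> b) *\<^sub>R q b t (p, v)) has_vector_derivative
          (v \<bullet> b) *\<^sub>R (A (s, p + v) (q b s (p, v)) + R b s p v)) (at s)" for b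
        using bounded_linear.has_vector_derivative[OF bounded_linear_scaleR_right q(3)[of b "(p, v)" s], of "v \<bullet> b"]
        by simp
      note sumq = has_vector_derivative_sum[OF this]
      have "(?d has_vector_derivative (A (s, p + v) (y s (p + v)) + B (s, p + v)) - (A (s, p) (y s p) + B (s, p))
          - (\<Sum>b\<in>Basis. (v \<bullet> b) *\<^sub>R (A (s, p + v) (q b s (p, v)) + R b s p v))) (at s)"
        by (rule has_vector_derivative_diff[OF has_vector_derivative_diff[OF Suc.prems(3) Suc.prems(3)] sumq])
      moreover have "(\<Sum>b\<in>Basis. (v \<bullet> b) *\<^sub>R R b s p v) = (A (s, p + v) - A (s, p)) (y s p) + (B (s, p + v) - B (s, p))"
        unfolding hadamard_snd[OF A1] hadamard_snd[OF B1]
        by (simp add: R_def scaleR_add_right sum.distrib blinfun.sum_left blinfun.scaleR_left)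
      ultimately show "(?d has_vector_derivative A (s, p + v) (?d s)) (at s)"
        by (simp add: scaleR_add_right sum.distrib blinfun.diff_right blinfun.diff_left blinfun.sum_right
            blinfun.scaleR_right blinfun.add_right algebra_simps)
      show "norm (A (s, p + v) (?d s)) \<le> L * norm (?d s)"
        by (meson A(2) mult_right_mono norm_blinfun norm_ge_zero order_trans)
    qed (simp add: Suc.prems(4) q(2))
    then show ?thesis by simp
  qed
  have qk: "Ck k UNIV (\<lambda>(t, p). q b t (p, 0))" for b
  proof (rule Suc.IH[OF Ak, where B = "\<lambda>z. dd A z (0, b) (case z of (t, p) \<Rightarrow> y t p) + dd B z (0, b)" and c = 0])
    show "Ck k UNIV (\<lambda>z. dd A z (0, b) (case z of (t, p) \<Rightarrow> y t p) + dd B z (0, b))"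
      using Suc.prems(1,2)
      by (intro Ck_add[OF open_UNIV Ck_bilinear[OF bounded_bilinear_blinfun_apply open_UNIV _ yk]]) auto
    have "R b t p 0 = dd A (t, p) (0, b) (y t p) + dd B (t, p) (0, b)" for t p
      using A1 B1 by (simp add: R_def hadamard_same bd_apply)
    then show "((\<lambda>t. q b t (p, 0)) has_vector_derivative
       A (t, p) (q b t (p, 0)) + (dd A (t, p) (0, b) (case (t, p) of (t, p) \<Rightarrow> y t p) + dd B (t, p) (0, b))) (at t)" for t p
      using q(3)[of b "(p, 0)" t] by simp
  qed (rule q(2))
  show ?case
  proof (rule Ck_SucI[OF open_UNIV, where f' = "\<lambda>z v. case z of (t, p) \<Rightarrow> case v of (\<tau>, e) \<Rightarrow>
      \<tau> *\<^sub>R (A (t, p) (y t p) + B (t, p)) + (\<Sum>b\<in>Basis. (e \<bullet> b) *\<^sub>R q b t (p, 0))"])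
    fix z :: "real \<times> 'p"
    show "((\<lambda>(t, p). y t p) has_derivative (\<lambda>v. case z of (t, p) \<Rightarrow> case v of (\<tau>, e) \<Rightarrow>
      \<tau> *\<^sub>R (A (t, p) (y t p) + B (t, p)) + (\<Sum>b\<in>Basis. (e \<bullet> b) *\<^sub>R q b t (p, 0)))) (at z)"
      using joint_derivative[of y, OF Suc.prems(3) H q(1)] by (cases z) auto
  next
    fix v :: "real \<times> 'p"
    have "Ck k UNIV (\<lambda>z. fst v *\<^sub>R (A z (case z of (t, p) \<Rightarrow> y t p) + B z) +
        (\<Sum>b\<in>Basis. (snd v \<bullet> b) *\<^sub>R (case z of (t, p) \<Rightarrow> q b t (p, 0))))"
      by (rule Ck_add[OF open_UNIV Ck_bounded_linear[OF bounded_linear_scaleR_right open_UNIV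
            Ck_add[OF open_UNIV Ck_bilinear[OF bounded_bilinear_blinfun_apply open_UNIV Ak yk] Bk]]
          Ck_sum[OF open_UNIV Ck_bounded_linear[OF bounded_linear_scaleR_right open_UNIV qk]]])
    then show "Ck k UNIV (\<lambda>z. case z of (t, p) \<Rightarrow> case v of (\<tau>, e) \<Rightarrow>
      \<tau> *\<^sub>R (A (t, p) (y t p) + B (t, p)) + (\<Sum>b\<in>Basis. (e \<bullet> b) *\<^sub>R q b t (p, 0)))"
      by (simp add: split_def)
  qed
qed

text \<open>The scheme of the linear case, with the Hadamard average of \<open>X\<close> between two
  trajectories as coefficient. The expansion coefficients start at the basis vectors because the
  parameter is the initial point itself. Smoothness bootstraps: the variational equation has the
  coefficient \<open>bd X\<close> along \<open>\<phi>\<close>, which is as smooth as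
  \<open>\<phi>\<close>.\<close>

lemma lipschitz_flow:
  fixes X :: "'a::euclidean_space \<Rightarrow> 'a"
  assumes X: "Cinf UNIV X" and L: "\<And>x. norm (bd X x) \<le> L"
  obtains \<phi> where "Cinf UNIV (\<lambda>(t, x). \<phi> t x)" "\<And>x. \<phi> 0 x = x"
    "\<And>t x. ((\<lambda>t. \<phi> t x) has_vector_derivative X (\<phi> t x)) (at t)"
proof -
  have X1: "Ck (Suc 0) UNIV X" using X unfolding Cinf_def by blast
  have L0: "L \<ge> 0" using L norm_ge_zero order_trans by blast
  have cX: "continuous_on UNIV X" by (rule Cinf_continuous[OF X])
  have XL: "norm (X x - X y) \<le> L * norm (x - y)" for x y
    unfolding hadamard[OF X1, of x y]
    by (meson hadamard_bound[OF X1 L] mult_right_mono norm_blinfun norm_ge_zero order_trans)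
  have c: "continuous_on UNIV (\<lambda>(t :: real, p :: 'a, x). X x)"
    unfolding split_def by (intro continuous_on_compose2[OF cX] continuous_intros) auto
  obtain \<phi> where \<phi>: "continuous_on UNIV (\<lambda>(t, x). \<phi> t x)" "\<And>x. \<phi> 0 x = x"
    "\<And>t x. ((\<lambda>t. \<phi> t x) has_vector_derivative X (\<phi> t x)) (at t)"
    by (rule picard[OF c XL L0 continuous_on_id]) (rule that)
  have c\<phi>: "continuous_on S (\<lambda>z. \<phi> (f z) (g z))" if "continuous_on S f" "continuous_on S g"
    for S :: "'z::topological_space set" and f g
    using continuous_on_compose2[OF \<phi>(1) continuous_on_Pair[OF that]] by simp
  define Ah where "Ah t p = hadamard X (\<phi> t (fst p)) (\<phi> t (fst p + snd p))" for t p
  have nA: "norm (Ah t p x) \<le> L * norm x" for t p x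
    by (metis Ah_def hadamard_bound[OF X1 L] mult_right_mono norm_blinfun norm_ge_zero order_trans)
  have "\<exists>q. continuous_on UNIV (\<lambda>(t, p). q t p) \<and> (\<forall>p. q 0 p = b) \<and>
    (\<forall>t p. ((\<lambda>t. q t p) has_vector_derivative Ah t p (q t p)) (at t))" for b
  proof -
    have c: "continuous_on UNIV (\<lambda>(t, p, x). Ah t p x)"
      unfolding split_def Ah_def
      by (intro bounded_bilinear.continuous_on[OF bounded_bilinear_blinfun_apply]
          continuous_hadamard[OF X1] c\<phi> continuous_intros)
    have lip: "norm (Ah t p x - Ah t p x') \<le> L * norm (x - x')" for t p x x'
      using nA by (simp add: blinfun.diff_right[symmetric])
    show ?thesis
      by (rule picard[OF c lip L0 continuous_on_const[of UNIV b]]) blast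
  qed
  then obtain q where q: "\<And>b. continuous_on UNIV (\<lambda>(t, p). q b t p)" "\<And>b p. q b 0 p = b"
    "\<And>b t p. ((\<lambda>t. q b t p) has_vector_derivative Ah t p (q b t p)) (at t)"
    by metis
  have H: "\<phi> t (p + v) - \<phi> t p = (\<Sum>b\<in>Basis. (v \<bullet> b) *\<^sub>R q b t (p, v))" for t p v
  proof -
    let ?d = "\<lambda>t. \<phi> t (p + v) - \<phi> t p - (\<Sum>b\<in>Basis. (v \<bullet> b) *\<^sub>R q b t (p, v))"
    have "?d t = 0"
    proof (rule gronwall_zero)
      fix s
      have "((\<lambda>t. (v \<bullet> b) *\<^sub>R q b t (p, v)) has_vector_derivative
          (v \<bullet> b) *\<^sub>R Ah s (p, v) (q b s (p, v))) (at s)" for b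
        using bounded_linear.has_vector_derivative[OF bounded_linear_scaleR_right q(3)[of b "(p, v)" s], of "v \<bullet> b"]
        by simp
      note sumq = has_vector_derivative_sum[OF this]
      have "(?d has_vector_derivative X (\<phi> s (p + v)) - X (\<phi> s p)
          - (\<Sum>b\<in>Basis. (v \<bullet> b) *\<^sub>R Ah s (p, v) (q b s (p, v)))) (at s)"
        by (rule has_vector_derivative_diff[OF has_vector_derivative_diff[OF \<phi>(3) \<phi>(3)] sumq])
      then show "(?d has_vector_derivative Ah s (p, v) (?d s)) (at s)"
        unfolding hadamard[OF X1, of "\<phi> s (p + v)" "\<phi> s p"]
        by (simp add: Ah_def blinfun.diff_right blinfun.sum_right blinfun.scaleR_right)
      show "norm (Ah s (p, v) (?d s)) \<le> L * norm (?d s)" by (rule nA)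
    qed (simp add: \<phi>(2) q(2) euclidean_representation)
    then show ?thesis by simp
  qed
  have der: "((\<lambda>(t, x). \<phi> t x) has_derivative
      (\<lambda>v. case z of (t, p) \<Rightarrow> case v of (\<tau>, e) \<Rightarrow> \<tau> *\<^sub>R X (\<phi> t p) + (\<Sum>b\<in>Basis. (e \<bullet> b) *\<^sub>R q b t (p, 0)))) (at z)" for z
    using joint_derivative[of \<phi>, OF \<phi>(3) H q(1)] by (cases z) auto
  have "Ck k UNIV (\<lambda>(t, x). \<phi> t x)" for k
  proof (induction k)
    case (Suc k)
    have Xk: "Ck k UNIV X" "Ck (Suc k) UNIV X" using X unfolding Cinf_def by blast+
    have X\<phi>: "Ck k UNIV (\<lambda>z. X (case z of (t, x) \<Rightarrow> \<phi> t x))"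
      by (rule Ck_compose[OF open_UNIV open_UNIV Xk(1) Suc]) auto
    have bX: "Ck k UNIV (\<lambda>z. bd X (case z of (t, x) \<Rightarrow> \<phi> t x))"
      by (rule Ck_compose[OF open_UNIV open_UNIV Ck_bd[OF open_UNIV Xk(2)] Suc]) auto
    have qk: "Ck k UNIV (\<lambda>(t, p). q b t (p, 0))" for b
    proof (rule linear_ode_Ck[OF bX, where B = "\<lambda>z. 0" and c = b])
      show "((\<lambda>t. q b t (p, 0)) has_vector_derivative
          bd X (case (t, p) of (t, x) \<Rightarrow> \<phi> t x) (q b t (p, 0)) + 0) (at t)" for t p
        using q(3)[of b "(p, 0)" t] by (simp add: Ah_def hadamard_same[OF X1])
    qed (use L q(2) in auto)
    show ?case
    proof (rule Ck_SucI[OF open_UNIV der])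
      fix v :: "real \<times> 'a"
      have "Ck k UNIV (\<lambda>z. fst v *\<^sub>R X (case z of (t, p) \<Rightarrow> \<phi> t p) +
          (\<Sum>b\<in>Basis. (snd v \<bullet> b) *\<^sub>R (case z of (t, p) \<Rightarrow> q b t (p, 0))))"
        by (rule Ck_add[OF open_UNIV Ck_bounded_linear[OF bounded_linear_scaleR_right open_UNIV X\<phi>]
            Ck_sum[OF open_UNIV Ck_bounded_linear[OF bounded_linear_scaleR_right open_UNIV qk]]])
      then show "Ck k UNIV (\<lambda>z. case z of (t, p) \<Rightarrow> case v of (\<tau>, e) \<Rightarrow>
          \<tau> *\<^sub>R X (\<phi> t p) + (\<Sum>b\<in>Basis. (e \<bullet> b) *\<^sub>R q b t (p, 0)))"
        by (simp add: split_def)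
    qed
  qed (use \<phi>(1) in simp)
  then show thesis using \<phi>(2,3) by (intro that[of \<phi>]) (auto simp: Cinf_def)
qed

section \<open>Uniqueness of solutions, and flows of vector fields of linear growth\<close>

lemma gronwall_abs:
  fixes y :: "real \<Rightarrow> 'a::real_inner"
  assumes y: "\<And>s. \<bar>s\<bar> \<le> \<bar>t\<bar> \<Longrightarrow> (y has_vector_derivative y' s) (at s)"
    and le: "\<And>s. \<bar>s\<bar> \<le> \<bar>t\<bar> \<Longrightarrow> norm (y' s) \<le> L * norm (y s)"
  shows "norm (y t) \<le> exp (L * \<bar>t\<bar>) * norm (y 0)"
proof (cases "t \<ge> 0")
  case True
  then show ?thesis using gronwall[OF True, of y y' L] y le by auto
next
  case False
  have "((\<lambda>s. y (- s)) has_vector_derivative - y' (- s)) (at s)" if "0 \<le> s" "s \<le> - t" for s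
  proof -
    have "(y has_vector_derivative y' (- s)) (at (- s))" using y[of "- s"] that by simp
    then have "((y \<circ> uminus) has_vector_derivative (- 1) *\<^sub>R y' (- s)) (at s)"
      by (intro vector_diff_chain_at) (auto intro!: derivative_eq_intros)
    then show ?thesis by (simp add: o_def)
  qed
  from gronwall[OF _ this, of "- t" L] show ?thesis using False le by auto
qed

lemma Cinf_lipschitz_on_ball:
  fixes X :: "'a::euclidean_space \<Rightarrow> 'b::real_normed_vector"
  assumes X: "Cinf UNIV X"
  obtains L where "L \<ge> 0" "\<And>x. norm x \<le> R \<Longrightarrow> norm (bd X x) \<le> L"
    "\<And>x y. norm x \<le> R \<Longrightarrow> norm y \<le> R \<Longrightarrow> norm (X x - X y) \<le> L * norm (x - y)"
proof -
  have "compact (bd X ` cball 0 R)"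
    by (intro compact_continuous_image continuous_on_subset[OF Cinf_continuous[OF Cinf_bd[OF open_UNIV X]]]) auto
  then have "bounded (bd X ` cball 0 R)" by (rule compact_imp_bounded)
  then obtain L where "L > 0" "\<forall>z\<in>bd X ` cball 0 R. norm z \<le> L" unfolding bounded_pos by blast
  then have L: "L > 0" "\<And>x. norm x \<le> R \<Longrightarrow> norm (bd X x) \<le> L" by simp_all
  show thesis
  proof (rule that[OF _ L(2)])
    fix x y :: 'a assume xy: "norm x \<le> R" "norm y \<le> R"
    show "norm (X x - X y) \<le> L * norm (x - y)"
    proof (rule differentiable_bound[where S = "cball 0 R" and f' = "\<lambda>x. bd X x"])
      fix x :: 'a assume "x \<in> cball 0 R"
      then show "onorm (blinfun_apply (bd X x)) \<le> L" using L(2)[of x] by (simp add: norm_blinfun.rep_eq)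
      show "(X has_derivative blinfun_apply (bd X x)) (at x within cball 0 R)"
        by (rule has_derivative_at_withinI[OF bd_has_derivative[OF Cinf_differentiable[OF X UNIV_I]]])
    qed (use xy in auto)
  qed (use L in auto)
qed

text \<open>Over the compact time interval both trajectories stay in one ball, on which
  \<open>X\<close> has a Lipschitz constant.\<close>

lemma ode_unique:
  fixes X :: "'a::euclidean_space \<Rightarrow> 'a"
  assumes X: "Cinf UNIV X"
    and y: "\<And>s. \<bar>s\<bar> \<le> \<bar>t\<bar> \<Longrightarrow> (y has_vector_derivative X (y s)) (at s)"
    and z: "\<And>s. \<bar>s\<bar> \<le> \<bar>t\<bar> \<Longrightarrow> (z has_vector_derivative X (z s)) (at s)"
    and "y 0 = z 0"
  shows "y t = z t"
proof -
  have cont: "continuous_on {- \<bar>t\<bar>..\<bar>t\<bar>} f"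
    if "\<And>s. \<bar>s\<bar> \<le> \<bar>t\<bar> \<Longrightarrow> (f has_vector_derivative X (f s)) (at s)" for f
  proof (rule continuous_at_imp_continuous_on, rule ballI)
    fix s assume "s \<in> {- \<bar>t\<bar>..\<bar>t\<bar>}"
    then have "\<bar>s\<bar> \<le> \<bar>t\<bar>" by auto
    from has_vector_derivative_continuous[OF that[OF this]] show "isCont f s" .
  qed
  have "bounded (y ` {- \<bar>t\<bar>..\<bar>t\<bar>} \<union> z ` {- \<bar>t\<bar>..\<bar>t\<bar>})"
    by (intro bounded_Un[THEN iffD2] conjI compact_imp_bounded compact_continuous_image cont y z compact_Icc)
  then obtain R where R: "\<And>s. s \<in> {- \<bar>t\<bar>..\<bar>t\<bar>} \<Longrightarrow> norm (y s) \<le> R \<and> norm (z s) \<le> R"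
    unfolding bounded_iff by blast
  obtain L where L: "L \<ge> 0" "\<And>x. norm x \<le> R \<Longrightarrow> norm (bd X x) \<le> L"
    "\<And>x y. norm x \<le> R \<Longrightarrow> norm y \<le> R \<Longrightarrow> norm (X x - X y) \<le> L * norm (x - y)"
    by (rule Cinf_lipschitz_on_ball[OF X, of R]) (rule that)
  have "(\<lambda>s. y s - z s) t = 0"
  proof (rule gronwall_zero)
    fix s assume s: "\<bar>s\<bar> \<le> \<bar>t\<bar>"
    show "((\<lambda>s. y s - z s) has_vector_derivative X (y s) - X (z s)) (at s)"
      by (rule has_vector_derivative_diff[OF y[OF s] z[OF s]])
    have "s \<in> {- \<bar>t\<bar>..\<bar>t\<bar>}" using s by auto
    then show "norm (X (y s) - X (z s)) \<le> L * norm (y s - z s)" using R L(3) by blast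
  qed (simp add: assms(4))
  then show ?thesis by simp
qed

lemma bd_bounded_support:
  fixes X :: "'a::euclidean_space \<Rightarrow> 'b::real_normed_vector"
  assumes X: "Cinf UNIV X" and 0: "\<And>x. norm x > R \<Longrightarrow> X x = 0"
  obtains L where "\<And>x. norm (bd X x) \<le> L"
proof -
  obtain L where L: "L \<ge> 0" "\<And>x. norm x \<le> R \<Longrightarrow> norm (bd X x) \<le> L"
    "\<And>x y. norm x \<le> R \<Longrightarrow> norm y \<le> R \<Longrightarrow> norm (X x - X y) \<le> L * norm (x - y)"
    by (rule Cinf_lipschitz_on_ball[OF X, of R]) (rule that)
  have "norm (bd X x) \<le> L" for x
  proof (cases "norm x \<le> R")
    case False
    have o: "open (- cball (0::'a) R)" by (simp add: open_Compl)
    have "(X has_derivative (\<lambda>v. 0)) (at x)"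
      by (rule has_derivative_transform_within_open[OF has_derivative_const[of 0] o]) (use False 0 in auto)
    then have "dd X x = (\<lambda>v. 0)" by (rule frechet_derivative_at[symmetric])
    then have "bd X x = 0"
      by (intro blinfun_eqI) (simp add: bd_apply[OF Cinf_differentiable[OF X UNIV_I]])
    then show ?thesis using L(1) by simp
  qed (use L in blast)
  then show thesis using that by blast
qed

text \<open>On the set where a trajectory cannot leave the ball of radius \<open>n\<close>, the flow agrees with the
  flow of the field cut off outside of that ball.\<close>

theorem smooth_flow:
  fixes X :: "'a::euclidean_space \<Rightarrow> 'a"
  assumes X: "Cinf UNIV X" and K: "\<And>x. norm (X x) \<le> K * (1 + norm x)"
  obtains \<phi> where "Cinf UNIV (\<lambda>(t, x). \<phi> t x)" "\<And>x. \<phi> 0 x = x"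
    "\<And>t x. ((\<lambda>t. \<phi> t x) has_vector_derivative X (\<phi> t x)) (at t)"
    "\<And>s t x. \<phi> (s + t) x = \<phi> s (\<phi> t x)"
proof -
  have K0: "K \<ge> 0" using order_trans[OF norm_ge_zero K[of 0]] by simp
  obtain \<beta> :: "real \<Rightarrow> real" where \<beta>: "Cinf UNIV \<beta>" "\<And>x. x \<le> 1 \<Longrightarrow> \<beta> x = 1" "\<And>x. x \<ge> 4 \<Longrightarrow> \<beta> x = 0"
    "\<And>x. 0 \<le> \<beta> x" "\<And>x. \<beta> x \<le> 1"
    using smooth_step[of 1 4] by auto
  define Xn where "Xn n x = \<beta> ((x \<bullet> x) * inverse (n * n)) *\<^sub>R X x" for n :: real and x
  have Xn_eq: "Xn n x = X x" if "norm x \<le> n" "n > 0" for n x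
  proof -
    have "x \<bullet> x \<le> n * n" using that by (simp add: power2_norm_eq_inner[symmetric] power2_eq_square mult_mono)
    then show ?thesis using that by (simp add: Xn_def \<beta>(2) field_simps)
  qed
  have Xn_K: "norm (Xn n x) \<le> K * (1 + norm x)" for n x
  proof -
    have "norm (Xn n x) \<le> 1 * norm (X x)"
      unfolding Xn_def norm_scaleR using \<beta>(4,5) by (intro mult_right_mono) auto
    then show ?thesis using K[of x] by simp
  qed
  have Xn_C: "Cinf UNIV (Xn n)" for n
    unfolding Xn_def
    by (intro Cinf_scaleR[OF open_UNIV _ X] Cinf_compose_UNIV[OF open_UNIV \<beta>(1)] Cinf_mult Cinf_inner Cinf_ident Cinf_const open_UNIV)
  have "\<exists>\<phi>. n > 0 \<longrightarrow> Cinf UNIV (\<lambda>(t, x). \<phi> t x) \<and> (\<forall>x. \<phi> 0 x = x) \<and>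
    (\<forall>t x. ((\<lambda>t. \<phi> t x) has_vector_derivative Xn n (\<phi> t x)) (at t))" for n
  proof (cases "n > 0")
    case True
    have "Xn n x = 0" if "norm x > 2 * n" for x
    proof -
      have "(2 * n) * (2 * n) \<le> norm x * norm x" using that True by (intro mult_mono) auto
      then have "(2 * n) * (2 * n) \<le> x \<bullet> x" by (simp add: power2_norm_eq_inner[symmetric] power2_eq_square)
      then show ?thesis using True by (simp add: Xn_def \<beta>(3) field_simps)
    qed
    then obtain L where L: "\<And>x. norm (bd (Xn n) x) \<le> L" using bd_bounded_support[OF Xn_C] by blast
    show ?thesis by (rule lipschitz_flow[OF Xn_C L]) blast
  qed blast
  then obtain \<phi>n where \<phi>n: "\<And>n. n > 0 \<Longrightarrow> Cinf UNIV (\<lambda>(t, x). \<phi>n n t x)" "\<And>n x. n > 0 \<Longrightarrow> \<phi>n n 0 x = x"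
    "\<And>n t x. n > 0 \<Longrightarrow> ((\<lambda>t. \<phi>n n t x) has_vector_derivative Xn n (\<phi>n n t x)) (at t)"
    by metis
  \<comment> \<open>\<open>norm (1, x)\<close> is comparable with \<open>1 + norm x\<close> but
    comes from an inner product, so the Gronwall estimate applies to the curve
    \<open>(1, \<phi>n n t x)\<close>.\<close>
  define B where "B t x = exp (2 * K * \<bar>t\<bar>) * norm (1 :: real, x)" for t :: real and x :: 'a
  have B1: "B t x \<ge> 1" for t x
  proof -
    have "norm (1 :: real, x) \<ge> 1" using norm_fst_le[of "1 :: real" x] by simp
    moreover have "exp (2 * K * \<bar>t\<bar>) \<ge> 1" using K0 by simp
    ultimately show ?thesis unfolding B_def using mult_mono[of 1 _ 1] by fastforce
  qed
  have bound: "norm (\<phi>n n t x) \<le> B t x" if n: "n > 0" for n t x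
  proof -
    have "norm (1 :: real, \<phi>n n t x) \<le> exp (2 * K * \<bar>t\<bar>) * norm (1 :: real, \<phi>n n 0 x)"
    proof (rule gronwall_abs)
      fix s
      show "((\<lambda>t. (1 :: real, \<phi>n n t x)) has_vector_derivative (0, Xn n (\<phi>n n s x))) (at s)"
        by (intro has_vector_derivative_Pair has_vector_derivative_const \<phi>n(3) n)
      have "norm (0 :: real, Xn n (\<phi>n n s x)) \<le> K * (1 + norm (\<phi>n n s x))" using Xn_K by simp
      also have "\<dots> \<le> K * (2 * norm (1 :: real, \<phi>n n s x))"
        using norm_fst_le[of "1 :: real" "\<phi>n n s x"] norm_snd_le[of "\<phi>n n s x" "1 :: real"]
        by (intro mult_left_mono K0) simp
      finally show "norm (0 :: real, Xn n (\<phi>n n s x)) \<le> 2 * K * norm (1 :: real, \<phi>n n s x)" by simp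
    qed
    then show ?thesis
      using norm_snd_le[of "\<phi>n n t x" "1 :: real"] n by (simp add: B_def \<phi>n(2))
  qed
  have Bmono: "B s x \<le> B t x" if "\<bar>s\<bar> \<le> \<bar>t\<bar>" for s t x
    unfolding B_def using that K0 by (intro mult_right_mono) (auto intro: mult_left_mono)
  have sol: "((\<lambda>t. \<phi>n n t x) has_vector_derivative X (\<phi>n n s x)) (at s)" if "B t x \<le> n" "\<bar>s\<bar> \<le> \<bar>t\<bar>" for n t x s
  proof -
    have n: "n > 0" using B1[of t x] that by linarith
    have "norm (\<phi>n n s x) \<le> n" using bound[OF n, of s x] Bmono[OF that(2), of x] that(1) by linarith
    then show ?thesis using \<phi>n(3)[OF n, of x s] Xn_eq n by simp
  qed
  define \<phi> where "\<phi> t x = \<phi>n (B t x) t x" for t x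
  have eq: "\<phi> t x = \<phi>n n t x" if "B t x \<le> n" for n t x
    unfolding \<phi>_def
  proof (rule ode_unique[OF X, of t "\<lambda>s. \<phi>n (B t x) s x" "\<lambda>s. \<phi>n n s x"])
    show "\<phi>n (B t x) 0 x = \<phi>n n 0 x" using \<phi>n(2) B1[of t x] that by auto
  qed (use sol that in auto)
  have op: "open {z. B (fst z) (snd z) < n}" for n
    unfolding B_def by (intro open_Collect_less continuous_intros)
  have 1: "Cinf UNIV (\<lambda>(t, x). \<phi> t x)"
  proof (rule Cinf_local)
    fix z :: "real \<times> 'a"
    define n where "n = B (fst z) (snd z) + 1"
    have n: "n > 0" using B1[of "fst z" "snd z"] by (simp add: n_def)
    let ?U = "{z. B (fst z) (snd z) < n}"
    have "Cinf ?U (\<lambda>(t, x). \<phi>n n t x)" by (rule Cinf_subset[OF \<phi>n(1)[OF n]]) simp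
    then have "Cinf ?U (\<lambda>(t, x). \<phi> t x)" by (rule Cinf_cong[OF op, rotated]) (auto intro!: eq[symmetric])
    then show "\<exists>U. open U \<and> z \<in> U \<and> Cinf U (\<lambda>(t, x). \<phi> t x)" using op by (intro exI[of _ ?U]) (auto simp: n_def)
  qed
  have 2: "\<phi> 0 x = x" for x using \<phi>n(2) B1[of 0 x] by (simp add: \<phi>_def)
  have 3: "((\<lambda>t. \<phi> t x) has_vector_derivative X (\<phi> t x)) (at t)" for t x
  proof -
    define n where "n = B t x + 1"
    have "open {s. B s x < n}" unfolding B_def by (intro open_Collect_less continuous_intros)
    moreover have "((\<lambda>t. \<phi>n n t x) has_vector_derivative X (\<phi> t x)) (at t)"
      using sol[of t x n t] eq[of t x n] by (simp add: n_def)
    ultimately show ?thesis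
      by (elim has_vector_derivative_transform_within_open) (auto simp: n_def intro!: eq[symmetric])
  qed
  have 4: "\<phi> (s + t) x = \<phi> s (\<phi> t x)" for s t x
  proof (rule ode_unique[OF X, of s "\<lambda>s. \<phi> (s + t) x" "\<lambda>s. \<phi> s (\<phi> t x)"])
    fix r
    have "((\<lambda>s. \<phi> s x) \<circ> (\<lambda>s. s + t) has_vector_derivative 1 *\<^sub>R X (\<phi> (r + t) x)) (at r)"
      by (rule vector_diff_chain_at[OF _ 3]) (auto intro!: derivative_eq_intros)
    then show "((\<lambda>s. \<phi> (s + t) x) has_vector_derivative X (\<phi> (r + t) x)) (at r)" by (simp add: o_def)
  qed (use 2 3 in auto)
  show thesis by (rule that[OF 1 2 3 4])
qed

section \<open>Closed two-forms and Moser's method\<close>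

lemma ddI: "(f has_derivative f') (at x) \<Longrightarrow> dd f x = f'"
  by (rule frechet_derivative_at[symmetric])

definition mkbl :: "('a::euclidean_space \<Rightarrow> 'b::real_normed_vector) \<Rightarrow> 'a \<Rightarrow>\<^sub>L 'b" where
  "mkbl F = (\<Sum>b\<in>Basis. blinfun_scaleR_left (F b) o\<^sub>L blinfun_inner_left b)"

lemma mkbl_apply:
  assumes "linear F"
  shows "blinfun_apply (mkbl F) v = F v"
proof -
  have "F (\<Sum>b\<in>Basis. (v \<bullet> b) *\<^sub>R b) = (\<Sum>b\<in>Basis. (v \<bullet> b) *\<^sub>R F b)"
    using assms by (simp add: linear_sum linear_scale)
  then show ?thesis
    by (simp add: mkbl_def euclidean_representation blinfun.sum_left)
qed

lemma Cinf_mkbl: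
  fixes F :: "'c::euclidean_space \<Rightarrow> 'a::euclidean_space \<Rightarrow> 'b::real_normed_vector"
  assumes S: "open S" and F: "\<And>v. Cinf S (\<lambda>x. F x v)"
  shows "Cinf S (\<lambda>x. mkbl (F x))"
proof -
  have "bounded_linear (\<lambda>y. blinfun_scaleR_left y o\<^sub>L blinfun_inner_left b)" for b :: 'a
    by (rule bounded_linear_compose[OF bounded_bilinear.bounded_linear_left[OF bounded_bilinear_blinfun_compose]
        bounded_linear_blinfun_scaleR_left])
  from Cinf_sum[OF S Cinf_bounded_linear[OF this S F]]
  show ?thesis unfolding mkbl_def .
qed

text \<open>A closed two-form \<open>\<omega>\<close> is encoded by endomorphisms, with
  \<open>\<omega>(v, w) = \<Theta> y v \<bullet> w\<close>; contraction with a vector and inversion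
  of the form become linear algebra. The cyclic sum is the exterior derivative of
  \<open>\<omega>\<close>.\<close>

definition form2 :: "('a::euclidean_space \<Rightarrow> 'a \<Rightarrow>\<^sub>L 'a) \<Rightarrow> bool" where
  "form2 \<Theta> \<longleftrightarrow> Cinf UNIV \<Theta> \<and> (\<forall>y v w. \<Theta> y v \<bullet> w = - (\<Theta> y w \<bullet> v)) \<and>
     (\<forall>y u v w. dd \<Theta> y u v \<bullet> w + dd \<Theta> y v w \<bullet> u + dd \<Theta> y w u \<bullet> v = 0)"

text \<open>The exterior derivative of the one-form
  \<open>w \<mapsto> b y \<bullet> w\<close>.\<close>

definition curl :: "('a::euclidean_space \<Rightarrow> 'a) \<Rightarrow> 'a \<Rightarrow> 'a \<Rightarrow> 'a \<Rightarrow> real" where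
  "curl b y v w = dd b y v \<bullet> w - dd b y w \<bullet> v"

lemma form2_Cinf: "form2 \<Theta> \<Longrightarrow> Cinf UNIV \<Theta>"
  and form2_skew: "form2 \<Theta> \<Longrightarrow> \<Theta> y v \<bullet> w = - (\<Theta> y w \<bullet> v)"
  and form2_closed: "form2 \<Theta> \<Longrightarrow> dd \<Theta> y u v \<bullet> w + dd \<Theta> y v w \<bullet> u + dd \<Theta> y w u \<bullet> v = 0"
  unfolding form2_def by blast+

lemma form2_has_derivative:
  assumes "form2 \<Theta>"
  shows "((\<lambda>y. \<Theta> y v \<bullet> w) has_derivative (\<lambda>u. dd \<Theta> y u v \<bullet> w)) (at y)"
  by (rule bounded_linear.has_derivative[OF bounded_linear_inner_left
        bounded_linear.has_derivative[OF blinfun.bounded_linear_left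
        Cinf_has_derivative[OF form2_Cinf[OF assms] UNIV_I]]])

lemma form2_dd_skew:
  assumes "form2 \<Theta>"
  shows "dd \<Theta> y u v \<bullet> w = - (dd \<Theta> y u w \<bullet> v)"
proof -
  have "(\<lambda>y. \<Theta> y v \<bullet> w + \<Theta> y w \<bullet> v) = (\<lambda>y. 0)" using form2_skew[OF assms, of _ v w] by auto
  then have "((\<lambda>y. 0) has_derivative (\<lambda>u. dd \<Theta> y u v \<bullet> w + dd \<Theta> y u w \<bullet> v)) (at y)"
    using has_derivative_add[OF form2_has_derivative[OF assms, of v w] form2_has_derivative[OF assms, of w v]] by simp
  then have "(\<lambda>u. dd \<Theta> y u v \<bullet> w + dd \<Theta> y u w \<bullet> v) = (\<lambda>u. 0)"
    by (rule has_derivative_unique[OF _ has_derivative_const])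
  from fun_cong[OF this, of u] show ?thesis by linarith
qed

lemma form2_const:
  assumes "\<And>v w. blinfun_apply A v \<bullet> w = - (A w \<bullet> v)"
  shows "form2 (\<lambda>y. A)"
  unfolding form2_def
proof (intro conjI allI)
  show "Cinf UNIV (\<lambda>y. A)" by (rule Cinf_const)
qed (rule assms, simp)

lemma form2_diff:
  assumes "form2 \<Theta>" "form2 \<Psi>"
  shows "form2 (\<lambda>y. \<Theta> y - \<Psi> y)"
proof -
  have "dd (\<lambda>y. \<Theta> y - \<Psi> y) y u = dd \<Theta> y u - dd \<Psi> y u" for y u
    using ddI[OF has_derivative_diff[OF Cinf_has_derivative[OF form2_Cinf[OF assms(1)] UNIV_I]
        Cinf_has_derivative[OF form2_Cinf[OF assms(2)] UNIV_I]]] by simp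
  then show ?thesis
    unfolding form2_def
  proof (intro conjI allI)
    show "Cinf UNIV (\<lambda>y. \<Theta> y - \<Psi> y)"
      by (rule Cinf_diff[OF open_UNIV form2_Cinf[OF assms(1)] form2_Cinf[OF assms(2)]])
    fix y u v w
    show "(\<Theta> y - \<Psi> y) v \<bullet> w = - ((\<Theta> y - \<Psi> y) w \<bullet> v)"
      using form2_skew[OF assms(1), of y v w] form2_skew[OF assms(2), of y v w]
      by (simp add: blinfun.diff_left inner_diff_left)
    assume *: "\<And>y u. dd (\<lambda>y. \<Theta> y - \<Psi> y) y u = dd \<Theta> y u - dd \<Psi> y u"
    show "dd (\<lambda>y. \<Theta> y - \<Psi> y) y u v \<bullet> w + dd (\<lambda>y. \<Theta> y - \<Psi> y) y v w \<bullet> u + dd (\<lambda>y. \<Theta> y - \<Psi> y) y w u \<bullet> v = 0"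
      using form2_closed[OF assms(1), of y u v w] form2_closed[OF assms(2), of y u v w]
      by (simp add: * blinfun.diff_left inner_diff_left)
  qed
qed

lemma vector_derivative_zero_eq:
  assumes "\<And>t. (f has_vector_derivative 0) (at t)"
  shows "f s = f t"
proof -
  have "\<exists>c. \<forall>x\<in>UNIV. f x = c"
    using assms by (intro has_derivative_zero_constant) (auto simp: has_vector_derivative_def)
  then show ?thesis by (metis UNIV_I)
qed

lemma dd_fst:
  assumes "Cinf UNIV (\<lambda>(y, s). F y s)"
  shows "dd (\<lambda>(y, s). F y s) (y, s) (v, 0) = dd (\<lambda>y. F y s) y v"
proof -
  have "((\<lambda>y. (y, s)) has_derivative (\<lambda>v. (v, 0))) (at y)" by (auto intro!: derivative_eq_intros)
  from has_derivative_compose[OF this Cinf_has_derivative[OF assms UNIV_I]]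
  have "((\<lambda>y. F y s) has_derivative (\<lambda>v. dd (\<lambda>(y, s). F y s) (y, s) (v, 0))) (at y)" by simp
  from ddI[OF this] show ?thesis by simp
qed

lemma dd_snd:
  assumes "Cinf UNIV (\<lambda>(t, x). F t x)"
  shows "dd (\<lambda>(t, x). F t x) (t, x) (0, v) = dd (F t) x v"
proof -
  have "((\<lambda>x. (t, x)) has_derivative (\<lambda>v. (0, v))) (at x)" by (auto intro!: derivative_eq_intros)
  from has_derivative_compose[OF this Cinf_has_derivative[OF assms UNIV_I]]
  have "((\<lambda>x. F t x) has_derivative (\<lambda>v. dd (\<lambda>(t, x). F t x) (t, x) (0, v))) (at x)" by simp
  from ddI[OF this] show ?thesis by simp
qed

text \<open>Cartan's formula for a family of linear maps \<open>L s\<close>, integrated against the weight \<open>k\<close>: by closedness,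
  the integrand of \<open>b\<close> has as curl the \<open>s\<close>-derivative of the pulled back form.\<close>

lemma cartan_linear:
  fixes \<Theta> :: "'a::euclidean_space \<Rightarrow> 'a \<Rightarrow>\<^sub>L 'a" and L L' Lt :: "real \<Rightarrow> 'a \<Rightarrow>\<^sub>L 'a"
  assumes \<Theta>: "form2 \<Theta>" and L: "Cinf UNIV L" "Cinf UNIV L'" "Cinf UNIV Lt"
    and dL: "\<And>s. (L has_vector_derivative L' s) (at s)"
    and Lt: "\<And>s x y. Lt s x \<bullet> y = x \<bullet> L s y"
    and k: "Cinf UNIV k" "\<And>s. (k has_vector_derivative k' s) (at s)" "continuous_on UNIV k'" and "a \<le> c"
  defines "b \<equiv> \<lambda>y. integral {a..c} (\<lambda>s. k s *\<^sub>R Lt s (\<Theta> (L s y) (L' s y)))"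
  shows "Cinf UNIV b"
    and "curl b y v w + integral {a..c} (\<lambda>s. k' s * (\<Theta> (L s y) (L s v) \<bullet> L s w)) =
      k c * (\<Theta> (L c y) (L c v) \<bullet> L c w) - k a * (\<Theta> (L a y) (L a v) \<bullet> L a w)"
proof -
  define F where "F y s = k s *\<^sub>R Lt s (\<Theta> (L s y) (L' s y))" for y s
  note C\<Theta> = form2_Cinf[OF \<Theta>]
  have sn: "Cinf UNIV (\<lambda>z :: 'a \<times> real. snd z)" and fs: "Cinf UNIV (\<lambda>z :: 'a \<times> real. fst z)"
    by (rule Cinf_linear[OF bounded_linear_snd open_UNIV] Cinf_linear[OF bounded_linear_fst open_UNIV])+
  note cs = Cinf_compose_UNIV[OF open_UNIV _ sn]
  have Ly: "Cinf UNIV (\<lambda>z. L (snd z) (fst z))"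
    by (rule Cinf_blinfun_apply[OF open_UNIV cs[OF L(1)] fs])
  have L'y: "Cinf UNIV (\<lambda>z. L' (snd z) (fst z))"
    by (rule Cinf_blinfun_apply[OF open_UNIV cs[OF L(2)] fs])
  have "Cinf UNIV (\<lambda>z. F (fst z) (snd z))"
    unfolding F_def
    by (rule Cinf_scaleR[OF open_UNIV cs[OF k(1)] Cinf_blinfun_apply[OF open_UNIV cs[OF L(3)]
        Cinf_blinfun_apply[OF open_UNIV Cinf_compose_UNIV[OF open_UNIV C\<Theta> Ly] L'y]]])
  then have F: "Cinf UNIV (\<lambda>(y, s). F y s)" by (simp add: split_def)
  show b: "Cinf UNIV b" unfolding b_def using Cinf_integral[OF F] by (simp add: F_def[abs_def])
  have dF: "dd (\<lambda>(y, s). F y s) (y, s) (v, 0) =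
      k s *\<^sub>R Lt s (\<Theta> (L s y) (L' s v) + dd \<Theta> (L s y) (L s v) (L' s y))" for y s v
  proof -
    have "((\<lambda>y. \<Theta> (L s y)) has_derivative (\<lambda>v. dd \<Theta> (L s y) (L s v))) (at y)"
      by (rule has_derivative_compose[OF bounded_linear_imp_has_derivative[OF blinfun.bounded_linear_right]
            Cinf_has_derivative[OF C\<Theta> UNIV_I]])
    from bounded_bilinear.FDERIV[OF bounded_bilinear_blinfun_apply this
        bounded_linear_imp_has_derivative[OF blinfun.bounded_linear_right[of "L' s"]]]
    have "((\<lambda>y. F y s) has_derivative (\<lambda>v. k s *\<^sub>R Lt s (\<Theta> (L s y) (L' s v) + dd \<Theta> (L s y) (L s v) (L' s y)))) (at y)"
      unfolding F_def
      by (rule bounded_linear.has_derivative[OF bounded_linear_scaleR_right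
            bounded_linear.has_derivative[OF blinfun.bounded_linear_right]])
    from ddI[OF this] show ?thesis by (simp add: dd_fst[OF F])
  qed
  define P where "P s = \<Theta> (L s y) (L s v) \<bullet> L s w" for s
  define P' where "P' s = \<Theta> (L s y) (L' s v) \<bullet> L s w + dd \<Theta> (L s y) (L' s y) (L s v) \<bullet> L s w + \<Theta> (L s y) (L s v) \<bullet> L' s w" for s
  have dP: "(P has_vector_derivative P' s) (at s)" for s
  proof -
    have dLx: "((\<lambda>s. L s x) has_derivative (\<lambda>h. h *\<^sub>R L' s x)) (at s)" for x
      using bounded_linear.has_derivative[OF blinfun.bounded_linear_left[of x] dL[unfolded has_vector_derivative_def]]
      by (simp add: blinfun.scaleR_left)
    have lin: "linear (dd \<Theta> (L s y))"
      using Cinf_dd_linear[OF C\<Theta> UNIV_I] by (rule bounded_linear.linear)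
    have "((\<lambda>s. \<Theta> (L s y)) has_derivative (\<lambda>h. dd \<Theta> (L s y) (h *\<^sub>R L' s y))) (at s)"
      by (rule has_derivative_compose[OF dLx Cinf_has_derivative[OF C\<Theta> UNIV_I]])
    from has_derivative_inner[OF bounded_bilinear.FDERIV[OF bounded_bilinear_blinfun_apply this dLx[of v]] dLx[of w]]
    show ?thesis
      unfolding has_vector_derivative_def P_def[abs_def] P'_def
      by (rule has_derivative_eq_rhs)
        (simp add: fun_eq_iff linear_scale[OF lin] blinfun.scaleR_left blinfun.scaleR_right inner_add_left algebra_simps)
  qed
  have cF: "continuous_on {a..c} (\<lambda>s. dd (\<lambda>(y, s). F y s) (y, s) (v, 0))" for v
  proof -
    have "continuous_on {a..c} (\<lambda>s. (y, s))" by (rule continuous_on_Pair[OF continuous_on_const continuous_on_id])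
    from continuous_on_compose2[OF Cinf_continuous[OF Cinf_dd[OF F]] this] show ?thesis by simp
  qed
  have db: "dd b y v \<bullet> w = integral {a..c} (\<lambda>s. dd (\<lambda>(y, s). F y s) (y, s) (v, 0) \<bullet> w)"
    and ib: "(\<lambda>s. dd (\<lambda>(y, s). F y s) (y, s) (v, 0) \<bullet> w) integrable_on {a..c}" for v w
  proof -
    have 1: "Ck (Suc 0) UNIV (\<lambda>(y, s). F y s)" using F unfolding Cinf_def by blast
    have "b = (\<lambda>y. integral {a..c} (F y))" unfolding b_def F_def[abs_def] ..
    then have "dd b y v = integral {a..c} (\<lambda>s. dd (\<lambda>(y, s). F y s) (y, s) (v, 0))"
      using ddI[OF integral_param_has_derivative[OF 1]] by simp
    moreover note int = integrable_continuous_real[OF cF[of v]]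
    ultimately show "dd b y v \<bullet> w = integral {a..c} (\<lambda>s. dd (\<lambda>(y, s). F y s) (y, s) (v, 0) \<bullet> w)"
      using integral_linear[OF int bounded_linear_inner_left[of w]] by (simp add: o_def)
    show "(\<lambda>s. dd (\<lambda>(y, s). F y s) (y, s) (v, 0) \<bullet> w) integrable_on {a..c}"
      using integrable_linear[OF int bounded_linear_inner_left[of w]] by (simp add: o_def)
  qed
  have dFi: "dd (\<lambda>(y, s). F y s) (y, s) (v, 0) \<bullet> w =
      k s * (\<Theta> (L s y) (L' s v) \<bullet> L s w + dd \<Theta> (L s y) (L s v) (L' s y) \<bullet> L s w)" for s v w
    by (simp add: dF Lt inner_add_left)
  have P'_eq: "(\<Theta> (L s y) (L' s v) \<bullet> L s w + dd \<Theta> (L s y) (L s v) (L' s y) \<bullet> L s w) -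
      (\<Theta> (L s y) (L' s w) \<bullet> L s v + dd \<Theta> (L s y) (L s w) (L' s y) \<bullet> L s v) = P' s" for s
    using form2_closed[OF \<Theta>, of "L s y" "L' s y" "L s v" "L s w"]
      form2_dd_skew[OF \<Theta>, of "L s y" "L s v" "L' s y" "L s w"]
      form2_skew[OF \<Theta>, of "L s y" "L' s w" "L s v"]
    unfolding P'_def by linarith
  have "dd (\<lambda>(y, s). F y s) (y, s) (v, 0) \<bullet> w - dd (\<lambda>(y, s). F y s) (y, s) (w, 0) \<bullet> v = k s * P' s" for s
    unfolding dFi right_diff_distrib[symmetric] P'_eq ..
  then have curl: "curl b y v w = integral {a..c} (\<lambda>s. k s * P' s)" and int: "(\<lambda>s. k s * P' s) integrable_on {a..c}"
    using integral_diff[OF ib[of v w] ib[of w v]] integrable_diff[OF ib[of v w] ib[of w v]]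
    by (simp_all add: curl_def db)
  have kP: "((\<lambda>s. k s * P s) has_vector_derivative (k s * P' s + k' s * P s)) (at s)" for s
    by (rule has_vector_derivative_mult[OF k(2) dP])
  have 1: "((\<lambda>s. k s * P' s + k' s * P s) has_integral (k c * P c - k a * P a)) {a..c}"
    by (rule fundamental_theorem_of_calculus[OF \<open>a \<le> c\<close> has_vector_derivative_at_within[OF kP]])
  have "continuous_on {a..c} P"
    using dP has_vector_derivative_continuous by (intro continuous_at_imp_continuous_on) blast
  then have 2: "(\<lambda>s. k' s * P s) integrable_on {a..c}"
    by (intro integrable_continuous_real continuous_on_mult continuous_on_subset[OF k(3)]) auto
  show "curl b y v w + integral {a..c} (\<lambda>s. k' s * (\<Theta> (L s y) (L s v) \<bullet> L s w)) =
      k c * (\<Theta> (L c y) (L c v) \<bullet> L c w) - k a * (\<Theta> (L a y) (L a v) \<bullet> L a w)"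
    using integral_unique[OF 1] integral_add[OF int 2] by (simp add: curl P_def)
qed

text \<open>Moser's method, along the path of forms \<open>\<Theta>0 + sin \<tau> (\<Theta>1 - \<Theta>0)\<close>; this
  parametrization keeps the path close to \<open>J\<close> for all real \<open>\<tau>\<close>.\<close>

lemma moser:
  fixes \<Theta>0 \<Theta>1 :: "'a::euclidean_space \<Rightarrow> 'a \<Rightarrow>\<^sub>L 'a" and b J :: "'a \<Rightarrow> 'a"
  assumes \<Theta>0: "form2 \<Theta>0" and \<Theta>1: "form2 \<Theta>1" and b: "Cinf UNIV b"
    and curl: "\<And>y v w. curl b y v w = \<Theta>1 y v \<bullet> w - \<Theta>0 y v \<bullet> w"
    and J: "\<And>v. norm (J v) = norm v"
    and near: "\<And>y v. norm (\<Theta>0 y v - J v) \<le> norm v / 6" "\<And>y v. norm (\<Theta>1 y v - J v) \<le> norm v / 6"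
    and growth: "\<And>y. norm (b y) \<le> C * (1 + norm y)"
  defines "\<Omega> \<equiv> \<lambda>s y. \<Theta>0 y + s *\<^sub>R (\<Theta>1 y - \<Theta>0 y)"
  obtains m m' :: "real \<Rightarrow> 'a \<Rightarrow> 'a" where "Cinf UNIV (m (pi/2))" "Cinf UNIV (m' (pi/2))"
    "\<And>y. m' (pi/2) (m (pi/2) y) = y" "\<And>y. m (pi/2) (m' (pi/2) y) = y" "\<And>y. m 0 y = y"
    "\<And>\<tau> y. ((\<lambda>\<tau>. m \<tau> y) has_vector_derivative - (cos \<tau> *\<^sub>R blinv (\<Omega> (sin \<tau>) (m \<tau> y)) (b (m \<tau> y)))) (at \<tau>)"
    "\<And>y v w. \<Theta>1 (m (pi/2) y) (dd (m (pi/2)) y v) \<bullet> dd (m (pi/2)) y w = \<Theta>0 y v \<bullet> w"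
    "\<And>s y v. \<bar>s\<bar> \<le> 1 \<Longrightarrow> norm v \<le> 2 * norm (\<Omega> s y v)"
proof -
  note C0 = form2_Cinf[OF \<Theta>0] and C1 = form2_Cinf[OF \<Theta>1]
  \<comment> \<open>Three errors of size \<open>norm v / 6\<close> leave
    \<open>\<Omega> s y v\<close> within \<open>norm v / 2\<close> of \<open>J v\<close>, which has
    the norm of \<open>v\<close>.\<close>
  have inv: "norm v \<le> 2 * norm (\<Omega> s y v)" if "\<bar>s\<bar> \<le> 1" for s y v
  proof -
    have "\<Omega> s y v - J v = (\<Theta>0 y v - J v) + s *\<^sub>R ((\<Theta>1 y v - J v) - (\<Theta>0 y v - J v))"
      by (simp add: \<Omega>_def blinfun.add_left blinfun.scaleR_left blinfun.diff_left)
    also have "norm \<dots> \<le> norm (\<Theta>0 y v - J v) + \<bar>s\<bar> * norm ((\<Theta>1 y v - J v) - (\<Theta>0 y v - J v))"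
      by (metis norm_scaleR norm_triangle_ineq)
    also have "\<dots> \<le> norm v / 6 + 1 * (norm v / 6 + norm v / 6)"
      by (intro add_mono mult_mono near that order_trans[OF norm_triangle_ineq4]) auto
    finally have "norm (\<Omega> s y v - J v) \<le> norm v / 2" by simp
    moreover have "norm (J v) \<le> norm (\<Omega> s y v) + norm (\<Omega> s y v - J v)"
      by (metis norm_minus_commute norm_triangle_sub)
    ultimately show ?thesis using J[of v] by simp
  qed
  \<comment> \<open>Moser's field: its contraction with the form at time \<open>\<tau>\<close> is
    \<open>- cos \<tau>\<close> times \<open>b\<close>, which cancels the rate of change of the
    form, \<open>cos \<tau>\<close> times the curl of \<open>b\<close>.\<close>
  define W where "W \<tau> y = - (cos \<tau> *\<^sub>R blinv (\<Omega> (sin \<tau>) y) (b y))" for \<tau> y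
  have f1: "Cinf UNIV (\<lambda>z :: real \<times> 'a. fst z)" and s1: "Cinf UNIV (\<lambda>z :: real \<times> 'a. snd z)"
    by (rule Cinf_linear[OF bounded_linear_snd open_UNIV] Cinf_linear[OF bounded_linear_fst open_UNIV])+
  note cs = Cinf_compose_UNIV[OF open_UNIV _ s1]
  have "Cinf UNIV (\<lambda>z. \<Omega> (sin (fst z)) (snd z))"
    unfolding \<Omega>_def
    by (rule Cinf_add[OF open_UNIV cs[OF C0] Cinf_scaleR[OF open_UNIV Cinf_sin[OF open_UNIV f1]
        Cinf_diff[OF open_UNIV cs[OF C1] cs[OF C0]]]])
  then have "Cinf UNIV (\<lambda>z. blinv (\<Omega> (sin (fst z)) (snd z)))"
    by (rule Cinf_blinv[OF open_UNIV, where K = 2, rotated 2]) (auto intro: inv)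
  then have CW: "Cinf UNIV (\<lambda>z. W (fst z) (snd z))"
    unfolding W_def
    by (intro Cinf_minus[OF open_UNIV] Cinf_scaleR[OF open_UNIV] Cinf_cos[OF open_UNIV] f1
        Cinf_blinfun_apply[OF open_UNIV] cs[OF b])
  have WC: "norm (W \<tau> y) \<le> 2 * C * (1 + norm y)" for \<tau> y
  proof -
    have "norm (W \<tau> y) = \<bar>cos \<tau>\<bar> * norm (blinv (\<Omega> (sin \<tau>) y) (b y))" by (simp add: W_def)
    also have "\<dots> \<le> 1 * (2 * norm (b y))"
      by (intro mult_mono blinv(3) inv) auto
    also have "\<dots> \<le> 2 * C * (1 + norm y)" using growth[of y] by simp
    finally show ?thesis .
  qed
  have C0': "C \<ge> 0" using order_trans[OF norm_ge_zero growth[of 0]] by simp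
  \<comment> \<open>Adding time as a coordinate of speed 1 makes the time-dependent field autonomous
    while preserving linear growth, so that \<open>smooth_flow\<close> applies.\<close>
  define Z where "Z z = (1 :: real, W (fst z) (snd z))" for z
  have "Cinf UNIV Z" unfolding Z_def by (rule Cinf_Pair[OF open_UNIV Cinf_const CW])
  moreover have "norm (Z z) \<le> (1 + 2 * C) * (1 + norm z)" for z
  proof -
    have "norm (Z z) \<le> norm (1 :: real) + norm (W (fst z) (snd z))" unfolding Z_def by (rule norm_Pair_le)
    also have "\<dots> \<le> 1 + 2 * C * (1 + norm (snd z))" using WC[of "fst z" "snd z"] by simp
    also have "\<dots> \<le> (1 + norm z) + 2 * C * (1 + norm z)"
      using C0' norm_snd_le[of "snd z" "fst z"] by (intro add_mono mult_left_mono) auto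
    finally show ?thesis by (simp add: algebra_simps)
  qed
  ultimately obtain \<Phi> where \<Phi>: "Cinf UNIV (\<lambda>(t, x). \<Phi> t x)" "\<And>x. \<Phi> 0 x = x"
    "\<And>t x. ((\<lambda>t. \<Phi> t x) has_vector_derivative Z (\<Phi> t x)) (at t)"
    "\<And>s t x. \<Phi> (s + t) x = \<Phi> s (\<Phi> t x)"
    by (rule smooth_flow) (rule that)
  have fst\<Phi>: "fst (\<Phi> t x) = t + fst x" for t x
  proof -
    have "((\<lambda>t. fst (\<Phi> t x) - t) has_vector_derivative 0) (at t)" for t
    proof -
      have "((\<lambda>t. fst (\<Phi> t x)) has_vector_derivative 1) (at t)"
        using bounded_linear.has_vector_derivative[OF bounded_linear_fst \<Phi>(3)] by (simp add: Z_def)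
      from has_vector_derivative_diff[OF this has_vector_derivative_id] show ?thesis by simp
    qed
    from vector_derivative_zero_eq[of "\<lambda>t. fst (\<Phi> t x) - t", OF this, of t 0]
    show ?thesis by (simp add: \<Phi>(2))
  qed
  define M where "M \<tau> y = snd (\<Phi> \<tau> (0, y))" for \<tau> y
  define M' where "M' \<tau> y = snd (\<Phi> (- \<tau>) (\<tau>, y))" for \<tau> y
  have \<Phi>M: "\<Phi> \<tau> (0, y) = (\<tau>, M \<tau> y)" for \<tau> y using fst\<Phi>[of \<tau> "(0, y)"] by (simp add: M_def prod_eq_iff)
  have \<Phi>M': "\<Phi> (- \<tau>) (\<tau>, y) = (0, M' \<tau> y)" for \<tau> y using fst\<Phi>[of "- \<tau>" "(\<tau>, y)"] by (simp add: M'_def prod_eq_iff)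
  have CM: "Cinf UNIV (\<lambda>(\<tau>, y). M \<tau> y)"
  proof -
    have "Cinf UNIV (\<lambda>z :: real \<times> 'a. (fst z, (0 :: real, snd z)))"
      by (rule Cinf_Pair[OF open_UNIV f1 Cinf_Pair[OF open_UNIV Cinf_const s1]])
    from Cinf_snd[OF open_UNIV Cinf_compose_UNIV[OF open_UNIV \<Phi>(1) this]]
    show ?thesis by (simp add: M_def split_def)
  qed
  have CMt: "Cinf UNIV (M \<tau>)" for \<tau>
  proof -
    have "Cinf UNIV (\<lambda>y :: 'a. (\<tau>, y))" by (rule Cinf_Pair[OF open_UNIV Cinf_const Cinf_ident[OF open_UNIV]])
    from Cinf_compose_UNIV[OF open_UNIV CM this] show ?thesis by simp
  qed
  have CM't: "Cinf UNIV (M' \<tau>)" for \<tau>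
  proof -
    have "Cinf UNIV (\<lambda>y :: 'a. (- \<tau>, (\<tau>, y)))"
      by (rule Cinf_Pair[OF open_UNIV Cinf_const Cinf_Pair[OF open_UNIV Cinf_const Cinf_ident[OF open_UNIV]]])
    from Cinf_snd[OF open_UNIV Cinf_compose_UNIV[OF open_UNIV \<Phi>(1) this]] show ?thesis by (simp add: M'_def[abs_def])
  qed
  have M0: "M 0 y = y" for y by (simp add: M_def \<Phi>(2))
  have M'M: "M' \<tau> (M \<tau> y) = y" for \<tau> y
    using \<Phi>(4)[of "- \<tau>" \<tau> "(0, y)"] by (simp add: \<Phi>M \<Phi>M' M0)
  have MM': "M \<tau> (M' \<tau> y) = y" for \<tau> y
    using \<Phi>(4)[of \<tau> "- \<tau>" "(\<tau>, y)"] by (simp add: \<Phi>M \<Phi>M' \<Phi>(2))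
  have dM: "((\<lambda>\<tau>. M \<tau> y) has_vector_derivative W \<tau> (M \<tau> y)) (at \<tau>)" for \<tau> y
    using bounded_linear.has_vector_derivative[OF bounded_linear_snd \<Phi>(3)[of "(0, y)" \<tau>]] by (simp add: M_def[symmetric] \<Phi>M Z_def)
  have CWt: "Cinf UNIV (W \<tau>)" for \<tau>
  proof -
    have "Cinf UNIV (\<lambda>y :: 'a. (\<tau>, y))" by (rule Cinf_Pair[OF open_UNIV Cinf_const Cinf_ident[OF open_UNIV]])
    from Cinf_compose_UNIV[OF open_UNIV CW this] show ?thesis by simp
  qed
  \<comment> \<open>The variational equation, from the symmetry of the mixed second derivatives of
    \<open>M\<close> in \<open>\<tau>\<close> and \<open>y\<close>.\<close>
  have dA: "((\<lambda>\<tau>. dd (M \<tau>) y v) has_vector_derivative dd (W \<tau>) (M \<tau> y) (dd (M \<tau>) y v)) (at \<tau>)" for \<tau> y v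
  proof -
    let ?M = "\<lambda>(\<tau>, y). M \<tau> y"
    have D1: "dd ?M (\<tau>, y) (1, 0) = W \<tau> (M \<tau> y)" for \<tau> y
    proof -
      have "((\<lambda>\<tau>. (\<tau>, y)) has_derivative (\<lambda>h. (h, 0))) (at \<tau>)" by (auto intro!: derivative_eq_intros)
      from has_derivative_compose[OF this Cinf_has_derivative[OF CM UNIV_I]]
      have "((\<lambda>\<tau>. M \<tau> y) has_derivative (\<lambda>h. dd ?M (\<tau>, y) (h, 0))) (at \<tau>)" by simp
      from fun_cong[OF has_derivative_unique[OF this dM[unfolded has_vector_derivative_def]], of 1] show ?thesis by simp
    qed
    have D2: "dd ?M (\<tau>, y) (0, v) = dd (M \<tau>) y v" for \<tau> by (rule dd_snd[OF CM])
    have "((\<lambda>\<tau>. (\<tau>, y)) has_derivative (\<lambda>h. h *\<^sub>R (1, 0))) (at \<tau>)" by (auto intro!: derivative_eq_intros)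
    from has_derivative_compose[OF this Cinf_has_derivative[OF Cinf_dd[OF CM, of "(0, v)"] UNIV_I]]
    have "((\<lambda>\<tau>. dd (M \<tau>) y v) has_derivative (\<lambda>h. dd (\<lambda>z. dd ?M z (0, v)) (\<tau>, y) (h *\<^sub>R (1, 0)))) (at \<tau>)"
      by (simp add: D2)
    moreover have "linear (dd (\<lambda>z. dd ?M z (0, v)) (\<tau>, y))"
      using Cinf_dd_linear[OF Cinf_dd[OF CM] UNIV_I] by (rule bounded_linear.linear)
    ultimately have "((\<lambda>\<tau>. dd (M \<tau>) y v) has_vector_derivative dd (\<lambda>z. dd ?M z (0, v)) (\<tau>, y) (1, 0)) (at \<tau>)"
      unfolding has_vector_derivative_def by (simp only: linear_scale)
    also have "dd (\<lambda>z. dd ?M z (0, v)) (\<tau>, y) (1, 0) = dd (\<lambda>z. dd ?M z (1, 0)) (\<tau>, y) (0, v)"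
      by (rule dd_commute[OF CM])
    also have "(\<lambda>z. dd ?M z (1, 0)) = (\<lambda>(\<tau>, y). W \<tau> (M \<tau> y))" using D1 by auto
    also have "dd (\<lambda>(\<tau>, y). W \<tau> (M \<tau> y)) (\<tau>, y) (0, v) = dd (\<lambda>y. W \<tau> (M \<tau> y)) y v"
    proof (rule dd_snd)
      have "Cinf UNIV (\<lambda>z. (fst z, M (fst z) (snd z)))"
        using Cinf_Pair[OF open_UNIV f1 CM] by (simp add: split_def)
      from Cinf_compose_UNIV[OF open_UNIV CW this] show "Cinf UNIV (\<lambda>(\<tau>, y). W \<tau> (M \<tau> y))" by (simp add: split_def)
    qed
    also have "dd (\<lambda>y. W \<tau> (M \<tau> y)) y v = dd (W \<tau>) (M \<tau> y) (dd (M \<tau>) y v)"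
      using ddI[OF has_derivative_compose[OF Cinf_has_derivative[OF CMt UNIV_I] Cinf_has_derivative[OF CWt UNIV_I]]] by simp
    finally show ?thesis .
  qed
  have pres: "\<Theta>1 (M (pi/2) y) (dd (M (pi/2)) y v) \<bullet> dd (M (pi/2)) y w = \<Theta>0 y v \<bullet> w" for y v w
  proof -
    let ?A = "\<lambda>\<tau>. dd (M \<tau>) y v" and ?B = "\<lambda>\<tau>. dd (M \<tau>) y w"
    \<comment> \<open>The pull-back of the form at time \<open>\<tau>\<close>, evaluated at
      \<open>v\<close> and \<open>w\<close>. It is constant in \<open>\<tau>\<close>, and its values
      at 0 and \<open>pi/2\<close> belong to \<open>\<Theta>0\<close> and \<open>\<Theta>1\<close>,
      as \<open>sin\<close> runs from 0 to 1.\<close>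
    define g where "g \<tau> = \<Omega> (sin \<tau>) (M \<tau> y) (?A \<tau>) \<bullet> ?B \<tau>" for \<tau>
    have "(g has_vector_derivative 0) (at \<tau>)" for \<tau>
    proof -
      let ?m = "M \<tau> y" let ?s = "sin \<tau>" let ?c = "cos \<tau>" let ?Y = "W \<tau> ?m"
      define D where "D u = dd \<Theta>0 ?m u + ?s *\<^sub>R (dd \<Theta>1 ?m u - dd \<Theta>0 ?m u)" for u
      have Dskew: "D u v \<bullet> w = - (D u w \<bullet> v)" for u v w
        using form2_dd_skew[OF \<Theta>0, of ?m u v w] form2_dd_skew[OF \<Theta>1, of ?m u v w]
        by (simp add: D_def blinfun.add_left blinfun.scaleR_left blinfun.diff_left inner_add_left inner_diff_left algebra_simps)
      have Dclosed: "D u v \<bullet> w + D v w \<bullet> u + D w u \<bullet> v = 0" for u v w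
      proof -
        have "D u v \<bullet> w + D v w \<bullet> u + D w u \<bullet> v =
          (1 - ?s) * (dd \<Theta>0 ?m u v \<bullet> w + dd \<Theta>0 ?m v w \<bullet> u + dd \<Theta>0 ?m w u \<bullet> v) +
          ?s * (dd \<Theta>1 ?m u v \<bullet> w + dd \<Theta>1 ?m v w \<bullet> u + dd \<Theta>1 ?m w u \<bullet> v)"
          by (simp add: D_def blinfun.add_left blinfun.scaleR_left blinfun.diff_left inner_add_left inner_diff_left algebra_simps)
        then show ?thesis using form2_closed[OF \<Theta>0, of ?m u v w] form2_closed[OF \<Theta>1, of ?m u v w] by simp
      qed
      have \<Omega>skew: "\<Omega> ?s ?m v \<bullet> w = - (\<Omega> ?s ?m w \<bullet> v)" for v w
        using form2_skew[OF \<Theta>0, of ?m v w] form2_skew[OF \<Theta>1, of ?m v w]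
        by (simp add: \<Omega>_def blinfun.add_left blinfun.scaleR_left blinfun.diff_left inner_add_left inner_diff_left algebra_simps)
      have \<Omega>d: "((\<lambda>y. \<Omega> ?s y) has_derivative D) (at ?m)"
        unfolding \<Omega>_def D_def
        by (intro has_derivative_add has_derivative_diff bounded_linear.has_derivative[OF bounded_linear_scaleR_right]
            Cinf_has_derivative[OF C0 UNIV_I] Cinf_has_derivative[OF C1 UNIV_I])
      have lin: "linear (dd \<Theta>0 ?m)" "linear (dd \<Theta>1 ?m)"
        using Cinf_dd_linear[OF C0 UNIV_I] Cinf_dd_linear[OF C1 UNIV_I] by (auto intro: bounded_linear.linear)
      have Yb: "\<Omega> ?s y (W \<tau> y) = - ?c *\<^sub>R b y" for y
        using blinv(1)[OF inv[OF abs_sin_le_one], of \<tau> y "b y"] by (simp add: W_def blinfun.minus_right blinfun.scaleR_right)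
      have Yd: "\<Omega> ?s ?m (dd (W \<tau>) ?m u) + D u ?Y = - ?c *\<^sub>R dd b ?m u" for u
      proof -
        note 1 = bounded_bilinear.FDERIV[OF bounded_bilinear_blinfun_apply \<Omega>d Cinf_has_derivative[OF CWt[of \<tau>] UNIV_I]]
        note 2 = bounded_linear.has_derivative[OF bounded_linear_scaleR_right[of "- ?c"] Cinf_has_derivative[OF b UNIV_I]]
        from fun_cong[OF has_derivative_unique[OF 1[unfolded Yb] 2], of u] show ?thesis by simp
      qed
      have dm: "((\<lambda>\<tau>. M \<tau> y) has_derivative (\<lambda>h. h *\<^sub>R ?Y)) (at \<tau>)"
        using dM unfolding has_vector_derivative_def .
      have d\<Theta>: "((\<lambda>\<tau>. \<Theta> (M \<tau> y)) has_vector_derivative dd \<Theta> ?m ?Y) (at \<tau>)" if "form2 \<Theta>" for \<Theta>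
        by (rule Cinf_along_curve[OF form2_Cinf[OF that] dM])
      have "((\<lambda>\<tau>. sin \<tau>) has_vector_derivative ?c) (at \<tau>)"
        by (auto simp: has_real_derivative_iff_has_vector_derivative[symmetric] intro!: derivative_eq_intros)
      from has_vector_derivative_add[OF d\<Theta>[OF \<Theta>0]
          bounded_bilinear.has_vector_derivative[OF bounded_bilinear_scaleR this
          has_vector_derivative_diff[OF d\<Theta>[OF \<Theta>1] d\<Theta>[OF \<Theta>0]]]]
      have d\<Omega>: "((\<lambda>\<tau>. \<Omega> (sin \<tau>) (M \<tau> y)) has_vector_derivative ?c *\<^sub>R (\<Theta>1 ?m - \<Theta>0 ?m) + D ?Y) (at \<tau>)"
        by (simp add: \<Omega>_def D_def add_ac)
      have "(g has_vector_derivative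
          (\<Omega> ?s ?m (?A \<tau>) \<bullet> dd (W \<tau>) ?m (?B \<tau>) +
          (\<Omega> ?s ?m (dd (W \<tau>) ?m (?A \<tau>)) + (?c *\<^sub>R (\<Theta>1 ?m - \<Theta>0 ?m) + D ?Y) (?A \<tau>)) \<bullet> ?B \<tau>)) (at \<tau>)"
        unfolding g_def[abs_def]
        by (rule bounded_bilinear.has_vector_derivative[OF bounded_bilinear_inner
              bounded_bilinear.has_vector_derivative[OF bounded_bilinear_blinfun_apply d\<Omega> dA] dA])
      moreover have "\<Omega> ?s ?m (?A \<tau>) \<bullet> dd (W \<tau>) ?m (?B \<tau>) +
          (\<Omega> ?s ?m (dd (W \<tau>) ?m (?A \<tau>)) + (?c *\<^sub>R (\<Theta>1 ?m - \<Theta>0 ?m) + D ?Y) (?A \<tau>)) \<bullet> ?B \<tau> = 0"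
      proof -
        have a: "\<Omega> ?s ?m (dd (W \<tau>) ?m u) = - ?c *\<^sub>R dd b ?m u - D u ?Y" for u
          using Yd[of u] by (simp add: algebra_simps)
        have "\<Omega> ?s ?m (?A \<tau>) \<bullet> dd (W \<tau>) ?m (?B \<tau>) = - ((- ?c *\<^sub>R dd b ?m (?B \<tau>) - D (?B \<tau>) ?Y) \<bullet> ?A \<tau>)"
          using \<Omega>skew[of "?A \<tau>" "dd (W \<tau>) ?m (?B \<tau>)"] by (simp add: a)
        moreover have "\<Theta>1 ?m (?A \<tau>) \<bullet> ?B \<tau> - \<Theta>0 ?m (?A \<tau>) \<bullet> ?B \<tau> = dd b ?m (?A \<tau>) \<bullet> ?B \<tau> - dd b ?m (?B \<tau>) \<bullet> ?A \<tau>"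
          using curl[of ?m "?A \<tau>" "?B \<tau>"] by (simp add: curl_def)
        then have "?c * (\<Theta>1 ?m (?A \<tau>) \<bullet> ?B \<tau> - \<Theta>0 ?m (?A \<tau>) \<bullet> ?B \<tau>) = ?c * (dd b ?m (?A \<tau>) \<bullet> ?B \<tau> - dd b ?m (?B \<tau>) \<bullet> ?A \<tau>)"
          by simp
        ultimately show ?thesis
          using Dclosed[of ?Y "?A \<tau>" "?B \<tau>"] Dskew[of "?A \<tau>" "?B \<tau>" ?Y]
          by (simp add: a blinfun.add_left blinfun.scaleR_left blinfun.diff_left inner_add_left inner_diff_left algebra_simps)
      qed
      ultimately show ?thesis by simp
    qed
    then have "g (pi/2) = g 0" by (rule vector_derivative_zero_eq)
    moreover have "M 0 = (\<lambda>y. y)" by (rule ext) (simp add: M_def \<Phi>(2))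
    ultimately show ?thesis by (simp add: g_def \<Omega>_def)
  qed
  show thesis
    by (rule that[of M M']) (use CMt CM't M'M MM' dM pres inv \<Phi>(2) in \<open>auto simp: M_def W_def\<close>)
qed

section \<open>Exact two-forms and gradient fields\<close>

definition curlbl :: "('a::euclidean_space \<Rightarrow> 'a) \<Rightarrow> 'a \<Rightarrow> 'a \<Rightarrow>\<^sub>L 'a" where
  "curlbl b y = mkbl (\<lambda>v. \<Sum>e\<in>Basis. curl b y v e *\<^sub>R e)"

lemma curl_linear:
  assumes b: "Cinf UNIV b"
  shows "linear (\<lambda>v. curl b y v w)" "linear (\<lambda>w. curl b y v w)"
proof -
  have l: "linear (dd b y)" using Cinf_dd_linear[OF b UNIV_I] by (rule bounded_linear.linear)
  show "linear (\<lambda>v. curl b y v w)" "linear (\<lambda>w. curl b y v w)"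
    by (auto intro!: linearI simp: curl_def linear_add[OF l] linear_scale[OF l] inner_add_left inner_add_right algebra_simps)
qed

lemma curlbl:
  fixes b :: "'a::euclidean_space \<Rightarrow> 'a"
  assumes b: "Cinf UNIV b"
  shows "curlbl b y v \<bullet> w = curl b y v w"
proof -
  note l = curl_linear[OF b]
  have "linear (\<lambda>v. \<Sum>e\<in>Basis. curl b y v e *\<^sub>R e)"
    by (rule linearI) (simp_all add: linear_add[OF l(1)] linear_scale[OF l(1)] scaleR_add_left sum.distrib scaleR_sum_right)
  then have "curlbl b y v \<bullet> w = (\<Sum>e\<in>Basis. curl b y v e *\<^sub>R e) \<bullet> w"
    by (simp add: curlbl_def mkbl_apply)
  also have "\<dots> = (\<Sum>e\<in>Basis. (w \<bullet> e) * curl b y v e)"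
    unfolding inner_sum_left inner_scaleR_left by (simp add: inner_commute[of _ w] mult.commute)
  also have "\<dots> = curl b y v (\<Sum>e\<in>Basis. (w \<bullet> e) *\<^sub>R e)"
    by (simp add: linear_sum[OF l(2)] linear_scale[OF l(2)])
  finally show ?thesis by (simp add: euclidean_representation)
qed

text \<open>An exact form is closed: by the symmetry of second derivatives, the six terms of the
  cyclic sum cancel in pairs.\<close>

lemma form2_curlbl:
  fixes b :: "'a::euclidean_space \<Rightarrow> 'a"
  assumes b: "Cinf UNIV b"
  shows "form2 (curlbl b)"
  unfolding form2_def
proof (intro conjI allI)
  have c: "Cinf UNIV (\<lambda>y. curl b y v w)" for v w
    unfolding curl_def
    by (rule Cinf_diff[OF open_UNIV Cinf_inner[OF open_UNIV Cinf_dd[OF b] Cinf_const] Cinf_inner[OF open_UNIV Cinf_dd[OF b] Cinf_const]])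
  show C: "Cinf UNIV (curlbl b)"
    unfolding curlbl_def[abs_def]
    by (rule Cinf_mkbl[OF open_UNIV Cinf_sum[OF open_UNIV Cinf_scaleR[OF open_UNIV c Cinf_const]]])
  fix y v w :: 'a
  show "curlbl b y v \<bullet> w = - (curlbl b y w \<bullet> v)" by (simp add: curlbl[OF b] curl_def)
  fix u
  have "dd (curlbl b) y u v \<bullet> w = dd (\<lambda>x. dd b x v) y u \<bullet> w - dd (\<lambda>x. dd b x w) y u \<bullet> v" for u v w
  proof -
    have "((\<lambda>y. curlbl b y v \<bullet> w) has_derivative (\<lambda>u. dd (curlbl b) y u v \<bullet> w)) (at y)"
      by (rule bounded_linear.has_derivative[OF bounded_linear_inner_left
        bounded_linear.has_derivative[OF blinfun.bounded_linear_left Cinf_has_derivative[OF C UNIV_I]]])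
    moreover have "((\<lambda>y. curl b y v w) has_derivative (\<lambda>u. dd (\<lambda>x. dd b x v) y u \<bullet> w - dd (\<lambda>x. dd b x w) y u \<bullet> v)) (at y)"
      unfolding curl_def
      by (rule has_derivative_diff[OF bounded_linear.has_derivative[OF bounded_linear_inner_left Cinf_has_derivative[OF Cinf_dd[OF b] UNIV_I]]
        bounded_linear.has_derivative[OF bounded_linear_inner_left Cinf_has_derivative[OF Cinf_dd[OF b] UNIV_I]]])
    ultimately show ?thesis
      unfolding curlbl[OF b] by (rule fun_cong[OF has_derivative_unique])
  qed
  then show "dd (curlbl b) y u v \<bullet> w + dd (curlbl b) y v w \<bullet> u + dd (curlbl b) y w u \<bullet> v = 0"
    using dd_commute[OF b, of v y u] dd_commute[OF b, of w y u] dd_commute[OF b, of w y v] by simp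
qed

definition grad :: "('a::euclidean_space \<Rightarrow> real) \<Rightarrow> 'a \<Rightarrow> 'a" where
  "grad h y = (\<Sum>e\<in>Basis. dd h y e *\<^sub>R e)"

lemma grad:
  fixes h :: "'a::euclidean_space \<Rightarrow> real"
  assumes h: "h differentiable (at y)"
  shows "grad h y \<bullet> w = dd h y w"
proof -
  have l: "linear (dd h y)" using h by (rule linear_frechet_derivative)
  have "grad h y \<bullet> w = (\<Sum>e\<in>Basis. (w \<bullet> e) * dd h y e)"
    unfolding grad_def inner_sum_left inner_scaleR_left by (simp add: inner_commute[of _ w] mult.commute)
  also have "\<dots> = dd h y (\<Sum>e\<in>Basis. (w \<bullet> e) *\<^sub>R e)"
    by (simp add: linear_sum[OF l] linear_scale[OF l])
  finally show ?thesis by (simp add: euclidean_representation)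
qed

lemma Cinf_grad: "Cinf UNIV h \<Longrightarrow> Cinf UNIV (grad h)"
  unfolding grad_def[abs_def]
  by (rule Cinf_sum[OF open_UNIV Cinf_scaleR[OF open_UNIV Cinf_dd Cinf_const]])

lemma dd_grad:
  assumes h: "Cinf UNIV h"
  shows "dd (grad h) y v \<bullet> w = dd (\<lambda>x. dd h x w) y v"
proof -
  have "((\<lambda>y. grad h y \<bullet> w) has_derivative (\<lambda>v. dd (grad h) y v \<bullet> w)) (at y)"
    by (rule bounded_linear.has_derivative[OF bounded_linear_inner_left Cinf_has_derivative[OF Cinf_grad[OF h] UNIV_I]])
  then have "((\<lambda>y. dd h y w) has_derivative (\<lambda>v. dd (grad h) y v \<bullet> w)) (at y)"
    by (simp add: grad[OF Cinf_differentiable[OF h UNIV_I]])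
  from fun_cong[OF ddI[OF this], of v] show ?thesis by simp
qed

lemma curl_grad: "Cinf UNIV h \<Longrightarrow> curl (grad h) y v w = 0"
  by (simp add: curl_def dd_grad dd_commute[of h v y w])

text \<open>A Lipschitz bound based at the single point \<open>x\<close> is enough. This is how
  Lipschitz estimates become bounds for derivatives.\<close>

lemma lipschitz_dd:
  fixes f :: "'a::euclidean_space \<Rightarrow> 'b::real_normed_vector"
  assumes "f differentiable (at x)" and L: "\<And>y. norm (f y - f x) \<le> L * norm (y - x)"
  shows "norm (dd f x v) \<le> L * norm v"
proof -
  let ?w = "dd f x v"
  let ?q = "\<lambda>s. norm (f (x + s *\<^sub>R v) - f x - s *\<^sub>R ?w) / \<bar>s\<bar>"
  have "((\<lambda>s. f (x + s *\<^sub>R v)) has_vector_derivative dd f (x + 0 *\<^sub>R v) v) (at 0)"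
    by (rule dd_line) (use assms in simp)
  then have "(?q \<longlongrightarrow> 0) (at 0)"
    by (simp add: has_vector_derivative_def has_derivative_iff_norm)
  moreover have "\<forall>\<^sub>F s in at 0. norm ?w - L * norm v \<le> ?q s"
  proof -
    have "norm ?w - L * norm v \<le> ?q s" if "s \<noteq> 0" for s
    proof -
      have "\<bar>s\<bar> * norm ?w = norm (s *\<^sub>R ?w)" by simp
      also have "\<dots> \<le> norm (f (x + s *\<^sub>R v) - f x) + norm (f (x + s *\<^sub>R v) - f x - s *\<^sub>R ?w)"
        by (metis norm_minus_commute norm_triangle_sub)
      also have "norm (f (x + s *\<^sub>R v) - f x) \<le> L * (\<bar>s\<bar> * norm v)"
        using L[of "x + s *\<^sub>R v"] by simp
      finally have "\<bar>s\<bar> * (norm ?w - L * norm v) \<le> norm (f (x + s *\<^sub>R v) - f x - s *\<^sub>R ?w)"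
        by (simp add: algebra_simps)
      then show ?thesis using that by (simp add: le_divide_eq mult.commute)
    qed
    then show ?thesis by (auto simp: eventually_at_filter)
  qed
  ultimately have "norm ?w - L * norm v \<le> 0"
    by (intro tendsto_lowerbound[of ?q 0 "at 0"]) auto
  then show ?thesis by simp
qed

section \<open>Hamiltonian flows close to the Hopf flow\<close>

text \<open>The analytic part uses no more than an orthogonal complex structure on a Euclidean
  space; its symplectic form is \<open>J v \<bullet> w\<close>.\<close>

locale cplx =
  fixes J :: "'a::euclidean_space \<Rightarrow> 'a"
  assumes J_linear: "linear J" and J_J [simp]: "J (J x) = - x" and J_inner [simp]: "J x \<bullet> J y = x \<bullet> y"
begin

lemma J_bl: "bounded_linear J" using J_linear by (simp add: linear_conv_bounded_linear)
lemma J_add: "J (x + y) = J x + J y" using J_linear by (rule linear_add)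
lemma J_diff: "J (x - y) = J x - J y" using J_linear by (rule linear_diff)
lemma J_scale [simp]: "J (c *\<^sub>R x) = c *\<^sub>R J x" using J_linear by (rule linear_scale)
lemma J_minus [simp]: "J (- x) = - J x" using J_linear by (rule linear_neg)
lemma J_0 [simp]: "J 0 = 0" using J_linear by (rule linear_0)

lemma J_skew: "J x \<bullet> y = - (x \<bullet> J y)"
  using J_inner[of x "J y"] by simp

lemma J_self [simp]: "J x \<bullet> x = 0" "x \<bullet> J x = 0"
  using J_skew[of x x] by (simp_all add: inner_commute)

lemma norm_J [simp]: "norm (J x) = norm x"
  by (simp add: norm_eq_sqrt_inner)

text \<open>As \<open>J\<close> has square \<open>- 1\<close>, this is \<open>exp (s J)\<close>, the
  Hopf flow.\<close>

definition R :: "real \<Rightarrow> 'a \<Rightarrow> 'a" where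
  "R s x = cos s *\<^sub>R x + sin s *\<^sub>R J x"

lemma R_linear: "linear (R s)"
  by (rule linearI) (simp_all add: R_def J_add scaleR_add_right algebra_simps)

lemmas R_add = linear_add[OF R_linear] and R_diff = linear_diff[OF R_linear]
  and R_scale = linear_scale[OF R_linear] and R_0 [simp] = linear_0[OF R_linear]

lemma R_bl: "bounded_linear (R s)" using R_linear by (simp add: linear_conv_bounded_linear)

lemma R_R: "R s (R t x) = R (s + t) x"
  by (simp add: R_def J_add cos_add sin_add scaleR_add_right algebra_simps)

lemma R_zero [simp]: "R 0 x = x" by (simp add: R_def)
lemma R_2pi [simp]: "R (2 * pi) x = x" "R (- (2 * pi)) x = x" by (simp_all add: R_def)
lemma R_inv [simp]: "R (- s) (R s x) = x" "R s (R (- s) x) = x" by (simp_all add: R_R)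
lemma R_J: "R s (J x) = J (R s x)" by (simp add: R_def J_add)

lemma R_inner: "R s x \<bullet> R s y = x \<bullet> y"
proof -
  have "R s x \<bullet> R s y = cos s * (cos s * (x \<bullet> y)) + sin s * (sin s * (x \<bullet> y))"
    by (simp add: R_def inner_add_left inner_add_right J_skew distrib_left right_diff_distrib)
  also have "\<dots> = (cos s * cos s + sin s * sin s) * (x \<bullet> y)" by (simp only: distrib_right mult.assoc)
  finally show ?thesis by simp
qed

lemma norm_R [simp]: "norm (R s x) = norm x"
  by (simp add: norm_eq_sqrt_inner R_inner)

lemma R_adj: "R (- s) x \<bullet> y = x \<bullet> R s y"
  using R_inner[of s "R (- s) x" y] by simp

lemma R_deriv: "((\<lambda>s. R s x) has_vector_derivative J (R s x)) (at s)"
  unfolding R_def[abs_def] by (auto intro!: derivative_eq_intros simp: J_add has_vector_derivative_def scaleR_diff_right)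

lemma R_plus_pi: "R (s + 2 * pi) x = R s x"
  by (simp add: R_def)

definition Rb :: "real \<Rightarrow> 'a \<Rightarrow>\<^sub>L 'a" where
  "Rb s = cos s *\<^sub>R id_blinfun + sin s *\<^sub>R mkbl J"

lemma Rb [simp]: "blinfun_apply (Rb s) x = R s x"
  by (simp add: Rb_def R_def blinfun.add_left blinfun.scaleR_left mkbl_apply[OF J_linear])

lemma Cinf_Rb: "Cinf UNIV Rb"
  unfolding Rb_def[abs_def]
  by (rule Cinf_add[OF open_UNIV Cinf_scaleR[OF open_UNIV Cinf_cos[OF open_UNIV Cinf_ident[OF open_UNIV]] Cinf_const]
      Cinf_scaleR[OF open_UNIV Cinf_sin[OF open_UNIV Cinf_ident[OF open_UNIV]] Cinf_const]])

lemma Cinf_Rb_minus: "Cinf UNIV (\<lambda>s. Rb (- s))"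
  by (rule Cinf_compose_UNIV[OF open_UNIV Cinf_Rb Cinf_minus[OF open_UNIV Cinf_ident[OF open_UNIV]]])

lemma Cinf_R:
  assumes "open S" "Cinf S f" "Cinf S g"
  shows "Cinf S (\<lambda>z. R (f z) (g z))"
  using Cinf_blinfun_apply[OF assms(1) Cinf_compose_UNIV[OF assms(1) Cinf_Rb assms(2)] assms(3)] by simp

lemma Cinf_J: "open S \<Longrightarrow> Cinf S f \<Longrightarrow> Cinf S (\<lambda>x. J (f x))"
  by (rule Cinf_bounded_linear[OF J_bl])

lemma Rb_deriv: "(Rb has_vector_derivative (mkbl J o\<^sub>L Rb s)) (at s)"
proof -
  have "(Rb has_vector_derivative (- sin s *\<^sub>R id_blinfun + cos s *\<^sub>R mkbl J)) (at s)"
    unfolding Rb_def[abs_def] by (auto intro!: derivative_eq_intros simp: has_vector_derivative_def scaleR_diff_right)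
  moreover have "- sin s *\<^sub>R id_blinfun + cos s *\<^sub>R mkbl J = mkbl J o\<^sub>L Rb s"
    by (rule blinfun_eqI) (simp add: blinfun.diff_left blinfun.scaleR_left mkbl_apply[OF J_linear] R_def J_add)
  ultimately show ?thesis by simp
qed

end

section \<open>Averages over one period\<close>

definition avg :: "(real \<Rightarrow> 'b::banach) \<Rightarrow> 'b" where
  "avg g = (1 / (2 * pi)) *\<^sub>R integral {0..2 * pi} g"

lemma avg_norm:
  assumes "continuous_on UNIV g" "\<And>s. 0 \<le> s \<Longrightarrow> s \<le> 2 * pi \<Longrightarrow> norm (g s) \<le> B"
  shows "norm (avg g) \<le> B"
proof -
  have "norm (integral {0..2 * pi} g) \<le> B * (2 * pi - 0)"
    by (rule integral_bound) (use assms in \<open>auto intro: continuous_on_subset\<close>)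
  then show ?thesis by (simp add: avg_def divide_simps)
qed

lemma avg_linear:
  assumes "bounded_linear h" "continuous_on UNIV g"
  shows "avg (\<lambda>s. h (g s)) = h (avg g)"
proof -
  have "g integrable_on {0..2 * pi}"
    using assms(2) by (auto intro: integrable_continuous_real continuous_on_subset)
  from integral_linear[OF this assms(1)] show ?thesis
    by (simp add: avg_def o_def linear_scale[OF bounded_linear.linear[OF assms(1)]])
qed

lemma avg_add:
  assumes "continuous_on UNIV f" "continuous_on UNIV g"
  shows "avg (\<lambda>s. f s + g s) = avg f + avg g"
proof -
  have "f integrable_on {0..2 * pi}" "g integrable_on {0..2 * pi}"
    using assms by (auto intro: integrable_continuous_real continuous_on_subset)
  then show ?thesis by (simp add: avg_def integral_add scaleR_add_right)
qed

lemma avg_diff: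
  assumes "continuous_on UNIV f" "continuous_on UNIV g"
  shows "avg (\<lambda>s. f s - g s) = avg f - avg g"
proof -
  have "f integrable_on {0..2 * pi}" "g integrable_on {0..2 * pi}"
    using assms by (auto intro: integrable_continuous_real continuous_on_subset)
  then show ?thesis by (simp add: avg_def integral_diff scaleR_diff_right)
qed

lemma avg_const [simp]: "avg (\<lambda>s. c) = c"
  by (simp add: avg_def)

lemma avg_mono:
  fixes f g :: "real \<Rightarrow> real"
  assumes "continuous_on UNIV f" "continuous_on UNIV g" "\<And>s. 0 \<le> s \<Longrightarrow> s \<le> 2 * pi \<Longrightarrow> f s \<le> g s"
  shows "avg f \<le> avg g"
proof -
  have "f integrable_on {0..2 * pi}" "g integrable_on {0..2 * pi}"
    using assms by (auto intro: integrable_continuous_real continuous_on_subset)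
  then have "integral {0..2 * pi} f \<le> integral {0..2 * pi} g" using assms(3) by (intro integral_le) auto
  then show ?thesis by (simp add: avg_def divide_right_mono)
qed

lemma integral_shift:
  fixes g :: "real \<Rightarrow> 'b::banach"
  assumes g: "continuous_on UNIV g" and "c \<ge> 0"
  shows "integral {0..c} (\<lambda>s. g (s + a)) = tint (c + a) g - tint a g"
proof -
  have "((\<lambda>s. tint (s + a) g) has_vector_derivative g (s + a)) (at s within {0..c})" for s
  proof -
    have "((\<lambda>t. tint t g) \<circ> (\<lambda>s. s + a) has_vector_derivative 1 *\<^sub>R g (s + a)) (at s)"
      by (rule vector_diff_chain_at[OF _ tint_has_derivative[OF g]]) (auto intro!: derivative_eq_intros)
    then show ?thesis by (auto simp: o_def intro: has_vector_derivative_at_within)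
  qed
  from fundamental_theorem_of_calculus[OF assms(2) this] show ?thesis by (simp add: integral_unique)
qed

lemma avg_periodic:
  fixes g :: "real \<Rightarrow> 'b::banach"
  assumes g: "continuous_on UNIV g" and per: "\<And>s. g (s + 2 * pi) = g s"
  shows "avg (\<lambda>s. g (s + a)) = avg g"
proof -
  let ?G = "\<lambda>a. tint (2 * pi + a) g - tint a g"
  have "(?G has_vector_derivative 0) (at a)" for a
  proof -
    have "((\<lambda>t. tint t g) \<circ> (\<lambda>a. 2 * pi + a) has_vector_derivative 1 *\<^sub>R g (2 * pi + a)) (at a)"
      by (rule vector_diff_chain_at[OF _ tint_has_derivative[OF g]]) (auto intro!: derivative_eq_intros)
    from has_vector_derivative_diff[OF this tint_has_derivative[OF g]] show ?thesis
      using per[of a] by (simp add: o_def add.commute)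
  qed
  from vector_derivative_zero_eq[of ?G, OF this, of a 0]
  show ?thesis using integral_shift[OF g, of "2 * pi" a] integral_shift[OF g, of "2 * pi" 0] by (simp add: avg_def)
qed

lemma Cinf_avg:
  fixes F :: "'a::euclidean_space \<Rightarrow> real \<Rightarrow> 'b::banach"
  assumes "Cinf UNIV (\<lambda>(x, t). F x t)"
  shows "Cinf UNIV (\<lambda>x. avg (F x))"
  unfolding avg_def
  by (rule Cinf_bounded_linear[OF bounded_linear_scaleR_right open_UNIV Cinf_integral[OF assms]])

lemma Cinf_continuous_snd:
  fixes F :: "'a::euclidean_space \<Rightarrow> real \<Rightarrow> 'b::real_normed_vector"
  assumes "Cinf UNIV (\<lambda>(x, t). F x t)"
  shows "continuous_on S (F x)"
  using continuous_on_compose2[OF Cinf_continuous[OF assms] continuous_on_Pair[OF continuous_on_const[of S x] continuous_on_id]]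
  by simp

lemma avg_has_derivative:
  fixes F :: "'a::euclidean_space \<Rightarrow> real \<Rightarrow> 'b::banach"
  assumes F: "Cinf UNIV (\<lambda>(x, t). F x t)"
  shows "((\<lambda>x. avg (F x)) has_derivative (\<lambda>v. avg (\<lambda>t. dd (\<lambda>x. F x t) x v))) (at x)"
proof -
  have "Ck (Suc 0) UNIV (\<lambda>(x, t). F x t)" using F unfolding Cinf_def by blast
  from bounded_linear.has_derivative[OF bounded_linear_scaleR_right integral_param_has_derivative[OF this]]
  show ?thesis unfolding avg_def by (simp only: dd_fst[OF F])
qed

lemma Cinf_swap: 
  fixes F :: "'a::euclidean_space \<Rightarrow> 'c::euclidean_space \<Rightarrow> 'b::real_normed_vector"
  assumes F: "Cinf UNIV (\<lambda>(x, t). F x t)" shows "Cinf UNIV (\<lambda>(t, x). F x t)"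
proof -
  have "Cinf UNIV (\<lambda>z :: 'c \<times> 'a. (snd z, fst z))"
    by (rule Cinf_Pair[OF open_UNIV Cinf_linear[OF bounded_linear_snd open_UNIV] Cinf_linear[OF bounded_linear_fst open_UNIV]])
  from Cinf_compose_UNIV[OF open_UNIV F this] show ?thesis by (simp add: split_def)
qed

lemma Cinf_fst_UNIV: "Cinf UNIV (\<lambda>z :: 'a::euclidean_space \<times> 'b::euclidean_space. fst z)"
  and Cinf_snd_UNIV: "Cinf UNIV (\<lambda>z :: 'a::euclidean_space \<times> 'b::euclidean_space. snd z)"
  by (rule Cinf_linear[OF bounded_linear_fst open_UNIV] Cinf_linear[OF bounded_linear_snd open_UNIV])+

text \<open>The flow \<open>\<phi>\<close> of \<open>X = J \<circ> grad H\<close> is compared with the Hopf flow \<open>R\<close> through \<open>\<zeta> s = R (-s) \<circ> \<phi> s\<close>; \<open>u\<close> is the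
  average of \<open>\<zeta>\<close> over a period and \<open>r\<close> the inverse of \<open>u\<close>.\<close>

locale near_hopf = cplx J for J :: "'a::euclidean_space \<Rightarrow> 'a" +
  fixes H :: "'a \<Rightarrow> real" and \<xi> :: "'a \<Rightarrow> 'a" and \<epsilon> \<kappa> :: real
  assumes H: "Cinf UNIV H" and \<xi>: "Cinf UNIV \<xi>"
    and H_deriv: "\<And>x. (H has_derivative (\<lambda>v. (x - J (\<xi> x)) \<bullet> v)) (at x)"
    and \<xi>_lip: "\<And>x y. norm (\<xi> x - \<xi> y) \<le> \<epsilon> * norm (x - y)" and \<xi>_0: "\<xi> 0 = 0"
    and \<epsilon>: "0 \<le> \<epsilon>" "10 * \<epsilon> \<le> \<kappa>" and \<kappa>: "\<kappa> \<le> 1 / 1000000"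
begin

text \<open>By \<open>H_deriv\<close> the gradient of \<open>H\<close> is
  \<open>x - J (\<xi> x)\<close>, and this is \<open>J\<close> applied to it. In the resulting sign
  convention, \<open>J (X x) \<bullet> w\<close> is minus the derivative of \<open>H\<close> in the
  direction \<open>w\<close>.\<close>

definition X :: "'a \<Rightarrow> 'a" where "X x = J x + \<xi> x"

lemma \<kappa>0: "0 \<le> \<kappa>" using \<epsilon> by simp

lemma Cinf_X: "Cinf UNIV X"
  unfolding X_def[abs_def] by (rule Cinf_add[OF open_UNIV Cinf_linear[OF J_bl open_UNIV] \<xi>])

lemma X_growth: "norm (X x) \<le> 2 * (1 + norm x)"
proof -
  have "norm (X x) \<le> norm (J x) + norm (\<xi> x)" unfolding X_def by (rule norm_triangle_ineq)
  also have "\<dots> \<le> norm x + \<epsilon> * norm x" using \<xi>_lip[of x 0] \<xi>_0 by simp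
  also have "\<epsilon> * norm x \<le> 1 * norm x" using \<epsilon> \<kappa> by (intro mult_right_mono) auto
  finally show ?thesis by simp
qed

definition flow_spec :: "(real \<Rightarrow> 'a \<Rightarrow> 'a) \<Rightarrow> bool" where
  "flow_spec f \<longleftrightarrow> Cinf UNIV (\<lambda>(t, x). f t x) \<and> (\<forall>x. f 0 x = x) \<and>
    (\<forall>t x. ((\<lambda>t. f t x) has_vector_derivative X (f t x)) (at t)) \<and> (\<forall>s t x. f (s + t) x = f s (f t x))"

definition \<phi> :: "real \<Rightarrow> 'a \<Rightarrow> 'a" where "\<phi> = (SOME f. flow_spec f)"

lemma \<phi>_spec: "flow_spec \<phi>"
proof -
  have "\<exists>f. flow_spec f" by (rule smooth_flow[OF Cinf_X X_growth]) (auto simp: flow_spec_def)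
  then show ?thesis unfolding \<phi>_def by (rule someI_ex)
qed

lemma \<phi>: "Cinf UNIV (\<lambda>(t, x). \<phi> t x)" "\<phi> 0 x = x"
    "((\<lambda>t. \<phi> t x) has_vector_derivative X (\<phi> t x)) (at t)"
    "\<phi> (s + t) x = \<phi> s (\<phi> t x)"
  using \<phi>_spec unfolding flow_spec_def by blast+

lemma \<phi>_fix_0: "\<phi> t 0 = 0"
proof (rule ode_unique[OF Cinf_X, of t "\<lambda>t. \<phi> t 0" "\<lambda>t. 0"])
  show "((\<lambda>t. 0) has_vector_derivative X 0) (at s)" for s by (simp add: X_def \<xi>_0)
qed (rule \<phi>(3), simp add: \<phi>(2))

definition \<zeta> :: "real \<Rightarrow> 'a \<Rightarrow> 'a" where "\<zeta> s x = R (- s) (\<phi> s x)"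

lemma \<phi>_\<zeta>: "\<phi> s x = R s (\<zeta> s x)" by (simp add: \<zeta>_def)
lemma \<zeta>_0 [simp]: "\<zeta> 0 x = x" by (simp add: \<zeta>_def \<phi>(2))
lemma \<zeta>_fix_0 [simp]: "\<zeta> s 0 = 0" by (simp add: \<zeta>_def \<phi>_fix_0)

lemma Cinf_\<zeta>: "Cinf UNIV (\<lambda>(s, x). \<zeta> s x)"
proof -
  have "Cinf UNIV (\<lambda>z. R (- fst z) (case z of (t, x) \<Rightarrow> \<phi> t x))"
    by (rule Cinf_R[OF open_UNIV Cinf_minus[OF open_UNIV Cinf_fst_UNIV] \<phi>(1)])
  then show ?thesis by (simp add: \<zeta>_def split_def)
qed

lemma \<zeta>_cont: "continuous_on S (\<lambda>s. \<zeta> s x)"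
  using Cinf_continuous_snd[OF Cinf_swap[OF Cinf_\<zeta>]] .

lemma Rb_minus_deriv: "((\<lambda>s. Rb (- s)) has_vector_derivative - (mkbl J o\<^sub>L Rb (- s))) (at s)"
proof -
  have "(Rb \<circ> uminus has_vector_derivative (- 1) *\<^sub>R (mkbl J o\<^sub>L Rb (- s))) (at s)"
    by (rule vector_diff_chain_at[OF _ Rb_deriv]) (auto intro!: derivative_eq_intros)
  then show ?thesis by (simp add: o_def)
qed

lemma \<zeta>_deriv: "((\<lambda>s. \<zeta> s x) has_vector_derivative R (- s) (\<xi> (\<phi> s x))) (at s)"
proof -
  have "((\<lambda>s. Rb (- s) (\<phi> s x)) has_vector_derivative
      (Rb (- s) (X (\<phi> s x)) + (- (mkbl J o\<^sub>L Rb (- s))) (\<phi> s x))) (at s)"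
    by (rule bounded_bilinear.has_vector_derivative[OF bounded_bilinear_blinfun_apply Rb_minus_deriv \<phi>(3)])
  then show ?thesis
    by (simp add: \<zeta>_def[abs_def] X_def R_add R_J blinfun.minus_left mkbl_apply[OF J_linear])
qed

text \<open>The source of the factor 10 in \<open>10 * \<epsilon> \<le> \<kappa>\<close>: as
  \<open>pi < 4\<close>, the product of the period with \<open>11/10\<close> is below 8.8. From here
  on \<open>\<kappa>\<close> absorbs the length of the period.\<close>

lemma exp_\<epsilon>: "0 \<le> s \<Longrightarrow> s \<le> 2 * pi \<Longrightarrow> exp (\<epsilon> * s) \<le> 11 / 10" and \<epsilon>_pi: "2 * pi * \<epsilon> * (11 / 10) \<le> \<kappa>"
proof -
  have p: "pi < 4" by (rule pi_less_4)
  have e: "\<epsilon> \<le> 1 / 1000" using \<epsilon> \<kappa> by linarith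
  { assume s: "0 \<le> s" "s \<le> 2 * pi"
    have "\<epsilon> * s \<le> (1 / 1000) * 8" using s p e \<epsilon> by (intro mult_mono) auto
    moreover have "0 \<le> \<epsilon> * s" using s \<epsilon> by simp
    ultimately have "exp (\<epsilon> * s) \<le> 1 + \<epsilon> * s + (\<epsilon> * s)\<^sup>2" "(\<epsilon> * s)\<^sup>2 \<le> (1 / 100)\<^sup>2"
      by (auto intro!: exp_bound power_mono)
    then show "exp (\<epsilon> * s) \<le> 11 / 10" using \<open>\<epsilon> * s \<le> (1 / 1000) * 8\<close> by (simp add: power2_eq_square) }
  have "\<epsilon> * pi \<le> \<epsilon> * 4" using p \<epsilon> by (intro mult_left_mono) auto
  then show "2 * pi * \<epsilon> * (11 / 10) \<le> \<kappa>" using \<epsilon> by (simp add: algebra_simps)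
qed

text \<open>In the rotating frame \<open>J\<close> disappears from the equation and only
  \<open>\<xi>\<close> drives the motion. Integrating its Lipschitz bound over at most one period
  controls differences, which stands in for \<open>C\<^sup>1\<close>-closeness to the
  identity.\<close>

lemma \<zeta>_lip:
  assumes s: "0 \<le> s" "s \<le> 2 * pi"
  shows "norm ((\<zeta> s x - \<zeta> s y) - (x - y)) \<le> \<kappa> * norm (x - y)"
proof -
  let ?z = "\<lambda>s. \<zeta> s x - \<zeta> s y" and ?z' = "\<lambda>s. R (- s) (\<xi> (\<phi> s x)) - R (- s) (\<xi> (\<phi> s y))"
  have d: "(?z has_vector_derivative ?z' s) (at s)" for s
    by (rule has_vector_derivative_diff[OF \<zeta>_deriv \<zeta>_deriv])
  have b: "norm (?z' s) \<le> \<epsilon> * norm (?z s)" for s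
  proof -
    have "norm (?z' s) = norm (\<xi> (\<phi> s x) - \<xi> (\<phi> s y))" by (simp add: R_diff[symmetric])
    also have "\<dots> \<le> \<epsilon> * norm (\<phi> s x - \<phi> s y)" by (rule \<xi>_lip)
    finally show ?thesis by (simp add: \<phi>_\<zeta> R_diff[symmetric])
  qed
  have g: "norm (?z r) \<le> (11 / 10) * norm (x - y)" if "0 \<le> r" "r \<le> s" for r
  proof -
    have "norm (?z r) \<le> exp (\<epsilon> * r) * norm (?z 0)" by (rule gronwall[OF that(1) d b])
    also have "\<dots> \<le> (11 / 10) * norm (?z 0)" using that s by (intro mult_right_mono exp_\<epsilon>) auto
    finally show ?thesis by simp
  qed
  have "norm (?z s - ?z 0) \<le> (\<epsilon> * ((11 / 10) * norm (x - y))) * norm (s - 0)"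
  proof (rule differentiable_bound[where S = "{0..s}" and f' = "\<lambda>r h. h *\<^sub>R ?z' r"])
    fix r assume r: "r \<in> {0..s}"
    show "(?z has_derivative (\<lambda>h. h *\<^sub>R ?z' r)) (at r within {0..s})"
      using d by (auto simp: has_vector_derivative_def intro: has_derivative_at_withinI)
    have "norm (?z' r) \<le> \<epsilon> * ((11 / 10) * norm (x - y))"
      by (rule order_trans[OF b mult_left_mono[OF g]]) (use r \<epsilon> in auto)
    note le = this
    show "onorm (\<lambda>h. h *\<^sub>R ?z' r) \<le> \<epsilon> * ((11 / 10) * norm (x - y))"
    proof (rule onorm_le)
      fix h :: real
      show "norm (h *\<^sub>R ?z' r) \<le> \<epsilon> * ((11 / 10) * norm (x - y)) * norm h"
        using mult_left_mono[OF le, of "norm h"] unfolding norm_scaleR real_norm_def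
        by (simp only: abs_ge_zero mult.commute)
    qed
  qed (use s in auto)
  also have "\<dots> \<le> (\<epsilon> * ((11 / 10) * norm (x - y))) * (2 * pi)"
    using s \<epsilon> by (intro mult_left_mono) auto
  also have "\<dots> = (2 * pi * \<epsilon> * (11 / 10)) * norm (x - y)" by simp
  also have "\<dots> \<le> \<kappa> * norm (x - y)" by (intro mult_right_mono \<epsilon>_pi) auto
  finally show ?thesis by simp
qed

lemma \<zeta>_near: "0 \<le> s \<Longrightarrow> s \<le> 2 * pi \<Longrightarrow> norm (\<zeta> s x - x) \<le> \<kappa> * norm x"
  using \<zeta>_lip[of s x 0] by simp

definition u :: "'a \<Rightarrow> 'a" where "u x = avg (\<lambda>s. \<zeta> s x)"

lemma Cinf_u: "Cinf UNIV u"
  unfolding u_def[abs_def] by (rule Cinf_avg[OF Cinf_swap[OF Cinf_\<zeta>]])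

lemma u_lip: "norm ((u x - u y) - (x - y)) \<le> \<kappa> * norm (x - y)"
proof -
  have "(u x - u y) - (x - y) = avg (\<lambda>s. (\<zeta> s x - \<zeta> s y) - (x - y))"
    by (simp add: u_def avg_diff \<zeta>_cont continuous_on_diff)
  also have "norm \<dots> \<le> \<kappa> * norm (x - y)"
    by (rule avg_norm[OF _ \<zeta>_lip]) (intro continuous_on_diff \<zeta>_cont continuous_on_const)
  finally show ?thesis .
qed

lemma u_0 [simp]: "u 0 = 0" by (simp add: u_def)

lemma u_expand: "norm (x - y) \<le> (1 + 2 * \<kappa>) * norm (u x - u y)"
proof -
  have "norm (x - y) \<le> norm (u x - u y) + norm ((u x - u y) - (x - y))"
    by (metis norm_minus_commute norm_triangle_sub)
  then have "(1 - \<kappa>) * norm (x - y) \<le> norm (u x - u y)" using u_lip[of x y] by (simp add: algebra_simps)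
  then have "(1 + 2 * \<kappa>) * ((1 - \<kappa>) * norm (x - y)) \<le> (1 + 2 * \<kappa>) * norm (u x - u y)"
    using \<kappa>0 by (intro mult_left_mono) auto
  moreover have "1 * norm (x - y) \<le> ((1 + 2 * \<kappa>) * (1 - \<kappa>)) * norm (x - y)"
  proof (rule mult_right_mono)
    have "\<kappa> * \<kappa> \<le> \<kappa> * (1 / 2)" using \<kappa> \<kappa>0 by (intro mult_left_mono) auto
    then show "1 \<le> (1 + 2 * \<kappa>) * (1 - \<kappa>)" by (simp add: algebra_simps)
  qed simp
  ultimately show ?thesis by (simp add: mult.assoc)
qed

text \<open>Solving \<open>u x = y\<close> is a fixed point problem for
  \<open>x \<mapsto> y - (u x - x)\<close>, a contraction by \<open>u_lip\<close>.\<close>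

lemma u_bij: "bij u"
proof (rule bijI)
  show "inj u"
  proof (rule injI)
    fix x y assume "u x = u y" then show "x = y" using u_expand[of x y] by simp
  qed
  show "surj u"
    unfolding surj_def
  proof
    fix y
    have "\<exists>!x. y - (u x - x) = x"
    proof (rule banach_fix_type[where c = \<kappa>])
      show "\<forall>x z. dist (y - (u x - x)) (y - (u z - z)) \<le> \<kappa> * dist x z"
      proof (intro allI)
        fix x z
        have "(y - (u x - x)) - (y - (u z - z)) = - ((u x - u z) - (x - z))" by simp
        then show "dist (y - (u x - x)) (y - (u z - z)) \<le> \<kappa> * dist x z"
          using u_lip[of x z] unfolding dist_norm by (metis norm_minus_cancel)
      qed
    qed (use \<kappa> \<kappa>0 in auto)
    then obtain x where "y - (u x - x) = x" by blast
    then show "\<exists>x. y = u x" by (intro exI[of _ x]) (simp add: algebra_simps)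
  qed
qed

definition r :: "'a \<Rightarrow> 'a" where "r = inv u"

lemma u_r [simp]: "u (r y) = y" and r_u [simp]: "r (u x) = x"
  using u_bij by (simp_all add: r_def bij_is_surj surj_f_inv_f bij_is_inj inv_f_f)

lemma r_0 [simp]: "r 0 = 0" using r_u[of 0] by simp

lemma r_expand: "norm (r y - r z) \<le> (1 + 2 * \<kappa>) * norm (y - z)"
  using u_expand[of "r y" "r z"] by simp

lemma r_lip: "norm ((r y - r z) - (y - z)) \<le> 2 * \<kappa> * norm (y - z)"
proof -
  have "norm ((r y - r z) - (y - z)) \<le> \<kappa> * norm (r y - r z)"
    using u_lip[of "r y" "r z"] by (simp add: norm_minus_commute)
  also have "\<dots> \<le> \<kappa> * ((1 + 2 * \<kappa>) * norm (y - z))" by (rule mult_left_mono[OF r_expand \<kappa>0])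
  also have "\<dots> \<le> \<kappa> * (2 * norm (y - z))" using \<kappa> \<kappa>0 by (intro mult_left_mono mult_right_mono) auto
  finally show ?thesis by simp
qed

lemma r_near: "norm (r y - y) \<le> 2 * \<kappa> * norm y" using r_lip[of y 0] by simp

lemma r_cont: "continuous_on UNIV r"
proof (rule continuous_on_subset[OF lipschitz_on_continuous_on])
  show "(1 + 2 * \<kappa>)-lipschitz_on UNIV r"
    using r_expand \<kappa>0 by (auto simp: lipschitz_on_def dist_norm)
qed simp

lemma Cinf_r: "Cinf UNIV r"
proof (rule Cinf_inverse_map(1)[OF Cinf_u, where K = 2])
  show "norm v \<le> 2 * norm (dd u x v)" for x v
  proof -
    have d: "((\<lambda>y. u y - y) has_derivative (\<lambda>v. dd u x v - v)) (at x)"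
      by (rule has_derivative_diff[OF Cinf_has_derivative[OF Cinf_u UNIV_I] has_derivative_ident])
    have "norm (dd (\<lambda>y. u y - y) x v) \<le> \<kappa> * norm v"
    proof (rule lipschitz_dd)
      show "(\<lambda>y. u y - y) differentiable (at x)" using d by (auto simp: differentiable_def)
      show "norm (u y - y - (u x - x)) \<le> \<kappa> * norm (y - x)" for y
        using u_lip[of y x] by (simp add: algebra_simps)
    qed
    then have "norm (dd u x v - v) \<le> (1 / 2) * norm v"
      unfolding ddI[OF d] using \<kappa> mult_right_mono[of \<kappa> "1 / 2" "norm v"] by simp
    moreover have "norm v \<le> norm (dd u x v) + norm (dd u x v - v)"
      by (metis norm_minus_commute norm_triangle_sub)
    ultimately show ?thesis by simp
  qed
qed (use r_cont in auto)

lemma dd_r: "norm (dd r y v - v) \<le> 2 * \<kappa> * norm v"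
proof -
  have d: "((\<lambda>y. r y - y) has_derivative (\<lambda>v. dd r y v - v)) (at y)"
    by (rule has_derivative_diff[OF Cinf_has_derivative[OF Cinf_r UNIV_I] has_derivative_ident])
  have "norm (dd (\<lambda>y. r y - y) y v) \<le> 2 * \<kappa> * norm v"
  proof (rule lipschitz_dd)
    show "(\<lambda>y. r y - y) differentiable (at y)" using d by (auto simp: differentiable_def)
    show "norm (r z - z - (r y - y)) \<le> 2 * \<kappa> * norm (z - y)" for z
      using r_lip[of z y] by (simp add: algebra_simps)
  qed
  then show ?thesis unfolding ddI[OF d] .
qed

lemma dd_r_linear: "linear (dd r y)"
  using Cinf_dd_linear[OF Cinf_r UNIV_I] by (rule bounded_linear.linear)

lemma dd_r_dd_u: "dd r y (dd u (r y) v) = v"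
proof -
  have "((\<lambda>x. r (u x)) has_derivative (\<lambda>v. dd r (u (r y)) (dd u (r y) v))) (at (r y))"
    by (rule has_derivative_compose[OF Cinf_has_derivative[OF Cinf_u UNIV_I] Cinf_has_derivative[OF Cinf_r UNIV_I]])
  then have "((\<lambda>x. x) has_derivative (\<lambda>v. dd r y (dd u (r y) v))) (at (r y))" by simp
  from fun_cong[OF has_derivative_unique[OF this has_derivative_ident], of v] show ?thesis .
qed

text \<open>The displacement of the flow after one period, because \<open>R (2 * pi)\<close> is the
  identity; it vanishes exactly at points whose orbit closes up at time
  \<open>2 * pi\<close>.\<close>

definition \<delta> :: "'a \<Rightarrow> 'a" where "\<delta> x = \<zeta> (2 * pi) x - x"

lemma \<phi>_2pi: "\<phi> (2 * pi) x = x + \<delta> x" by (simp add: \<delta>_def \<zeta>_def)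

lemma \<delta>_lip: "norm (\<delta> x - \<delta> y) \<le> \<kappa> * norm (x - y)"
  using \<zeta>_lip[of "2 * pi" x y] by (simp add: \<delta>_def algebra_simps)

lemma \<delta>_0 [simp]: "\<delta> 0 = 0" by (simp add: \<delta>_def)

lemma \<zeta>_add_2pi: "\<zeta> (s + 2 * pi) x = \<zeta> s (x + \<delta> x)"
proof -
  have "R (- (s + 2 * pi)) z = R (- s) z" for z using R_plus_pi[of "- (s + 2 * pi)" z] by simp
  then show ?thesis by (simp only: \<zeta>_def \<phi>(4) \<phi>_2pi)
qed

text \<open>Following the flow for time \<open>s\<close> shifts the averaging window by
  \<open>s\<close> and rotates by \<open>R s\<close>, because
  \<open>\<zeta> t (\<phi> s x) = R s (\<zeta> (t + s) x)\<close>.\<close>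

lemma u_\<phi>: "u (\<phi> s x) = (1 / (2 * pi)) *\<^sub>R R s (tint (2 * pi + s) (\<lambda>t. \<zeta> t x) - tint s (\<lambda>t. \<zeta> t x))"
proof -
  have "\<zeta> t (\<phi> s x) = R s (\<zeta> (t + s) x)" for t
    by (simp add: \<zeta>_def \<phi>(4) R_R)
  then have "u (\<phi> s x) = avg (\<lambda>t. R s (\<zeta> (t + s) x))" by (simp add: u_def)
  also have "\<dots> = R s (avg (\<lambda>t. \<zeta> (t + s) x))"
    by (rule avg_linear[OF R_bl]) (intro continuous_on_compose2[OF \<zeta>_cont[of UNIV]] continuous_intros, auto)
  finally show ?thesis
    using integral_shift[OF \<zeta>_cont[of UNIV x], of "2 * pi" s] by (simp add: avg_def R_scale)
qed

lemma tint_2pi: "tint (2 * pi) (\<lambda>t. \<zeta> t x) = (2 * pi) *\<^sub>R u x"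
  using integral_shift[OF \<zeta>_cont[of UNIV x], of "2 * pi" 0] by (simp add: tint_def u_def avg_def)

text \<open>The rotation contributes \<open>J (u x)\<close>. The sliding window contributes the
  difference of its two end values, which is \<open>\<delta> x\<close>, divided by the
  period.\<close>

lemma dd_u_X: "dd u x (X x) = J (u x) + (1 / (2 * pi)) *\<^sub>R \<delta> x"
proof -
  have 1: "((\<lambda>s. u (\<phi> s x)) has_vector_derivative dd u x (X x)) (at 0)"
    using Cinf_along_curve[OF Cinf_u \<phi>(3)[of x 0]] by (simp add: \<phi>(2))
  let ?T = "\<lambda>s. tint (2 * pi + s) (\<lambda>t. \<zeta> t x) - tint s (\<lambda>t. \<zeta> t x)"
  have "((\<lambda>t. tint t (\<lambda>t. \<zeta> t x)) \<circ> (\<lambda>s. 2 * pi + s) has_vector_derivative 1 *\<^sub>R \<zeta> (2 * pi + 0) x) (at 0)"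
    by (rule vector_diff_chain_at[OF _ tint_has_derivative[OF \<zeta>_cont]]) (auto intro!: derivative_eq_intros)
  from has_vector_derivative_diff[OF this tint_has_derivative[OF \<zeta>_cont, of x 0]]
  have T: "(?T has_vector_derivative \<delta> x) (at 0)" by (simp add: o_def \<delta>_def)
  from bounded_bilinear.has_vector_derivative[OF bounded_bilinear_blinfun_apply Rb_deriv[of 0] T]
  have "((\<lambda>s. R s (?T s)) has_vector_derivative \<delta> x + J (?T 0)) (at 0)"
    by (simp add: mkbl_apply[OF J_linear])
  from bounded_linear.has_vector_derivative[OF bounded_linear_scaleR_right[of "1 / (2 * pi)"] this]
  have 2: "((\<lambda>s. u (\<phi> s x)) has_vector_derivative (1 / (2 * pi)) *\<^sub>R (\<delta> x + J (?T 0))) (at 0)"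
    by (simp only: u_\<phi>)
  have "?T 0 = (2 * pi) *\<^sub>R u x" by (simp add: tint_2pi) (simp add: tint_def)
  then show ?thesis using vector_derivative_unique_at[OF 1 2] by (simp add: scaleR_add_right)
qed

text \<open>In the coordinates \<open>r\<close> the vector field \<open>X\<close> reads \<open>J y + \<delta>' y\<close> (see \<open>dd_r_X\<close>).\<close>

definition \<delta>' :: "'a \<Rightarrow> 'a" where "\<delta>' y = (1 / (2 * pi)) *\<^sub>R \<delta> (r y)"

lemma inv_2pi: "1 / (2 * pi) \<le> 1 / 4" using pi_gt3 by (simp add: divide_simps)

lemma \<delta>'_lip: "norm (\<delta>' y - \<delta>' z) \<le> \<kappa> * norm (y - z)"
proof -
  have "norm (\<delta>' y - \<delta>' z) = 1 / (2 * pi) * norm (\<delta> (r y) - \<delta> (r z))"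
    unfolding \<delta>'_def scaleR_diff_right[symmetric] by simp
  also have "\<dots> \<le> (1 / 4) * (\<kappa> * ((1 + 2 * \<kappa>) * norm (y - z)))"
    using inv_2pi \<kappa>0 by (intro mult_mono order_trans[OF \<delta>_lip] mult_left_mono r_expand) auto
  also have "\<dots> \<le> (1 / 4) * (\<kappa> * (2 * norm (y - z)))"
    using \<kappa> \<kappa>0 by (intro mult_left_mono mult_right_mono) auto
  finally show ?thesis using mult_nonneg_nonneg[OF \<kappa>0 norm_ge_zero[of "y - z"]] by simp
qed

lemma \<delta>'_0 [simp]: "\<delta>' 0 = 0" by (simp add: \<delta>'_def)

lemma \<delta>'_le: "norm (\<delta>' y) \<le> \<kappa> * norm y" using \<delta>'_lip[of y 0] by simp

lemma Cinf_\<delta>': "Cinf UNIV \<delta>'"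
proof -
  have "Cinf UNIV (\<lambda>x :: 'a. (2 * pi, x))" by (rule Cinf_Pair[OF open_UNIV Cinf_const Cinf_ident[OF open_UNIV]])
  from Cinf_compose_UNIV[OF open_UNIV Cinf_\<zeta> this] have "Cinf UNIV (\<zeta> (2 * pi))" by simp
  then have "Cinf UNIV \<delta>" unfolding \<delta>_def[abs_def] by (rule Cinf_diff[OF open_UNIV _ Cinf_ident[OF open_UNIV]])
  from Cinf_bounded_linear[OF bounded_linear_scaleR_right open_UNIV Cinf_compose_UNIV[OF open_UNIV this Cinf_r]]
  show ?thesis unfolding \<delta>'_def[abs_def] .
qed

text \<open>The time \<open>2 pi\<close> map of the flow commutes with \<open>\<phi> s\<close>, so \<open>\<delta>'\<close> is equivariant under \<open>R\<close> up to an
  error that is small relative to \<open>\<delta>'\<close> itself, not merely relative to \<open>y\<close>.\<close>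

lemma \<delta>'_R:
  assumes s: "0 \<le> s" "s \<le> 2 * pi"
  shows "norm (\<delta>' (R s y) - R s (\<delta>' y)) \<le> 3 * \<kappa> * norm (\<delta>' y)"
proof -
  define x where "x = r y"
  have uxy: "u x = y" by (simp add: x_def)
  have "\<delta> (\<phi> s x) = R s (\<zeta> s (x + \<delta> x) - \<zeta> s x)"
  proof -
    have "\<phi> (2 * pi) (\<phi> s x) = \<phi> s (x + \<delta> x)" by (metis \<phi>(4) \<phi>_2pi add.commute)
    then have "\<delta> (\<phi> s x) = \<phi> s (x + \<delta> x) - \<phi> s x" unfolding \<phi>_2pi by (metis add_diff_cancel_left')
    then show ?thesis by (simp only: \<phi>_\<zeta> R_diff)
  qed
  then have "\<delta> (\<phi> s x) - R s (\<delta> x) = R s ((\<zeta> s (x + \<delta> x) - \<zeta> s x) - (x + \<delta> x - x))" by (simp add: R_diff)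
  then have 1: "norm (\<delta> (\<phi> s x) - R s (\<delta> x)) \<le> \<kappa> * norm (\<delta> x)"
    using \<zeta>_lip[OF s, of "x + \<delta> x" x] by simp
  \<comment> \<open>Shifting the window by \<open>s\<close> replaces the part of
    \<open>\<zeta> t x\<close> over \<open>[0, s]\<close> by the part one period later, which is
    \<open>\<zeta> t (x + \<delta> x)\<close>.\<close>
  have "u (\<phi> s x) - R s (u x) = (1 / (2 * pi)) *\<^sub>R R s (integral {0..s} (\<lambda>t. \<zeta> t (x + \<delta> x) - \<zeta> t x))"
  proof -
    have "integral {0..s} (\<lambda>t. \<zeta> t (x + \<delta> x)) = tint (2 * pi + s) (\<lambda>t. \<zeta> t x) - tint (2 * pi) (\<lambda>t. \<zeta> t x)"
      using integral_shift[OF \<zeta>_cont[of UNIV x] s(1), of "2 * pi"] by (simp add: \<zeta>_add_2pi add.commute)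
    moreover have "integral {0..s} (\<lambda>t. \<zeta> t x) = tint s (\<lambda>t. \<zeta> t x)"
      using integral_shift[OF \<zeta>_cont[of UNIV x] s(1), of 0] by (simp add: tint_def[of 0])
    ultimately have "integral {0..s} (\<lambda>t. \<zeta> t (x + \<delta> x) - \<zeta> t x) =
        tint (2 * pi + s) (\<lambda>t. \<zeta> t x) - tint s (\<lambda>t. \<zeta> t x) - (2 * pi) *\<^sub>R u x"
      by (simp add: integral_diff integrable_continuous_real \<zeta>_cont tint_2pi)
    then show ?thesis by (simp add: u_\<phi> R_diff R_scale scaleR_diff_right)
  qed
  then have "norm (u (\<phi> s x) - R s (u x)) = 1 / (2 * pi) * norm (integral {0..s} (\<lambda>t. \<zeta> t (x + \<delta> x) - \<zeta> t x))" by simp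
  also have "\<dots> \<le> 1 / (2 * pi) * ((1 + \<kappa>) * norm (\<delta> x) * (s - 0))"
  proof (intro mult_left_mono integral_bound s(1))
    show "continuous_on {0..s} (\<lambda>t. \<zeta> t (x + \<delta> x) - \<zeta> t x)" by (intro continuous_on_diff \<zeta>_cont)
    fix t assume t: "t \<in> {0..s}"
    have "norm (\<zeta> t (x + \<delta> x) - \<zeta> t x) \<le> norm (\<delta> x) + norm ((\<zeta> t (x + \<delta> x) - \<zeta> t x) - \<delta> x)"
      by (metis norm_triangle_sub)
    then show "norm (\<zeta> t (x + \<delta> x) - \<zeta> t x) \<le> (1 + \<kappa>) * norm (\<delta> x)"
      using \<zeta>_lip[of t "x + \<delta> x" x] t s by (simp add: algebra_simps)
  qed simp
  also have "\<dots> \<le> 1 / (2 * pi) * ((1 + \<kappa>) * norm (\<delta> x) * (2 * pi))"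
    using s \<kappa>0 by (intro mult_left_mono) auto
  also have "\<dots> = (1 + \<kappa>) * norm (\<delta> x)" by simp
  finally have 2: "norm (u (\<phi> s x) - R s (u x)) \<le> (1 + \<kappa>) * norm (\<delta> x)" .
  have "norm (r (R s y) - \<phi> s x) \<le> (1 + 2 * \<kappa>) * norm (R s y - u (\<phi> s x))"
    using r_expand[of "R s y" "u (\<phi> s x)"] by simp
  also have "\<dots> \<le> (1 + 2 * \<kappa>) * ((1 + \<kappa>) * norm (\<delta> x))"
    using 2 \<kappa>0 uxy by (intro mult_left_mono) (auto simp: norm_minus_commute)
  also have "\<dots> \<le> (4 / 3) * ((3 / 2) * norm (\<delta> x))"
    using \<kappa> \<kappa>0 by (intro mult_mono) auto
  finally have 3: "norm (r (R s y) - \<phi> s x) \<le> 2 * norm (\<delta> x)" by simp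
  have "norm (\<delta> (r (R s y)) - R s (\<delta> x)) \<le> norm (\<delta> (r (R s y)) - \<delta> (\<phi> s x)) + norm (\<delta> (\<phi> s x) - R s (\<delta> x))"
    using norm_triangle_ineq[of "\<delta> (r (R s y)) - \<delta> (\<phi> s x)" "\<delta> (\<phi> s x) - R s (\<delta> x)"] by simp
  also have "\<dots> \<le> \<kappa> * (2 * norm (\<delta> x)) + \<kappa> * norm (\<delta> x)"
    by (intro add_mono 1 order_trans[OF \<delta>_lip] mult_left_mono 3 \<kappa>0)
  finally have 4: "norm (\<delta> (r (R s y)) - R s (\<delta> x)) \<le> 3 * \<kappa> * norm (\<delta> x)" by simp
  have "\<delta>' (R s y) - R s (\<delta>' y) = (1 / (2 * pi)) *\<^sub>R (\<delta> (r (R s y)) - R s (\<delta> x))"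
    by (simp add: \<delta>'_def x_def R_scale scaleR_diff_right)
  then have "norm (\<delta>' (R s y) - R s (\<delta>' y)) \<le> 1 / (2 * pi) * (3 * \<kappa> * norm (\<delta> x))"
    using 4 by (simp add: divide_right_mono)
  then show ?thesis by (simp add: \<delta>'_def x_def)
qed

lemma \<delta>'_R_le:
  assumes "0 \<le> s" "s \<le> 2 * pi"
  shows "norm (\<delta>' (R s y)) \<le> 2 * norm (\<delta>' y)"
proof -
  have "norm (\<delta>' (R s y)) \<le> norm (R s (\<delta>' y)) + norm (\<delta>' (R s y) - R s (\<delta>' y))"
    by (rule norm_triangle_sub)
  also have "\<dots> \<le> norm (\<delta>' y) + 3 * \<kappa> * norm (\<delta>' y)" using \<delta>'_R[OF assms, of y] by simp
  also have "\<dots> \<le> norm (\<delta>' y) + 1 * norm (\<delta>' y)"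
    using \<kappa> by (intro add_left_mono mult_right_mono) auto
  finally show ?thesis by simp
qed

end

section \<open>The averaged symplectic form and the action\<close>

lemma norm_le_inner:
  fixes z :: "'a::real_inner"
  assumes "\<And>w. z \<bullet> w \<le> B * norm w" "0 \<le> B"
  shows "norm z \<le> B"
proof (cases "z = 0")
  case False
  have "norm z * norm z \<le> B * norm z" using assms(1)[of z] by (simp add: power2_norm_eq_inner[symmetric] power2_eq_square)
  then show ?thesis using False by simp
qed (use assms in simp)

lemma curl_add: "Cinf UNIV b \<Longrightarrow> Cinf UNIV c \<Longrightarrow> curl (\<lambda>y. b y + c y) y v w = curl b y v w + curl c y v w"
  using ddI[OF has_derivative_add[OF Cinf_has_derivative Cinf_has_derivative], of UNIV b y UNIV c]
  by (simp add: curl_def inner_add_left)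

context near_hopf begin

text \<open>The pull-back under \<open>r\<close> of the one-form
  \<open>v \<mapsto> J x \<bullet> v / 2\<close>, a primitive of the standard form.\<close>

definition a :: "'a \<Rightarrow> 'a" where
  "a y = (1 / 2) *\<^sub>R (\<Sum>e\<in>Basis. (J (r y) \<bullet> dd r y e) *\<^sub>R e)"

lemma a_inner: "a y \<bullet> w = 1 / 2 * (J (r y) \<bullet> dd r y w)"
proof -
  have "(\<Sum>e\<in>Basis. (J (r y) \<bullet> dd r y e) *\<^sub>R e) \<bullet> w = (\<Sum>e\<in>Basis. (w \<bullet> e) * (J (r y) \<bullet> dd r y e))"
    unfolding inner_sum_left inner_scaleR_left by (simp add: inner_commute[of _ w] mult.commute)
  also have "\<dots> = J (r y) \<bullet> dd r y (\<Sum>e\<in>Basis. (w \<bullet> e) *\<^sub>R e)"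
    by (simp add: linear_sum[OF dd_r_linear] linear_scale[OF dd_r_linear] inner_sum_right)
  finally show ?thesis by (simp add: a_def euclidean_representation)
qed

lemma Cinf_a: "Cinf UNIV a"
  unfolding a_def[abs_def]
  by (rule Cinf_bounded_linear[OF bounded_linear_scaleR_right open_UNIV Cinf_sum[OF open_UNIV
      Cinf_scaleR[OF open_UNIV Cinf_inner[OF open_UNIV Cinf_J[OF open_UNIV Cinf_r] Cinf_dd[OF Cinf_r]] Cinf_const]]])

text \<open>The pull-back of the standard form under \<open>r\<close>; the standard form is \<open>J v \<bullet> w\<close>.\<close>

definition Om :: "'a \<Rightarrow> 'a \<Rightarrow>\<^sub>L 'a" where "Om = curlbl a"

lemma form2_Om: "form2 Om"
  unfolding Om_def by (rule form2_curlbl[OF Cinf_a])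

lemma Om_inner: "Om y v \<bullet> w = J (dd r y v) \<bullet> dd r y w"
proof -
  have d: "dd a y v \<bullet> w = 1 / 2 * (J (r y) \<bullet> dd (\<lambda>x. dd r x w) y v + J (dd r y v) \<bullet> dd r y w)" for v w
  proof -
    have "((\<lambda>y. a y \<bullet> w) has_derivative (\<lambda>v. dd a y v \<bullet> w)) (at y)"
      by (rule bounded_linear.has_derivative[OF bounded_linear_inner_left Cinf_has_derivative[OF Cinf_a UNIV_I]])
    moreover have "((\<lambda>y. 1 / 2 * (J (r y) \<bullet> dd r y w)) has_derivative
        (\<lambda>v. 1 / 2 * (J (r y) \<bullet> dd (\<lambda>x. dd r x w) y v + J (dd r y v) \<bullet> dd r y w))) (at y)"
      by (rule has_derivative_mult_right[OF has_derivative_inner[OF bounded_linear.has_derivative[OF J_bl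
          Cinf_has_derivative[OF Cinf_r UNIV_I]] Cinf_has_derivative[OF Cinf_dd[OF Cinf_r] UNIV_I]]])
    ultimately show ?thesis unfolding a_inner by (rule fun_cong[OF has_derivative_unique])
  qed
  have "Om y v \<bullet> w = curl a y v w" by (simp add: Om_def curlbl[OF Cinf_a])
  also have "\<dots> = 1 / 2 * (J (dd r y v) \<bullet> dd r y w - J (dd r y w) \<bullet> dd r y v)"
    unfolding curl_def d dd_commute[OF Cinf_r, of w y v] by (simp add: algebra_simps)
  also have "J (dd r y w) \<bullet> dd r y v = - (J (dd r y v) \<bullet> dd r y w)"
    by (metis J_skew inner_commute)
  finally show ?thesis by simp
qed

lemma Om_near: "norm (Om y v - J v) \<le> 5 * \<kappa> * norm v"
proof (rule norm_le_inner)
  fix w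
  define p where "p = dd r y v - v"
  define q where "q = dd r y w - w"
  have p: "norm p \<le> 2 * \<kappa> * norm v" and q: "norm q \<le> 2 * \<kappa> * norm w"
    unfolding p_def q_def by (rule dd_r)+
  have "dd r y v = v + p" "dd r y w = w + q" by (simp_all add: p_def q_def)
  then have "(Om y v - J v) \<bullet> w = J p \<bullet> w + J p \<bullet> q + J v \<bullet> q"
    by (simp add: inner_diff_left Om_inner J_add inner_add_left inner_add_right)
  also have "\<dots> \<le> norm p * norm w + norm p * norm q + norm v * norm q"
    by (metis add_mono norm_J norm_cauchy_schwarz)
  also have "\<dots> \<le> (2 * \<kappa> * norm v) * norm w + (2 * \<kappa> * norm v) * (2 * \<kappa> * norm w) + norm v * (2 * \<kappa> * norm w)"
    using \<kappa>0 by (intro add_mono mult_mono p q) auto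
  also have "\<dots> = (4 * \<kappa> + 4 * \<kappa> * \<kappa>) * (norm v * norm w)" by (simp add: algebra_simps)
  also have "\<dots> \<le> (5 * \<kappa>) * (norm v * norm w)"
  proof (rule mult_right_mono)
    have "\<kappa> * \<kappa> \<le> \<kappa> * (1 / 4)" using \<kappa> \<kappa>0 by (intro mult_left_mono) auto
    then show "4 * \<kappa> + 4 * \<kappa> * \<kappa> \<le> 5 * \<kappa>" by simp
  qed simp
  finally show "(Om y v - J v) \<bullet> w \<le> 5 * \<kappa> * norm v * norm w" by (simp add: mult.assoc)
qed (simp add: \<kappa>0)

section \<open>The Hamiltonian in the coordinates \<open>r\<close>\<close>

definition Hr :: "'a \<Rightarrow> real" where "Hr y = H (r y)"

lemma Cinf_Hr: "Cinf UNIV Hr"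
  unfolding Hr_def[abs_def] by (rule Cinf_compose_UNIV[OF open_UNIV H Cinf_r])

lemma dd_Hr: "dd Hr y w = - (J (X (r y)) \<bullet> dd r y w)"
proof -
  have "(Hr has_derivative (\<lambda>w. (r y - J (\<xi> (r y))) \<bullet> dd r y w)) (at y)"
    unfolding Hr_def[abs_def] by (rule has_derivative_compose[OF Cinf_has_derivative[OF Cinf_r UNIV_I] H_deriv])
  then show ?thesis by (simp add: ddI X_def J_add inner_diff_left inner_add_left)
qed

lemma dd_r_X: "dd r y (J y + \<delta>' y) = X (r y)"
  using dd_r_dd_u[of y "X (r y)"] by (simp add: dd_u_X \<delta>'_def)

definition \<eta> :: "'a \<Rightarrow> 'a" where "\<eta> y = Om y (\<delta>' y)"

lemma Cinf_\<eta>: "Cinf UNIV \<eta>"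
  unfolding \<eta>_def[abs_def] by (rule Cinf_blinfun_apply[OF open_UNIV form2_Cinf[OF form2_Om] Cinf_\<delta>'])

text \<open>The field \<open>J y + \<delta>' y\<close>, which \<open>r\<close> carries to
  \<open>X\<close>, is the Hamiltonian field of \<open>Hr\<close> for the form \<open>Om\<close>. So
  \<open>\<eta>\<close> measures how far the Hopf field is from being that field.\<close>

lemma Om_J: "Om y (J y) \<bullet> w = - dd Hr y w - \<eta> y \<bullet> w"
proof -
  have "Om y (J y + \<delta>' y) \<bullet> w = - dd Hr y w" by (simp only: Om_inner dd_r_X dd_Hr minus_minus)
  then show ?thesis by (simp add: \<eta>_def blinfun.add_right inner_add_left)
qed

lemma Om_bound: "norm (Om y v) \<le> 2 * norm v"
proof -
  have "norm (Om y v) \<le> norm (J v) + norm (Om y v - J v)" by (rule norm_triangle_sub)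
  also have "\<dots> \<le> norm v + 1 * norm v"
    using \<kappa> by (intro add_mono order_trans[OF Om_near] mult_right_mono) auto
  finally show ?thesis by simp
qed

lemma \<eta>_le: "norm (\<eta> y) \<le> 2 * norm (\<delta>' y)"
  unfolding \<eta>_def by (rule Om_bound)

text \<open>The weight \<open>k\<close> has slope \<open>1/2 pi\<close> and vanishes at the end of the period, so that integrating by parts against it
  produces the difference between a function and its average. In this way \<open>\<rho>\<close> is a primitive of the difference between \<open>Om\<close>
  and its average \<open>Ob\<close>, with \<open>\<rho> y \<bullet> J y = Hr y - Hb y\<close>.\<close>

definition k :: "real \<Rightarrow> real" where "k s = s / (2 * pi) - 1"

lemma k: "Cinf UNIV k" "(k has_vector_derivative 1 / (2 * pi)) (at s)" "k 0 = - 1" "k (2 * pi) = 0"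
  and k_bound: "0 \<le> s \<Longrightarrow> s \<le> 2 * pi \<Longrightarrow> \<bar>k s\<bar> \<le> 1"
proof -
  have "Cinf UNIV (\<lambda>s. s * (1 / (2 * pi)) - 1)"
    by (rule Cinf_diff[OF open_UNIV Cinf_mult[OF open_UNIV Cinf_ident[OF open_UNIV] Cinf_const] Cinf_const])
  then show "Cinf UNIV k" by (simp add: k_def[abs_def])
  show "(k has_vector_derivative 1 / (2 * pi)) (at s)"
    unfolding k_def[abs_def] has_real_derivative_iff_has_vector_derivative[symmetric]
    by (auto intro!: derivative_eq_intros)
  show "k 0 = - 1" "k (2 * pi) = 0" by (simp_all add: k_def)
  show "\<bar>k s\<bar> \<le> 1" if "0 \<le> s" "s \<le> 2 * pi"
    using that pi_gt_zero by (simp add: k_def abs_le_iff divide_simps)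
qed

lemma Cinf_R_pair: "Cinf UNIV (\<lambda>(y :: 'a, s). R s y)"
  using Cinf_R[OF open_UNIV Cinf_snd_UNIV[where 'a = 'a] Cinf_fst_UNIV] by (simp add: split_def)

lemma Cinf_comp_R:
  fixes f :: "'a \<Rightarrow> 'b::real_normed_vector"
  assumes "Cinf UNIV f" shows "Cinf UNIV (\<lambda>(y, s). f (R s y))"
  using Cinf_compose_UNIV[OF open_UNIV assms Cinf_R_pair] by (simp add: split_def)

lemma comp_R_cont:
  fixes f :: "'a \<Rightarrow> 'b::real_normed_vector"
  assumes "Cinf UNIV f" shows "continuous_on S (\<lambda>s. f (R s y))"
  by (rule Cinf_continuous_snd[OF Cinf_comp_R[OF assms]])

lemma dd_comp_R:
  assumes "Cinf UNIV f" shows "dd (\<lambda>y. f (R s y)) y v = dd f (R s y) (R s v)"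
  using ddI[OF has_derivative_compose[OF bounded_linear_imp_has_derivative[OF R_bl] Cinf_has_derivative[OF assms UNIV_I]]]
  by (rule fun_cong)

definition \<rho> :: "'a \<Rightarrow> 'a" where
  "\<rho> y = - integral {0..2 * pi} (\<lambda>s. k s *\<^sub>R R (- s) (\<eta> (R s y)))"

definition Jb :: "'a \<Rightarrow>\<^sub>L 'a" where "Jb = mkbl J"

lemma Jb [simp]: "blinfun_apply Jb x = J x" by (simp add: Jb_def mkbl_apply[OF J_linear])

text \<open>Cartan's primitive for the difference between \<open>Om\<close> and its average, taken
  along the rotations \<open>Rb s\<close> with weight \<open>k\<close>.\<close>

definition b0 :: "'a \<Rightarrow> 'a" where
  "b0 y = integral {0..2 * pi} (\<lambda>s. k s *\<^sub>R Rb (- s) (Om (Rb s y) ((Jb o\<^sub>L Rb s) y)))"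

lemma b0: "Cinf UNIV b0"
    "curl b0 y v w + avg (\<lambda>s. Om (R s y) (R s v) \<bullet> R s w) = Om y v \<bullet> w"
proof -
  have *: "Cinf UNIV (\<lambda>s. Jb o\<^sub>L Rb s)"
    by (rule Cinf_bounded_linear[OF bounded_bilinear.bounded_linear_right[OF bounded_bilinear_blinfun_compose] open_UNIV Cinf_Rb])
  have **: "(Rb has_vector_derivative (Jb o\<^sub>L Rb s)) (at s)" for s using Rb_deriv by (simp add: Jb_def)
  note c = cartan_linear[OF form2_Om Cinf_Rb * Cinf_Rb_minus ** _ k(1,2) continuous_on_const, of 0 "2 * pi"]
  show "Cinf UNIV b0" unfolding b0_def[abs_def] by (rule c(1)) (simp_all add: R_adj)
  have "curl b0 y v w + integral {0..2 * pi} (\<lambda>s. 1 / (2 * pi) * (Om (R s y) (R s v) \<bullet> R s w)) = Om y v \<bullet> w"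
    using c(2)[of y v w] by (simp add: R_adj k b0_def[abs_def])
  then show "curl b0 y v w + avg (\<lambda>s. Om (R s y) (R s v) \<bullet> R s w) = Om y v \<bullet> w"
    by (simp add: avg_def)
qed

definition hh :: "'a \<Rightarrow> real" where "hh y = integral {0..2 * pi} (\<lambda>s. k s * Hr (R s y))"

lemma Cinf_k_snd: "Cinf UNIV (\<lambda>z :: 'a \<times> real. k (snd z))"
  by (rule Cinf_compose_UNIV[OF open_UNIV k(1) Cinf_snd_UNIV])

lemma hh: "Cinf UNIV hh" "dd hh y w = integral {0..2 * pi} (\<lambda>s. k s * dd Hr (R s y) (R s w))"
proof -
  have F: "Cinf UNIV (\<lambda>(y, s). k s * Hr (R s y))"
    using Cinf_mult[OF open_UNIV Cinf_k_snd Cinf_comp_R[OF Cinf_Hr]] by (simp add: split_def)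
  show "Cinf UNIV hh" unfolding hh_def[abs_def] by (rule Cinf_integral[OF F])
  have "dd (\<lambda>y. k s * Hr (R s y)) y w = k s * dd Hr (R s y) (R s w)" for s
  proof -
    have "((\<lambda>y. k s * Hr (R s y)) has_derivative (\<lambda>w. k s * dd Hr (R s y) (R s w))) (at y)"
      by (rule has_derivative_mult_right[OF has_derivative_compose[OF bounded_linear_imp_has_derivative[OF R_bl]
          Cinf_has_derivative[OF Cinf_Hr UNIV_I]]])
    from fun_cong[OF ddI[OF this]] show ?thesis .
  qed
  moreover have "Ck (Suc 0) UNIV (\<lambda>(y, s). k s * Hr (R s y))" using F unfolding Cinf_def by blast
  ultimately show "dd hh y w = integral {0..2 * pi} (\<lambda>s. k s * dd Hr (R s y) (R s w))"
    using ddI[OF integral_param_has_derivative[of "\<lambda>y s. k s * Hr (R s y)"]] by (simp add: hh_def[abs_def] dd_fst[OF F])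
qed

lemma Cinf_\<rho>: "Cinf UNIV \<rho>"
proof -
  have 1: "Cinf UNIV (\<lambda>z :: 'a \<times> real. R (- snd z) (case z of (y, s) \<Rightarrow> \<eta> (R s y)))"
    by (rule Cinf_R[OF open_UNIV Cinf_minus[OF open_UNIV Cinf_snd_UNIV] Cinf_comp_R[OF Cinf_\<eta>]])
  have "Cinf UNIV (\<lambda>(y, s). k s *\<^sub>R R (- s) (\<eta> (R s y)))"
    using Cinf_scaleR[OF open_UNIV Cinf_k_snd 1] by (simp add: split_def)
  from Cinf_minus[OF open_UNIV Cinf_integral[OF this]] show ?thesis unfolding \<rho>_def[abs_def] .
qed

lemma R_\<eta>_cont: "continuous_on S (\<lambda>s. R (- s) (\<eta> (R s y)))"
proof -
  have "Cinf UNIV (\<lambda>z :: 'a \<times> real. R (- snd z) (case z of (y, s) \<Rightarrow> \<eta> (R s y)))"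
    by (rule Cinf_R[OF open_UNIV Cinf_minus[OF open_UNIV Cinf_snd_UNIV] Cinf_comp_R[OF Cinf_\<eta>]])
  then have "Cinf UNIV (\<lambda>(y, s). R (- s) (\<eta> (R s y)))" by (simp add: split_def)
  then show ?thesis by (rule Cinf_continuous_snd)
qed

lemma k_cont: "continuous_on S k"
  using Cinf_continuous[OF k(1)] by (rule continuous_on_subset) simp

lemma integral_inner:
  fixes f :: "real \<Rightarrow> 'a"
  assumes "continuous_on {c..d} f"
  shows "integral {c..d} f \<bullet> w = integral {c..d} (\<lambda>s. f s \<bullet> w)"
  using integral_linear[OF integrable_continuous_real[OF assms] bounded_linear_inner_left[of w]] by (simp add: o_def)

lemma \<rho>_inner: "\<rho> y \<bullet> w = - integral {0..2 * pi} (\<lambda>s. k s * (\<eta> (R s y) \<bullet> R s w))"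
  unfolding \<rho>_def inner_minus_left
  by (subst integral_inner) (auto intro!: continuous_on_scaleR k_cont R_\<eta>_cont simp: R_adj)

text \<open>In \<open>b0\<close> the contraction of \<open>Om\<close> with the Hopf field splits
  into minus the differential of \<open>Hr\<close> and minus \<open>\<eta>\<close>. The first part
  integrates to \<open>- grad hh\<close>, which has no curl and can be removed; what remains is
  \<open>\<rho>\<close>. The gain is that \<open>\<rho>\<close> is bounded by
  \<open>\<delta>'\<close>, while \<open>b0\<close> need not be small.\<close>

lemma \<rho>_eq: "\<rho> y = b0 y + grad hh y"
proof (rule vector_eq_rdot[THEN iffD1], rule allI)
  fix w
  have cO: "continuous_on {0..2 * pi} (\<lambda>s. Rb (- s) (Om (Rb s y) ((Jb o\<^sub>L Rb s) y)))"
    by (simp only: Rb Jb blinfun_apply_blinfun_compose)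
      (intro continuous_on_subset[OF bounded_bilinear.continuous_on[OF bounded_bilinear_blinfun_apply
          Cinf_continuous[OF Cinf_Rb_minus], of "\<lambda>s. Om (R s y) (J (R s y))", simplified]]
        bounded_bilinear.continuous_on[OF bounded_bilinear_blinfun_apply]
        comp_R_cont[OF form2_Cinf[OF form2_Om]] comp_R_cont[OF Cinf_linear[OF J_bl open_UNIV]] subset_UNIV)
  have c1: "continuous_on S (\<lambda>s. dd Hr (R s y) (R s w))" for S
  proof -
    have "Cinf UNIV (\<lambda>s. dd Hr (R s y) (R s w))"
      by (rule Cinf_dd_compose[OF open_UNIV open_UNIV Cinf_Hr Cinf_R[OF open_UNIV Cinf_ident[OF open_UNIV] Cinf_const] _
            Cinf_R[OF open_UNIV Cinf_ident[OF open_UNIV] Cinf_const]]) simp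
    then show ?thesis using Cinf_continuous continuous_on_subset by blast
  qed
  have c2: "continuous_on S (\<lambda>s. \<eta> (R s y) \<bullet> R s w)" for S
    using continuous_on_inner[OF comp_R_cont[OF Cinf_\<eta>] comp_R_cont[OF Cinf_ident[OF open_UNIV]]] .
  have "b0 y \<bullet> w = integral {0..2 * pi} (\<lambda>s. k s * (Om (R s y) (J (R s y)) \<bullet> R s w))"
    unfolding b0_def by (subst integral_inner) (intro continuous_on_scaleR k_cont cO, simp add: R_adj)
  also have "\<dots> = integral {0..2 * pi} (\<lambda>s. - (k s * (\<eta> (R s y) \<bullet> R s w)) - k s * dd Hr (R s y) (R s w))"
    unfolding Om_J by (rule arg_cong[of _ _ "integral {0..2 * pi}"]) (auto simp: algebra_simps)
  also have "\<dots> = \<rho> y \<bullet> w - dd hh y w"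
    by (subst integral_diff)
      (auto intro!: integrable_continuous_real continuous_intros k_cont c1 c2 simp: \<rho>_inner hh(2))
  finally show "\<rho> y \<bullet> w = (b0 y + grad hh y) \<bullet> w"
    by (simp add: inner_add_left grad[OF Cinf_differentiable[OF hh(1) UNIV_I]])
qed

lemma curl_\<rho>: "curl \<rho> y v w = Om y v \<bullet> w - avg (\<lambda>s. Om (R s y) (R s v) \<bullet> R s w)"
proof -
  have "\<rho> = (\<lambda>y. b0 y + grad hh y)" using \<rho>_eq by blast
  then show ?thesis
    using curl_add[OF b0(1) Cinf_grad[OF hh(1)], of y v w] curl_grad[OF hh(1), of y v w] b0(2)[of y v w] by simp
qed

text \<open>Subtracting an exact form makes closedness immediate; \<open>Ob_inner\<close> identifies
  the result with the average of \<open>Om\<close> over the rotations.\<close>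

definition Ob :: "'a \<Rightarrow> 'a \<Rightarrow>\<^sub>L 'a" where "Ob y = Om y - curlbl \<rho> y"

lemma form2_Ob: "form2 Ob"
  unfolding Ob_def[abs_def] by (rule form2_diff[OF form2_Om form2_curlbl[OF Cinf_\<rho>]])

lemma Ob_inner: "Ob y v \<bullet> w = avg (\<lambda>s. Om (R s y) (R s v) \<bullet> R s w)"
  by (simp add: Ob_def blinfun.diff_left inner_diff_left curlbl[OF Cinf_\<rho>] curl_\<rho>)

lemma Om_R_cont: "continuous_on S (\<lambda>s. Om (R s y) (R s v) \<bullet> R s w)"
  by (intro continuous_on_inner bounded_bilinear.continuous_on[OF bounded_bilinear_blinfun_apply]
      comp_R_cont[OF form2_Cinf[OF form2_Om]] comp_R_cont[OF Cinf_ident[OF open_UNIV]])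

lemma Ob_near: "norm (Ob y v - J v) \<le> 5 * \<kappa> * norm v"
proof (rule norm_le_inner)
  fix w
  have "(Ob y v - J v) \<bullet> w = avg (\<lambda>s. Om (R s y) (R s v) \<bullet> R s w - J v \<bullet> w)"
    by (simp add: inner_diff_left Ob_inner avg_diff Om_R_cont)
  also have "\<dots> \<le> norm (avg (\<lambda>s. Om (R s y) (R s v) \<bullet> R s w - J v \<bullet> w))" by simp
  also have "\<dots> \<le> 5 * \<kappa> * norm v * norm w"
  proof (rule avg_norm)
    show "continuous_on UNIV (\<lambda>s. Om (R s y) (R s v) \<bullet> R s w - J v \<bullet> w)"
      by (intro continuous_on_diff Om_R_cont continuous_on_const)
    fix s
    have "Om (R s y) (R s v) \<bullet> R s w - J v \<bullet> w = (Om (R s y) (R s v) - J (R s v)) \<bullet> R s w"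
      by (simp add: inner_diff_left R_J[symmetric] R_inner)
    also have "norm \<dots> \<le> norm (Om (R s y) (R s v) - J (R s v)) * norm (R s w)"
      unfolding real_norm_def by (rule Cauchy_Schwarz_ineq2)
    also have "\<dots> \<le> (5 * \<kappa> * norm v) * norm w" using Om_near[of "R s y" "R s v"] by (simp add: mult_right_mono)
    finally show "norm (Om (R s y) (R s v) \<bullet> R s w - J v \<bullet> w) \<le> 5 * \<kappa> * norm v * norm w" by simp
  qed
  finally show "(Ob y v - J v) \<bullet> w \<le> 5 * \<kappa> * norm v * norm w" .
qed (simp add: \<kappa>0)

lemma \<rho>_le: "norm (\<rho> y) \<le> 32 * norm (\<delta>' y)"
proof -
  have "norm (integral {0..2 * pi} (\<lambda>s. k s *\<^sub>R R (- s) (\<eta> (R s y)))) \<le> (4 * norm (\<delta>' y)) * (2 * pi - 0)"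
  proof (rule integral_bound)
    show "continuous_on {0..2 * pi} (\<lambda>s. k s *\<^sub>R R (- s) (\<eta> (R s y)))"
      by (intro continuous_on_scaleR k_cont R_\<eta>_cont)
    fix s assume s: "s \<in> {0..2 * pi}"
    have "norm (k s *\<^sub>R R (- s) (\<eta> (R s y))) \<le> 1 * (2 * (2 * norm (\<delta>' y)))"
      unfolding norm_scaleR norm_R
      by (intro mult_mono k_bound order_trans[OF \<eta>_le] mult_left_mono \<delta>'_R_le) (use s in auto)
    then show "norm (k s *\<^sub>R R (- s) (\<eta> (R s y))) \<le> 4 * norm (\<delta>' y)" by simp
  qed simp
  also have "\<dots> \<le> (4 * norm (\<delta>' y)) * 8" using pi_less_4 by (intro mult_left_mono) auto
  finally show ?thesis by (simp add: \<rho>_def)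
qed

definition Hb :: "'a \<Rightarrow> real" where "Hb y = avg (\<lambda>s. Hr (R s y))"

lemma \<rho>_J: "\<rho> y \<bullet> J y = Hr y - Hb y"
proof -
  have e: "\<eta> z \<bullet> J z = - dd Hr z (J z)" for z
    using Om_J[of z "J z"] form2_skew[OF form2_Om, of z "J z" "J z"] by simp
  let ?g = "\<lambda>s. Hr (R s y)"
  have g: "(?g has_vector_derivative dd Hr (R s y) (J (R s y))) (at s)" for s
    by (rule Cinf_along_curve[OF Cinf_Hr R_deriv])
  have "\<rho> y \<bullet> J y = integral {0..2 * pi} (\<lambda>s. k s * dd Hr (R s y) (J (R s y)))"
    by (simp add: \<rho>_inner R_J e)
  moreover have "((\<lambda>s. k s * dd Hr (R s y) (J (R s y)) + 1 / (2 * pi) * ?g s) has_integral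
      (k (2 * pi) * ?g (2 * pi) - k 0 * ?g 0)) {0..2 * pi}"
    by (rule fundamental_theorem_of_calculus[OF _ has_vector_derivative_at_within[OF has_vector_derivative_mult[OF k(2) g]]]) simp
  then have "integral {0..2 * pi} (\<lambda>s. k s * dd Hr (R s y) (J (R s y)) + 1 / (2 * pi) * ?g s) = Hr y"
    by (simp add: k integral_unique)
  moreover have "integral {0..2 * pi} (\<lambda>s. k s * dd Hr (R s y) (J (R s y)) + 1 / (2 * pi) * ?g s) =
     integral {0..2 * pi} (\<lambda>s. k s * dd Hr (R s y) (J (R s y))) + integral {0..2 * pi} (\<lambda>s. 1 / (2 * pi) * ?g s)"
  proof (rule integral_add)
    have "Cinf UNIV (\<lambda>s. dd Hr (R s y) (J (R s y)))"
      by (rule Cinf_dd_compose[OF open_UNIV open_UNIV Cinf_Hr Cinf_R[OF open_UNIV Cinf_ident[OF open_UNIV] Cinf_const] _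
            Cinf_J[OF open_UNIV Cinf_R[OF open_UNIV Cinf_ident[OF open_UNIV] Cinf_const]]]) simp
    then have "continuous_on {0..2 * pi} (\<lambda>s. dd Hr (R s y) (J (R s y)))"
      using Cinf_continuous continuous_on_subset by blast
    then show "(\<lambda>s. k s * dd Hr (R s y) (J (R s y))) integrable_on {0..2 * pi}"
      by (intro integrable_continuous_real continuous_on_mult k_cont)
    show "(\<lambda>s. 1 / (2 * pi) * ?g s) integrable_on {0..2 * pi}"
      by (intro integrable_continuous_real continuous_on_mult continuous_on_const comp_R_cont[OF Cinf_Hr])
  qed
  ultimately show ?thesis by (simp add: Hb_def avg_def)
qed

text \<open>The action of the loop \<open>s \<mapsto> r (R s y)\<close>, divided by its period.\<close>

definition Sb :: "'a \<Rightarrow> real" where "Sb y = avg (\<lambda>s. a (R s y) \<bullet> J (R s y))"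

lemma Cinf_aJ: "Cinf UNIV (\<lambda>y. a y \<bullet> J y)"
  by (rule Cinf_inner[OF open_UNIV Cinf_a Cinf_linear[OF J_bl open_UNIV]])

lemma Cinf_Sb: "Cinf UNIV Sb"
  unfolding Sb_def[abs_def] by (rule Cinf_avg[OF Cinf_comp_R[OF Cinf_aJ]])

lemma Cinf_Hb: "Cinf UNIV Hb"
  unfolding Hb_def[abs_def] by (rule Cinf_avg[OF Cinf_comp_R[OF Cinf_Hr]])

lemma dd_Hb: "dd Hb y v = avg (\<lambda>s. dd Hr (R s y) (R s v))"
  unfolding Hb_def[abs_def] ddI[OF avg_has_derivative[OF Cinf_comp_R[OF Cinf_Hr]]] dd_comp_R[OF Cinf_Hr] ..

text \<open>First variation of the action: \<open>q'\<close> is the derivative of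
  \<open>a (R s y) \<bullet> R s v\<close> around a closed circle and averages to 0. Consequently
  \<open>Sb\<close> generates the Hopf flow exactly with respect to \<open>Ob\<close>.\<close>

lemma dd_Sb: "dd Sb y v = - (Ob y (J y) \<bullet> v)"
proof -
  have daJ: "dd (\<lambda>y. a y \<bullet> J y) z v = dd a z v \<bullet> J z + a z \<bullet> J v" for z v
    using fun_cong[OF ddI[OF has_derivative_inner[OF Cinf_has_derivative[OF Cinf_a UNIV_I]
        bounded_linear_imp_has_derivative[OF J_bl]]], of z v] by (simp add: add.commute)
  define q' where "q' s = dd a (R s y) (J (R s y)) \<bullet> R s v + a (R s y) \<bullet> J (R s v)" for s
  have q: "((\<lambda>s. a (R s y) \<bullet> R s v) has_vector_derivative q' s) (at s)" for s
  proof -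
    have "((\<lambda>s. a (R s y)) has_vector_derivative dd a (R s y) (J (R s y))) (at s)"
      by (rule Cinf_along_curve[OF Cinf_a R_deriv])
    from bounded_bilinear.has_vector_derivative[OF bounded_bilinear_inner this R_deriv] show ?thesis
      by (simp add: q'_def add.commute)
  qed
  have "(q' has_integral (a (R (2 * pi) y) \<bullet> R (2 * pi) v - a (R 0 y) \<bullet> R 0 v)) {0..2 * pi}"
    by (rule fundamental_theorem_of_calculus[OF _ has_vector_derivative_at_within[OF q]]) simp
  then have q0: "avg q' = 0" by (simp add: avg_def integral_unique)
  have cR: "Cinf UNIV (\<lambda>s. R s z)" for z by (rule Cinf_R[OF open_UNIV Cinf_ident[OF open_UNIV] Cinf_const])
  have cd: "Cinf UNIV (\<lambda>s. dd a (R s y) (h s))" if "Cinf UNIV h" for h :: "real \<Rightarrow> 'a"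
    by (rule Cinf_dd_compose[OF open_UNIV open_UNIV Cinf_a cR _ that]) simp
  have "Cinf UNIV q'"
    unfolding q'_def[abs_def]
    by (rule Cinf_add[OF open_UNIV Cinf_inner[OF open_UNIV cd[OF Cinf_J[OF open_UNIV cR]] cR]
        Cinf_inner[OF open_UNIV Cinf_compose_UNIV[OF open_UNIV Cinf_a cR] Cinf_J[OF open_UNIV cR]]])
  then have cq: "continuous_on UNIV q'" by (rule Cinf_continuous)
  have "dd a (R s y) (R s v) \<bullet> J (R s y) + a (R s y) \<bullet> J (R s v) = Om (R s y) (R s v) \<bullet> R s (J y) + q' s" for s
    using curlbl[OF Cinf_a, of "R s y" "R s v" "J (R s y)"] by (simp add: Om_def curl_def q'_def R_J)
  then have "dd Sb y v = avg (\<lambda>s. Om (R s y) (R s v) \<bullet> R s (J y) + q' s)"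
    unfolding Sb_def[abs_def] ddI[OF avg_has_derivative[OF Cinf_comp_R[OF Cinf_aJ]]] dd_comp_R[OF Cinf_aJ] daJ by simp
  also have "\<dots> = Ob y v \<bullet> J y" by (simp add: avg_add Om_R_cont cq q0 Ob_inner)
  also have "\<dots> = - (Ob y (J y) \<bullet> v)" by (rule form2_skew[OF form2_Ob])
  finally show ?thesis .
qed

definition \<Gamma> :: "'a \<Rightarrow> real" where "\<Gamma> y = Hb y - Sb y"

definition \<eta>b :: "'a \<Rightarrow> 'a" where "\<eta>b y = avg (\<lambda>s. R (- s) (\<eta> (R s y)))"

text \<open>The differentials of \<open>Hb\<close> and \<open>Sb\<close> both contain the averaged
  contraction \<open>- Ob y (J y)\<close>; it cancels in the difference and only the averaged
  \<open>\<eta>\<close> survives.\<close>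

lemma \<Gamma>_has_derivative: "(\<Gamma> has_derivative (\<lambda>v. - (\<eta>b y \<bullet> v))) (at y)"
proof -
  have c2: "continuous_on S (\<lambda>s. \<eta> (R s y) \<bullet> R s w)" for S w
    using continuous_on_inner[OF comp_R_cont[OF Cinf_\<eta>] comp_R_cont[OF Cinf_ident[OF open_UNIV]]] .
  have "dd Hb y v - dd Sb y v = - (\<eta>b y \<bullet> v)" for v
  proof -
    have "dd Hb y v = avg (\<lambda>s. - (Om (R s y) (R s (J y)) \<bullet> R s v) - \<eta> (R s y) \<bullet> R s v)"
      unfolding dd_Hb by (simp add: R_J Om_J)
    also have "\<dots> = - avg (\<lambda>s. Om (R s y) (R s (J y)) \<bullet> R s v) - avg (\<lambda>s. \<eta> (R s y) \<bullet> R s v)"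
      by (subst avg_diff) (auto intro!: continuous_on_minus Om_R_cont c2 simp: avg_def)
    also have "avg (\<lambda>s. \<eta> (R s y) \<bullet> R s v) = \<eta>b y \<bullet> v"
      unfolding \<eta>b_def using avg_linear[OF bounded_linear_inner_left[of v] R_\<eta>_cont[of UNIV y]] by (simp add: R_adj)
    finally show ?thesis by (simp add: dd_Sb Ob_inner)
  qed
  then show ?thesis
    unfolding \<Gamma>_def[abs_def]
    using has_derivative_diff[OF Cinf_has_derivative[OF Cinf_Hb UNIV_I] Cinf_has_derivative[OF Cinf_Sb UNIV_I], of y] by simp
qed

text \<open>Two relative errors add up: \<open>Om\<close> differs from \<open>J\<close> by
  \<open>5 * \<kappa>\<close> on a vector of length at most \<open>2 * norm (\<delta>' y)\<close>,
  and \<open>\<delta>'\<close> fails to be equivariant by \<open>3 * \<kappa>\<close>.\<close>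

lemma \<eta>b_near: "norm (\<eta>b y - J (\<delta>' y)) \<le> 13 * \<kappa> * norm (\<delta>' y)"
proof -
  have "\<eta>b y - J (\<delta>' y) = avg (\<lambda>s. R (- s) (\<eta> (R s y)) - J (\<delta>' y))"
    by (simp add: \<eta>b_def avg_diff R_\<eta>_cont)
  also have "norm \<dots> \<le> 13 * \<kappa> * norm (\<delta>' y)"
  proof (rule avg_norm)
    show "continuous_on UNIV (\<lambda>s. R (- s) (\<eta> (R s y)) - J (\<delta>' y))"
      by (intro continuous_on_diff R_\<eta>_cont continuous_on_const)
    fix s assume s: "0 \<le> s" "s \<le> 2 * pi"
    have "norm (R (- s) (\<eta> (R s y)) - J (\<delta>' y)) = norm (R s (R (- s) (\<eta> (R s y)) - J (\<delta>' y)))" by simp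
    also have "\<dots> = norm ((\<eta> (R s y) - J (\<delta>' (R s y))) + J (\<delta>' (R s y) - R s (\<delta>' y)))"
      by (simp add: R_diff R_J J_diff)
    also have "\<dots> \<le> norm (\<eta> (R s y) - J (\<delta>' (R s y))) + norm (\<delta>' (R s y) - R s (\<delta>' y))"
      by (metis norm_J norm_triangle_ineq)
    also have "\<dots> \<le> 5 * \<kappa> * norm (\<delta>' (R s y)) + 3 * \<kappa> * norm (\<delta>' y)"
      unfolding \<eta>_def by (intro add_mono Om_near \<delta>'_R s)
    also have "\<dots> \<le> 5 * \<kappa> * (2 * norm (\<delta>' y)) + 3 * \<kappa> * norm (\<delta>' y)"
      using \<kappa>0 by (intro add_right_mono mult_left_mono \<delta>'_R_le s) auto
    finally show "norm (R (- s) (\<eta> (R s y)) - J (\<delta>' y)) \<le> 13 * \<kappa> * norm (\<delta>' y)" by simp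
  qed
  finally show ?thesis .
qed

end

section \<open>Homogeneity and the isotopy to the averaged form\<close>

lemma displacement_bound:
  fixes m :: "real \<Rightarrow> 'a::real_normed_vector"
  assumes t: "0 \<le> t" and m: "\<And>s. 0 \<le> s \<Longrightarrow> s \<le> t \<Longrightarrow> (m has_vector_derivative m' s) (at s)"
    and B: "\<And>s. 0 \<le> s \<Longrightarrow> s \<le> t \<Longrightarrow> norm (m' s) \<le> B"
  shows "norm (m t - m 0) \<le> B * t"
proof -
  have "norm (m t - m 0) \<le> B * norm (t - 0)"
  proof (rule differentiable_bound[where S = "{0..t}" and f' = "\<lambda>r h. h *\<^sub>R m' r"])
    fix r assume r: "r \<in> {0..t}"
    show "(m has_derivative (\<lambda>h. h *\<^sub>R m' r)) (at r within {0..t})"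
      by (rule has_derivative_at_withinI[OF m[unfolded has_vector_derivative_def]]) (use r in auto)
    show "onorm (\<lambda>h. h *\<^sub>R m' r) \<le> B"
    proof (rule onorm_le)
      fix h :: real
      show "norm (h *\<^sub>R m' r) \<le> B * norm h"
        using mult_left_mono[OF B[of r], of "norm h"] r unfolding norm_scaleR real_norm_def
        by (simp add: mult.commute)
    qed
  qed (use t in auto)
  then show ?thesis using t by simp
qed

lemma gronwall_displacement:
  fixes m :: "real \<Rightarrow> 'a::real_inner"
  assumes t: "0 \<le> t" and m: "\<And>s. 0 \<le> s \<Longrightarrow> s \<le> t \<Longrightarrow> (m has_vector_derivative m' s) (at s)"
    and B: "\<And>s. 0 \<le> s \<Longrightarrow> s \<le> t \<Longrightarrow> norm (m' s) \<le> L * norm (m s)" and L: "0 \<le> L" "L * t \<le> 1 / 2"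
  shows "norm (m t - m 0) \<le> 2 * L * t * norm (m 0)" "norm (m t) \<le> 2 * norm (m 0)"
proof -
  have e: "exp (L * s) \<le> 2" if "0 \<le> s" "s \<le> t" for s
  proof -
    have "exp (L * s) \<le> exp (1 / 2)" using order_trans[OF mult_left_mono[OF that(2) L(1)] L(2)] by simp
    also have "\<dots> \<le> 1 + 1 / 2 + (1 / 2)\<^sup>2" by (rule exp_bound) auto
    also have "\<dots> \<le> 2" by (simp add: power2_eq_square)
    finally show ?thesis .
  qed
  have n: "norm (m s) \<le> 2 * norm (m 0)" if s: "0 \<le> s" "s \<le> t" for s
  proof -
    have "norm (m s) \<le> exp (L * s) * norm (m 0)"
      by (rule gronwall[OF s(1) m B]) (use s in auto)
    also have "\<dots> \<le> 2 * norm (m 0)" by (rule mult_right_mono[OF e[OF s] norm_ge_zero])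
    finally show ?thesis .
  qed
  show "norm (m t) \<le> 2 * norm (m 0)" by (rule n[OF t order_refl])
  have "norm (m t - m 0) \<le> (L * (2 * norm (m 0))) * t"
    by (rule displacement_bound[OF t m order_trans[OF B mult_left_mono[OF n L(1)]]]) auto
  then show "norm (m t - m 0) \<le> 2 * L * t * norm (m 0)" by (simp add: algebra_simps)
qed

context cplx begin

text \<open>Along the isotopy of Moser's method, the interpolation of two Hamiltonians that generate the Hopf flow (up to \<open>\<eta>\<close>) for the
  two forms changes only by what their difference has in excess of \<open>b y \<bullet> J y\<close>.\<close>

lemma moser_energy:
  fixes \<Theta>0 \<Theta>1 :: "'a \<Rightarrow> 'a \<Rightarrow>\<^sub>L 'a" and b \<eta> :: "'a \<Rightarrow> 'a" and F0 F1 :: "'a \<Rightarrow> real"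
  assumes \<Theta>0: "form2 \<Theta>0" and \<Theta>1: "form2 \<Theta>1" and b: "Cinf UNIV b"
    and curl: "\<And>y v w. curl b y v w = \<Theta>1 y v \<bullet> w - \<Theta>0 y v \<bullet> w"
    and near: "\<And>y v. norm (\<Theta>0 y v - J v) \<le> norm v / 6" "\<And>y v. norm (\<Theta>1 y v - J v) \<le> norm v / 6"
    and growth: "\<And>y. norm (b y) \<le> C * (1 + norm y)"
    and F: "Cinf UNIV F0" "Cinf UNIV F1"
    and dF: "\<And>y v. dd F0 y v = - (\<Theta>0 y (J y) \<bullet> v)" "\<And>y v. dd F1 y v = - (\<Theta>1 y (J y) \<bullet> v) - \<eta> y \<bullet> v"
  obtains m m' :: "real \<Rightarrow> 'a \<Rightarrow> 'a" and w' :: "'a \<Rightarrow> 'a" and e :: "real \<Rightarrow> 'a \<Rightarrow> real" where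
    "Cinf UNIV (m (pi/2))" "Cinf UNIV w'" "\<And>y. w' (m (pi/2) y) = y" "\<And>y. m (pi/2) (w' y) = y" "\<And>y. m 0 y = y"
    "\<And>\<tau> y. ((\<lambda>\<tau>. m \<tau> y) has_vector_derivative m' \<tau> y) (at \<tau>)"
    "\<And>\<tau> y. norm (m' \<tau> y) \<le> 2 * norm (b (m \<tau> y))"
    "\<And>y v w. \<Theta>1 (m (pi/2) y) (dd (m (pi/2)) y v) \<bullet> dd (m (pi/2)) y w = \<Theta>0 y v \<bullet> w"
    "\<And>\<tau> y. ((\<lambda>\<tau>. F0 (m \<tau> y) + sin \<tau> * (F1 (m \<tau> y) - F0 (m \<tau> y))) has_vector_derivative
       cos \<tau> * (F1 (m \<tau> y) - F0 (m \<tau> y) - b (m \<tau> y) \<bullet> J (m \<tau> y) + e \<tau> y)) (at \<tau>)"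
    "\<And>\<tau> y. \<bar>e \<tau> y\<bar> \<le> 2 * norm (\<eta> (m \<tau> y)) * norm (b (m \<tau> y))"
proof -
  obtain m w' :: "real \<Rightarrow> 'a \<Rightarrow> 'a" where m: "Cinf UNIV (m (pi/2))" "Cinf UNIV (w' (pi/2))"
    "\<And>y. w' (pi/2) (m (pi/2) y) = y" "\<And>y. m (pi/2) (w' (pi/2) y) = y" "\<And>y. m 0 y = y"
    and d': "\<And>\<tau> y. ((\<lambda>\<tau>. m \<tau> y) has_vector_derivative
      - (cos \<tau> *\<^sub>R blinv (\<Theta>0 (m \<tau> y) + sin \<tau> *\<^sub>R (\<Theta>1 (m \<tau> y) - \<Theta>0 (m \<tau> y))) (b (m \<tau> y)))) (at \<tau>)"
    and p: "\<And>y v w. \<Theta>1 (m (pi/2) y) (dd (m (pi/2)) y v) \<bullet> dd (m (pi/2)) y w = \<Theta>0 y v \<bullet> w"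
    and inv': "\<And>s y v. \<bar>s\<bar> \<le> 1 \<Longrightarrow> norm v \<le> 2 * norm ((\<Theta>0 y + s *\<^sub>R (\<Theta>1 y - \<Theta>0 y)) v)"
    by (rule moser[OF \<Theta>0 \<Theta>1 b curl norm_J near growth]) (rule that)
  define \<Omega> where "\<Omega> = (\<lambda>s y. \<Theta>0 y + s *\<^sub>R (\<Theta>1 y - \<Theta>0 y))"
  have \<Omega>: "\<Omega> s y = \<Theta>0 y + s *\<^sub>R (\<Theta>1 y - \<Theta>0 y)" for s y by (simp add: \<Omega>_def)
  note d = d'[folded \<Omega>] and inv = inv'[folded \<Omega>]
  define q where "q \<tau> y = blinv (\<Omega> (sin \<tau>) (m \<tau> y)) (b (m \<tau> y))" for \<tau> y
  have q: "norm (q \<tau> y) \<le> 2 * norm (b (m \<tau> y))" "\<Omega> (sin \<tau>) (m \<tau> y) (q \<tau> y) = b (m \<tau> y)" for \<tau> y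
    unfolding q_def by (rule blinv(3)[OF inv] blinv(1)[OF inv]; simp)+
  show ?thesis
  proof (rule that[of m "w' (pi/2)" "\<lambda>\<tau> y. - (cos \<tau> *\<^sub>R q \<tau> y)" "\<lambda>\<tau> y. sin \<tau> * (\<eta> (m \<tau> y) \<bullet> q \<tau> y)", OF m])
    show "((\<lambda>\<tau>. m \<tau> y) has_vector_derivative - (cos \<tau> *\<^sub>R q \<tau> y)) (at \<tau>)" for \<tau> y
      using d unfolding q_def .
    note dm = this
    show "norm (- (cos \<tau> *\<^sub>R q \<tau> y)) \<le> 2 * norm (b (m \<tau> y))" for \<tau> y
      using mult_mono[OF abs_cos_le_one q(1)] by simp
    show "\<bar>sin \<tau> * (\<eta> (m \<tau> y) \<bullet> q \<tau> y)\<bar> \<le> 2 * norm (\<eta> (m \<tau> y)) * norm (b (m \<tau> y))" for \<tau> y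
    proof -
      have "\<bar>\<eta> (m \<tau> y) \<bullet> q \<tau> y\<bar> \<le> norm (\<eta> (m \<tau> y)) * norm (q \<tau> y)" by (rule Cauchy_Schwarz_ineq2)
      also have "\<dots> \<le> norm (\<eta> (m \<tau> y)) * (2 * norm (b (m \<tau> y)))" by (rule mult_left_mono[OF q(1) norm_ge_zero])
      finally have *: "\<bar>\<eta> (m \<tau> y) \<bullet> q \<tau> y\<bar> \<le> norm (\<eta> (m \<tau> y)) * (2 * norm (b (m \<tau> y)))" .
      have "\<bar>sin \<tau>\<bar> * \<bar>\<eta> (m \<tau> y) \<bullet> q \<tau> y\<bar> \<le> 1 * (norm (\<eta> (m \<tau> y)) * (2 * norm (b (m \<tau> y))))"
        by (rule mult_mono[OF abs_sin_le_one *]) auto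
      then show ?thesis by (simp add: abs_mult mult.commute mult.left_commute)
    qed
    show "((\<lambda>\<tau>. F0 (m \<tau> y) + sin \<tau> * (F1 (m \<tau> y) - F0 (m \<tau> y))) has_vector_derivative
       cos \<tau> * (F1 (m \<tau> y) - F0 (m \<tau> y) - b (m \<tau> y) \<bullet> J (m \<tau> y) + sin \<tau> * (\<eta> (m \<tau> y) \<bullet> q \<tau> y))) (at \<tau>)" for \<tau> y
    proof -
      let ?v = "- (cos \<tau> *\<^sub>R q \<tau> y)"
      have dF': "((\<lambda>\<tau>. G (m \<tau> y)) has_vector_derivative dd G (m \<tau> y) ?v) (at \<tau>)" if G: "Cinf UNIV G" for G :: "'a \<Rightarrow> real"
        by (rule Cinf_along_curve[OF G dm])
      have s: "(sin has_vector_derivative cos \<tau>) (at \<tau>)"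
        unfolding has_real_derivative_iff_has_vector_derivative[symmetric] by (rule DERIV_sin)
      note D = has_vector_derivative_add[OF dF'[OF F(1)] has_vector_derivative_mult[OF s has_vector_derivative_diff[OF dF'[OF F(2)] dF'[OF F(1)]]]]
      let ?y = "m \<tau> y"
      \<comment> \<open>Skewness of the forms moves \<open>q\<close> into the interpolated form,
        where it yields \<open>b\<close> by its definition.\<close>
      have k1: "\<Theta>0 ?y (J ?y) \<bullet> q \<tau> y + sin \<tau> * (\<Theta>1 ?y (J ?y) \<bullet> q \<tau> y - \<Theta>0 ?y (J ?y) \<bullet> q \<tau> y) = - (b ?y \<bullet> J ?y)"
      proof -
        have "b ?y \<bullet> J ?y = \<Theta>0 ?y (q \<tau> y) \<bullet> J ?y + sin \<tau> * (\<Theta>1 ?y (q \<tau> y) \<bullet> J ?y - \<Theta>0 ?y (q \<tau> y) \<bullet> J ?y)"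
          unfolding q(2)[symmetric] by (simp add: \<Omega>_def blinfun.add_left blinfun.scaleR_left blinfun.diff_left inner_add_left inner_diff_left)
        also have "\<dots> = - (\<Theta>0 ?y (J ?y) \<bullet> q \<tau> y) + sin \<tau> * (- (\<Theta>1 ?y (J ?y) \<bullet> q \<tau> y) - - (\<Theta>0 ?y (J ?y) \<bullet> q \<tau> y))"
          unfolding form2_skew[OF \<Theta>0, of _ "q \<tau> y"] form2_skew[OF \<Theta>1, of _ "q \<tau> y"] ..
        finally show ?thesis by (simp add: algebra_simps)
      qed
      have "dd F0 ?y ?v + (sin \<tau> * (dd F1 ?y ?v - dd F0 ?y ?v) + cos \<tau> * (F1 ?y - F0 ?y)) =
        cos \<tau> * (F1 ?y - F0 ?y) + cos \<tau> * (\<Theta>0 ?y (J ?y) \<bullet> q \<tau> y + sin \<tau> * (\<Theta>1 ?y (J ?y) \<bullet> q \<tau> y - \<Theta>0 ?y (J ?y) \<bullet> q \<tau> y))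
        + cos \<tau> * (sin \<tau> * (\<eta> ?y \<bullet> q \<tau> y))"
        unfolding dF by (simp add: algebra_simps)
      also have "\<dots> = cos \<tau> * (F1 ?y - F0 ?y - b ?y \<bullet> J ?y + sin \<tau> * (\<eta> ?y \<bullet> q \<tau> y))"
        unfolding k1 by (simp add: algebra_simps)
      finally show ?thesis using D by simp
    qed
  qed (rule p)
qed

end

lemma abs_scale: "0 < t \<Longrightarrow> \<bar>t * p - t * q\<bar> = t * \<bar>p - q\<bar>" for t p q :: real
  by (metis abs_mult abs_of_pos right_diff_distrib)

text \<open>Because of the cutoff, homogeneity holds only while both \<open>x\<close> and
  \<open>t *\<^sub>R x\<close> lie in the shell between radii \<open>1/2\<close> and 2. Orbits,
  \<open>r\<close> and the averages are studied on successively smaller shells, which leaves room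
  for the small displacement in each step.\<close>

locale shell_hopf = near_hopf +
  assumes \<kappa>_pos: "0 < \<kappa>"
    and H_shell: "\<And>t x. 0 < t \<Longrightarrow> 1 / 2 < norm x \<Longrightarrow> norm x < 2 \<Longrightarrow> 1 / 2 < t * norm x \<Longrightarrow> t * norm x < 2 \<Longrightarrow>
      H (t *\<^sub>R x) = t\<^sup>2 * H x"
begin

lemma X_shell:
  assumes t: "0 < t" and x: "1 / 2 < norm x" "norm x < 2" "1 / 2 < t * norm x" "t * norm x < 2"
  shows "X (t *\<^sub>R x) = t *\<^sub>R X x"
proof -
  define S where "S = {z :: 'a. 1 / 2 < norm z \<and> norm z < 2 \<and> 1 / 2 < t * norm z \<and> t * norm z < 2}"
  have S: "open S" unfolding S_def by (intro open_Collect_conj open_Collect_less continuous_intros)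
  have xS: "x \<in> S" using x by (simp add: S_def)
  have "((\<lambda>z. H (t *\<^sub>R z)) has_derivative (\<lambda>v. (t *\<^sub>R x - J (\<xi> (t *\<^sub>R x))) \<bullet> (t *\<^sub>R v))) (at x)"
    by (rule has_derivative_compose[OF bounded_linear_imp_has_derivative[OF bounded_linear_scaleR_right] H_deriv])
  note * = this
  have "((\<lambda>z. t\<^sup>2 * H z) has_derivative (\<lambda>v. (t *\<^sub>R x - J (\<xi> (t *\<^sub>R x))) \<bullet> (t *\<^sub>R v))) (at x)"
    by (rule has_derivative_transform_within_open[OF * S xS]) (auto simp: S_def H_shell t)
  from has_derivative_unique[OF this has_derivative_mult_right[OF H_deriv]]
  have "(t *\<^sub>R x - J (\<xi> (t *\<^sub>R x))) \<bullet> (t *\<^sub>R v) = t\<^sup>2 * ((x - J (\<xi> x)) \<bullet> v)" for v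
    by (rule fun_cong)
  then have "\<forall>v. J (\<xi> (t *\<^sub>R x)) \<bullet> v = (t *\<^sub>R J (\<xi> x)) \<bullet> v" using t
    by (force simp: inner_diff_left inner_diff_right power2_eq_square right_diff_distrib)
  then have "J (\<xi> (t *\<^sub>R x)) = J (t *\<^sub>R \<xi> x)" unfolding vector_eq_rdot by (simp add: J_scale)
  then have "J (J (\<xi> (t *\<^sub>R x))) = J (J (t *\<^sub>R \<xi> x))" by (rule arg_cong)
  then show ?thesis by (simp add: X_def J_scale scaleR_add_right)
qed

lemma \<phi>_norm: "0 \<le> s \<Longrightarrow> s \<le> 2 * pi \<Longrightarrow> \<bar>norm (\<phi> s x) - norm x\<bar> \<le> \<kappa> * norm x"
  using \<zeta>_near[of s x] norm_triangle_ineq3[of "\<zeta> s x" x] by (simp add: \<phi>_\<zeta>)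

lemma \<phi>_shell_bounds:
  assumes s: "0 \<le> s" "s \<le> 2 * pi" and x: "11 / 20 \<le> norm x" "norm x \<le> 19 / 10"
  shows "1 / 2 < norm (\<phi> s x)" "norm (\<phi> s x) < 2"
proof -
  have "\<bar>norm (\<phi> s x) - norm x\<bar> \<le> \<kappa> * norm x" by (rule \<phi>_norm[OF s])
  also have "\<dots> \<le> (1 / 1000000) * 2" using x \<kappa> \<kappa>0 by (intro mult_mono) auto
  finally show "1 / 2 < norm (\<phi> s x)" "norm (\<phi> s x) < 2" using x by linarith+
qed

text \<open>Orbits from the smaller shell stay in the larger one, where \<open>X\<close> is
  1-homogeneous. So \<open>t\<close> times an orbit is again an orbit, and Gronwall's inequality
  identifies it with the one starting at \<open>t *\<^sub>R x\<close>.\<close>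

lemma \<phi>_shell:
  assumes s: "0 \<le> s" "s \<le> 2 * pi" and t: "0 < t" and x: "11 / 20 \<le> norm x" "norm x \<le> 19 / 10"
    "11 / 20 \<le> t * norm x" "t * norm x \<le> 19 / 10"
  shows "\<phi> s (t *\<^sub>R x) = t *\<^sub>R \<phi> s x"
proof -
  have nt: "norm (t *\<^sub>R x) = t * norm x" using t by simp
  let ?z = "\<lambda>s. \<phi> s (t *\<^sub>R x) - t *\<^sub>R \<phi> s x"
  have "norm (?z s) \<le> exp (2 * s) * norm (?z 0)"
  proof (rule gronwall[where y = ?z and y' = "\<lambda>q. X (\<phi> q (t *\<^sub>R x)) - t *\<^sub>R X (\<phi> q x)", OF s(1)])
    fix q assume q: "0 \<le> q" "q \<le> s"
    show "(?z has_vector_derivative X (\<phi> q (t *\<^sub>R x)) - t *\<^sub>R X (\<phi> q x)) (at q)"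
      by (rule has_vector_derivative_diff[OF \<phi>(3) bounded_linear.has_vector_derivative[OF bounded_linear_scaleR_right \<phi>(3)]])
    have q': "q \<le> 2 * pi" using q s by simp
    note b = \<phi>_shell_bounds[OF q(1) q' x(1,2)]
    have "\<bar>norm (\<phi> q x) - norm x\<bar> \<le> \<kappa> * norm x" by (rule \<phi>_norm[OF q(1) q'])
    then have "t * \<bar>norm (\<phi> q x) - norm x\<bar> \<le> t * (\<kappa> * norm x)" using t by (intro mult_left_mono) auto
    also have "\<dots> = \<kappa> * (t * norm x)" by simp
    also have "\<dots> \<le> (1 / 1000000) * 2" using x \<kappa> \<kappa>0 t by (intro mult_mono) auto
    finally have "\<bar>t * norm (\<phi> q x) - t * norm x\<bar> \<le> 2 / 1000000" unfolding abs_scale[OF t] by simp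
    then have b': "1 / 2 < t * norm (\<phi> q x)" "t * norm (\<phi> q x) < 2" using x by linarith+
    have e: "X (\<phi> q (t *\<^sub>R x)) - t *\<^sub>R X (\<phi> q x) = J (?z q) + (\<xi> (\<phi> q (t *\<^sub>R x)) - \<xi> (t *\<^sub>R \<phi> q x))"
      unfolding X_shell[OF t b b', symmetric] unfolding X_def J_diff by (rule add_diff_add)
    have "norm (J (?z q) + (\<xi> (\<phi> q (t *\<^sub>R x)) - \<xi> (t *\<^sub>R \<phi> q x))) \<le> norm (?z q) + \<epsilon> * norm (?z q)"
      by (rule order_trans[OF norm_triangle_ineq]) (simp add: \<xi>_lip)
    moreover have "\<epsilon> * norm (?z q) \<le> 1 * norm (?z q)" using \<epsilon> \<kappa> by (intro mult_right_mono) auto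
    ultimately show "norm (X (\<phi> q (t *\<^sub>R x)) - t *\<^sub>R X (\<phi> q x)) \<le> 2 * norm (?z q)" unfolding e by simp
  qed
  then show ?thesis by (simp add: \<phi>(2))
qed

lemma u_shell:
  assumes t: "0 < t" and x: "11 / 20 \<le> norm x" "norm x \<le> 19 / 10" "11 / 20 \<le> t * norm x" "t * norm x \<le> 19 / 10"
  shows "u (t *\<^sub>R x) = t *\<^sub>R u x"
proof -
  have "integral {0..2 * pi} (\<lambda>s. \<zeta> s (t *\<^sub>R x)) = integral {0..2 * pi} (\<lambda>s. t *\<^sub>R \<zeta> s x)"
    by (rule integral_cong) (simp add: \<zeta>_def \<phi>_shell[OF _ _ t x] R_scale)
  then have "u (t *\<^sub>R x) = avg (\<lambda>s. t *\<^sub>R \<zeta> s x)" by (simp add: u_def avg_def)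
  then show ?thesis using avg_linear[OF bounded_linear_scaleR_right \<zeta>_cont] by (simp add: u_def)
qed

lemma r_norm: "\<bar>norm (r y) - norm y\<bar> \<le> 2 * \<kappa> * norm y"
  using r_near[of y] norm_triangle_ineq3[of "r y" y] by simp

lemma r_shell_bounds:
  assumes t: "0 < t" and y: "6 / 10 \<le> norm y" "norm y \<le> 18 / 10" "6 / 10 \<le> t * norm y" "t * norm y \<le> 18 / 10"
  shows "11 / 20 < norm (r y)" "norm (r y) < 19 / 10" "11 / 20 < t * norm (r y)" "t * norm (r y) < 19 / 10"
proof -
  have 1: "2 * \<kappa> * norm y \<le> 2 * (1 / 1000000) * 2" using y \<kappa> \<kappa>0 by (intro mult_mono) auto
  have "t * \<bar>norm (r y) - norm y\<bar> \<le> t * (2 * \<kappa> * norm y)" using t by (intro mult_left_mono r_norm) auto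
  also have "\<dots> = 2 * \<kappa> * (t * norm y)" by simp
  also have "\<dots> \<le> 2 * (1 / 1000000) * 2" using y \<kappa> \<kappa>0 t by (intro mult_mono) auto
  finally have 2: "\<bar>t * norm (r y) - t * norm y\<bar> \<le> 4 / 1000000" unfolding abs_scale[OF t] by simp
  show "11 / 20 < norm (r y)" "norm (r y) < 19 / 10" "11 / 20 < t * norm (r y)" "t * norm (r y) < 19 / 10"
    using 1 2 r_norm[of y] y by linarith+
qed

lemma r_shell:
  assumes t: "0 < t" and y: "6 / 10 \<le> norm y" "norm y \<le> 18 / 10" "6 / 10 \<le> t * norm y" "t * norm y \<le> 18 / 10"
  shows "r (t *\<^sub>R y) = t *\<^sub>R r y"
proof -
  note b = r_shell_bounds[OF t y]
  have "u (t *\<^sub>R r y) = t *\<^sub>R u (r y)"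
    by (rule u_shell[OF t]) (use b in linarith)+
  then show ?thesis using r_u[of "t *\<^sub>R r y"] by simp
qed

lemma Hr_shell:
  assumes t: "0 < t" and y: "6 / 10 \<le> norm y" "norm y \<le> 18 / 10" "6 / 10 \<le> t * norm y" "t * norm y \<le> 18 / 10"
  shows "Hr (t *\<^sub>R y) = t\<^sup>2 * Hr y"
proof -
  note b = r_shell_bounds[OF t y]
  show ?thesis unfolding Hr_def r_shell[OF t y]
    by (rule H_shell[OF t]) (use b in linarith)+
qed

lemma dd_r_shell:
  assumes t: "0 < t" and y: "6 / 10 < norm y" "norm y < 18 / 10" "6 / 10 < t * norm y" "t * norm y < 18 / 10"
  shows "dd r (t *\<^sub>R y) v = dd r y v"
proof -
  define S where "S = {z :: 'a. 6 / 10 < norm z \<and> norm z < 18 / 10 \<and> 6 / 10 < t * norm z \<and> t * norm z < 18 / 10}"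
  have S: "open S" unfolding S_def by (intro open_Collect_conj open_Collect_less continuous_intros)
  have yS: "y \<in> S" using y by (simp add: S_def)
  have "((\<lambda>z. r (t *\<^sub>R z)) has_derivative (\<lambda>v. dd r (t *\<^sub>R y) (t *\<^sub>R v))) (at y)"
    by (rule has_derivative_compose[OF bounded_linear_imp_has_derivative[OF bounded_linear_scaleR_right] Cinf_has_derivative[OF Cinf_r UNIV_I]])
  note * = this
  have "((\<lambda>z. t *\<^sub>R r z) has_derivative (\<lambda>v. dd r (t *\<^sub>R y) (t *\<^sub>R v))) (at y)"
    by (rule has_derivative_transform_within_open[OF * S yS]) (auto simp: S_def r_shell t)
  from fun_cong[OF has_derivative_unique[OF this bounded_linear.has_derivative[OF bounded_linear_scaleR_right Cinf_has_derivative[OF Cinf_r UNIV_I]]], of v]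
  show ?thesis using t by (simp add: linear_scale[OF dd_r_linear])
qed

lemma \<Gamma>_shell:
  assumes t: "0 < t" and y: "6 / 10 < norm y" "norm y < 18 / 10" "6 / 10 < t * norm y" "t * norm y < 18 / 10"
  shows "Sb (t *\<^sub>R y) = t\<^sup>2 * Sb y" "\<Gamma> (t *\<^sub>R y) = t\<^sup>2 * \<Gamma> y"
proof -
  have "a (R s (t *\<^sub>R y)) \<bullet> J (R s (t *\<^sub>R y)) = t\<^sup>2 * (a (R s y) \<bullet> J (R s y))" for s
  proof -
    have 1: "r (t *\<^sub>R R s y) = t *\<^sub>R r (R s y)" by (rule r_shell[OF t]) (use y in simp_all)
    have 2: "dd r (t *\<^sub>R R s y) v = dd r (R s y) v" for v by (rule dd_r_shell[OF t]) (use y in simp_all)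
    show ?thesis unfolding a_inner R_scale J_scale 1 2 linear_scale[OF dd_r_linear]
      by (simp add: power2_eq_square)
  qed
  then show S: "Sb (t *\<^sub>R y) = t\<^sup>2 * Sb y"
    unfolding Sb_def using avg_linear[OF bounded_linear_mult_right comp_R_cont[OF Cinf_aJ], of "t\<^sup>2" y] by simp
  have "Hr (R s (t *\<^sub>R y)) = t\<^sup>2 * Hr (R s y)" for s
    unfolding R_scale by (rule Hr_shell[OF t]) (use y in simp_all)
  then have "Hb (t *\<^sub>R y) = t\<^sup>2 * Hb y"
    unfolding Hb_def using avg_linear[OF bounded_linear_mult_right comp_R_cont[OF Cinf_Hr], of "t\<^sup>2" y] by simp
  then show "\<Gamma> (t *\<^sub>R y) = t\<^sup>2 * \<Gamma> y" by (simp add: \<Gamma>_def S algebra_simps)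
qed

lemma \<Gamma>_R: "Sb (R s y) = Sb y" "\<Gamma> (R s y) = \<Gamma> y"
proof -
  have *: "avg (\<lambda>t. f (R t (R s y))) = avg (\<lambda>t. f (R t y))" if "Cinf UNIV f" for f :: "'a \<Rightarrow> real"
    using avg_periodic[OF comp_R_cont[OF that], of y s] by (simp add: R_R R_plus_pi)
  show S: "Sb (R s y) = Sb y" unfolding Sb_def by (rule *[OF Cinf_aJ])
  show "\<Gamma> (R s y) = \<Gamma> y" unfolding \<Gamma>_def S Hb_def by (simp add: *[OF Cinf_Hr])
qed

lemma \<eta>b_le: "norm (\<eta>b y) \<le> 11 / 10 * norm (\<delta>' y)"
proof -
  have "norm (\<eta>b y) \<le> norm (J (\<delta>' y)) + norm (\<eta>b y - J (\<delta>' y))" by (rule norm_triangle_sub)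
  also have "\<dots> \<le> norm (\<delta>' y) + 13 * \<kappa> * norm (\<delta>' y)" using \<eta>b_near[of y] by simp
  also have "13 * \<kappa> * norm (\<delta>' y) \<le> 1 / 10 * norm (\<delta>' y)" using \<kappa> by (intro mult_right_mono) auto
  finally show ?thesis by simp
qed

lemma \<Gamma>_line: "((\<lambda>t. \<Gamma> (y + t *\<^sub>R v)) has_vector_derivative - (\<eta>b (y + t *\<^sub>R v) \<bullet> v)) (at t)"
proof -
  have "((\<lambda>t. y + t *\<^sub>R v) has_derivative (\<lambda>h. h *\<^sub>R v)) (at t)"
    by (auto intro!: derivative_eq_intros)
  from has_derivative_compose[OF this \<Gamma>_has_derivative[of "y + t *\<^sub>R v"]]
  show ?thesis by (simp add: has_vector_derivative_def)
qed

end

locale min_hopf = shell_hopf +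
  assumes \<Gamma>_nonneg: "\<And>y. norm y = 1 \<Longrightarrow> 0 \<le> \<Gamma> y"
begin

lemma \<Gamma>_nonneg_shell:
  assumes "6 / 10 < norm y" "norm y < 18 / 10"
  shows "0 \<le> \<Gamma> y"
proof -
  have y: "norm y \<noteq> 0" using assms by linarith
  have 1: "norm (y /\<^sub>R norm y) = 1" and 2: "norm y *\<^sub>R (y /\<^sub>R norm y) = y" using y by simp_all
  have "\<Gamma> (norm y *\<^sub>R (y /\<^sub>R norm y)) = (norm y)\<^sup>2 * \<Gamma> (y /\<^sub>R norm y)"
    by (rule \<Gamma>_shell; (unfold 1)?) (use assms in linarith)+
  then show ?thesis using \<Gamma>_nonneg[OF 1] unfolding 2 by simp
qed

text \<open>Moving from \<open>y\<close> along \<open>J (\<delta>' y)\<close> decreases \<open>\<Gamma>\<close> at a rate of about \<open>\<bar>\<delta>' y\<bar>\<^sup>2\<close> for a time of order \<open>1/\<kappa>\<close>,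
  and \<open>\<Gamma>\<close> is still nonnegative at the end.\<close>

lemma \<delta>'_\<Gamma>:
  assumes y: "65 / 100 \<le> norm y" "norm y \<le> 16 / 10"
  shows "(norm (\<delta>' y))\<^sup>2 \<le> 200 * \<kappa> * \<Gamma> y"
proof -
  define v where "v = J (\<delta>' y)"
  \<comment> \<open>During this time \<open>\<delta>'\<close>, with Lipschitz constant
    \<open>\<kappa>\<close>, changes by at most one percent, and the point moves by at most one
    percent of \<open>norm y\<close>.\<close>
  define T where "T = 1 / (100 * \<kappa>)"
  have T: "0 < T" using \<kappa>_pos by (simp add: T_def)
  have nv: "norm v = norm (\<delta>' y)" by (simp add: v_def)
  define g where "g t = \<Gamma> (y + t *\<^sub>R v) + t * (9 / 10 * (norm v)\<^sup>2)" for t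
  have Tv: "t * norm v \<le> norm y / 100" if "t \<le> T" for t
  proof -
    have "t * norm v \<le> T * (\<kappa> * norm y)" unfolding nv using that T by (intro mult_mono \<delta>'_le) auto
    also have "\<dots> = norm y / 100" using \<kappa>_pos by (simp add: T_def)
    finally show ?thesis .
  qed
  have "g T \<le> g 0"
  proof (rule DERIV_nonpos_imp_nonincreasing[where f = g])
    show "0 \<le> T" using T by simp
    fix t assume t: "0 \<le> t" "t \<le> T"
    let ?z = "y + t *\<^sub>R v"
    have gd: "(g has_real_derivative - (\<eta>b ?z \<bullet> v) + 9 / 10 * (norm v)\<^sup>2) (at t)"
      unfolding g_def
      by (auto intro!: derivative_eq_intros \<Gamma>_line[folded has_real_derivative_iff_has_vector_derivative])
    have z: "norm (\<delta>' ?z - \<delta>' y) \<le> norm v / 100"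
    proof -
      have "norm (\<delta>' ?z - \<delta>' y) \<le> \<kappa> * (t * norm v)" using \<delta>'_lip[of ?z y] t by simp
      also have "\<dots> \<le> \<kappa> * (T * norm v)" using \<kappa>_pos t by (intro mult_left_mono mult_right_mono) auto
      also have "\<dots> = norm v / 100" using \<kappa>_pos by (simp add: T_def)
      finally show ?thesis .
    qed
    have 1: "norm (\<eta>b ?z - v) \<le> norm (\<eta>b ?z - J (\<delta>' ?z)) + norm (J (\<delta>' ?z) - v)"
      using norm_triangle_ineq[of "\<eta>b ?z - J (\<delta>' ?z)" "J (\<delta>' ?z) - v"] by simp
    have 2: "norm (J (\<delta>' ?z) - v) = norm (\<delta>' ?z - \<delta>' y)" by (metis J_diff norm_J v_def)
    have 3: "norm (\<eta>b ?z - J (\<delta>' ?z)) \<le> 1 / 100 * norm (\<delta>' ?z)"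
      by (rule order_trans[OF \<eta>b_near]) (use \<kappa> in \<open>intro mult_right_mono; simp\<close>)
    have 4: "norm (\<delta>' ?z) \<le> norm v + norm (\<delta>' ?z - \<delta>' y)" unfolding nv by (rule norm_triangle_sub)
    have *: "norm (\<eta>b ?z - v) \<le> norm v / 10" using 1 2 3 4 z norm_ge_zero[of v] by linarith
    have "(norm v)\<^sup>2 - \<eta>b ?z \<bullet> v = (v - \<eta>b ?z) \<bullet> v" by (simp add: inner_diff_left power2_norm_eq_inner)
    also have "\<dots> \<le> norm (v - \<eta>b ?z) * norm v" by (rule norm_cauchy_schwarz)
    also have "\<dots> \<le> (norm v / 10) * norm v" using * by (intro mult_right_mono) (simp_all add: norm_minus_commute)
    finally have "- (\<eta>b ?z \<bullet> v) + 9 / 10 * (norm v)\<^sup>2 \<le> 0" by (simp add: power2_eq_square)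
    with gd show "\<exists>d. (g has_real_derivative d) (at t) \<and> d \<le> 0" by blast
  qed
  moreover have "0 \<le> \<Gamma> (y + T *\<^sub>R v)"
  proof (rule \<Gamma>_nonneg_shell)
    have "norm (T *\<^sub>R v) \<le> norm y / 100" using Tv[of T] T by simp
    then show "6 / 10 < norm (y + T *\<^sub>R v)" "norm (y + T *\<^sub>R v) < 18 / 10"
      using y norm_triangle_ineq[of y "T *\<^sub>R v"] norm_diff_ineq[of y "T *\<^sub>R v"] by linarith+
  qed
  ultimately have "T * (9 / 10 * (norm v)\<^sup>2) \<le> \<Gamma> y" by (simp add: g_def)
  then have "(100 * \<kappa>) * (T * (9 / 10 * (norm v)\<^sup>2)) \<le> (100 * \<kappa>) * \<Gamma> y" using \<kappa>_pos by (intro mult_left_mono) auto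
  then have "9 / 10 * (norm v)\<^sup>2 \<le> 100 * \<kappa> * \<Gamma> y" using \<kappa>_pos by (simp add: T_def)
  moreover have "0 \<le> \<kappa> * \<Gamma> y" using \<kappa>_pos \<Gamma>_nonneg_shell[of y] y by simp
  ultimately show ?thesis unfolding nv by linarith
qed

end

section \<open>Normal form along a complex line\<close>

locale cline = cplx J for J :: "'a::euclidean_space \<Rightarrow> 'a" +
  fixes e :: 'a
  assumes norm_e: "norm e = 1"
begin

lemma ee [simp]: "e \<bullet> e = 1" "J e \<bullet> J e = 1" using norm_e by (simp_all add: norm_eq_1)

text \<open>Orthogonal projection onto the complex line through \<open>e\<close>. The map
  \<open>N\<close> below is the projection onto the complement of that line, called \<open>p\<close>
  in the introduction, and not the homogeneous function \<open>N\<close> mentioned there.\<close>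

definition P :: "'a \<Rightarrow> 'a" where "P z = (z \<bullet> e) *\<^sub>R e + (z \<bullet> J e) *\<^sub>R J e"

definition N :: "'a \<Rightarrow> 'a" where "N z = z - P z"

lemma P_linear: "linear P"
  by (rule linearI) (simp_all add: P_def inner_add_left algebra_simps)

lemma N_linear: "linear N"
  unfolding N_def[abs_def] by (rule linear_compose_sub[OF linear_ident P_linear])

lemma P_J: "P (J z) = J (P z)"
  by (simp add: P_def J_add J_scale J_skew)

lemma N_J: "N (J z) = J (N z)" by (simp add: N_def P_J J_diff)

lemma P_P [simp]: "P (P z) = P z"
  by (simp add: P_def inner_add_left)

lemma P_adj: "P x \<bullet> y = x \<bullet> P y"
  by (simp add: P_def inner_add_left inner_add_right inner_commute[of y])

lemma N_adj: "N x \<bullet> y = x \<bullet> N y"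
  by (simp add: N_def inner_diff_left inner_diff_right P_adj)

lemma P_N [simp]: "P (N z) = 0" by (simp add: N_def linear_diff[OF P_linear])

lemma P_add_N: "P z + N z = z" by (simp add: N_def)

lemma norm_P_N: "(norm z)\<^sup>2 = (norm (P z))\<^sup>2 + (norm (N z))\<^sup>2"
proof -
  have "P z \<bullet> N z = 0" by (simp add: P_adj)
  then have "(P z + N z) \<bullet> (P z + N z) = P z \<bullet> P z + N z \<bullet> N z"
    by (simp add: inner_add_left inner_add_right inner_commute)
  then show ?thesis unfolding P_add_N power2_norm_eq_inner .
qed

lemma norm_P: "norm (P z) \<le> norm z" and norm_N: "norm (N z) \<le> norm z"
  by (rule power2_le_imp_le[OF _ norm_ge_zero], simp add: norm_P_N[of z])+

lemma N_large:
  assumes "7 / 10 \<le> norm y" "\<not> 65 / 100 \<le> norm (P y)"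
  shows "25 / 100 \<le> norm (N y)"
proof -
  have "(7 / 10)\<^sup>2 \<le> (norm y)\<^sup>2" using assms by (intro power_mono) auto
  moreover have "(norm (P y))\<^sup>2 \<le> (65 / 100)\<^sup>2" using assms by (intro power_mono) auto
  ultimately have "(25 / 100)\<^sup>2 \<le> (norm (N y))\<^sup>2" unfolding norm_P_N[of y] by (simp add: power2_eq_square)
  then show ?thesis by (rule power2_le_imp_le) simp
qed

lemma P_fixed_polar:
  assumes "P z = z" "z \<noteq> 0"
  obtains s where "z = norm z *\<^sub>R R s e"
proof -
  define p q where "p = z \<bullet> e" and "q = z \<bullet> J e"
  have z: "z = p *\<^sub>R e + q *\<^sub>R J e" using assms(1) by (simp add: P_def p_def q_def)
  have "z \<bullet> z = p * p + q * q" unfolding z by (simp add: inner_add_left inner_add_right)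
  then have n: "(norm z)\<^sup>2 = p\<^sup>2 + q\<^sup>2" unfolding power2_norm_eq_inner by (simp add: power2_eq_square)
  have "(p / norm z)\<^sup>2 + (q / norm z)\<^sup>2 = 1"
    using assms(2) by (simp add: power_divide add_divide_distrib[symmetric] n[symmetric])
  then obtain s where "p / norm z = cos s" "q / norm z = sin s" by (rule sincos_total_2pi) (rule that)
  then have "p = norm z * cos s" "q = norm z * sin s" using assms(2) by (simp_all add: field_simps)
  then have "z = norm z *\<^sub>R R s e" by (subst z) (simp add: R_def scaleR_add_right)
  then show ?thesis by (rule that)
qed

text \<open>The line has real dimension 2 and is spanned by \<open>p\<close> and
  \<open>J p\<close>.\<close>

lemma P_fixed_orthogonal:
  assumes z: "P z = z" and p: "P p = p" "p \<noteq> 0" and "z \<bullet> p = 0" "z \<bullet> J p = 0"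
  shows "z = 0"
proof (cases "z = 0")
  case False
  obtain s where s: "z = norm z *\<^sub>R R s e" by (rule P_fixed_polar[OF z False])
  obtain t where t: "p = norm p *\<^sub>R R t e" by (rule P_fixed_polar[OF p])
  define A B where "A = R s e" and "B = R t e"
  obtain c d where "z = c *\<^sub>R A" "p = d *\<^sub>R B" "c \<noteq> 0" "d \<noteq> 0"
    using s t False p(2) unfolding A_def B_def by (metis norm_eq_zero)
  then have "A \<bullet> B = 0" "A \<bullet> J B = 0" using assms(4,5) by (simp_all add: J_scale)
  then have "R s e \<bullet> R t e = 0" "R s e \<bullet> J (R t e) = 0" by (simp_all add: A_def B_def)
  then have "R s e = 0" 
  proof -
    have *: "R s e = (cos (s - t)) *\<^sub>R R t e + sin (s - t) *\<^sub>R J (R t e)"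
      using R_R[of "s - t" t e] by (simp add: R_def)
    have "R s e \<bullet> R t e = cos (s - t) * (R t e \<bullet> R t e)" "R s e \<bullet> J (R t e) = sin (s - t) * (R t e \<bullet> R t e)"
      by (subst *, simp add: inner_add_left)+
    moreover have "R t e \<bullet> R t e = 1" by (simp add: R_inner)
    ultimately have "cos (s - t) = 0" "sin (s - t) = 0"
      using \<open>R s e \<bullet> R t e = 0\<close> \<open>R s e \<bullet> J (R t e) = 0\<close> by simp_all
    then show ?thesis using sin_cos_squared_add[of "s - t"] by simp
  qed
  then have "norm e = 0" by (metis norm_R norm_zero)
  then show ?thesis using norm_e by simp
qed

end

locale line_hopf = min_hopf J H \<xi> \<epsilon> \<kappa> + cline J e
  for J :: "'a::euclidean_space \<Rightarrow> 'a" and H \<xi> \<epsilon> \<kappa> e +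
  assumes \<Gamma>_e: "\<Gamma> e = 0"
begin

text \<open>On the line through \<open>e\<close> the action is \<open>\<sigma> / 2\<close> times the
  squared norm; a dilation removes this factor at the end.\<close>

definition \<sigma> :: real where "\<sigma> = 2 * Sb e"

text \<open>Up to a positive factor and a rotation \<open>R s\<close>, a nonzero point of the line
  is \<open>e\<close>. Both functions are 2-homogeneous in the shell and invariant under
  \<open>R\<close>.\<close>

lemma on_line:
  assumes y: "P y = y" "6 / 10 < norm y" "norm y < 18 / 10"
  shows "\<Gamma> y = 0" "Sb y = \<sigma> / 2 * (y \<bullet> y)"
proof -
  have "y \<noteq> 0" using y by auto
  then obtain s where s: "y = norm y *\<^sub>R R s e" by (rule P_fixed_polar[OF y(1)])
  have n: "norm (R s e) = 1" by (simp add: norm_e)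
  have sh: "Sb (norm y *\<^sub>R R s e) = (norm y)\<^sup>2 * Sb (R s e)" "\<Gamma> (norm y *\<^sub>R R s e) = (norm y)\<^sup>2 * \<Gamma> (R s e)"
    by (rule \<Gamma>_shell; (unfold n)?; use y in linarith)+
  show "\<Gamma> y = 0" using sh(2) unfolding s[symmetric] \<Gamma>_R \<Gamma>_e by simp
  show "Sb y = \<sigma> / 2 * (y \<bullet> y)" using sh(1) unfolding s[symmetric] \<Gamma>_R by (simp add: \<sigma>_def power2_norm_eq_inner)
qed

lemma \<delta>'_on_line:
  assumes y: "P y = y" "65 / 100 \<le> norm y" "norm y \<le> 16 / 10"
  shows "\<delta>' y = 0"
proof -
  have "\<Gamma> y = 0" by (rule on_line(1)[OF y(1)]) (use y in linarith)+
  then show ?thesis using \<delta>'_\<Gamma>[OF y(2,3)] by simp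
qed

text \<open>If \<open>P y\<close> is shorter than \<open>65/100\<close>, then
  \<open>norm (N y)\<close> is at least \<open>1/4\<close> and a fixed point of the line will do:
  its distance from \<open>y\<close> is at most \<open>15/10 + 65/100\<close>, below
  \<open>9/4\<close>.\<close>

lemma near_line:
  assumes y: "7 / 10 \<le> norm y" "norm y \<le> 15 / 10"
  obtains w where "P w = w" "65 / 100 \<le> norm w" "norm w \<le> 15 / 10" "norm (y - w) \<le> 9 * norm (N y)"
proof (cases "65 / 100 \<le> norm (P y)")
  case True
  show ?thesis
    by (rule that[of "P y"]) (use True y norm_P[of y] in \<open>simp_all add: N_def[symmetric]\<close>)
next
  case False
  have n: "25 / 100 \<le> norm (N y)" by (rule N_large[OF y(1) False])
  let ?w = "(65 / 100) *\<^sub>R e"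
  have w: "norm ?w = 65 / 100" by (simp add: norm_e)
  have "norm (y - ?w) \<le> norm y + norm ?w" by (rule norm_triangle_ineq4)
  then have "norm (y - ?w) \<le> 9 * norm (N y)" using y n w by linarith
  moreover have "P ?w = ?w" by (simp add: P_def)
  ultimately show ?thesis using that[of ?w] w by linarith
qed

text \<open>Compare with a point \<open>w\<close> of the line, where \<open>\<delta>'\<close> and
  \<open>\<Gamma>\<close> vanish. The gradient of \<open>\<Gamma>\<close> is of the size of
  \<open>\<delta>'\<close>, so it grows at most linearly from \<open>w\<close>, and
  \<open>\<Gamma>\<close> grows at most quadratically.\<close>

lemma \<delta>'_N:
  assumes y: "7 / 10 \<le> norm y" "norm y \<le> 15 / 10"
  shows "norm (\<delta>' y) \<le> 9 * \<kappa> * norm (N y)" "\<Gamma> y \<le> 100 * \<kappa> * (norm (N y))\<^sup>2"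
proof -
  obtain w where w: "P w = w" "65 / 100 \<le> norm w" "norm w \<le> 15 / 10" "norm (y - w) \<le> 9 * norm (N y)"
    by (rule near_line[OF y])
  have d0: "\<delta>' w = 0" by (rule \<delta>'_on_line[OF w(1)]) (use w in linarith)+
  have G0: "\<Gamma> w = 0" by (rule on_line(1)[OF w(1)]) (use w in linarith)+
  have d: "norm (\<delta>' z) \<le> \<kappa> * norm (z - w)" for z using \<delta>'_lip[of z w] d0 by simp
  have "norm (\<delta>' y) \<le> \<kappa> * (9 * norm (N y))" by (rule order_trans[OF d mult_left_mono[OF w(4) \<kappa>0]])
  then show "norm (\<delta>' y) \<le> 9 * \<kappa> * norm (N y)" by simp
  define D where "D = norm (y - w)"
  have "norm (\<Gamma> (w + 1 *\<^sub>R (y - w)) - \<Gamma> (w + 0 *\<^sub>R (y - w))) \<le> (11 / 10 * \<kappa> * D * D) * 1"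
  proof (rule displacement_bound[OF _ \<Gamma>_line])
    fix t :: real assume t: "0 \<le> t" "t \<le> 1"
    have "norm (- (\<eta>b (w + t *\<^sub>R (y - w)) \<bullet> (y - w))) \<le> norm (\<eta>b (w + t *\<^sub>R (y - w))) * D"
      unfolding D_def norm_minus_cancel unfolding real_norm_def by (rule Cauchy_Schwarz_ineq2)
    also have "\<dots> \<le> (11 / 10 * \<kappa> * D) * D"
    proof (rule mult_right_mono)
      have "norm (\<eta>b (w + t *\<^sub>R (y - w))) \<le> 11 / 10 * (\<kappa> * norm (t *\<^sub>R (y - w)))"
        using order_trans[OF \<eta>b_le mult_left_mono[OF d], of "w + t *\<^sub>R (y - w)"] by simp
      also have "\<dots> \<le> 11 / 10 * (\<kappa> * D)"
        using t \<kappa>0 by (intro mult_left_mono) (auto simp: D_def mult_left_le_one_le)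
      finally show "norm (\<eta>b (w + t *\<^sub>R (y - w))) \<le> 11 / 10 * \<kappa> * D" by simp
    qed (simp add: D_def)
    finally show "norm (- (\<eta>b (w + t *\<^sub>R (y - w)) \<bullet> (y - w))) \<le> 11 / 10 * \<kappa> * D * D" .
  qed simp
  then have "\<Gamma> y \<le> 11 / 10 * \<kappa> * D\<^sup>2" using G0 by (simp add: power2_eq_square)
  also have "\<dots> \<le> 11 / 10 * \<kappa> * (9 * norm (N y))\<^sup>2"
    using w(4) \<kappa>0 by (intro mult_left_mono power_mono) (auto simp: D_def)
  also have "\<dots> = 891 / 10 * (\<kappa> * (norm (N y))\<^sup>2)" by (simp add: power2_eq_square)
  also have "\<dots> \<le> 100 * (\<kappa> * (norm (N y))\<^sup>2)" using \<kappa>0 by (intro mult_right_mono) auto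
  finally show "\<Gamma> y \<le> 100 * \<kappa> * (norm (N y))\<^sup>2" by simp
qed

text \<open>Moser's method from \<open>Ob\<close> to \<open>Om\<close> with primitive
  \<open>\<rho>\<close>. As \<open>\<rho> y \<bullet> J y = Hr y - Hb y\<close>, the interpolation
  between \<open>Sb\<close> and \<open>Hr\<close> grows along the isotopy at the rate
  \<open>cos \<tau>\<close> times the sum of \<open>\<Gamma>\<close> and an error quadratic in
  \<open>\<delta>'\<close>. Nonnegativity of \<open>\<Gamma>\<close> gives the lower bound, its
  quadratic growth off the line the upper bound.\<close>

lemma stage_w:
  obtains w w' where "Cinf UNIV w" "Cinf UNIV w'" "\<And>y. w' (w y) = y" "\<And>y. w (w' y) = y"
    "\<And>y a b. Om (w y) (dd w y a) \<bullet> dd w y b = Ob y a \<bullet> b"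
    "\<And>y. norm (w y - y) \<le> 256 * \<kappa> * norm y"
    "\<And>y. 75 / 100 \<le> norm y \<Longrightarrow> norm y \<le> 14 / 10 \<Longrightarrow> Sb y \<le> Hr (w y)"
    "\<And>y. 75 / 100 \<le> norm y \<Longrightarrow> norm y \<le> 14 / 10 \<Longrightarrow> Hr (w y) \<le> Sb y + 1200 * \<kappa> * (norm (N y))\<^sup>2"
proof -
  have near: "norm (Ob y v - J v) \<le> norm v / 6" "norm (Om y v - J v) \<le> norm v / 6" for y v
  proof -
    have "5 * \<kappa> * norm v \<le> (1 / 6) * norm v" using \<kappa> by (intro mult_right_mono) auto
    then show "norm (Ob y v - J v) \<le> norm v / 6" "norm (Om y v - J v) \<le> norm v / 6"
      using Ob_near[of y v] Om_near[of y v] by simp_all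
  qed
  have \<rho>y: "norm (\<rho> y) \<le> 32 * \<kappa> * norm y" for y
    using \<rho>_le[of y] \<delta>'_le[of y] by simp
  have growth: "norm (\<rho> y) \<le> 1 * (1 + norm y)" for y
  proof -
    have "32 * \<kappa> * norm y \<le> 1 * norm y" using \<kappa> by (intro mult_right_mono) auto
    then show ?thesis using \<rho>y[of y] by simp
  qed
  have curl: "curl \<rho> y v w = Om y v \<bullet> w - Ob y v \<bullet> w" for y v w by (simp add: curl_\<rho> Ob_inner)
  have dH: "dd Hr y v = - (Om y (J y) \<bullet> v) - \<eta> y \<bullet> v" for y v by (simp add: Om_J)
  obtain m m' w' E where m: "Cinf UNIV (m (pi/2))" "Cinf UNIV w'" "\<And>y. w' (m (pi/2) y) = y" "\<And>y. m (pi/2) (w' y) = y" "\<And>y. m 0 y = y"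
    "\<And>\<tau> y. ((\<lambda>\<tau>. m \<tau> y) has_vector_derivative m' \<tau> y) (at \<tau>)"
    "\<And>\<tau> y. norm (m' \<tau> y) \<le> 2 * norm (\<rho> (m \<tau> y))"
    "\<And>y v w. Om (m (pi/2) y) (dd (m (pi/2)) y v) \<bullet> dd (m (pi/2)) y w = Ob y v \<bullet> w"
    "\<And>\<tau> y. ((\<lambda>\<tau>. Sb (m \<tau> y) + sin \<tau> * (Hr (m \<tau> y) - Sb (m \<tau> y))) has_vector_derivative
       cos \<tau> * (Hr (m \<tau> y) - Sb (m \<tau> y) - \<rho> (m \<tau> y) \<bullet> J (m \<tau> y) + E \<tau> y)) (at \<tau>)"
    "\<And>\<tau> y. \<bar>E \<tau> y\<bar> \<le> 2 * norm (\<eta> (m \<tau> y)) * norm (\<rho> (m \<tau> y))"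
    by (rule moser_energy[OF form2_Ob form2_Om Cinf_\<rho> curl near growth Cinf_Sb Cinf_Hr dd_Sb dH]) (rule that)
  have pi2: "0 \<le> \<tau> \<Longrightarrow> \<tau> \<le> pi / 2 \<Longrightarrow> \<tau> \<le> 2" for \<tau> :: real using pi_less_4 by linarith
  have disp: "norm (m \<tau> y - y) \<le> 256 * \<kappa> * norm y" if \<tau>: "0 \<le> \<tau>" "\<tau> \<le> pi / 2" for \<tau> y
  proof -
    have "norm (m \<tau> y - m 0 y) \<le> 2 * (64 * \<kappa>) * \<tau> * norm (m 0 y)"
    proof (rule gronwall_displacement(1)[OF \<tau>(1) m(6)])
      show "norm (m' s y) \<le> 64 * \<kappa> * norm (m s y)" for s
        using m(7)[of s y] \<rho>y[of "m s y"] by linarith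
      have "64 * \<kappa> * \<tau> \<le> 64 * (1 / 1000000) * 2" using \<kappa> \<kappa>0 \<tau> pi2[OF \<tau>] by (intro mult_mono) auto
      then show "64 * \<kappa> * \<tau> \<le> 1 / 2" by simp
    qed (simp add: \<kappa>0)
    also have "\<dots> \<le> 2 * (64 * \<kappa>) * 2 * norm (m 0 y)"
      using pi2[OF \<tau>] \<kappa>0 by (intro mult_right_mono mult_left_mono) auto
    finally show ?thesis by (simp add: m(5))
  qed
  have E: "Sb y \<le> Hr (m (pi/2) y) \<and> Hr (m (pi/2) y) \<le> Sb y + 1200 * \<kappa> * (norm (N y))\<^sup>2"
    if y: "75 / 100 \<le> norm y" "norm y \<le> 14 / 10" for y
  proof -
    have sh: "7 / 10 \<le> norm (m \<tau> y)" "norm (m \<tau> y) \<le> 15 / 10" if \<tau>: "0 \<le> \<tau>" "\<tau> \<le> pi / 2" for \<tau>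
    proof -
      have "256 * \<kappa> * norm y \<le> 256 * (1 / 1000000) * 2" using y \<kappa> \<kappa>0 by (intro mult_mono) auto
      then have "\<bar>norm (m \<tau> y) - norm y\<bar> \<le> 512 / 1000000" 
        using disp[OF \<tau>, of y] norm_triangle_ineq3[of "m \<tau> y" y] by linarith
      then show "7 / 10 \<le> norm (m \<tau> y)" "norm (m \<tau> y) \<le> 15 / 10" using y by linarith+
    qed
    have \<rho>N: "norm (\<rho> (m \<tau> y)) \<le> 288 * \<kappa> * norm (N (m \<tau> y))" if \<tau>: "0 \<le> \<tau>" "\<tau> \<le> pi / 2" for \<tau>
      using \<rho>_le[of "m \<tau> y"] \<delta>'_N(1)[OF sh[OF \<tau>]] by linarith
    have Nm: "norm (N (m \<tau> y)) \<le> 2 * norm (N y)" if \<tau>: "0 \<le> \<tau>" "\<tau> \<le> pi / 2" for \<tau>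
    proof -
      have "norm (N (m \<tau> y)) \<le> 2 * norm (N (m 0 y))"
      proof (rule gronwall_displacement(2)[where m = "\<lambda>\<tau>. N (m \<tau> y)" and m' = "\<lambda>\<tau>. N (m' \<tau> y)" and L = "576 * \<kappa>", OF \<tau>(1)])
        show "((\<lambda>\<tau>. N (m \<tau> y)) has_vector_derivative N (m' s y)) (at s)" for s
          by (rule bounded_linear.has_vector_derivative[OF linear_conv_bounded_linear[THEN iffD1, OF N_linear] m(6)])
        show "norm (N (m' s y)) \<le> 576 * \<kappa> * norm (N (m s y))" if "0 \<le> s" "s \<le> \<tau>" for s
          using norm_N[of "m' s y"] m(7)[of s y] \<rho>N[of s] that \<tau> by linarith
        have "576 * \<kappa> * \<tau> \<le> 576 * (1 / 1000000) * 2" using \<kappa> \<kappa>0 \<tau> pi2[OF \<tau>] by (intro mult_mono) auto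
        then show "576 * \<kappa> * \<tau> \<le> 1 / 2" by simp
      qed (simp add: \<kappa>0)
      then show ?thesis by (simp add: m(5))
    qed
    define g where "g \<tau> = Sb (m \<tau> y) + sin \<tau> * (Hr (m \<tau> y) - Sb (m \<tau> y))" for \<tau>
    define g' where "g' \<tau> = cos \<tau> * (\<Gamma> (m \<tau> y) + E \<tau> y)" for \<tau>
    have dg: "(g has_real_derivative g' \<tau>) (at \<tau>)" for \<tau>
      using m(9)[of y \<tau>] unfolding has_real_derivative_iff_has_vector_derivative g_def g'_def
      by (simp add: \<rho>_J \<Gamma>_def)
    have g': "0 \<le> g' \<tau> \<and> g' \<tau> \<le> 600 * \<kappa> * (norm (N y))\<^sup>2" if \<tau>: "0 \<le> \<tau>" "\<tau> \<le> pi / 2" for \<tau>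
    proof -
      let ?z = "m \<tau> y"
      have z: "65 / 100 \<le> norm ?z" "norm ?z \<le> 16 / 10" using sh[OF \<tau>] by linarith+
      have G0: "0 \<le> \<Gamma> ?z" by (rule \<Gamma>_nonneg_shell) (use z in linarith)+
      have "\<bar>E \<tau> y\<bar> \<le> 2 * norm (\<eta> ?z) * norm (\<rho> ?z)" by (rule m(10))
      also have "\<dots> \<le> 2 * (2 * norm (\<delta>' ?z)) * (32 * norm (\<delta>' ?z))"
        by (intro mult_mono \<eta>_le \<rho>_le mult_left_mono) auto
      also have "\<dots> = 128 * (norm (\<delta>' ?z))\<^sup>2" by (simp add: power2_eq_square)
      also have "\<dots> \<le> 128 * (200 * \<kappa> * \<Gamma> ?z)" by (rule mult_left_mono[OF \<delta>'_\<Gamma>[OF z]]) simp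
      also have "\<dots> = (25600 * \<kappa>) * \<Gamma> ?z" by simp
      \<comment> \<open>Here the smallness of \<open>\<kappa>\<close> beats the error: at most half
        of \<open>\<Gamma>\<close> is lost, so the rate stays nonnegative.\<close>
      also have "\<dots> \<le> (1 / 2) * \<Gamma> ?z" using \<kappa> G0 by (intro mult_right_mono) auto
      finally have E: "\<bar>E \<tau> y\<bar> \<le> \<Gamma> ?z / 2" by simp
      have c: "0 \<le> cos \<tau>" "cos \<tau> \<le> 1" using \<tau> by (auto intro: cos_ge_zero)
      have "\<Gamma> ?z \<le> 100 * \<kappa> * (norm (N ?z))\<^sup>2" by (rule \<delta>'_N(2)[OF sh[OF \<tau>]])
      also have "\<dots> \<le> 100 * \<kappa> * (2 * norm (N y))\<^sup>2"
        using Nm[OF \<tau>] \<kappa>0 by (intro mult_left_mono power_mono) auto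
      also have "\<dots> = 400 * \<kappa> * (norm (N y))\<^sup>2" by (simp add: power2_eq_square)
      finally have G: "\<Gamma> ?z + E \<tau> y \<le> 600 * \<kappa> * (norm (N y))\<^sup>2" using E by linarith
      have "0 \<le> \<Gamma> ?z + E \<tau> y" using E G0 by linarith
      moreover from this have "cos \<tau> * (\<Gamma> ?z + E \<tau> y) \<le> 1 * (\<Gamma> ?z + E \<tau> y)" by (rule mult_right_mono[OF c(2)])
      ultimately show ?thesis using c G by (simp add: g'_def)
    qed
    have "norm (g (pi/2) - g 0) \<le> (600 * \<kappa> * (norm (N y))\<^sup>2) * (pi / 2)"
      by (rule displacement_bound[OF _ dg[unfolded has_real_derivative_iff_has_vector_derivative]]) (use g' in auto)
    also have "\<dots> \<le> (600 * \<kappa> * (norm (N y))\<^sup>2) * 2" using pi_less_4 \<kappa>0 by (intro mult_left_mono) auto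
    finally have "g (pi/2) \<le> g 0 + 1200 * \<kappa> * (norm (N y))\<^sup>2" by simp
    moreover have "g 0 \<le> g (pi/2)"
      by (rule DERIV_nonneg_imp_nondecreasing[where f = g]) (use dg g' in \<open>auto intro!: exI\<close>)
    ultimately show ?thesis by (simp add: g_def m(5))
  qed
  show ?thesis
    by (rule that[of "m (pi/2)" w', OF m(1-4,8) disp]) (use E in auto)
qed

end

context cplx begin

text \<open>Since the \<open>L s\<close> commute with \<open>J\<close>, pairing the primitive with
  \<open>J y\<close> gives the integral of the derivative of \<open>G\<close> along the path
  \<open>s \<mapsto> L s y\<close>.\<close>

lemma cartan_primitive:
  fixes \<Theta> :: "'a \<Rightarrow> 'a \<Rightarrow>\<^sub>L 'a" and L L' Lt :: "real \<Rightarrow> 'a \<Rightarrow>\<^sub>L 'a" and G :: "'a \<Rightarrow> real"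
  assumes \<Theta>: "form2 \<Theta>" and L: "Cinf UNIV L" "Cinf UNIV L'" "Cinf UNIV Lt"
    and dL: "\<And>s. (L has_vector_derivative L' s) (at s)"
    and Lt: "\<And>s x y. Lt s x \<bullet> y = x \<bullet> L s y"
    and LJ: "\<And>s x. L s (J x) = J (L s x)"
    and G: "\<And>y. (G has_derivative (\<lambda>v. \<Theta> y v \<bullet> J y)) (at y)"
  defines "b \<equiv> \<lambda>y. integral {0..1} (\<lambda>s. Lt s (\<Theta> (L s y) (L' s y)))"
  shows "Cinf UNIV b"
    and "curl b y v w = \<Theta> (L 1 y) (L 1 v) \<bullet> L 1 w - \<Theta> (L 0 y) (L 0 v) \<bullet> L 0 w"
    and "b y \<bullet> J y = G (L 1 y) - G (L 0 y)"
    and "(\<And>s. 0 \<le> s \<Longrightarrow> s \<le> 1 \<Longrightarrow> norm (Lt s (\<Theta> (L s y) (L' s y))) \<le> B) \<Longrightarrow> norm (b y) \<le> B"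
proof -
  have k: "((\<lambda>_. 1 :: real) has_vector_derivative 0) (at s)" for s by (rule has_vector_derivative_const)
  note c = cartan_linear[OF \<Theta> L dL Lt Cinf_const k continuous_on_const zero_le_one]
  show "Cinf UNIV b" using c(1) by (simp add: b_def)
  show "curl b y v w = \<Theta> (L 1 y) (L 1 v) \<bullet> L 1 w - \<Theta> (L 0 y) (L 0 v) \<bullet> L 0 w"
    using c(2)[of y v w] by (simp add: b_def)
  have cL: "Cinf UNIV (\<lambda>s. L s y)" and cL': "Cinf UNIV (\<lambda>s. L' s y)"
    by (rule Cinf_blinfun_apply[OF open_UNIV L(1) Cinf_const] Cinf_blinfun_apply[OF open_UNIV L(2) Cinf_const])+
  have "Cinf UNIV (\<lambda>s. Lt s (\<Theta> (L s y) (L' s y)))"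
    by (rule Cinf_blinfun_apply[OF open_UNIV L(3) Cinf_blinfun_apply[OF open_UNIV
          Cinf_compose_UNIV[OF open_UNIV form2_Cinf[OF \<Theta>] cL] cL']])
  then have cont: "continuous_on {0..1} (\<lambda>s. Lt s (\<Theta> (L s y) (L' s y)))"
    using Cinf_continuous continuous_on_subset by blast
  show "norm (b y) \<le> B" if "\<And>s. 0 \<le> s \<Longrightarrow> s \<le> 1 \<Longrightarrow> norm (Lt s (\<Theta> (L s y) (L' s y))) \<le> B"
    using integral_bound[OF _ cont, of B] that by (simp add: b_def)
  have "((\<lambda>s. G (L s y)) has_vector_derivative Lt s (\<Theta> (L s y) (L' s y)) \<bullet> J y) (at s)" for s
  proof -
    have "((\<lambda>s. L s y) has_vector_derivative L' s y) (at s)"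
      by (rule bounded_linear.has_vector_derivative[OF blinfun.bounded_linear_left dL])
    then have "((\<lambda>s. L s y) has_derivative (\<lambda>h. h *\<^sub>R L' s y)) (at s)"
      by (simp add: has_vector_derivative_def)
    from has_derivative_compose[OF this G]
    show ?thesis by (simp add: has_vector_derivative_def Lt LJ blinfun.scaleR_right)
  qed
  note d = this
  have "((\<lambda>s. Lt s (\<Theta> (L s y) (L' s y)) \<bullet> J y) has_integral (G (L 1 y) - G (L 0 y))) {0..1}"
    by (rule fundamental_theorem_of_calculus[OF _ has_vector_derivative_at_within[OF d]]) simp
  moreover have "b y \<bullet> J y = integral {0..1} (\<lambda>s. Lt s (\<Theta> (L s y) (L' s y)) \<bullet> J y)"
    using integral_linear[OF integrable_continuous_real[OF cont] bounded_linear_inner_left[of "J y"]]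
    by (simp add: o_def b_def)
  ultimately show "b y \<bullet> J y = G (L 1 y) - G (L 0 y)" by (simp add: integral_unique)
qed

end

context line_hopf begin

lemma Sb_near: "\<bar>Sb y - y \<bullet> y / 2\<bar> \<le> 5 * \<kappa> * (norm y)\<^sup>2"
proof -
  define f where "f t = Sb (t *\<^sub>R y) - t\<^sup>2 * (y \<bullet> y) / 2" for t :: real
  have "norm (f 1 - f 0) \<le> (5 * \<kappa> * norm y * norm y) * 1"
  proof (rule displacement_bound)
    fix t :: real assume t: "0 \<le> t" "t \<le> 1"
    have "((\<lambda>t. Sb (t *\<^sub>R y)) has_vector_derivative dd Sb (t *\<^sub>R y) y) (at t)"
      using dd_line[where f = Sb and x = 0 and t = t and w = y, OF Cinf_differentiable[OF Cinf_Sb UNIV_I]] by simp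
    moreover have "((\<lambda>t. t\<^sup>2 * (y \<bullet> y) / 2) has_vector_derivative t * (y \<bullet> y)) (at t)"
      unfolding has_real_derivative_iff_has_vector_derivative[symmetric] by (auto intro!: derivative_eq_intros)
    ultimately show "(f has_vector_derivative (dd Sb (t *\<^sub>R y) y - t * (y \<bullet> y))) (at t)"
      unfolding f_def by (rule has_vector_derivative_diff)
    have "dd Sb (t *\<^sub>R y) y - t * (y \<bullet> y) = - ((Ob (t *\<^sub>R y) (J (t *\<^sub>R y)) - J (J (t *\<^sub>R y))) \<bullet> y)"
      by (simp add: dd_Sb inner_diff_left inner_add_left)
    also have "norm \<dots> \<le> norm (Ob (t *\<^sub>R y) (J (t *\<^sub>R y)) - J (J (t *\<^sub>R y))) * norm y"
      unfolding norm_minus_cancel unfolding real_norm_def by (rule Cauchy_Schwarz_ineq2)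
    also have "\<dots> \<le> (5 * \<kappa> * norm (J (t *\<^sub>R y))) * norm y" by (rule mult_right_mono[OF Ob_near norm_ge_zero])
    also have "\<dots> \<le> (5 * \<kappa> * norm y) * norm y"
      using t \<kappa>0 by (intro mult_right_mono mult_left_mono) (auto simp: mult_left_le_one_le)
    finally show "norm (dd Sb (t *\<^sub>R y) y - t * (y \<bullet> y)) \<le> 5 * \<kappa> * norm y * norm y" .
  qed simp
  moreover have "Sb 0 = 0" by (simp add: Sb_def)
  ultimately show ?thesis by (simp add: f_def power2_eq_square)
qed

lemma \<sigma>_near: "\<bar>\<sigma> - 1\<bar> \<le> 10 * \<kappa>"
  using Sb_near[of e] by (simp add: \<sigma>_def norm_e)

text \<open>The primitive \<open>b\<close> of \<open>Ob - \<sigma> J\<close> is obtained by contracting first to the complex line and then to the origin. The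
  second part \<open>b1\<close> takes values in the line and is orthogonal to \<open>P y\<close> and \<open>J (P y)\<close> when \<open>P y\<close> lies in the
  shell, so it vanishes there and \<open>b\<close> is bounded by the distance to the line.\<close>

lemma stage_v0:
  obtains v v' where "Cinf UNIV v" "Cinf UNIV v'" "\<And>y. v' (v y) = y" "\<And>y. v (v' y) = y"
    "\<And>y a b. Ob (v y) (dd v y a) \<bullet> dd v y b = \<sigma> * (J a \<bullet> b)"
    "\<And>y. norm (v y - y) \<le> 360 * \<kappa> * norm y"
    "\<And>y. Sb (v y) = \<sigma> / 2 * (y \<bullet> y)"
    "\<And>y. 75 / 100 \<le> norm y \<Longrightarrow> norm y \<le> 14 / 10 \<Longrightarrow> norm (N (v y)) \<le> 2 * norm (N y)"
proof -
  define Jb where "Jb = \<sigma> *\<^sub>R mkbl J"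
  have Jb: "Jb v = \<sigma> *\<^sub>R J v" for v by (simp add: Jb_def blinfun.scaleR_left mkbl_apply[OF J_linear])
  have fJ: "form2 (\<lambda>y. Jb)" 
  proof (rule form2_const)
    show "Jb v \<bullet> w = - (Jb w \<bullet> v)" for v w
      unfolding Jb inner_scaleR_left J_skew[of v w] by (simp add: inner_commute)
  qed
  define \<Theta> where "\<Theta> y = Ob y - Jb" for y
  have f\<Theta>: "form2 \<Theta>" unfolding \<Theta>_def[abs_def] by (rule form2_diff[OF form2_Ob fJ])
  have \<Theta>: "\<Theta> y v = Ob y v - \<sigma> *\<^sub>R J v" for y v by (simp add: \<Theta>_def blinfun.diff_left Jb)
  have \<Theta>_le: "norm (\<Theta> y v) \<le> 15 * \<kappa> * norm v" for y v
  proof -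
    have "\<Theta> y v = (Ob y v - J v) - (\<sigma> - 1) *\<^sub>R J v" by (simp add: \<Theta> algebra_simps)
    then have "norm (\<Theta> y v) \<le> norm (Ob y v - J v) + \<bar>\<sigma> - 1\<bar> * norm v"
      by (metis norm_triangle_ineq4 norm_scaleR norm_J)
    also have "\<dots> \<le> 5 * \<kappa> * norm v + 10 * \<kappa> * norm v" by (intro add_mono Ob_near mult_right_mono \<sigma>_near) simp
    finally show ?thesis by simp
  qed
  define G where "G y = Sb y - \<sigma> / 2 * (y \<bullet> y)" for y
  define F0 where "F0 y = \<sigma> / 2 * (y \<bullet> y)" for y :: 'a
  have F0: "Cinf UNIV F0"
    unfolding F0_def[abs_def]
    by (rule Cinf_mult[OF open_UNIV Cinf_const Cinf_inner[OF open_UNIV Cinf_ident[OF open_UNIV] Cinf_ident[OF open_UNIV]]])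
  have F0': "(F0 has_derivative (\<lambda>v. \<sigma> * (y \<bullet> v))) (at y)" for y
    unfolding F0_def[abs_def] by (auto intro!: derivative_eq_intros simp: inner_commute)
  have G': "(G has_derivative (\<lambda>v. \<Theta> y v \<bullet> J y)) (at y)" for y
  proof -
    have "(G has_derivative (\<lambda>v. dd Sb y v - \<sigma> * (y \<bullet> v))) (at y)"
      unfolding G_def[abs_def] F0_def[symmetric]
      by (rule has_derivative_diff[OF Cinf_has_derivative[OF Cinf_Sb UNIV_I] F0'])
    moreover have "dd Sb y v - \<sigma> * (y \<bullet> v) = \<Theta> y v \<bullet> J y" for v
      using form2_skew[OF form2_Ob, of y v "J y"]
      unfolding dd_Sb \<Theta> inner_diff_left inner_scaleR_left J_inner by (simp add: inner_commute[of y v])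
    ultimately show ?thesis by simp
  qed
  define Pb Nb where "Pb = mkbl P" and "Nb = mkbl N"
  have Pb [simp]: "Pb x = P x" and Nb [simp]: "Nb x = N x" for x
    by (simp_all add: Pb_def Nb_def mkbl_apply P_linear N_linear)
  define L1 where "L1 s = s *\<^sub>R Pb" for s :: real
  define L2 where "L2 s = Pb + s *\<^sub>R Nb" for s :: real
  have cs: "Cinf UNIV (\<lambda>s :: real. s *\<^sub>R (A :: 'a \<Rightarrow>\<^sub>L 'a))" for A
    by (rule Cinf_scaleR[OF open_UNIV Cinf_ident[OF open_UNIV] Cinf_const])
  have cL1: "Cinf UNIV L1" unfolding L1_def[abs_def] by (rule cs)
  have cL2: "Cinf UNIV L2" unfolding L2_def[abs_def] by (rule Cinf_add[OF open_UNIV Cinf_const cs])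
  have L1: "L1 s x = s *\<^sub>R P x" and L2: "L2 s x = P x + s *\<^sub>R N x" for s x
    by (simp_all add: L1_def L2_def blinfun.scaleR_left blinfun.add_left)
  have dL1: "(L1 has_vector_derivative Pb) (at s)" for s
    unfolding L1_def[abs_def] has_vector_derivative_def by (auto intro!: derivative_eq_intros)
  have dL2: "(L2 has_vector_derivative Nb) (at s)" for s
    unfolding L2_def[abs_def] has_vector_derivative_def by (auto intro!: derivative_eq_intros)
  have t1: "L1 s x \<bullet> y = x \<bullet> L1 s y" and t2: "L2 s x \<bullet> y = x \<bullet> L2 s y" for s x y
    by (simp_all add: L1 L2 inner_add_left inner_add_right P_adj N_adj)
  have j1: "L1 s (J x) = J (L1 s x)" and j2: "L2 s (J x) = J (L2 s x)" for s x
    by (simp_all add: L1 L2 P_J N_J J_add J_scale)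
  define b1 where "b1 y = integral {0..1} (\<lambda>s. L1 s (\<Theta> (L1 s y) (Pb y)))" for y
  define b2 where "b2 y = integral {0..1} (\<lambda>s. L2 s (\<Theta> (L2 s y) (Nb y)))" for y
  note B1 = cartan_primitive[OF f\<Theta> cL1 Cinf_const cL1 dL1 t1 j1 G', folded b1_def[abs_def] b1_def]
  note B2 = cartan_primitive[OF f\<Theta> cL2 Cinf_const cL2 dL2 t2 j2 G', folded b2_def[abs_def] b2_def]
  define b where "b y = b1 y + b2 y" for y
  have cb: "Cinf UNIV b" unfolding b_def[abs_def] by (rule Cinf_add[OF open_UNIV B1(1) B2(1)])
  have L20: "L2 0 x = P x" "L2 1 x = x" for x by (simp_all add: L2 P_add_N)
  have cu: "curl b y v w = \<Theta> y v \<bullet> w" for y v w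
    unfolding b_def[abs_def] curl_add[OF B1(1) B2(1)] B1(2) B2(2) by (simp add: L1 L20)
  have G0: "G 0 = 0" by (simp add: G_def Sb_def)
  have b1J: "b1 y \<bullet> J y = G (P y)" for y unfolding B1(3) by (simp add: L1 G0)
  have bJ: "b y \<bullet> J y = G y" for y
    unfolding b_def inner_add_left b1J B2(3) by (simp add: L20)
  have n1: "norm (b1 y) \<le> 15 * \<kappa> * norm (P y)" for y
  proof (rule B1(4))
    fix s :: real assume s: "0 \<le> s" "s \<le> 1"
    have "norm (L1 s (\<Theta> (L1 s y) (Pb y))) = s * norm (P (\<Theta> (L1 s y) (P y)))" using s by (simp add: L1)
    also have "\<dots> \<le> 1 * norm (\<Theta> (L1 s y) (P y))" using s by (intro mult_mono norm_P) auto
    also have "\<dots> \<le> 15 * \<kappa> * norm (P y)" using \<Theta>_le by simp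
    finally show "norm (L1 s (\<Theta> (L1 s y) (Pb y))) \<le> 15 * \<kappa> * norm (P y)" .
  qed
  have n2: "norm (b2 y) \<le> 30 * \<kappa> * norm (N y)" for y
  proof (rule B2(4))
    fix s :: real assume s: "0 \<le> s" "s \<le> 1"
    let ?x = "\<Theta> (L2 s y) (N y)"
    have "norm (L2 s ?x) \<le> norm (P ?x) + s * norm (N ?x)"
      using norm_triangle_ineq[of "P ?x" "s *\<^sub>R N ?x"] s by (simp add: L2)
    also have "\<dots> \<le> norm ?x + 1 * norm ?x" using s by (intro add_mono mult_mono norm_P norm_N) auto
    also have "\<dots> \<le> 2 * (15 * \<kappa> * norm (N y))" using \<Theta>_le[of "L2 s y" "N y"] by simp
    finally show "norm (L2 s (\<Theta> (L2 s y) (Nb y))) \<le> 30 * \<kappa> * norm (N y)" by simp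
  qed
  have b_le: "norm (b y) \<le> 45 * \<kappa> * norm y" for y
  proof -
    have "norm (b y) \<le> 15 * \<kappa> * norm (P y) + 30 * \<kappa> * norm (N y)"
      unfolding b_def by (rule order_trans[OF norm_triangle_ineq add_mono[OF n1 n2]])
    also have "\<dots> \<le> 15 * \<kappa> * norm y + 30 * \<kappa> * norm y"
      using \<kappa>0 by (intro add_mono mult_left_mono norm_P norm_N) auto
    finally show ?thesis by simp
  qed
  have b1_0: "b1 y = 0" if y: "65 / 100 \<le> norm (P y)" "norm (P y) \<le> 15 / 10" for y
  proof (rule P_fixed_orthogonal[where p = "P y"])
    have "Cinf UNIV (\<lambda>s. L1 s y)" by (rule Cinf_blinfun_apply[OF open_UNIV cL1 Cinf_const])
    then have "Cinf UNIV (\<lambda>s. L1 s (\<Theta> (L1 s y) (Pb y)))"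
      by (rule Cinf_blinfun_apply[OF open_UNIV cL1 Cinf_blinfun_apply[OF open_UNIV
          Cinf_compose_UNIV[OF open_UNIV form2_Cinf[OF f\<Theta>]] Cinf_const]])
    then have cont: "continuous_on {0..1} (\<lambda>s. L1 s (\<Theta> (L1 s y) (Pb y)))"
      using Cinf_continuous continuous_on_subset by blast
    have "P (b1 y) \<bullet> z = b1 y \<bullet> z" for z
    proof -
      note integrable_continuous_real[OF cont]
      from integral_linear[OF this linear_conv_bounded_linear[THEN iffD1, OF P_linear]]
      have "P (b1 y) = integral {0..1} (\<lambda>s. P (L1 s (\<Theta> (L1 s y) (Pb y))))"
        by (simp add: o_def b1_def)
      also have "\<dots> = b1 y" by (simp add: b1_def L1 linear_scale[OF P_linear])
      finally show ?thesis by simp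
    qed
    then show "P (b1 y) = b1 y" by (meson vector_eq_rdot)
    show "P (P y) = P y" by simp
    show "P y \<noteq> 0" using y by auto
    have "b1 (P y) = b1 y" by (simp add: b1_def L1)
    show "b1 y \<bullet> J (P y) = 0"
    proof -
      have "G (P y) = 0" using on_line(2)[of "P y"] y by (simp add: G_def)
      then show ?thesis using b1J[of "P y"] \<open>b1 (P y) = b1 y\<close> by simp
    qed
    show "b1 y \<bullet> P y = 0"
    proof -
      have "b1 y \<bullet> P y = integral {0..1} (\<lambda>s. L1 s (\<Theta> (L1 s y) (Pb y)) \<bullet> P y)"
        using integral_inner[OF cont] by (simp add: b1_def)
      also have "(\<lambda>s. L1 s (\<Theta> (L1 s y) (Pb y)) \<bullet> P y) = (\<lambda>s. 0)"
      proof
        fix s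
        have "\<Theta> (s *\<^sub>R P y) (P y) \<bullet> P y = 0"
          using form2_skew[OF f\<Theta>, of "s *\<^sub>R P y" "P y" "P y"] by simp
        then show "L1 s (\<Theta> (L1 s y) (Pb y)) \<bullet> P y = 0" by (simp add: L1 P_adj)
      qed
      finally show ?thesis by simp
    qed
  qed
  have bN: "norm (b y) \<le> 300 * \<kappa> * norm (N y)" if y: "7 / 10 \<le> norm y" "norm y \<le> 15 / 10" for y
  proof (cases "65 / 100 \<le> norm (P y)")
    case True
    then have "b y = b2 y" using b1_0[of y] norm_P[of y] y by (simp add: b_def)
    then have "norm (b y) \<le> 30 * (\<kappa> * norm (N y))" using n2[of y] by simp
    also have "\<dots> \<le> 300 * (\<kappa> * norm (N y))" using \<kappa>0 by (intro mult_right_mono) auto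
    finally show ?thesis by simp
  next
    case False
    have n: "25 / 100 \<le> norm (N y)" by (rule N_large[OF y(1) False])
    have "norm (b y) \<le> (45 * \<kappa>) * norm y" by (rule b_le)
    \<comment> \<open>\<open>norm y \<le> 15/10\<close> and \<open>norm (N y) \<ge> 1/4\<close> give
      the factor 6.\<close>
    also have "\<dots> \<le> (45 * \<kappa>) * (6 * norm (N y))" using y n \<kappa>0 by (intro mult_left_mono) linarith+
    also have "\<dots> = 270 * (\<kappa> * norm (N y))" by simp
    also have "\<dots> \<le> 300 * (\<kappa> * norm (N y))" using \<kappa>0 by (intro mult_right_mono) auto
    finally show ?thesis by simp
  qed
  have near: "norm (Jb v - J v) \<le> norm v / 6" "norm (Ob y v - J v) \<le> norm v / 6" for y v
  proof -
    have "Jb v - J v = (\<sigma> - 1) *\<^sub>R J v" by (simp add: Jb scaleR_left_diff_distrib)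
    then have "norm (Jb v - J v) = \<bar>\<sigma> - 1\<bar> * norm v" by simp
    also have "\<dots> \<le> (1 / 6) * norm v" using \<sigma>_near \<kappa> by (intro mult_right_mono) auto
    finally show "norm (Jb v - J v) \<le> norm v / 6" by simp
    have "5 * \<kappa> * norm v \<le> (1 / 6) * norm v" using \<kappa> by (intro mult_right_mono) auto
    then show "norm (Ob y v - J v) \<le> norm v / 6" using Ob_near[of y v] by simp
  qed
  have growth: "norm (b y) \<le> 1 * (1 + norm y)" for y
  proof -
    have "45 * \<kappa> * norm y \<le> 1 * norm y" using \<kappa> by (intro mult_right_mono) auto
    then show ?thesis using b_le[of y] by simp
  qed
  have curl: "curl b y v w = Ob y v \<bullet> w - Jb v \<bullet> w" for y v w
    by (simp add: cu \<Theta> Jb inner_diff_left)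
  have d0: "dd F0 y v = - (Jb (J y) \<bullet> v)" for y v by (simp add: ddI[OF F0'] Jb)
  have d1: "dd Sb y v = - (Ob y (J y) \<bullet> v) - 0 \<bullet> v" for y v by (simp add: dd_Sb)
  obtain m m' w' E where m: "Cinf UNIV (m (pi/2))" "Cinf UNIV w'" "\<And>y. w' (m (pi/2) y) = y" "\<And>y. m (pi/2) (w' y) = y" "\<And>y. m 0 y = y"
    "\<And>\<tau> y. ((\<lambda>\<tau>. m \<tau> y) has_vector_derivative m' \<tau> y) (at \<tau>)"
    "\<And>\<tau> y. norm (m' \<tau> y) \<le> 2 * norm (b (m \<tau> y))"
    "\<And>y v w. Ob (m (pi/2) y) (dd (m (pi/2)) y v) \<bullet> dd (m (pi/2)) y w = Jb v \<bullet> w"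
    "\<And>\<tau> y. ((\<lambda>\<tau>. F0 (m \<tau> y) + sin \<tau> * (Sb (m \<tau> y) - F0 (m \<tau> y))) has_vector_derivative
       cos \<tau> * (Sb (m \<tau> y) - F0 (m \<tau> y) - b (m \<tau> y) \<bullet> J (m \<tau> y) + E \<tau> y)) (at \<tau>)"
    "\<And>\<tau> y. \<bar>E \<tau> y\<bar> \<le> 2 * norm (0 :: 'a) * norm (b (m \<tau> y))"
    by (rule moser_energy[OF fJ form2_Ob cb curl near growth F0 Cinf_Sb d0 d1]) (rule that)
  have pi2: "0 \<le> \<tau> \<Longrightarrow> \<tau> \<le> pi / 2 \<Longrightarrow> \<tau> \<le> 2" for \<tau> :: real using pi_less_4 by linarith
  have disp: "norm (m \<tau> y - y) \<le> 360 * \<kappa> * norm y" if \<tau>: "0 \<le> \<tau>" "\<tau> \<le> pi / 2" for \<tau> y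
  proof -
    have "norm (m \<tau> y - m 0 y) \<le> 2 * (90 * \<kappa>) * \<tau> * norm (m 0 y)"
    proof (rule gronwall_displacement(1)[OF \<tau>(1) m(6)])
      show "norm (m' s y) \<le> 90 * \<kappa> * norm (m s y)" for s
        using m(7)[of s y] b_le[of "m s y"] by linarith
      have "90 * \<kappa> * \<tau> \<le> 90 * (1 / 1000000) * 2" using \<kappa> \<kappa>0 \<tau> pi2[OF \<tau>] by (intro mult_mono) auto
      then show "90 * \<kappa> * \<tau> \<le> 1 / 2" by simp
    qed (simp add: \<kappa>0)
    also have "\<dots> \<le> 2 * (90 * \<kappa>) * 2 * norm (m 0 y)"
      using pi2[OF \<tau>] \<kappa>0 by (intro mult_right_mono mult_left_mono) auto
    finally show ?thesis by (simp add: m(5))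
  qed
  have NN: "norm (N (m (pi/2) y)) \<le> 2 * norm (N y)" if y: "75 / 100 \<le> norm y" "norm y \<le> 14 / 10" for y
  proof -
    have sh: "7 / 10 \<le> norm (m \<tau> y)" "norm (m \<tau> y) \<le> 15 / 10" if \<tau>: "0 \<le> \<tau>" "\<tau> \<le> pi / 2" for \<tau>
    proof -
      have "360 * \<kappa> * norm y \<le> 360 * (1 / 1000000) * 2" using y \<kappa> \<kappa>0 by (intro mult_mono) auto
      then have "\<bar>norm (m \<tau> y) - norm y\<bar> \<le> 720 / 1000000" 
        using disp[OF \<tau>, of y] norm_triangle_ineq3[of "m \<tau> y" y] by linarith
      then show "7 / 10 \<le> norm (m \<tau> y)" "norm (m \<tau> y) \<le> 15 / 10" using y by linarith+
    qed
    have "norm (N (m (pi/2) y)) \<le> 2 * norm (N (m 0 y))"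
    proof (rule gronwall_displacement(2)[where m = "\<lambda>\<tau>. N (m \<tau> y)" and m' = "\<lambda>\<tau>. N (m' \<tau> y)" and L = "600 * \<kappa>"])
      show "((\<lambda>\<tau>. N (m \<tau> y)) has_vector_derivative N (m' s y)) (at s)" for s
        by (rule bounded_linear.has_vector_derivative[OF linear_conv_bounded_linear[THEN iffD1, OF N_linear] m(6)])
      show "norm (N (m' s y)) \<le> 600 * \<kappa> * norm (N (m s y))" if "0 \<le> s" "s \<le> pi/2" for s
        using norm_N[of "m' s y"] m(7)[of s y] bN[OF sh[OF that]] by linarith
      have "600 * \<kappa> * (pi/2) \<le> 600 * (1 / 1000000) * 2" using \<kappa> \<kappa>0 pi_less_4 by (intro mult_mono) auto
      then show "600 * \<kappa> * (pi/2) \<le> 1 / 2" by simp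
    qed (simp_all add: \<kappa>0)
    then show ?thesis by (simp add: m(5))
  qed
  \<comment> \<open>Here the energy identity has no error term, and \<open>b z \<bullet> J z\<close>
    is exactly the difference of the two Hamiltonians, so their interpolation is constant along the
    isotopy.\<close>
  have S: "Sb (m (pi/2) y) = \<sigma> / 2 * (y \<bullet> y)" for y
  proof -
    have "Sb z - F0 z = b z \<bullet> J z" for z by (simp add: bJ G_def F0_def)
    moreover have "E \<tau> y = 0" for \<tau> using m(10)[of \<tau> y] by simp
    ultimately have "((\<lambda>\<tau>. F0 (m \<tau> y) + sin \<tau> * (Sb (m \<tau> y) - F0 (m \<tau> y))) has_vector_derivative 0) (at \<tau>)" for \<tau>
      using m(9)[of y \<tau>] by simp
    from vector_derivative_zero_eq[OF this, of "pi/2" 0] show ?thesis by (simp add: m(5) F0_def)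
  qed
  show ?thesis
    by (rule that[of "m (pi/2)" w', OF m(1-4) _ disp S NN]) (use m(8) in \<open>auto simp: Jb\<close>)
qed

end

context line_hopf begin

text \<open>The composition of \<open>v\<close>, \<open>w\<close> and \<open>r\<close> pulls the
  standard form back to \<open>\<sigma>\<close> times itself, and \<open>Sb (v y)\<close> is
  \<open>\<sigma> / 2\<close> times the squared norm of \<open>y\<close>. The dilation by
  \<open>1 / sqrt \<sigma>\<close> removes both factors at once.\<close>

theorem normal_form:
  obtains F F' where "Cinf UNIV F" "Cinf UNIV F'" "\<And>y. F' (F y) = y" "\<And>y. F (F' y) = y"
    "\<And>y a b. J (dd F y a) \<bullet> dd F y b = J a \<bullet> b"
    "\<And>y. norm (F y - y) \<le> 1000 * \<kappa> * norm y"
    "\<And>y. 8 / 10 \<le> norm y \<Longrightarrow> norm y \<le> 13 / 10 \<Longrightarrow> (norm y)\<^sup>2 / 2 \<le> H (F y)"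
    "\<And>y. 8 / 10 \<le> norm y \<Longrightarrow> norm y \<le> 13 / 10 \<Longrightarrow> H (F y) \<le> (norm y)\<^sup>2 / 2 + (norm (N y))\<^sup>2 / 2"
proof -
  obtain w w' where w: "Cinf UNIV w" "Cinf UNIV w'" "\<And>y. w' (w y) = y" "\<And>y. w (w' y) = y"
    "\<And>y a b. Om (w y) (dd w y a) \<bullet> dd w y b = Ob y a \<bullet> b"
    "\<And>y. norm (w y - y) \<le> 256 * \<kappa> * norm y"
    "\<And>y. 75 / 100 \<le> norm y \<Longrightarrow> norm y \<le> 14 / 10 \<Longrightarrow> Sb y \<le> Hr (w y)"
    "\<And>y. 75 / 100 \<le> norm y \<Longrightarrow> norm y \<le> 14 / 10 \<Longrightarrow> Hr (w y) \<le> Sb y + 1200 * \<kappa> * (norm (N y))\<^sup>2"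
    by (rule stage_w) (rule that)
  obtain v v' where v: "Cinf UNIV v" "Cinf UNIV v'" "\<And>y. v' (v y) = y" "\<And>y. v (v' y) = y"
    "\<And>y a b. Ob (v y) (dd v y a) \<bullet> dd v y b = \<sigma> * (J a \<bullet> b)"
    "\<And>y. norm (v y - y) \<le> 360 * \<kappa> * norm y"
    "\<And>y. Sb (v y) = \<sigma> / 2 * (y \<bullet> y)"
    "\<And>y. 75 / 100 \<le> norm y \<Longrightarrow> norm y \<le> 14 / 10 \<Longrightarrow> norm (N (v y)) \<le> 2 * norm (N y)"
    by (rule stage_v0) (rule that)
  define q where "q = sqrt \<sigma>"
  have \<sigma>: "99 / 100 \<le> \<sigma>" "\<sigma> \<le> 101 / 100" using \<sigma>_near \<kappa> by linarith+
  have q2: "q * q = \<sigma>" using \<sigma> by (simp add: q_def)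
  have q0: "0 < q" using \<sigma> by (simp add: q_def)
  have q1: "\<bar>q - 1\<bar> \<le> 10 * \<kappa>"
  proof -
    have "(q - 1) * (q + 1) = \<sigma> - 1" using q2 by (simp add: algebra_simps)
    then have "\<bar>q - 1\<bar> * (q + 1) = \<bar>\<sigma> - 1\<bar>" using q0 by (metis abs_mult abs_of_pos add_pos_pos zero_less_one)
    moreover have "\<bar>q - 1\<bar> * 1 \<le> \<bar>q - 1\<bar> * (q + 1)" using q0 by (intro mult_left_mono) auto
    ultimately show ?thesis using \<sigma>_near by simp
  qed
  have q3: "99 / 100 \<le> q" using q1 \<kappa> by linarith
  define p where "p = 1 / q"
  have pq: "p * q = 1" using q0 by (simp add: p_def)
  have p0: "0 < p" using q0 by (simp add: p_def)
  have p1: "\<bar>p - 1\<bar> \<le> 20 * \<kappa>"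
  proof -
    have "p - 1 = p * (1 - q)" using pq by (simp add: algebra_simps)
    then have "\<bar>p - 1\<bar> = p * \<bar>q - 1\<bar>" using p0 by (simp add: abs_mult abs_minus_commute)
    also have "p \<le> 2" using q3 by (simp add: p_def divide_simps)
    then have "p * \<bar>q - 1\<bar> \<le> 2 * (10 * \<kappa>)" using q1 by (intro mult_mono) auto
    finally show ?thesis by simp
  qed
  have p2: "p * p * \<sigma> = 1" using pq q2 by (metis mult.assoc mult.commute mult_1)
  define F where "F y = r (w (v (p *\<^sub>R y)))" for y
  define F' where "F' x = q *\<^sub>R v' (w' (u x))" for x
  have sc: "Cinf UNIV (\<lambda>y :: 'a. c *\<^sub>R y)" for c by (rule Cinf_linear[OF bounded_linear_scaleR_right open_UNIV])
  note CU = Cinf_compose_UNIV[OF open_UNIV]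
  have dF: "dd F y a = dd r (w (v (p *\<^sub>R y))) (dd w (v (p *\<^sub>R y)) (dd v (p *\<^sub>R y) (p *\<^sub>R a)))" for y a
    unfolding F_def[abs_def]
    by (rule fun_cong[OF ddI[OF has_derivative_compose[OF has_derivative_compose[OF has_derivative_compose[OF
        bounded_linear_imp_has_derivative[OF bounded_linear_scaleR_right] Cinf_has_derivative[OF v(1) UNIV_I]]
        Cinf_has_derivative[OF w(1) UNIV_I]] Cinf_has_derivative[OF Cinf_r UNIV_I]]]])
  have vy: "norm (v (p *\<^sub>R y) - y) \<le> 500 * \<kappa> * norm y" "norm (p *\<^sub>R y - y) \<le> 20 * \<kappa> * norm y" for y
  proof -
    have "p *\<^sub>R y - y = (p - 1) *\<^sub>R y" by (simp add: scaleR_left_diff_distrib)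
    then show 1: "norm (p *\<^sub>R y - y) \<le> 20 * \<kappa> * norm y" using mult_right_mono[OF p1, of "norm y"] by simp
    have "p \<le> 11 / 10" using p1 \<kappa> by linarith
    then have "p * norm y \<le> 11 / 10 * norm y" by (rule mult_right_mono) simp
    then have "norm (p *\<^sub>R y) \<le> 11 / 10 * norm y" using p0 by simp
    then have "360 * \<kappa> * norm (p *\<^sub>R y) \<le> 360 * \<kappa> * (11 / 10 * norm y)" using \<kappa>0 by (intro mult_left_mono) auto
    then have "norm (v (p *\<^sub>R y) - p *\<^sub>R y) \<le> 396 * (\<kappa> * norm y)" using v(6)[of "p *\<^sub>R y"] by simp
    moreover have "norm (v (p *\<^sub>R y) - y) \<le> norm (v (p *\<^sub>R y) - p *\<^sub>R y) + norm (p *\<^sub>R y - y)"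
      using norm_triangle_ineq[of "v (p *\<^sub>R y) - p *\<^sub>R y" "p *\<^sub>R y - y"] by simp
    moreover have "0 \<le> \<kappa> * norm y" using \<kappa>0 by simp
    ultimately show "norm (v (p *\<^sub>R y) - y) \<le> 500 * \<kappa> * norm y" using 1 by linarith
  qed
  have SF: "Sb (v (p *\<^sub>R y)) = (norm y)\<^sup>2 / 2" for y
  proof -
    have "Sb (v (p *\<^sub>R y)) = (p * p * \<sigma>) * (y \<bullet> y) / 2" unfolding v(7) by simp
    then show ?thesis unfolding p2 by (simp add: power2_norm_eq_inner)
  qed
  have small: "1000 * \<kappa> * norm y \<le> 2 / 1000" if "norm y \<le> 13 / 10" for y :: 'a
  proof -
    have "1000 * \<kappa> * norm y \<le> 1000 * (1 / 1000000) * 2" using that \<kappa> \<kappa>0 by (intro mult_mono) auto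
    then show ?thesis by simp
  qed
  have sh: "75 / 100 \<le> norm (p *\<^sub>R y)" "norm (p *\<^sub>R y) \<le> 14 / 10" "75 / 100 \<le> norm (v (p *\<^sub>R y))" "norm (v (p *\<^sub>R y)) \<le> 14 / 10"
    if y: "8 / 10 \<le> norm y" "norm y \<le> 13 / 10" for y
  proof -
    have "0 \<le> \<kappa> * norm y" using \<kappa>0 by simp
    then have "\<bar>norm (p *\<^sub>R y) - norm y\<bar> \<le> 2 / 1000" "\<bar>norm (v (p *\<^sub>R y)) - norm y\<bar> \<le> 2 / 1000"
      using vy[of y] small[OF y(2)] norm_triangle_ineq3[of "p *\<^sub>R y" y] norm_triangle_ineq3[of "v (p *\<^sub>R y)" y] by linarith+
    then show "75 / 100 \<le> norm (p *\<^sub>R y)" "norm (p *\<^sub>R y) \<le> 14 / 10" "75 / 100 \<le> norm (v (p *\<^sub>R y))" "norm (v (p *\<^sub>R y)) \<le> 14 / 10"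
      using y by linarith+
  qed
  show ?thesis
  proof (rule that[of F F'])
    show "Cinf UNIV F" unfolding F_def[abs_def] by (rule CU[OF Cinf_r CU[OF w(1) CU[OF v(1) sc]]])
    show "Cinf UNIV F'" unfolding F'_def[abs_def] by (rule CU[OF sc CU[OF v(2) CU[OF w(2) Cinf_u]]])
    show "F' (F y) = y" for y using pq by (simp add: F_def F'_def w v mult.commute)
    show "F (F' y) = y" for y using pq by (simp add: F_def F'_def w v)
    show "J (dd F y a) \<bullet> dd F y b = J a \<bullet> b" for y a b
    proof -
      have "J (dd F y a) \<bullet> dd F y b = \<sigma> * (J (p *\<^sub>R a) \<bullet> (p *\<^sub>R b))"
        unfolding dF Om_inner[symmetric] w(5) v(5) ..
      also have "\<dots> = (p * p * \<sigma>) * (J a \<bullet> b)" by (simp add: J_scale)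
      finally show ?thesis unfolding p2 by simp
    qed
    show "norm (F y - y) \<le> 1000 * \<kappa> * norm y" for y
    proof -
      define V W where "V = v (p *\<^sub>R y)" and "W = w V"
      have k: "0 \<le> \<kappa> * norm y" using \<kappa>0 by simp
      have ky: "\<kappa> * norm y \<le> (1 / 1000000) * norm y" by (rule mult_right_mono[OF \<kappa> norm_ge_zero])
      have V: "norm (V - y) \<le> 500 * (\<kappa> * norm y)" using vy(1)[of y] by (simp add: V_def)
      then have nV: "norm V \<le> 11 / 10 * norm y" using norm_triangle_sub[of V y] ky norm_ge_zero[of y] by linarith
      have kV: "\<kappa> * norm V \<le> 11 / 10 * (\<kappa> * norm y)" using mult_left_mono[OF nV \<kappa>0] by simp
      have W: "norm (W - V) \<le> 256 * (\<kappa> * norm V)" using w(6)[of V] by (simp add: W_def)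
      then have nW: "norm W \<le> 2 * norm y" using norm_triangle_sub[of W V] kV nV ky norm_ge_zero[of y] by linarith
      have kW: "\<kappa> * norm W \<le> 2 * (\<kappa> * norm y)" using mult_left_mono[OF nW \<kappa>0] by simp
      have "norm (r W - W) \<le> 2 * (\<kappa> * norm W)" using r_near[of W] by simp
      moreover have "norm (r W - y) \<le> norm (r W - W) + (norm (W - V) + norm (V - y))"
        using norm_triangle_ineq[of "r W - W" "W - y"] norm_triangle_ineq[of "W - V" "V - y"] by simp
      ultimately have "norm (r W - y) \<le> 1000 * (\<kappa> * norm y)" using k V W kV kW by linarith
      then show ?thesis by (simp add: F_def W_def V_def)
    qed
    fix y :: 'a assume y: "8 / 10 \<le> norm y" "norm y \<le> 13 / 10"
    have e: "H (F y) = Hr (w (v (p *\<^sub>R y)))" by (simp add: F_def Hr_def)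
    show "(norm y)\<^sup>2 / 2 \<le> H (F y)" unfolding e SF[symmetric] by (rule w(7)[OF sh(3,4)[OF y]])
    have "Hr (w (v (p *\<^sub>R y))) \<le> Sb (v (p *\<^sub>R y)) + 1200 * \<kappa> * (norm (N (v (p *\<^sub>R y))))\<^sup>2"
      by (rule w(8)[OF sh(3,4)[OF y]])
    moreover have "1200 * \<kappa> * (norm (N (v (p *\<^sub>R y))))\<^sup>2 \<le> (norm (N y))\<^sup>2 / 2"
    proof -
      have "p \<le> 11 / 10" using p1 \<kappa> by linarith
      then have "p * norm (N y) \<le> 11 / 10 * norm (N y)" by (rule mult_right_mono) simp
      then have "norm (N (p *\<^sub>R y)) \<le> 11 / 10 * norm (N y)"
        unfolding linear_scale[OF N_linear] using p0 by simp
      then have "norm (N (v (p *\<^sub>R y))) \<le> 3 * norm (N y)"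
        using v(8)[OF sh(1,2)[OF y]] norm_ge_zero[of "N y"] by linarith
      then have "1200 * \<kappa> * (norm (N (v (p *\<^sub>R y))))\<^sup>2 \<le> 1200 * (1 / 1000000) * (3 * norm (N y))\<^sup>2"
        using \<kappa> \<kappa>0 by (intro mult_mono power_mono) auto
      also have "\<dots> \<le> (norm (N y))\<^sup>2 / 2" by (simp add: power2_eq_square)
      finally show ?thesis .
    qed
    ultimately show "H (F y) \<le> (norm y)\<^sup>2 / 2 + (norm (N y))\<^sup>2 / 2" unfolding e SF by linarith
  qed
qed

end

context near_hopf begin

section \<open>Choice of the dilation\<close>

lemma \<delta>_near:
  assumes "\<And>s. 0 \<le> s \<Longrightarrow> s \<le> 2 * pi \<Longrightarrow> norm (R (- s) (\<xi> (\<phi> s x)) - v) \<le> B"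
  shows "norm (\<delta> x - (2 * pi) *\<^sub>R v) \<le> B * (2 * pi)"
proof -
  have "norm ((\<zeta> (2 * pi) x - (2 * pi) *\<^sub>R v) - (\<zeta> 0 x - 0 *\<^sub>R v)) \<le> B * (2 * pi)"
  proof (rule displacement_bound[where m = "\<lambda>s. \<zeta> s x - s *\<^sub>R v" and m' = "\<lambda>s. R (- s) (\<xi> (\<phi> s x)) - v"])
    show "((\<lambda>s. \<zeta> s x - s *\<^sub>R v) has_vector_derivative R (- s) (\<xi> (\<phi> s x)) - v) (at s)" for s
      using has_vector_derivative_diff[OF \<zeta>_deriv has_vector_derivative_scaleR[OF DERIV_ident has_vector_derivative_const]]
      by simp
  qed (use assms in auto)
  then show ?thesis by (simp add: \<delta>_def algebra_simps)
qed

lemma H_lip: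
  assumes "norm x \<le> 2" "norm y \<le> 2"
  shows "\<bar>H x - H y\<bar> \<le> 4 * norm (x - y)"
proof -
  have "norm (H (y + 1 *\<^sub>R (x - y)) - H (y + 0 *\<^sub>R (x - y))) \<le> (4 * norm (x - y)) * 1"
  proof (rule displacement_bound)
    fix t :: real assume t: "0 \<le> t" "t \<le> 1"
    let ?z = "y + t *\<^sub>R (x - y)"
    have "((\<lambda>t. y + t *\<^sub>R (x - y)) has_derivative (\<lambda>h. h *\<^sub>R (x - y))) (at t)" by (auto intro!: derivative_eq_intros)
    from has_derivative_compose[OF this H_deriv]
    show "((\<lambda>t. H (y + t *\<^sub>R (x - y))) has_vector_derivative (?z - J (\<xi> ?z)) \<bullet> (x - y)) (at t)"
      by (simp add: has_vector_derivative_def)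
    have "?z = (1 - t) *\<^sub>R y + t *\<^sub>R x" by (simp add: algebra_simps)
    then have "norm ?z \<le> (1 - t) * norm y + t * norm x"
      using norm_triangle_ineq[of "(1 - t) *\<^sub>R y" "t *\<^sub>R x"] t by simp
    also have "\<dots> \<le> (1 - t) * 2 + t * 2" using t assms by (intro add_mono mult_left_mono) auto
    finally have z: "norm ?z \<le> 2" by simp
    have "norm (?z - J (\<xi> ?z)) \<le> norm ?z + norm (\<xi> ?z)" using norm_triangle_ineq4[of ?z "J (\<xi> ?z)"] by simp
    also have "\<dots> \<le> norm ?z + \<epsilon> * norm ?z" using \<xi>_lip[of ?z 0] \<xi>_0 by simp
    also have "\<dots> \<le> 2 + 1 * 2" using z \<epsilon> \<kappa> by (intro add_mono mult_mono) auto
    finally have "norm (?z - J (\<xi> ?z)) * norm (x - y) \<le> 4 * norm (x - y)" by (intro mult_right_mono) auto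
    then show "norm ((?z - J (\<xi> ?z)) \<bullet> (x - y)) \<le> 4 * norm (x - y)"
      using Cauchy_Schwarz_ineq2[of "?z - J (\<xi> ?z)" "x - y"] by simp
  qed simp
  then show ?thesis by simp
qed

lemma loop:
  shows "((\<lambda>s. r (R s y)) has_vector_derivative dd r (R s y) (J (R s y))) (at s)"
    and "norm (dd r (R s y) (J (R s y))) \<le> 2 * norm y"
    and "continuous_on S (\<lambda>s. dd r (R s y) (J (R s y)))"
proof -
  show "((\<lambda>s. r (R s y)) has_vector_derivative dd r (R s y) (J (R s y))) (at s)"
    by (rule Cinf_along_curve[OF Cinf_r R_deriv])
  have "norm (dd r (R s y) (J (R s y))) \<le> norm y + 2 * \<kappa> * norm y"
    using dd_r[of "R s y" "J (R s y)"] norm_triangle_sub[of "dd r (R s y) (J (R s y))" "J (R s y)"] by simp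
  also have "2 * \<kappa> * norm y \<le> 1 * norm y" using \<kappa> by (intro mult_right_mono) auto
  finally show "norm (dd r (R s y) (J (R s y))) \<le> 2 * norm y" by simp
  have "Cinf UNIV (\<lambda>s. dd r (R s y) (J (R s y)))"
    by (rule Cinf_dd_compose[OF open_UNIV open_UNIV Cinf_r Cinf_R[OF open_UNIV Cinf_ident[OF open_UNIV] Cinf_const] _
          Cinf_J[OF open_UNIV Cinf_R[OF open_UNIV Cinf_ident[OF open_UNIV] Cinf_const]]]) simp
  then show "continuous_on S (\<lambda>s. dd r (R s y) (J (R s y)))"
    using Cinf_continuous continuous_on_subset by blast
qed

end

section \<open>The function \<open>\<Gamma>\<close> expressed through
  \<open>\<delta>'\<close>\<close>

context shell_hopf begin

lemma euler:
  assumes x: "1 / 2 < norm x" "norm x < 2"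
  shows "H x = 1 / 2 * (J x \<bullet> X x)"
proof -
  define S where "S = {t :: real. 0 < t \<and> 1 / 2 < t * norm x \<and> t * norm x < 2}"
  have S: "open S" unfolding S_def by (intro open_Collect_conj open_Collect_less continuous_intros)
  have 1: "1 \<in> S" using x by (simp add: S_def)
  have "((\<lambda>t. t *\<^sub>R x) has_derivative (\<lambda>h. h *\<^sub>R x)) (at 1)" by (auto intro!: derivative_eq_intros)
  note * = has_derivative_compose[OF this H_deriv]
  have "((\<lambda>t. t\<^sup>2 * H x) has_derivative (\<lambda>h. (1 *\<^sub>R x - J (\<xi> (1 *\<^sub>R x))) \<bullet> (h *\<^sub>R x))) (at 1)"
    by (rule has_derivative_transform_within_open[OF * S 1]) (use x in \<open>auto simp: S_def H_shell\<close>)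
  moreover have "((\<lambda>t. t\<^sup>2 * H x) has_derivative (\<lambda>h. 2 * h * H x)) (at 1)"
    by (auto intro!: derivative_eq_intros)
  ultimately have "(\<lambda>h. (1 *\<^sub>R x - J (\<xi> (1 *\<^sub>R x))) \<bullet> (h *\<^sub>R x)) = (\<lambda>h. 2 * h * H x)"
    by (rule has_derivative_unique)
  from fun_cong[OF this, of 1] have "(x - J (\<xi> x)) \<bullet> x = 2 * H x" by simp
  moreover have "J x \<bullet> X x = (x - J (\<xi> x)) \<bullet> x"
    using J_skew[of "\<xi> x" x] by (simp add: X_def inner_add_right inner_diff_left inner_diff_right inner_commute)
  ultimately show ?thesis by simp
qed

text \<open>By Euler's identity \<open>H\<close> is the action density of \<open>X\<close>, while
  the loop \<open>r (R s y)\<close> moves with velocity \<open>X\<close> minus the image of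
  \<open>\<delta>'\<close> under the differential of \<open>r\<close>. Only this last part
  contributes, so the sign of \<open>\<Gamma>\<close> can be read off from
  \<open>\<delta>'\<close>.\<close>

lemma \<Gamma>_formula:
  assumes y: "norm y = 1"
  shows "\<Gamma> y = avg (\<lambda>s. 1 / 2 * (J (r (R s y)) \<bullet> dd r (R s y) (\<delta>' (R s y))))"
proof -
  have "Hr z - a z \<bullet> J z = 1 / 2 * (J (r z) \<bullet> dd r z (\<delta>' z))" if z: "norm z = 1" for z
  proof -
    have "\<bar>norm (r z) - 1\<bar> \<le> 2 * \<kappa>" using r_norm[of z] z by simp
    then have b: "1 / 2 < norm (r z)" "norm (r z) < 2" using \<kappa> by linarith+
    have "dd r z (J z) = X (r z) - dd r z (\<delta>' z)"
      using dd_r_X[of z] by (simp add: linear_add[OF dd_r_linear] algebra_simps)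
    then have "J (r z) \<bullet> dd r z (J z) = J (r z) \<bullet> X (r z) - J (r z) \<bullet> dd r z (\<delta>' z)" by (simp only: inner_diff_right)
    then show ?thesis unfolding Hr_def euler[OF b] a_inner by linarith
  qed
  then have "Hr (R s y) - a (R s y) \<bullet> J (R s y) = 1 / 2 * (J (r (R s y)) \<bullet> dd r (R s y) (\<delta>' (R s y)))" for s
    using y by simp
  moreover have "\<Gamma> y = avg (\<lambda>s. Hr (R s y) - a (R s y) \<bullet> J (R s y))"
    by (simp add: \<Gamma>_def Hb_def Sb_def avg_diff comp_R_cont[OF Cinf_Hr] comp_R_cont[OF Cinf_aJ])
  ultimately show ?thesis by (simp only:)
qed

end

context cplx begin

text \<open>Integration by parts along the closed loops moves the derivative off \<open>l1 - l2\<close>, so no \<open>C\<^sup>1\<close>-closeness is needed.\<close>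

lemma action_lip:
  fixes l1 l2 :: "real \<Rightarrow> 'a"
  assumes l: "\<And>s. (l1 has_vector_derivative l1' s) (at s)" "\<And>s. (l2 has_vector_derivative l2' s) (at s)"
    and c: "continuous_on UNIV l1'" "continuous_on UNIV l2'"
    and closed: "l1 (2 * pi) = l1 0" "l2 (2 * pi) = l2 0"
    and B: "\<And>s. norm (l1' s) \<le> B" "\<And>s. norm (l2' s) \<le> B" and D: "\<And>s. norm (l1 s - l2 s) \<le> D"
  shows "\<bar>avg (\<lambda>s. J (l1 s) \<bullet> l1' s) - avg (\<lambda>s. J (l2 s) \<bullet> l2' s)\<bar> \<le> 2 * B * D"
proof -
  have cl: "continuous_on UNIV l1" "continuous_on UNIV l2"
    by (rule continuous_at_imp_continuous_on, use l has_vector_derivative_continuous in blast)+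
  note cJ = bounded_linear.continuous_on[OF J_bl]
  define g where "g s = J (l1 s - l2 s) \<bullet> l1' s - J (l2' s) \<bullet> (l1 s - l2 s)" for s
  define h where "h s = J (l2 s) \<bullet> (l1' s - l2' s) + J (l2' s) \<bullet> (l1 s - l2 s)" for s
  have cg: "continuous_on UNIV g" unfolding g_def by (intro continuous_on_diff continuous_on_inner cJ cl c)
  have ch: "continuous_on UNIV h" unfolding h_def by (intro continuous_on_diff continuous_on_add continuous_on_inner cJ cl c)
  have "((\<lambda>s. J (l2 s) \<bullet> (l1 s - l2 s)) has_vector_derivative h s) (at s)" for s
    unfolding h_def by (rule bounded_bilinear.has_vector_derivative[OF bounded_bilinear_inner
        bounded_linear.has_vector_derivative[OF J_bl l(2)] has_vector_derivative_diff[OF l]])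
  note dh = this
  have "(h has_integral (J (l2 (2 * pi)) \<bullet> (l1 (2 * pi) - l2 (2 * pi)) - J (l2 0) \<bullet> (l1 0 - l2 0))) {0..2 * pi}"
    by (rule fundamental_theorem_of_calculus[OF _ has_vector_derivative_at_within[OF dh]]) simp
  then have h0: "avg h = 0" by (simp add: avg_def integral_unique closed)
  have "avg (\<lambda>s. J (l1 s) \<bullet> l1' s) - avg (\<lambda>s. J (l2 s) \<bullet> l2' s) = avg (\<lambda>s. J (l1 s) \<bullet> l1' s - J (l2 s) \<bullet> l2' s)"
    by (rule avg_diff[symmetric]) (intro continuous_on_inner cJ cl c)+
  also have "(\<lambda>s. J (l1 s) \<bullet> l1' s - J (l2 s) \<bullet> l2' s) = (\<lambda>s. g s + h s)"
    by (simp add: g_def h_def J_diff inner_diff_left inner_diff_right fun_eq_iff)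
  also have "avg \<dots> = avg g" by (simp add: avg_add[OF cg ch] h0)
  finally have *: "avg (\<lambda>s. J (l1 s) \<bullet> l1' s) - avg (\<lambda>s. J (l2 s) \<bullet> l2' s) = avg g" .
  have "norm (avg g) \<le> 2 * B * D"
  proof (rule avg_norm[OF cg])
    fix s
    have B0: "0 \<le> B" using order_trans[OF norm_ge_zero B(1)] .
    have 1: "\<bar>J (l1 s - l2 s) \<bullet> l1' s\<bar> \<le> D * B"
      using Cauchy_Schwarz_ineq2[of "J (l1 s - l2 s)" "l1' s"] mult_mono[OF D[of s] B(1)[of s] order_trans[OF norm_ge_zero D] norm_ge_zero]
      by simp
    have 2: "\<bar>J (l2' s) \<bullet> (l1 s - l2 s)\<bar> \<le> B * D"
      using Cauchy_Schwarz_ineq2[of "J (l2' s)" "l1 s - l2 s"] mult_mono[OF B(2)[of s] D[of s] B0 norm_ge_zero] by simp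
    show "norm (g s) \<le> 2 * B * D" using 1 2 unfolding g_def real_norm_def by (simp add: algebra_simps)
  qed
  then show ?thesis unfolding * by simp
qed

end

text \<open>On the shell \<open>1/2 < \<bar>x\<bar> < 2\<close> the Hamiltonian \<open>Hc c\<close> below is \<open>c N\<close> with \<open>N x = \<bar>x\<bar>\<^sup>2/2 + q x\<close>.\<close>

locale hopf_family = cplx J for J :: "'a::euclidean_space \<Rightarrow> 'a" +
  fixes p q :: "'a \<Rightarrow> real" and L \<epsilon>0 c1 :: real
  assumes p: "Cinf UNIV p" and q: "Cinf UNIV q"
    and p_lip: "\<And>x y. norm (grad p x - grad p y) \<le> L * norm (x - y)" and p_0: "grad p 0 = 0"
    and q_lip: "\<And>x y. norm (grad q x - grad q y) \<le> \<epsilon>0 * norm (x - y)" and q_0: "grad q 0 = 0"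
    and p_shell: "\<And>x. 1 / 2 < norm x \<Longrightarrow> norm x < 2 \<Longrightarrow> p x = x \<bullet> x / 2"
    and q_shell: "\<And>t x. 0 < t \<Longrightarrow> 1 / 2 < norm x \<Longrightarrow> norm x < 2 \<Longrightarrow> 1 / 2 < t * norm x \<Longrightarrow> t * norm x < 2 \<Longrightarrow>
      q (t *\<^sub>R x) = t\<^sup>2 * q x"
    and L: "0 \<le> L" and \<epsilon>0: "0 \<le> \<epsilon>0" and c1: "0 < c1" "c1 * (1 + L) \<le> 1 / 100000000" "1000 * \<epsilon>0 \<le> c1"
begin

definition Hc :: "real \<Rightarrow> 'a \<Rightarrow> real" where "Hc c x = x \<bullet> x / 2 + (c - 1) * p x + c * q x"

definition \<xi>c :: "real \<Rightarrow> 'a \<Rightarrow> 'a" where "\<xi>c c x = J ((c - 1) *\<^sub>R grad p x + c *\<^sub>R grad q x)"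

lemma c1_small: "c1 \<le> 1 / 100000000" "c1 * L \<le> 1 / 100000000" "\<epsilon>0 \<le> 1 / 100000000000"
proof -
  have "0 \<le> c1 * L" using c1 L by simp
  then show "c1 \<le> 1 / 100000000" "c1 * L \<le> 1 / 100000000" using c1 by (simp_all add: algebra_simps)
  then show "\<epsilon>0 \<le> 1 / 100000000000" using c1(3) by simp
qed

lemma grad_p: "1 / 2 < norm x \<Longrightarrow> norm x < 2 \<Longrightarrow> grad p x = x"
proof -
  assume x: "1 / 2 < norm x" "norm x < 2"
  define S where "S = {z :: 'a. 1 / 2 < norm z \<and> norm z < 2}"
  have S: "open S" unfolding S_def by (intro open_Collect_conj open_Collect_less continuous_intros)
  have xS: "x \<in> S" using x by (simp add: S_def)
  have "((\<lambda>x. x \<bullet> x / 2) has_derivative (\<lambda>v. x \<bullet> v)) (at x)"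
    by (auto intro!: derivative_eq_intros simp: inner_commute)
  then have "(p has_derivative (\<lambda>v. x \<bullet> v)) (at x)"
    by (rule has_derivative_transform_within_open[OF _ S xS]) (auto simp: S_def p_shell)
  from ddI[OF this] have "grad p x \<bullet> v = x \<bullet> v" for v
    using grad[OF Cinf_differentiable[OF p UNIV_I], of x v] by simp
  then show "grad p x = x" by (meson vector_eq_rdot)
qed

text \<open>The Lipschitz constant of \<open>\<xi>c c\<close> is at most
  \<open>c1 * L + 2 * \<epsilon>0\<close>, which lies below \<open>1/10000000\<close>; ten times
  this number is the value of \<open>\<kappa>\<close>.\<close>

lemma shell_hopf_Hc:
  assumes c: "\<bar>c - 1\<bar> \<le> c1"
  shows "shell_hopf J (Hc c) (\<xi>c c) (1 / 10000000) (1 / 1000000)"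
proof (unfold_locales, goal_cases)
  case 1
  have "Cinf UNIV (\<lambda>x :: 'a. (x \<bullet> x) * (1 / 2))"
    by (rule Cinf_mult[OF open_UNIV Cinf_inner[OF open_UNIV Cinf_ident[OF open_UNIV] Cinf_ident[OF open_UNIV]] Cinf_const])
  from Cinf_add[OF open_UNIV Cinf_add[OF open_UNIV this Cinf_mult[OF open_UNIV Cinf_const p]] Cinf_mult[OF open_UNIV Cinf_const q]]
  show ?case unfolding Hc_def[abs_def] by simp
next
  case 2
  show ?case unfolding \<xi>c_def[abs_def]
    by (rule Cinf_J[OF open_UNIV Cinf_add[OF open_UNIV Cinf_scaleR[OF open_UNIV Cinf_const Cinf_grad[OF p]]
          Cinf_scaleR[OF open_UNIV Cinf_const Cinf_grad[OF q]]]])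
next
  case (3 x)
  have dp: "(p has_derivative (\<lambda>v. grad p x \<bullet> v)) (at x)" and dq: "(q has_derivative (\<lambda>v. grad q x \<bullet> v)) (at x)"
    using Cinf_has_derivative[OF p UNIV_I, of x] Cinf_has_derivative[OF q UNIV_I, of x]
    by (simp_all add: grad[OF Cinf_differentiable[OF p UNIV_I]] grad[OF Cinf_differentiable[OF q UNIV_I]])
  have "((\<lambda>x. x \<bullet> x / 2) has_derivative (\<lambda>v. x \<bullet> v)) (at x)"
    by (auto intro!: derivative_eq_intros simp: inner_commute)
  from has_derivative_add[OF has_derivative_add[OF this has_derivative_mult_right[OF dp]] has_derivative_mult_right[OF dq]]
  have "(Hc c has_derivative (\<lambda>v. x \<bullet> v + (c - 1) * (grad p x \<bullet> v) + c * (grad q x \<bullet> v))) (at x)"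
    unfolding Hc_def[abs_def] .
  then show ?case by (simp add: \<xi>c_def inner_add_left inner_diff_left algebra_simps)
next
  case (4 x y)
  have "\<xi>c c x - \<xi>c c y = J ((c - 1) *\<^sub>R (grad p x - grad p y) + c *\<^sub>R (grad q x - grad q y))"
    by (simp add: \<xi>c_def J_diff[symmetric] scaleR_diff_right add_diff_add)
  then have "norm (\<xi>c c x - \<xi>c c y) \<le> \<bar>c - 1\<bar> * norm (grad p x - grad p y) + \<bar>c\<bar> * norm (grad q x - grad q y)"
    using norm_triangle_ineq[of "(c - 1) *\<^sub>R (grad p x - grad p y)" "c *\<^sub>R (grad q x - grad q y)"] by simp
  also have "\<dots> \<le> c1 * (L * norm (x - y)) + 2 * (\<epsilon>0 * norm (x - y))"
    by (intro add_mono mult_mono c p_lip q_lip) (use c c1_small c1 L \<epsilon>0 in auto)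
  also have "\<dots> = (c1 * L + 2 * \<epsilon>0) * norm (x - y)" by (simp add: algebra_simps)
  also have "\<dots> \<le> (1 / 10000000) * norm (x - y)" using c1_small by (intro mult_right_mono) auto
  finally show ?case .
next
  case 5
  show ?case by (simp add: \<xi>c_def p_0 q_0)
next
  case (10 t x)
  then show ?case using 10 by (simp add: Hc_def p_shell q_shell power2_eq_square algebra_simps)
qed auto

abbreviation G :: "real \<Rightarrow> 'a \<Rightarrow> real" where "G c \<equiv> near_hopf.\<Gamma> J (Hc c) (\<xi>c c)"

end

context hopf_family begin

lemma \<zeta>_param:
  obtains K where "0 \<le> K" "\<And>c d s x. \<bar>c - 1\<bar> \<le> c1 \<Longrightarrow> \<bar>d - 1\<bar> \<le> c1 \<Longrightarrow> 0 \<le> s \<Longrightarrow> s \<le> 2 * pi \<Longrightarrow> norm x \<le> 2 \<Longrightarrow>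
    norm (near_hopf.\<zeta> J (\<xi>c c) s x - near_hopf.\<zeta> J (\<xi>c d) s x) \<le> K * \<bar>c - d\<bar>"
proof -
  define M where "M = (L + \<epsilon>0) * 3"
  have M: "0 \<le> M" using L \<epsilon>0 by (simp add: M_def)
  have "norm (near_hopf.\<zeta> J (\<xi>c c) s x - near_hopf.\<zeta> J (\<xi>c d) s x) \<le> exp (2 * (2 * pi)) * M * \<bar>c - d\<bar>"
    if c: "\<bar>c - 1\<bar> \<le> c1" and d: "\<bar>d - 1\<bar> \<le> c1" and s: "0 \<le> s" "s \<le> 2 * pi" and x: "norm x \<le> 2" for c d s x
  proof -
    interpret C: shell_hopf J "Hc c" "\<xi>c c" "1 / 10000000" "1 / 1000000" by (rule shell_hopf_Hc[OF c])
    interpret D: shell_hopf J "Hc d" "\<xi>c d" "1 / 10000000" "1 / 1000000" by (rule shell_hopf_Hc[OF d])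
    define k where "k = M * \<bar>c - d\<bar>"
    have k: "0 \<le> k" using M by (simp add: k_def)
    \<comment> \<open>Along the orbit for \<open>d\<close> the two fields differ by at most
      \<open>k\<close>. Carrying \<open>k\<close> as a constant second component turns the
      inhomogeneous estimate into the homogeneous one that \<open>gronwall\<close> handles.\<close>
    define z where "z s = (C.\<zeta> s x - D.\<zeta> s x, k)" for s
    define z' where "z' s = R (- s) (\<xi>c c (C.\<phi> s x)) - R (- s) (\<xi>c d (D.\<phi> s x))" for s
    have "norm (z s) \<le> exp (2 * s) * norm (z 0)"
    proof (rule gronwall[where y = z and y' = "\<lambda>s. (z' s, 0)", OF s(1)])
      fix t assume t: "0 \<le> t" "t \<le> s"
      show "(z has_vector_derivative (z' t, 0)) (at t)"
        unfolding z_def z'_def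
        by (rule has_vector_derivative_Pair[OF has_vector_derivative_diff[OF C.\<zeta>_deriv D.\<zeta>_deriv] has_vector_derivative_const])
      let ?w = "D.\<phi> t x"
      have w: "norm ?w \<le> 3"
      proof -
        have "\<bar>norm ?w - norm x\<bar> \<le> 1 / 1000000 * norm x" by (rule D.\<phi>_norm) (use t s in auto)
        then show ?thesis using x by linarith
      qed
      have 0: "norm (z' t) = norm (\<xi>c c (C.\<phi> t x) - \<xi>c d ?w)" by (simp add: z'_def R_diff[symmetric])
      have 1: "norm (z' t) \<le> norm (\<xi>c c (C.\<phi> t x) - \<xi>c c ?w) + norm (\<xi>c c ?w - \<xi>c d ?w)"
        unfolding 0 using norm_triangle_ineq[of "\<xi>c c (C.\<phi> t x) - \<xi>c c ?w" "\<xi>c c ?w - \<xi>c d ?w"] by simp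
      have "norm (C.\<phi> t x - ?w) = norm (C.\<zeta> t x - D.\<zeta> t x)" by (simp add: C.\<phi>_\<zeta> D.\<phi>_\<zeta> R_diff[symmetric])
      also have "\<dots> \<le> norm (z t)" using norm_fst_le[of "fst (z t)" "snd (z t)"] by (simp add: z_def)
      finally have 2: "norm (\<xi>c c (C.\<phi> t x) - \<xi>c c ?w) \<le> 1 / 10000000 * norm (z t)"
        using C.\<xi>_lip[of "C.\<phi> t x" ?w] by linarith
      have "\<xi>c c ?w - \<xi>c d ?w = (c - d) *\<^sub>R J (grad p ?w + grad q ?w)"
        
        unfolding \<xi>c_def J_diff[symmetric] J_scale[symmetric] by (rule arg_cong[of _ _ J]) (simp add: algebra_simps)
      then have 3: "norm (\<xi>c c ?w - \<xi>c d ?w) = \<bar>c - d\<bar> * norm (grad p ?w + grad q ?w)" by simp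
      have "norm (grad p ?w + grad q ?w) \<le> L * norm ?w + \<epsilon>0 * norm ?w"
        using p_lip[of ?w 0] q_lip[of ?w 0] norm_triangle_ineq[of "grad p ?w" "grad q ?w"] by (simp add: p_0 q_0)
      moreover have "L * norm ?w + \<epsilon>0 * norm ?w = (L + \<epsilon>0) * norm ?w" by (simp add: distrib_right)
      moreover have "(L + \<epsilon>0) * norm ?w \<le> M" unfolding M_def using w L \<epsilon>0 by (intro mult_left_mono) auto
      ultimately have "norm (grad p ?w + grad q ?w) \<le> M" by linarith
      then have 4: "norm (\<xi>c c ?w - \<xi>c d ?w) \<le> k"
        unfolding 3 k_def mult.commute[of M] by (rule mult_left_mono) simp
      have 5: "k \<le> norm (z t)" using norm_snd_le[of "snd (z t)" "fst (z t)"] k by (simp add: z_def)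
      show "norm (z' t, 0 :: real) \<le> 2 * norm (z t)" using 1 2 4 5 norm_Pair_le[of "z' t" "0 :: real"] norm_ge_zero[of "z t"] unfolding norm_zero by linarith
    qed
    also have "\<dots> = exp (2 * s) * k" using k by (simp add: z_def norm_Pair)
    also have "\<dots> \<le> exp (2 * (2 * pi)) * k" using s k by (intro mult_right_mono) auto
    finally have "norm (z s) \<le> exp (2 * (2 * pi)) * k" .
    moreover have "norm (C.\<zeta> s x - D.\<zeta> s x) \<le> norm (z s)" using norm_fst_le[of "fst (z s)" "snd (z s)"] by (simp add: z_def)
    ultimately show ?thesis by (simp add: k_def)
  qed
  then show ?thesis by (intro that[of "exp (2 * (2 * pi)) * M"]) (use M in auto)
qed

text \<open>Serves the continuity in \<open>c\<close> of the minimum of \<open>G c\<close> over the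
  sphere, for which any finite \<open>K\<close> is enough.\<close>

lemma G_lip:
  obtains K where "0 \<le> K" "\<And>c d y. \<bar>c - 1\<bar> \<le> c1 \<Longrightarrow> \<bar>d - 1\<bar> \<le> c1 \<Longrightarrow> norm y = 1 \<Longrightarrow> \<bar>G c y - G d y\<bar> \<le> K * \<bar>c - d\<bar>"
proof -
  obtain K where K: "0 \<le> K" "\<And>c d s x. \<bar>c - 1\<bar> \<le> c1 \<Longrightarrow> \<bar>d - 1\<bar> \<le> c1 \<Longrightarrow> 0 \<le> s \<Longrightarrow> s \<le> 2 * pi \<Longrightarrow> norm x \<le> 2 \<Longrightarrow>
    norm (near_hopf.\<zeta> J (\<xi>c c) s x - near_hopf.\<zeta> J (\<xi>c d) s x) \<le> K * \<bar>c - d\<bar>"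
    by (rule \<zeta>_param) (rule that)
  have "continuous_on (cball 0 2) (\<lambda>x. p x + q x)"
    by (intro continuous_on_add continuous_on_subset[OF Cinf_continuous[OF p]] continuous_on_subset[OF Cinf_continuous[OF q]]) auto
  then have "bounded ((\<lambda>x. p x + q x) ` cball 0 2)" using compact_continuous_image compact_imp_bounded compact_cball by blast
  then obtain M where M: "0 < M" "\<And>x. norm x \<le> 2 \<Longrightarrow> \<bar>p x + q x\<bar> \<le> M"
    unfolding bounded_pos by (auto simp: dist_norm)
  have "\<bar>G c y - G d y\<bar> \<le> (16 * K + M) * \<bar>c - d\<bar>"
    if c: "\<bar>c - 1\<bar> \<le> c1" and d: "\<bar>d - 1\<bar> \<le> c1" and y: "norm y = 1" for c d y
  proof -
    interpret C: shell_hopf J "Hc c" "\<xi>c c" "1 / 10000000" "1 / 1000000" by (rule shell_hopf_Hc[OF c])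
    interpret D: shell_hopf J "Hc d" "\<xi>c d" "1 / 10000000" "1 / 1000000" by (rule shell_hopf_Hc[OF d])
    have rd: "norm (C.r z - D.r z) \<le> 2 * K * \<bar>c - d\<bar>" "norm (C.r z) \<le> 2" "norm (D.r z) \<le> 2" if z: "norm z = 1" for z
    proof -
      show 1: "norm (C.r z) \<le> 2" "norm (D.r z) \<le> 2" using C.r_norm[of z] D.r_norm[of z] unfolding z by linarith+
      let ?x = "D.r z"
      have 2: "norm (C.r z - ?x) \<le> (1 + 2 * (1 / 1000000)) * norm (C.u (C.r z) - C.u ?x)" by (rule C.u_expand)
      have 3: "C.u (C.r z) - C.u ?x = - avg (\<lambda>s. C.\<zeta> s ?x - D.\<zeta> s ?x)"
        unfolding avg_diff[OF C.\<zeta>_cont D.\<zeta>_cont] C.u_def[symmetric] D.u_def[symmetric] by simp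
      have 4: "norm (avg (\<lambda>s. C.\<zeta> s ?x - D.\<zeta> s ?x)) \<le> K * \<bar>c - d\<bar>"
        by (rule avg_norm[OF continuous_on_diff[OF C.\<zeta>_cont D.\<zeta>_cont] K(2)[OF c d _ _ 1(2)]])
      have "norm (C.r z - ?x) \<le> (1 + 2 * (1 / 1000000)) * (K * \<bar>c - d\<bar>)"
        using 2 4 unfolding 3 norm_minus_cancel by simp
      moreover have "0 \<le> K * \<bar>c - d\<bar>" using K(1) by simp
      ultimately show "norm (C.r z - ?x) \<le> 2 * K * \<bar>c - d\<bar>" by simp
    qed
    have nR: "norm (R s y) = 1" for s using y by simp
    have Hd: "\<bar>C.Hb y - D.Hb y\<bar> \<le> 8 * K * \<bar>c - d\<bar> + M * \<bar>c - d\<bar>"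
    proof -
      have "C.Hb y - D.Hb y = avg (\<lambda>s. C.Hr (R s y) - D.Hr (R s y))"
        by (simp only: C.Hb_def D.Hb_def avg_diff[OF C.comp_R_cont[OF C.Cinf_Hr] D.comp_R_cont[OF D.Cinf_Hr]])
      moreover have "norm (avg (\<lambda>s. C.Hr (R s y) - D.Hr (R s y))) \<le> 8 * K * \<bar>c - d\<bar> + M * \<bar>c - d\<bar>"
      proof (rule avg_norm[OF continuous_on_diff[OF C.comp_R_cont[OF C.Cinf_Hr] D.comp_R_cont[OF D.Cinf_Hr]]])
        fix s
        let ?z = "R s y"
        have "\<bar>Hc c (C.r ?z) - Hc c (D.r ?z)\<bar> \<le> 4 * norm (C.r ?z - D.r ?z)" by (rule C.H_lip[OF rd(2,3)[OF nR]])
        moreover have "norm (C.r ?z - D.r ?z) \<le> 2 * K * \<bar>c - d\<bar>" by (rule rd(1)[OF nR])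
        moreover have "Hc c (D.r ?z) - Hc d (D.r ?z) = (p (D.r ?z) + q (D.r ?z)) * (c - d)"
          by (simp add: Hc_def algebra_simps)
        moreover have "\<bar>(p (D.r ?z) + q (D.r ?z)) * (c - d)\<bar> \<le> M * \<bar>c - d\<bar>"
          unfolding abs_mult by (rule mult_right_mono[OF M(2)[OF rd(3)[OF nR]]]) simp
        ultimately show "norm (C.Hr ?z - D.Hr ?z) \<le> 8 * K * \<bar>c - d\<bar> + M * \<bar>c - d\<bar>"
          unfolding C.Hr_def D.Hr_def real_norm_def by linarith
      qed
      ultimately show ?thesis by simp
    qed
    have Sd: "\<bar>C.Sb y - D.Sb y\<bar> \<le> 8 * K * \<bar>c - d\<bar>"
    proof -
      have a: "C.Sb y = 1 / 2 * avg (\<lambda>s. J (C.r (R s y)) \<bullet> dd C.r (R s y) (J (R s y)))"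
        "D.Sb y = 1 / 2 * avg (\<lambda>s. J (D.r (R s y)) \<bullet> dd D.r (R s y) (J (R s y)))"
        unfolding C.Sb_def D.Sb_def C.a_inner D.a_inner
        by (rule avg_linear[OF bounded_linear_mult_right], intro continuous_on_inner bounded_linear.continuous_on[OF J_bl]
            C.comp_R_cont[OF C.Cinf_r] D.comp_R_cont[OF D.Cinf_r] C.loop(3) D.loop(3))+
      have "\<bar>avg (\<lambda>s. J (C.r (R s y)) \<bullet> dd C.r (R s y) (J (R s y))) - avg (\<lambda>s. J (D.r (R s y)) \<bullet> dd D.r (R s y) (J (R s y)))\<bar>
          \<le> 2 * 2 * (2 * K * \<bar>c - d\<bar>)"
      proof (rule action_lip[OF C.loop(1) D.loop(1) C.loop(3) D.loop(3)])
        show "C.r (R (2 * pi) y) = C.r (R 0 y)" "D.r (R (2 * pi) y) = D.r (R 0 y)" using R_plus_pi[of 0 y] by simp_all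
        show "norm (dd C.r (R s y) (J (R s y))) \<le> 2" "norm (dd D.r (R s y) (J (R s y))) \<le> 2" for s
          using C.loop(2)[of s y] D.loop(2)[of s y] y by simp_all
        show "norm (C.r (R s y) - D.r (R s y)) \<le> 2 * K * \<bar>c - d\<bar>" for s by (rule rd(1)[OF nR])
      qed
      moreover have "0 \<le> K * \<bar>c - d\<bar>" using K(1) by simp
      ultimately show ?thesis unfolding a by linarith
    qed
    have "(16 * K + M) * \<bar>c - d\<bar> = (8 * K * \<bar>c - d\<bar> + M * \<bar>c - d\<bar>) + 8 * K * \<bar>c - d\<bar>" by (simp add: algebra_simps)
    then show ?thesis using Hd Sd unfolding C.\<Gamma>_def D.\<Gamma>_def by linarith
  qed
  then show ?thesis by (intro that[of "16 * K + M"]) (use K M in auto)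
qed

text \<open>For \<open>c\<close> at distance \<open>c1\<close> from \<open>1\<close> the perturbation \<open>q\<close> is negligible and \<open>\<delta>' y\<close> is close to \<open>(c - 1) J y\<close>.\<close>

lemma G_sign:
  assumes c: "\<bar>c - 1\<bar> = c1" and y: "norm y = 1"
  shows "0 \<le> (c - 1) * G c y"
proof -
  have cle: "\<bar>c - 1\<bar> \<le> c1" using c by simp
  interpret C: shell_hopf J "Hc c" "\<xi>c c" "1 / 10000000" "1 / 1000000" by (rule shell_hopf_Hc[OF cle])
  have "0 \<le> (c - 1) * (1 / 2 * (J (C.r z) \<bullet> dd C.r z (C.\<delta>' z)))" if z: "norm z = 1" for z
  proof -
    define x where "x = C.r z"
    have x: "\<bar>norm x - 1\<bar> \<le> 2 / 1000000" using C.r_norm[of z] z by (simp add: x_def)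
    have "norm (C.\<delta> x - (2 * pi) *\<^sub>R ((c - 1) *\<^sub>R J x)) \<le> (c1 / 100) * (2 * pi)"
    proof (rule C.\<delta>_near)
      fix s assume s: "0 \<le> s" "s \<le> 2 * pi"
      let ?w = "C.\<phi> s x"
      have w: "1 / 2 < norm ?w" "norm ?w < 2" by (rule C.\<phi>_shell_bounds[OF s]; use x in linarith)+
      have 1: "R (- s) (\<xi>c c ?w) - (c - 1) *\<^sub>R J x = (c - 1) *\<^sub>R J (C.\<zeta> s x - x) + c *\<^sub>R R (- s) (J (grad q ?w))"
        by (simp add: \<xi>c_def grad_p[OF w] J_add J_scale R_add R_scale R_J J_diff scaleR_diff_right C.\<zeta>_def)
      have 2: "norm ((c - 1) *\<^sub>R J (C.\<zeta> s x - x) + c *\<^sub>R R (- s) (J (grad q ?w)))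
          \<le> \<bar>c - 1\<bar> * norm (C.\<zeta> s x - x) + \<bar>c\<bar> * norm (grad q ?w)"
        using norm_triangle_ineq[of "(c - 1) *\<^sub>R J (C.\<zeta> s x - x)" "c *\<^sub>R R (- s) (J (grad q ?w))"] by simp
      have 3: "\<bar>c - 1\<bar> * norm (C.\<zeta> s x - x) + \<bar>c\<bar> * norm (grad q ?w) \<le> c1 * (1 / 1000000 * 2) + 2 * (\<epsilon>0 * 2)"
      proof (intro add_mono mult_mono)
        have "norm (C.\<zeta> s x - x) \<le> 1 / 1000000 * norm x" by (rule C.\<zeta>_near[OF s])
        then show "norm (C.\<zeta> s x - x) \<le> 1 / 1000000 * 2" using x by linarith
        have "norm (grad q ?w) \<le> \<epsilon>0 * norm ?w" using q_lip[of ?w 0] by (simp add: q_0)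
        also have "\<dots> \<le> \<epsilon>0 * 2" using w \<epsilon>0 by (intro mult_left_mono) auto
        finally show "norm (grad q ?w) \<le> \<epsilon>0 * 2" .
        show "\<bar>c\<bar> \<le> 2" using c c1_small by linarith
      qed (use c c1 in auto)
      show "norm (R (- s) (\<xi>c c ?w) - (c - 1) *\<^sub>R J x) \<le> c1 / 100"
        unfolding 1 using 2 3 c1 by linarith
    qed
    moreover have "C.\<delta>' z - (c - 1) *\<^sub>R J x = (1 / (2 * pi)) *\<^sub>R (C.\<delta> x - (2 * pi) *\<^sub>R ((c - 1) *\<^sub>R J x))"
      by (simp add: C.\<delta>'_def x_def scaleR_diff_right)
    ultimately have d: "norm (C.\<delta>' z - (c - 1) *\<^sub>R J x) \<le> c1 / 100"
      by (simp add: divide_simps mult.commute)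
    define D where "D = dd C.r z (C.\<delta>' z)"
    have nd: "norm (C.\<delta>' z) \<le> 2 * c1"
    proof -
      have "norm ((c - 1) *\<^sub>R J x) = c1 * norm x" using c by simp
      also have "\<dots> \<le> c1 * (11 / 10)" using x c1 by (intro mult_left_mono) linarith+
      finally show ?thesis using d norm_triangle_sub[of "C.\<delta>' z" "(c - 1) *\<^sub>R J x"] c1 by linarith
    qed
    have "norm (D - C.\<delta>' z) \<le> 2 * (1 / 1000000) * norm (C.\<delta>' z)" unfolding D_def by (rule C.dd_r)
    then have D1: "norm (D - (c - 1) *\<^sub>R J x) \<le> c1 / 10"
      using nd d norm_triangle_ineq[of "D - C.\<delta>' z" "C.\<delta>' z - (c - 1) *\<^sub>R J x"] c1 by simp
    have x': "9 / 10 \<le> norm x" "norm x \<le> 11 / 10" using x by linarith+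
    have f1: "J x \<bullet> D = (c - 1) * (norm x)\<^sup>2 + J x \<bullet> (D - (c - 1) *\<^sub>R J x)"
      by (simp add: inner_diff_right power2_norm_eq_inner)
    have f2: "\<bar>J x \<bullet> (D - (c - 1) *\<^sub>R J x)\<bar> \<le> (11 / 10) * (c1 / 10)"
    proof -
      have "\<bar>J x \<bullet> (D - (c - 1) *\<^sub>R J x)\<bar> \<le> norm (J x) * norm (D - (c - 1) *\<^sub>R J x)" by (rule Cauchy_Schwarz_ineq2)
      also have "\<dots> \<le> (11 / 10) * (c1 / 10)" using x' D1 by (intro mult_mono) auto
      finally show ?thesis .
    qed
    have "(9 / 10)\<^sup>2 \<le> (norm x)\<^sup>2" using x' by (intro power_mono) auto
    then have f3: "c1 * (8 / 10) \<le> c1 * (norm x)\<^sup>2" using c1 by (intro mult_left_mono) (auto simp: power2_eq_square)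
    have "0 \<le> c - 1 \<and> 0 \<le> J x \<bullet> D \<or> c - 1 \<le> 0 \<and> J x \<bullet> D \<le> 0"
    proof (cases "c - 1 = c1")
      case True
      then have "(c - 1) * (norm x)\<^sup>2 = c1 * (norm x)\<^sup>2" by simp
      then show ?thesis using f1 f2 f3 c1(1) True by linarith
    next
      case False
      then have e: "c - 1 = - c1" using c by linarith
      then have "(c - 1) * (norm x)\<^sup>2 = - (c1 * (norm x)\<^sup>2)" by simp
      then show ?thesis using f1 f2 f3 c1(1) e by linarith
    qed
    then have "0 \<le> (c - 1) * (J x \<bullet> D)" by (simp add: zero_le_mult_iff)
    then show ?thesis by (simp add: x_def D_def)
  qed
  note pos = this
  define g where "g s = 1 / 2 * (J (C.r (R s y)) \<bullet> dd C.r (R s y) (C.\<delta>' (R s y)))" for s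
  have "Cinf UNIV (\<lambda>s. dd C.r (R s y) (C.\<delta>' (R s y)))"
    by (rule Cinf_dd_compose[OF open_UNIV open_UNIV C.Cinf_r Cinf_R[OF open_UNIV Cinf_ident[OF open_UNIV] Cinf_const] _
          Cinf_compose_UNIV[OF open_UNIV C.Cinf_\<delta>' Cinf_R[OF open_UNIV Cinf_ident[OF open_UNIV] Cinf_const]]]) simp
  from Cinf_continuous[OF this] have cg: "continuous_on UNIV g"
    unfolding g_def[abs_def]
    by (intro continuous_on_mult continuous_on_const continuous_on_inner bounded_linear.continuous_on[OF J_bl] C.comp_R_cont[OF C.Cinf_r])
  have "avg (\<lambda>s. 0) \<le> avg (\<lambda>s. (c - 1) * g s)"
  proof (rule avg_mono)
    show "0 \<le> (c - 1) * g s" for s unfolding g_def by (rule pos) (use y in simp)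
  qed (intro continuous_on_const continuous_on_mult cg)+
  also have "avg (\<lambda>s. (c - 1) * g s) = (c - 1) * G c y"
    using avg_linear[OF bounded_linear_mult_right cg, of "c - 1"] C.\<Gamma>_formula[OF y] by (simp add: g_def[abs_def])
  finally show ?thesis by simp
qed

text \<open>As a minimum of functions uniformly Lipschitz in \<open>c\<close>, the minimum over the
  sphere is Lipschitz in \<open>c\<close>, although the minimizers \<open>e c\<close> need not vary
  continuously.\<close>

lemma choose_c:
  obtains c e where "\<bar>c - 1\<bar> \<le> c1" "norm e = 1" "G c e = 0" "\<And>y. norm y = 1 \<Longrightarrow> 0 \<le> G c y"
proof -
  obtain K where K: "0 \<le> K" "\<And>c d y. \<bar>c - 1\<bar> \<le> c1 \<Longrightarrow> \<bar>d - 1\<bar> \<le> c1 \<Longrightarrow> norm y = 1 \<Longrightarrow> \<bar>G c y - G d y\<bar> \<le> K * \<bar>c - d\<bar>"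
    by (rule G_lip) (rule that)
  have "\<exists>e. norm e = 1 \<and> (\<forall>y. norm y = 1 \<longrightarrow> G c e \<le> G c y)" if c: "\<bar>c - 1\<bar> \<le> c1" for c
  proof -
    interpret C: shell_hopf J "Hc c" "\<xi>c c" "1 / 10000000" "1 / 1000000" by (rule shell_hopf_Hc[OF c])
    obtain b :: 'a where b: "b \<in> Basis" using nonempty_Basis by blast
    have "continuous_on (sphere 0 1) C.\<Gamma>"
      by (rule continuous_at_imp_continuous_on) (blast intro: has_derivative_continuous[OF C.\<Gamma>_has_derivative])
    moreover have "sphere (0 :: 'a) 1 \<noteq> {}" using b by (auto intro!: exI[of _ b])
    ultimately obtain e where "e \<in> sphere 0 1" "\<forall>y\<in>sphere 0 1. C.\<Gamma> e \<le> C.\<Gamma> y"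
      using continuous_attains_inf[OF compact_sphere] by blast
    then show ?thesis by (auto simp: dist_norm)
  qed
  then obtain e where e: "\<And>c. \<bar>c - 1\<bar> \<le> c1 \<Longrightarrow> norm (e c) = 1" "\<And>c y. \<bar>c - 1\<bar> \<le> c1 \<Longrightarrow> norm y = 1 \<Longrightarrow> G c (e c) \<le> G c y"
    by metis
  define m where "m c = G c (e c)" for c
  have mle: "m c - m d \<le> K * \<bar>c - d\<bar>" if c: "\<bar>c - 1\<bar> \<le> c1" "\<bar>d - 1\<bar> \<le> c1" for c d
    using K(2)[OF c e(1)[OF c(2)]] e(2)[OF c(1) e(1)[OF c(2)]] unfolding m_def by linarith
  have "K-lipschitz_on {1 - c1..1 + c1} m"
  proof (rule lipschitz_onI[OF _ K(1)])
    fix c d assume "c \<in> {1 - c1..1 + c1}" "d \<in> {1 - c1..1 + c1}"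
    then have c: "\<bar>c - 1\<bar> \<le> c1" "\<bar>d - 1\<bar> \<le> c1" by auto
    show "dist (m c) (m d) \<le> K * dist c d"
      using mle[OF c] mle[OF c(2,1)] by (auto simp: dist_real_def abs_minus_commute)
  qed
  then have cm: "continuous_on {1 - c1..1 + c1} m" by (rule lipschitz_on_continuous_on)
  have 1: "m (1 - c1) \<le> 0"
    using G_sign[of "1 - c1" "e (1 - c1)"] e(1)[of "1 - c1"] c1 by (simp add: m_def zero_le_mult_iff mult_le_0_iff)
  have 2: "0 \<le> m (1 + c1)"
    using G_sign[of "1 + c1" "e (1 + c1)"] e(1)[of "1 + c1"] c1 by (simp add: m_def zero_le_mult_iff)
  obtain c where c: "1 - c1 \<le> c" "c \<le> 1 + c1" "m c = 0"
    using IVT'[of m "1 - c1" 0 "1 + c1", OF 1 2 _ cm] c1 by auto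
  then have "\<bar>c - 1\<bar> \<le> c1" by auto
  then show ?thesis using that[of c "e c"] e c(3) unfolding m_def by metis
qed

theorem normal_form_family:
  obtains c e F F' where "\<bar>c - 1\<bar> \<le> c1" "cline J e" "Cinf UNIV F" "Cinf UNIV F'" "\<And>y. F' (F y) = y" "\<And>y. F (F' y) = y"
    "\<And>y a b. J (dd F y a) \<bullet> dd F y b = J a \<bullet> b"
    "\<And>y. norm (F y - y) \<le> 1 / 1000 * norm y"
    "\<And>y. 8 / 10 \<le> norm y \<Longrightarrow> norm y \<le> 13 / 10 \<Longrightarrow> (norm y)\<^sup>2 / 2 \<le> c * ((norm (F y))\<^sup>2 / 2 + q (F y))"
    "\<And>y. 8 / 10 \<le> norm y \<Longrightarrow> norm y \<le> 13 / 10 \<Longrightarrow>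
      c * ((norm (F y))\<^sup>2 / 2 + q (F y)) \<le> (norm y)\<^sup>2 / 2 + (norm (cline.N J e y))\<^sup>2 / 2"
proof -
  obtain c e where c: "\<bar>c - 1\<bar> \<le> c1" and e: "norm e = 1" "G c e = 0" "\<And>y. norm y = 1 \<Longrightarrow> 0 \<le> G c y"
    by (rule choose_c) (rule that)
  interpret C: shell_hopf J "Hc c" "\<xi>c c" "1 / 10000000" "1 / 1000000" by (rule shell_hopf_Hc[OF c])
  interpret C: line_hopf J "Hc c" "\<xi>c c" "1 / 10000000" "1 / 1000000" e
    by unfold_locales (use e in auto)
  obtain F F' where F: "Cinf UNIV F" "Cinf UNIV F'" "\<And>y. F' (F y) = y" "\<And>y. F (F' y) = y"
    "\<And>y a b. J (dd F y a) \<bullet> dd F y b = J a \<bullet> b"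
    "\<And>y. norm (F y - y) \<le> 1000 * (1 / 1000000) * norm y"
    "\<And>y. 8 / 10 \<le> norm y \<Longrightarrow> norm y \<le> 13 / 10 \<Longrightarrow> (norm y)\<^sup>2 / 2 \<le> Hc c (F y)"
    "\<And>y. 8 / 10 \<le> norm y \<Longrightarrow> norm y \<le> 13 / 10 \<Longrightarrow> Hc c (F y) \<le> (norm y)\<^sup>2 / 2 + (norm (C.N y))\<^sup>2 / 2"
    by (rule C.normal_form) (rule that)
  have H: "Hc c (F y) = c * ((norm (F y))\<^sup>2 / 2 + q (F y))" if y: "8 / 10 \<le> norm y" "norm y \<le> 13 / 10" for y
  proof -
    have "\<bar>norm (F y) - norm y\<bar> \<le> 1 / 1000 * norm y" using F(6)[of y] norm_triangle_ineq3[of "F y" y] by simp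
    then have "1 / 2 < norm (F y)" "norm (F y) < 2" using y by linarith+
    from p_shell[OF this] have e: "p (F y) = F y \<bullet> F y / 2" .
    show ?thesis unfolding Hc_def e power2_norm_eq_inner by (simp add: field_simps)
  qed
  show ?thesis
    by (rule that[of c e F F', OF c _ F(1-5)]) (use F(6) F(7,8)[unfolded H] H C.cline_axioms in auto)
qed

end

section \<open>Domains close to the ball\<close>

text \<open>An upper bound for the \<open>C\<^sup>2\<close>-norm on \<open>K\<close>, kept as a
  relation so that it makes sense on noncompact sets and combines with explicit constants.\<close>

definition c2 :: "'a::euclidean_space set \<Rightarrow> ('a \<Rightarrow> real) \<Rightarrow> real \<Rightarrow> bool" where
  "c2 K f M \<longleftrightarrow> (\<forall>x\<in>K. \<bar>f x\<bar> \<le> M \<and> (\<forall>v. \<bar>dd f x v\<bar> \<le> M * norm v) \<and>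
     (\<forall>v w. \<bar>dd (\<lambda>x. dd f x v) x w\<bar> \<le> M * (norm v * norm w)))"

lemma c2D:
  assumes "c2 K f M" "x \<in> K"
  shows "\<bar>f x\<bar> \<le> M" "\<bar>dd f x v\<bar> \<le> M * norm v" "\<bar>dd (\<lambda>x. dd f x v) x w\<bar> \<le> M * (norm v * norm w)"
  using assms unfolding c2_def by blast+

lemma c2_pos: "c2 K f M \<Longrightarrow> x \<in> K \<Longrightarrow> 0 \<le> M"
  using order_trans[OF abs_ge_zero c2D(1)] .

lemma c2_mono: "c2 K f M \<Longrightarrow> M \<le> M' \<Longrightarrow> c2 K f M'"
  unfolding c2_def by (meson mult_right_mono norm_ge_zero mult_nonneg_nonneg order_trans)

lemma c2_subset: "c2 K f M \<Longrightarrow> K' \<subseteq> K \<Longrightarrow> c2 K' f M"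
  unfolding c2_def by blast

lemma c2_Un: "c2 K f M \<Longrightarrow> c2 K' f M \<Longrightarrow> c2 (K \<union> K') f M"
  unfolding c2_def by blast

lemma dd_cong:
  assumes "open S" "x \<in> S" "\<And>x. x \<in> S \<Longrightarrow> f x = g x" "(f has_derivative f') (at x)"
  shows "dd g x = f'"
  by (rule ddI[OF has_derivative_transform_within_open[OF assms(4,1,2,3)]])

lemma c2I:
  assumes S: "open S" "K \<subseteq> S" and f: "\<And>x. x \<in> S \<Longrightarrow> (f has_derivative f' x) (at x)"
    and f': "\<And>x v. x \<in> S \<Longrightarrow> ((\<lambda>x. f' x v) has_derivative f'' x v) (at x)"
    and b: "\<And>x. x \<in> K \<Longrightarrow> \<bar>f x\<bar> \<le> M" "\<And>x v. x \<in> K \<Longrightarrow> \<bar>f' x v\<bar> \<le> M * norm v"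
      "\<And>x v w. x \<in> K \<Longrightarrow> \<bar>f'' x v w\<bar> \<le> M * (norm v * norm w)"
  shows "c2 K f M"
proof -
  have d: "dd f x = f' x" if "x \<in> S" for x using ddI[OF f[OF that]] .
  have d2: "dd (\<lambda>x. dd f x v) x = f'' x v" if "x \<in> S" for x v
    by (rule dd_cong[OF S(1) that _ f'[OF that]]) (simp add: d)
  show ?thesis unfolding c2_def using b d d2 S(2) by auto
qed

text \<open>The factor 4 counts the terms in the second derivative of a product.\<close>

lemma c2_mult:
  assumes S: "open S" "K \<subseteq> S" and f: "Cinf S f" "c2 K f M" and g: "Cinf S g" "c2 K g M'"
  shows "c2 K (\<lambda>x. f x * g x) (4 * M * M')"
proof (rule c2I[OF S])
  note D = Cinf_has_derivative
  show "((\<lambda>x. f x * g x) has_derivative (\<lambda>v. f x * dd g x v + dd f x v * g x)) (at x)" if "x \<in> S" for x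
    by (rule has_derivative_mult[OF D[OF f(1) that] D[OF g(1) that]])
  show "((\<lambda>x. f x * dd g x v + dd f x v * g x) has_derivative
      (\<lambda>w. (f x * dd (\<lambda>x. dd g x v) x w + dd f x w * dd g x v) + (dd f x v * dd g x w + dd (\<lambda>x. dd f x v) x w * g x))) (at x)"
    if "x \<in> S" for x v
    by (rule has_derivative_add[OF has_derivative_mult[OF D[OF f(1) that] D[OF Cinf_dd[OF g(1)] that]]
        has_derivative_mult[OF D[OF Cinf_dd[OF f(1)] that] D[OF g(1) that]]])
  fix x assume x: "x \<in> K"
  note F = c2D[OF f(2) x] and G = c2D[OF g(2) x]
  have M: "0 \<le> M" "0 \<le> M'" using c2_pos f(2) g(2) x by blast+
  have MM: "0 \<le> M * M'" using M by simp
  have m: "\<bar>a * b\<bar> \<le> p * q" if "\<bar>a\<bar> \<le> p" "\<bar>b\<bar> \<le> q" for a b p q :: real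
    unfolding abs_mult by (rule mult_mono) (use that in auto)
  show "\<bar>f x * g x\<bar> \<le> 4 * M * M'" using m[OF F(1) G(1)] MM by simp
  show "\<bar>f x * dd g x v + dd f x v * g x\<bar> \<le> 4 * M * M' * norm v" for v
  proof -
    have "\<bar>f x * dd g x v\<bar> \<le> M * M' * norm v" "\<bar>dd f x v * g x\<bar> \<le> M * M' * norm v"
      using m[OF F(1) G(2)[of v]] m[OF F(2)[of v] G(1)] by (simp_all add: mult_ac)
    moreover have "0 \<le> M * M' * norm v" using MM by simp
    ultimately show ?thesis by linarith
  qed
  show "\<bar>(f x * dd (\<lambda>x. dd g x v) x w + dd f x w * dd g x v) + (dd f x v * dd g x w + dd (\<lambda>x. dd f x v) x w * g x)\<bar>
      \<le> 4 * M * M' * (norm v * norm w)" for v w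
  proof -
    have "\<bar>f x * dd (\<lambda>x. dd g x v) x w\<bar> \<le> M * M' * (norm v * norm w)"
      "\<bar>dd f x w * dd g x v\<bar> \<le> M * M' * (norm v * norm w)"
      "\<bar>dd f x v * dd g x w\<bar> \<le> M * M' * (norm v * norm w)"
      "\<bar>dd (\<lambda>x. dd f x v) x w * g x\<bar> \<le> M * M' * (norm v * norm w)"
      using m[OF F(1) G(3)[of v w]] m[OF F(2)[of w] G(2)[of v]] m[OF F(2)[of v] G(2)[of w]] m[OF F(3)[of v w] G(1)]
      by (simp_all add: mult_ac)
    then show ?thesis by linarith
  qed
qed

lemma c2_inverse:
  assumes S: "open S" "K \<subseteq> S" and w: "Cinf S w" "c2 K w M" and M: "M \<le> 1 / 2" and ne: "\<And>x. x \<in> S \<Longrightarrow> w x \<noteq> 1"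
  shows "c2 K (\<lambda>x. inverse (1 - w x)) 10"
proof (rule c2I[OF S])
  note D = Cinf_has_derivative
  let ?i = "\<lambda>x. inverse (1 - w x)"
  have di: "(?i has_derivative (\<lambda>v. ?i x * dd w x v * ?i x)) (at x)" if "x \<in> S" for x
  proof -
    have "((\<lambda>x. 1 - w x) has_derivative (\<lambda>v. - dd w x v)) (at x)"
      using has_derivative_diff[OF has_derivative_const D[OF w(1) that]] by simp
    from Deriv.has_derivative_inverse[OF _ this] show ?thesis using ne[OF that] by simp
  qed
  then show "(?i has_derivative (\<lambda>v. ?i x * dd w x v * ?i x)) (at x)" if "x \<in> S" for x using that .
  show "((\<lambda>x. ?i x * dd w x v * ?i x) has_derivative
     (\<lambda>h. (?i x * dd w x v) * (?i x * dd w x h * ?i x) +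
       (?i x * dd (\<lambda>x. dd w x v) x h + (?i x * dd w x h * ?i x) * dd w x v) * ?i x)) (at x)"
    if "x \<in> S" for x v
    by (rule has_derivative_mult[OF has_derivative_mult[OF di[OF that] D[OF Cinf_dd[OF w(1)] that]] di[OF that]])
  fix x assume x: "x \<in> K"
  note W = c2D[OF w(2) x]
  have M0: "0 \<le> M" by (rule c2_pos[OF w(2) x])
  define i where "i = ?i x"
  have "1 / 2 \<le> 1 - w x" using W(1) M by linarith
  then have i: "\<bar>i\<bar> \<le> 2" unfolding i_def by (simp add: field_simps)
  then show "\<bar>?i x\<bar> \<le> 10" unfolding i_def by simp
  have w1: "\<bar>dd w x v\<bar> \<le> 1 / 2 * norm v" for v
    by (rule order_trans[OF W(2) mult_right_mono[OF M norm_ge_zero]])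
  have w2: "\<bar>dd (\<lambda>x. dd w x v) x h\<bar> \<le> 1 / 2 * (norm v * norm h)" for v h
    by (rule order_trans[OF W(3) mult_right_mono[OF M]]) simp
  have m: "\<bar>a * b\<bar> \<le> p * q" if "\<bar>a\<bar> \<le> p" "\<bar>b\<bar> \<le> q" for a b p q :: real
    unfolding abs_mult by (rule mult_mono) (use that in auto)
  have i1: "\<bar>i * dd w x v\<bar> \<le> norm v" for v using m[OF i w1[of v]] by simp
  have i2: "\<bar>i * dd w x v * i\<bar> \<le> 2 * norm v" for v using m[OF i1[of v] i] by simp
  show "\<bar>?i x * dd w x v * ?i x\<bar> \<le> 10 * norm v" for v
    using i2[of v] norm_ge_zero[of v] unfolding i_def[symmetric] by linarith
  show "\<bar>(?i x * dd w x v) * (?i x * dd w x h * ?i x) +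
       (?i x * dd (\<lambda>x. dd w x v) x h + (?i x * dd w x h * ?i x) * dd w x v) * ?i x\<bar> \<le> 10 * (norm v * norm h)" for v h
  proof -
    have a: "\<bar>(i * dd w x v) * (i * dd w x h * i)\<bar> \<le> 2 * (norm v * norm h)" using m[OF i1[of v] i2[of h]] by simp
    have b: "\<bar>i * dd (\<lambda>x. dd w x v) x h\<bar> \<le> norm v * norm h" using m[OF i w2[of v h]] by simp
    have c: "\<bar>(i * dd w x h * i) * dd w x v\<bar> \<le> norm v * norm h" using m[OF i2[of h] w1[of v]] by (simp add: mult.commute)
    have "\<bar>(i * dd (\<lambda>x. dd w x v) x h + (i * dd w x h * i) * dd w x v) * i\<bar> \<le> (2 * (norm v * norm h)) * 2"
      by (rule m[OF _ i]) (use b c in linarith)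
    then show ?thesis using a unfolding i_def[symmetric]
      using mult_nonneg_nonneg[OF norm_ge_zero norm_ge_zero, of v h] by linarith
  qed
qed

lemma basis_sum_bound:
  fixes f :: "'a::euclidean_space \<Rightarrow> real" and B :: real
  assumes "\<And>e. e \<in> Basis \<Longrightarrow> \<bar>f e\<bar> \<le> B"
  shows "\<bar>\<Sum>e\<in>Basis. (v \<bullet> e) * f e\<bar> \<le> DIM('a) * B * norm v"
proof -
  have "\<bar>\<Sum>e\<in>Basis. (v \<bullet> e) * f e\<bar> \<le> (\<Sum>e\<in>(Basis :: 'a set). norm v * B)"
  proof (rule order_trans[OF sum_abs sum_mono])
    fix e :: 'a assume e: "e \<in> Basis"
    have "\<bar>v \<bullet> e\<bar> \<le> norm v" using e by (rule Basis_le_norm)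
    then show "\<bar>(v \<bullet> e) * f e\<bar> \<le> norm v * B" unfolding abs_mult by (rule mult_mono) (use assms[OF e] in auto)
  qed
  then show ?thesis by (simp add: mult_ac)
qed

lemma dd_basis:
  fixes f :: "'a::euclidean_space \<Rightarrow> real"
  assumes "f differentiable (at x)"
  shows "dd f x v = (\<Sum>e\<in>Basis. (v \<bullet> e) * dd f x e)"
proof -
  have l: "linear (dd f x)" using assms by (rule linear_frechet_derivative)
  have "dd f x (\<Sum>e\<in>Basis. (v \<bullet> e) *\<^sub>R e) = (\<Sum>e\<in>Basis. (v \<bullet> e) * dd f x e)"
    by (simp add: linear_sum[OF l] linear_scale[OF l])
  then show ?thesis by (simp add: euclidean_representation)
qed

text \<open>Passes from the coordinate derivatives used in \<open>Ck_dist\<close> to all directions,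
  at the price of one factor \<open>DIM('a)\<close> per derivative.\<close>

lemma c2_basis:
  fixes f :: "'a::euclidean_space \<Rightarrow> real" and d :: real
  assumes S: "open S" "K \<subseteq> S" and f: "Cinf S f"
    and b: "\<And>x. x \<in> K \<Longrightarrow> \<bar>f x\<bar> \<le> d" "\<And>x e. x \<in> K \<Longrightarrow> e \<in> Basis \<Longrightarrow> \<bar>dd f x e\<bar> \<le> d"
      "\<And>x e e'. x \<in> K \<Longrightarrow> e \<in> Basis \<Longrightarrow> e' \<in> Basis \<Longrightarrow> \<bar>dd (\<lambda>x. dd f x e) x e'\<bar> \<le> d"
  shows "c2 K f (DIM('a) * DIM('a) * d)"
proof (rule c2I[OF S Cinf_has_derivative[OF f]])
  have n: "1 \<le> real DIM('a)" using DIM_positive[where 'a = 'a] by linarith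
  show "((\<lambda>x. dd f x v) has_derivative dd (\<lambda>x. dd f x v) x) (at x)" if "x \<in> S" for x v
    by (rule Cinf_has_derivative[OF Cinf_dd[OF f] that])
  fix x assume x: "x \<in> K"
  then have xS: "x \<in> S" using S by auto
  have d: "0 \<le> d" using order_trans[OF abs_ge_zero b(1)[OF x]] .
  have n2: "1 \<le> real DIM('a) * real DIM('a)" using mult_mono[OF n n] by simp
  show "\<bar>f x\<bar> \<le> DIM('a) * DIM('a) * d"
    using b(1)[OF x] mult_right_mono[OF n2 d] by simp
  show "\<bar>dd f x v\<bar> \<le> DIM('a) * DIM('a) * d * norm v" for v
  proof -
    have "\<bar>dd f x v\<bar> \<le> DIM('a) * d * norm v"
      unfolding dd_basis[OF Cinf_differentiable[OF f xS], of v] by (rule basis_sum_bound[OF b(2)[OF x]])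
    also have "\<dots> \<le> DIM('a) * (DIM('a) * d * norm v)" using mult_right_mono[OF n, of "DIM('a) * d * norm v"] d by simp
    finally show ?thesis by (simp add: mult_ac)
  qed
  show "\<bar>dd (\<lambda>x. dd f x v) x w\<bar> \<le> DIM('a) * DIM('a) * d * (norm v * norm w)" for v w
  proof -
    have "((\<lambda>x. \<Sum>e\<in>Basis. (v \<bullet> e) * dd f x e) has_derivative (\<lambda>w. \<Sum>e\<in>Basis. (v \<bullet> e) * dd (\<lambda>x. dd f x e) x w)) (at x)"
      by (rule has_derivative_sum[OF has_derivative_mult_right[OF Cinf_has_derivative[OF Cinf_dd[OF f] xS]]])
    then have "dd (\<lambda>x. dd f x v) x = (\<lambda>w. \<Sum>e\<in>Basis. (v \<bullet> e) * dd (\<lambda>x. dd f x e) x w)"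
      by (rule dd_cong[OF S(1) xS, rotated]) (rule dd_basis[OF Cinf_differentiable[OF f], symmetric])
    then have "dd (\<lambda>x. dd f x v) x w = (\<Sum>e\<in>Basis. (v \<bullet> e) * dd (\<lambda>x. dd f x e) x w)" by (rule fun_cong)
    also have "\<bar>\<dots>\<bar> \<le> DIM('a) * (DIM('a) * d * norm w) * norm v"
    proof (rule basis_sum_bound)
      fix e :: 'a assume e: "e \<in> Basis"
      show "\<bar>dd (\<lambda>x. dd f x e) x w\<bar> \<le> DIM('a) * d * norm w"
        unfolding dd_basis[OF Cinf_differentiable[OF Cinf_dd[OF f] xS], of e w] by (rule basis_sum_bound[OF b(3)[OF x e]])
    qed
    finally show ?thesis by (simp add: mult_ac)
  qed
qed

lemma dd_homogeneous:
  fixes f :: "'a::euclidean_space \<Rightarrow> real"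
  assumes f: "Cinf (- {0}) f" and h: "\<And>x. x \<noteq> 0 \<Longrightarrow> f (t *\<^sub>R x) = c * f x" and t: "0 < t" and x: "x \<noteq> 0"
  shows "dd f (t *\<^sub>R x) v = c / t * dd f x v"
proof -
  have tx: "t *\<^sub>R x \<in> - {0}" using t x by simp
  have l: "linear (dd f (t *\<^sub>R x))" using Cinf_differentiable[OF f tx] by (rule linear_frechet_derivative)
  have "((\<lambda>x. f (t *\<^sub>R x)) has_derivative (\<lambda>v. dd f (t *\<^sub>R x) (t *\<^sub>R v))) (at x)"
    by (rule has_derivative_compose[OF bounded_linear_imp_has_derivative[OF bounded_linear_scaleR_right] Cinf_has_derivative[OF f tx]])
  then have "dd (\<lambda>x. c * f x) x = (\<lambda>v. dd f (t *\<^sub>R x) (t *\<^sub>R v))"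
    by (rule dd_cong[of "- {0}", rotated 3]) (use x in \<open>auto simp: h\<close>)
  moreover have "dd (\<lambda>x. c * f x) x = (\<lambda>v. c * dd f x v)"
    by (rule ddI[OF has_derivative_mult_right[OF Cinf_has_derivative[OF f]]]) (use x in simp)
  ultimately have "c * dd f x v = dd f (t *\<^sub>R x) (t *\<^sub>R v)" by metis
  then show ?thesis using t by (simp add: linear_scale[OF l] field_simps)
qed

text \<open>Each derivative of a 0-homogeneous function lowers the degree of homogeneity by one, so
  outside the ball of radius \<open>1/4\<close> second derivatives exceed those on the sphere by a
  factor of at most 16.\<close>

lemma c2_homogeneous:
  fixes w :: "'a::euclidean_space \<Rightarrow> real"
  assumes w: "Cinf (- {0}) w" and h: "\<And>t x. 0 < t \<Longrightarrow> w (t *\<^sub>R x) = w x" and c: "c2 (sphere 0 1) w M"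
  shows "c2 {x. 1 / 4 \<le> norm x} w (16 * M)"
  unfolding c2_def
proof (intro ballI conjI allI)
  fix x :: 'a assume "x \<in> {x. 1 / 4 \<le> norm x}"
  then have nx: "1 / 4 \<le> norm x" by simp
  then have nz: "norm x \<noteq> 0" by linarith
  define t where "t = norm x"
  define z where "z = x /\<^sub>R norm x"
  have t: "0 < t" "1 / 4 \<le> t" using nx by (auto simp: t_def)
  have z: "z \<in> sphere 0 1" and z0: "z \<noteq> 0" using nz by (auto simp: z_def)
  have x: "x = t *\<^sub>R z" using nz by (auto simp: t_def z_def)
  note C = c2D[OF c z]
  have M: "0 \<le> M" by (rule c2_pos[OF c z])
  have d1: "dd w (t *\<^sub>R y) v = 1 / t * dd w y v" if "y \<noteq> 0" for y v
    by (rule dd_homogeneous[OF w _ t(1) that, of 1]) (simp add: h[OF t(1)])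
  have d2: "dd (\<lambda>x. dd w x v) (t *\<^sub>R z) u = (1 / t) / t * dd (\<lambda>x. dd w x v) z u" for v u
    by (rule dd_homogeneous[OF Cinf_dd[OF w] d1 t(1) z0])
  have i: "1 / t \<le> 4" using t by (simp add: field_simps)
  have ii: "1 / t / t \<le> 16" 
    using mult_mono[OF i i] t by simp
  show "\<bar>w x\<bar> \<le> 16 * M" unfolding x h[OF t(1)] using C(1) M by linarith
  fix v u
  have "\<bar>dd w x v\<bar> = 1 / t * \<bar>dd w z v\<bar>" unfolding x d1[OF z0] abs_mult using t by simp
  also have "\<dots> \<le> 16 * (M * norm v)" using i t C(2)[of v] by (intro mult_mono) auto
  finally show "\<bar>dd w x v\<bar> \<le> 16 * M * norm v" by simp
  have "\<bar>dd (\<lambda>x. dd w x v) x u\<bar> = (1 / t / t) * \<bar>dd (\<lambda>x. dd w x v) z u\<bar>" unfolding x d2 abs_mult using t by simp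
  also have "\<dots> \<le> 16 * (M * (norm v * norm u))" using ii t C(3)[of v u] by (intro mult_mono) auto
  finally show "\<bar>dd (\<lambda>x. dd w x v) x u\<bar> \<le> 16 * M * (norm v * norm u)" by simp
qed

lemma c2_grad_lip:
  fixes f :: "'a::euclidean_space \<Rightarrow> real"
  assumes f: "Cinf UNIV f" and c: "c2 UNIV f M"
  shows "norm (grad f x - grad f y) \<le> M * norm (x - y)"
proof (rule norm_le_inner)
  have M: "0 \<le> M" by (rule c2_pos[OF c UNIV_I[of 0]])
  then show "0 \<le> M * norm (x - y)" by simp
  fix v
  let ?g = "\<lambda>x. dd f x v"
  have "norm (?g (y + 1 *\<^sub>R (x - y)) - ?g (y + 0 *\<^sub>R (x - y))) \<le> (M * (norm v * norm (x - y))) * 1"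
  proof (rule displacement_bound)
    fix t :: real
    show "((\<lambda>t. ?g (y + t *\<^sub>R (x - y))) has_vector_derivative dd ?g (y + t *\<^sub>R (x - y)) (x - y)) (at t)"
      by (rule dd_line[OF Cinf_differentiable[OF Cinf_dd[OF f] UNIV_I]])
    show "norm (dd ?g (y + t *\<^sub>R (x - y)) (x - y)) \<le> M * (norm v * norm (x - y))"
      unfolding real_norm_def by (rule c2D(3)[OF c UNIV_I])
  qed simp
  then have "\<bar>dd f x v - dd f y v\<bar> \<le> M * norm (x - y) * norm v" by (simp add: mult_ac)
  then show "(grad f x - grad f y) \<bullet> v \<le> M * norm (x - y) * norm v"
    by (simp add: inner_diff_left grad[OF Cinf_differentiable[OF f UNIV_I]])
qed

lemma c2_compact:
  fixes f :: "'a::euclidean_space \<Rightarrow> real"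
  assumes f: "Cinf UNIV f" and K: "compact K"
  obtains M where "0 \<le> M" "c2 K f M"
proof -
  have b: "\<exists>B\<ge>0. \<forall>x\<in>K. norm (g x) \<le> B" if "Cinf UNIV g" for g :: "'a \<Rightarrow> 'b::real_normed_vector"
  proof -
    have "continuous_on K g" using Cinf_continuous[OF that] continuous_on_subset by blast
    then have "bounded (g ` K)" using compact_continuous_image K compact_imp_bounded by blast
    then show ?thesis unfolding bounded_pos by (metis image_eqI less_imp_le)
  qed
  obtain B0 where B0: "0 \<le> B0" "\<And>x. x \<in> K \<Longrightarrow> norm (f x) \<le> B0" using b[OF f] by blast
  obtain B1 where B1: "0 \<le> B1" "\<And>x. x \<in> K \<Longrightarrow> norm (bd f x) \<le> B1" using b[OF Cinf_bd[OF open_UNIV f]] by blast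
  obtain B2 where B2: "0 \<le> B2" "\<And>x. x \<in> K \<Longrightarrow> norm (bd (bd f) x) \<le> B2"
    using b[OF Cinf_bd[OF open_UNIV Cinf_bd[OF open_UNIV f]]] by blast
  have fd: "dd f x v = bd f x v" for x v using bd_apply[OF Cinf_differentiable[OF f UNIV_I]] by simp
  have "c2 K f (B0 + B1 + B2)"
  proof (rule c2I[OF open_UNIV subset_UNIV])
    show "(f has_derivative bd f x) (at x)" for x
      by (rule bd_has_derivative[OF Cinf_differentiable[OF f UNIV_I]])
    show "((\<lambda>x. bd f x v) has_derivative (\<lambda>w. bd (bd f) x w v)) (at x)" for x v
      by (rule bounded_linear.has_derivative[OF blinfun.bounded_linear_left
          bd_has_derivative[OF Cinf_differentiable[OF Cinf_bd[OF open_UNIV f] UNIV_I]]])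
    fix x assume x: "x \<in> K"
    show "\<bar>f x\<bar> \<le> B0 + B1 + B2" using B0(2)[OF x] B1(1) B2(1) by simp
    show "\<bar>bd f x v\<bar> \<le> (B0 + B1 + B2) * norm v" for v
      using order_trans[OF norm_blinfun mult_right_mono[OF _ norm_ge_zero], of "bd f x" "B0 + B1 + B2" v] B1(2)[OF x] B0(1) B2(1) by simp
    show "\<bar>bd (bd f) x w v\<bar> \<le> (B0 + B1 + B2) * (norm v * norm w)" for v w
    proof -
      have "norm (bd (bd f) x w v) \<le> norm (bd (bd f) x w) * norm v" by (rule norm_blinfun)
      also have "\<dots> \<le> (norm (bd (bd f) x) * norm w) * norm v" by (rule mult_right_mono[OF norm_blinfun norm_ge_zero])
      also have "\<dots> \<le> ((B0 + B1 + B2) * norm w) * norm v"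
        using B2(2)[OF x] B0(1) B1(1) by (intro mult_right_mono) auto
      finally show ?thesis by (simp add: mult_ac)
    qed
  qed
  then show ?thesis by (rule that[rotated]) (use B0 B1 B2 in simp)
qed

lemma c2_zero:
  assumes "open U" "\<And>x. x \<in> U \<Longrightarrow> f x = 0" "0 \<le> M"
  shows "c2 U f M"
proof (rule c2I[where f' = "\<lambda>x v. 0" and f'' = "\<lambda>x v w. 0", OF assms(1) order_refl])
  show "(f has_derivative (\<lambda>v. 0)) (at x)" if "x \<in> U" for x
    by (rule has_derivative_transform_within_open[OF has_derivative_const assms(1) that]) (simp add: assms(2))
qed (use assms in auto)

lemma c2_add:
  assumes S: "open S" "K \<subseteq> S" and f: "Cinf S f" "c2 K f M" and g: "Cinf S g" "c2 K g M'"
  shows "c2 K (\<lambda>x. f x + g x) (M + M')"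
proof (rule c2I[OF S])
  note D = Cinf_has_derivative
  show "((\<lambda>x. f x + g x) has_derivative (\<lambda>v. dd f x v + dd g x v)) (at x)" if "x \<in> S" for x
    by (rule has_derivative_add[OF D[OF f(1) that] D[OF g(1) that]])
  show "((\<lambda>x. dd f x v + dd g x v) has_derivative (\<lambda>w. dd (\<lambda>x. dd f x v) x w + dd (\<lambda>x. dd g x v) x w)) (at x)"
    if "x \<in> S" for x v
    by (rule has_derivative_add[OF D[OF Cinf_dd[OF f(1)] that] D[OF Cinf_dd[OF g(1)] that]])
  fix x assume x: "x \<in> K"
  note F = c2D[OF f(2) x] and G = c2D[OF g(2) x]
  show "\<bar>f x + g x\<bar> \<le> M + M'" using F(1) G(1) by linarith
  show "\<bar>dd f x v + dd g x v\<bar> \<le> (M + M') * norm v" for v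
    using F(2)[of v] G(2)[of v] unfolding distrib_right by linarith
  show "\<bar>dd (\<lambda>x. dd f x v) x w + dd (\<lambda>x. dd g x v) x w\<bar> \<le> (M + M') * (norm v * norm w)" for v w
    using F(3)[of v w] G(3)[of v w] unfolding distrib_right by linarith
qed

lemma grad_zero:
  assumes "open U" "x \<in> U" "\<And>x. x \<in> U \<Longrightarrow> f x = (0::real)"
  shows "grad f x = 0"
proof -
  have "dd f x = (\<lambda>v. 0)"
    by (rule dd_cong[OF assms(1,2) _ has_derivative_const]) (simp add: assms(3))
  then show ?thesis by (simp add: grad_def)
qed

section \<open>Radial functions close to 1\<close>

lemma radial_ext_scale: "0 < t \<Longrightarrow> radial_ext f (t *\<^sub>R x) = radial_ext f x"
  by (simp add: radial_ext_def mult.commute[of _ t] mult.assoc[symmetric])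

lemma Cinf_radial_ext_diff:
  fixes g :: "'a::euclidean_space \<Rightarrow> real"
  assumes "smooth_positive_on_sphere g"
  shows "Cinf (- {0}) (radial_ext (\<lambda>x. 1 - g x))"
proof -
  have o: "open (- {0 :: 'a})" by (rule open_Compl[OF closed_singleton])
  have "Cinf (- {0}) (radial_ext g)"
    using assms smooth_on_iff_Cinf[OF o] unfolding smooth_positive_on_sphere_def by blast
  from Cinf_diff[OF o Cinf_const this, of 1] show ?thesis
    unfolding radial_ext_def[abs_def] .
qed

text \<open>A real supremum bounds the members only if they are bounded above. They are, since there
  are finitely many lists of directions and each derivative is continuous on the compact
  sphere.\<close>

lemma Ck_dist_bounds:
  fixes g :: "'a::euclidean_space \<Rightarrow> real" and d :: real
  assumes g: "smooth_positive_on_sphere g" and d: "Ck_dist 2 (\<lambda>_. 1) g \<le> d"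
  defines "w \<equiv> radial_ext (\<lambda>x. 1 - g x)"
  shows "c2 (sphere 0 1) w (DIM('a) * DIM('a) * d)" "z \<in> sphere 0 1 \<Longrightarrow> \<bar>w z\<bar> \<le> d"
proof -
  define Vs where "Vs = {vs :: 'a list. set vs \<subseteq> Basis \<and> length vs \<le> 2}"
  define f where "f = (\<lambda>(vs, z). \<bar>iter_deriv vs w z\<bar>)"
  have o: "open (- {0 :: 'a})" by (rule open_Compl[OF closed_singleton])
  have C: "Cinf (- {0}) w" unfolding w_def by (rule Cinf_radial_ext_diff[OF g])
  then have sm: "smooth_on (- {0}) w" using smooth_on_iff_Cinf[OF o] by blast
  have fin: "finite Vs" unfolding Vs_def by (rule finite_lists_length_le) simp
  have "bdd_above ((\<lambda>z. f (vs, z)) ` sphere 0 1)" for vs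
  proof -
    have "continuous_on (sphere 0 1) (iter_deriv vs w)"
    proof (rule continuous_at_imp_continuous_on, rule ballI)
      fix z :: 'a assume "z \<in> sphere 0 1"
      then have "z \<in> - {0}" by auto
      then show "isCont (iter_deriv vs w) z"
        using sm differentiable_imp_continuous_within unfolding smooth_on_def by blast
    qed
    then have "continuous_on (sphere 0 1) (\<lambda>z. f (vs, z))"
      unfolding f_def by (simp add: continuous_on_rabs)
    then have "bounded ((\<lambda>z. f (vs, z)) ` sphere 0 1)"
      using compact_continuous_image compact_imp_bounded compact_sphere by blast
    then show ?thesis by (rule bounded_imp_bdd_above)
  qed
  then have "bdd_above (\<Union>vs\<in>Vs. (\<lambda>z. f (vs, z)) ` sphere 0 1)" using fin by simp
  moreover have "(\<Union>vs\<in>Vs. (\<lambda>z. f (vs, z)) ` sphere 0 1) = f ` (Vs \<times> sphere 0 1)" by auto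
  ultimately have bdd: "bdd_above (f ` (Vs \<times> sphere 0 1))" by simp
  have le: "\<bar>iter_deriv vs w z\<bar> \<le> d" if "vs \<in> Vs" "z \<in> sphere 0 1" for vs z
  proof -
    have "f (vs, z) \<le> (SUP y\<in>Vs \<times> sphere 0 1. f y)" by (rule cSUP_upper[OF _ bdd]) (use that in auto)
    also have "\<dots> = Ck_dist 2 (\<lambda>_. 1) g" unfolding Ck_dist_def f_def Vs_def w_def ..
    finally show ?thesis using d by (simp add: f_def)
  qed
  have b0: "\<bar>w z\<bar> \<le> d" if "z \<in> sphere 0 1" for z using le[of "[]" z] that by (simp add: Vs_def)
  then show "z \<in> sphere 0 1 \<Longrightarrow> \<bar>w z\<bar> \<le> d" .
  have b1: "\<bar>dd w z e\<bar> \<le> d" if "z \<in> sphere 0 1" "e \<in> Basis" for z e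
    using le[of "[e]" z] that by (simp add: Vs_def)
  have b2: "\<bar>dd (\<lambda>x. dd w x e) z e'\<bar> \<le> d" if "z \<in> sphere 0 1" "e \<in> Basis" "e' \<in> Basis" for z e e'
    using le[of "[e', e]" z] that by (simp add: Vs_def)
  show "c2 (sphere 0 1) w (DIM('a) * DIM('a) * d)"
    by (rule c2_basis[OF o _ C b0 b1 b2]) auto
qed

text \<open>The origin needs its own case: \<open>radial_ext g 0\<close> is \<open>g 0\<close>, a
  value on which nothing is assumed.\<close>

lemma mem_radial_domain:
  fixes g :: "'a::euclidean_space \<Rightarrow> real"
  assumes g: "smooth_positive_on_sphere g"
  shows "x \<in> radial_domain g \<longleftrightarrow> x = 0 \<or> norm x < radial_ext g x"
proof
  assume "x \<in> radial_domain g"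
  then obtain r z where x: "x = r *\<^sub>R z" "norm z = 1" "0 \<le> r" "r < g z" by (auto simp: radial_domain_def)
  show "x = 0 \<or> norm x < radial_ext g x"
  proof (cases "r = 0")
    case False
    then have "radial_ext g x = g z" using x by (simp add: radial_ext_def)
    then show ?thesis using x by simp
  qed (use x in simp)
next
  assume x: "x = 0 \<or> norm x < radial_ext g x"
  show "x \<in> radial_domain g"
  proof (cases "x = 0")
    case True
    obtain b :: 'a where b: "b \<in> Basis" using nonempty_Basis by blast
    then have "0 < g b" using g unfolding smooth_positive_on_sphere_def by auto
    then show ?thesis using b True unfolding radial_domain_def by (intro CollectI exI[of _ 0] exI[of _ b]) auto
  next
    case False
    then show ?thesis using x unfolding radial_domain_def radial_ext_def
      by (intro CollectI exI[of _ "norm x"] exI[of _ "x /\<^sub>R norm x"]) auto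
  qed
qed

lemma cutoff:
  obtains B :: "'a::euclidean_space \<Rightarrow> real" and M where "Cinf UNIV B" "0 < M" "c2 UNIV B M"
    "\<And>x. norm x < 1 / 4 \<Longrightarrow> B x = 0" "\<And>x. 3 < norm x \<Longrightarrow> B x = 0"
    "\<And>x. 1 / 2 < norm x \<Longrightarrow> norm x < 2 \<Longrightarrow> B x = x \<bullet> x / 2"
proof -
  \<comment> \<open>The cutoffs are functions of the squared norm: \<open>s1\<close> switches off
    between the radii 2 and 3, and \<open>1 - s2\<close> switches on between \<open>1/4\<close> and
    \<open>1/2\<close>.\<close>
  obtain s1 :: "real \<Rightarrow> real" where s1: "Cinf UNIV s1" "\<And>x. x \<le> 4 \<Longrightarrow> s1 x = 1" "\<And>x. x \<ge> 9 \<Longrightarrow> s1 x = 0"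
    by (rule smooth_step[of 4 9]) (simp, rule that)
  obtain s2 :: "real \<Rightarrow> real" where s2: "Cinf UNIV s2" "\<And>x. x \<le> 1 / 16 \<Longrightarrow> s2 x = 1" "\<And>x. x \<ge> 1 / 4 \<Longrightarrow> s2 x = 0"
    by (rule smooth_step[of "1 / 16" "1 / 4"]) (simp, rule that)
  define B where "B x = (s1 (x \<bullet> x) * (1 - s2 (x \<bullet> x))) * ((x \<bullet> x) * (1 / 2))" for x :: 'a
  have ci: "Cinf UNIV (\<lambda>x :: 'a. x \<bullet> x)"
    by (rule Cinf_inner[OF open_UNIV Cinf_ident[OF open_UNIV] Cinf_ident[OF open_UNIV]])
  have C: "Cinf UNIV B"
    unfolding B_def[abs_def]
    by (rule Cinf_mult[OF open_UNIV Cinf_mult[OF open_UNIV Cinf_compose_UNIV[OF open_UNIV s1(1) ci]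
          Cinf_diff[OF open_UNIV Cinf_const Cinf_compose_UNIV[OF open_UNIV s2(1) ci]]] Cinf_mult[OF open_UNIV ci Cinf_const]])
  have sq: "x \<bullet> x = norm x * norm x" for x :: 'a
    by (simp add: power2_norm_eq_inner[symmetric] power2_eq_square)
  have z1: "B x = 0" if "norm x < 1 / 4" for x :: 'a
  proof -
    have "x \<bullet> x \<le> (1 / 4) * (1 / 4)" unfolding sq using that by (intro mult_mono) auto
    then show ?thesis by (simp add: B_def s2)
  qed
  have z2: "B x = 0" if "3 < norm x" for x :: 'a
  proof -
    have "3 * 3 \<le> x \<bullet> x" unfolding sq using that by (intro mult_mono) auto
    then show ?thesis by (simp add: B_def s1)
  qed
  have z3: "B x = x \<bullet> x / 2" if "1 / 2 < norm x" "norm x < 2" for x :: 'a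
  proof -
    have "x \<bullet> x \<le> 2 * 2" unfolding sq using that by (intro mult_mono) auto
    moreover have "(1 / 2) * (1 / 2) \<le> x \<bullet> x" unfolding sq using that by (intro mult_mono) auto
    ultimately show ?thesis by (simp add: B_def s1 s2)
  qed
  obtain M where M: "0 \<le> M" "c2 (cball 0 3) B M" by (rule c2_compact[OF C compact_cball]) (rule that)
  have "open {x :: 'a. 3 < norm x}" by (intro open_Collect_less continuous_intros)
  then have "c2 {x. 3 < norm x} B M" by (rule c2_zero) (use z2 M in auto)
  from c2_Un[OF M(2) this] have "c2 UNIV B M" by (rule c2_subset) auto
  then have "c2 UNIV B (M + 1)" by (rule c2_mono) simp
  moreover have "0 < M + 1" using M by simp
  ultimately show ?thesis using that[of B "M + 1", OF C _ _ z1 z2 z3] by blast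
qed

context cplx begin

lemma near_ball_normal_form:
  obtains d where "0 < d" "\<And>g. smooth_positive_on_sphere g \<Longrightarrow> Ck_dist 2 (\<lambda>_. 1) g < d \<Longrightarrow>
    \<exists>c e F F'. 0 < c \<and> cline J e \<and> Cinf UNIV F \<and> Cinf UNIV F' \<and> (\<forall>y. F' (F y) = y) \<and> (\<forall>y. F (F' y) = y) \<and>
      (\<forall>y a b. J (dd F y a) \<bullet> dd F y b = J a \<bullet> b) \<and>
      (\<forall>y. (norm y)\<^sup>2 + (norm (cline.N J e y))\<^sup>2 < c \<longrightarrow> F y \<in> radial_domain g) \<and>
      (\<forall>x\<in>radial_domain g. (norm (F' x))\<^sup>2 < c)"
proof -
  obtain B :: "'a \<Rightarrow> real" and M where B: "Cinf UNIV B" and M: "0 < M" "c2 UNIV B M"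
    and B0: "\<And>x. norm x < 1 / 4 \<Longrightarrow> B x = 0" "\<And>x. 3 < norm x \<Longrightarrow> B x = 0"
    and Bs: "\<And>x. 1 / 2 < norm x \<Longrightarrow> norm x < 2 \<Longrightarrow> B x = x \<bullet> x / 2"
    by (rule cutoff) (rule that)
  define D where "D = real DIM('a) * real DIM('a)"
  have n: "1 \<le> real DIM('a)" using DIM_positive[where 'a = 'a] by linarith
  have D: "1 \<le> D" unfolding D_def using mult_mono[OF n n] by simp
  \<comment> \<open>\<open>c1\<close> is limited by the cutoff through \<open>M\<close>. Then
    \<open>d\<close> is so small that the perturbation is below \<open>c1 / 1000\<close>, as the
    sign argument at both ends of the range of \<open>c\<close> requires; the numerical factor there
    is \<open>1000 * 4 * 1640 * 16\<close>, about \<open>1.05 * 10^8\<close>.\<close>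
  define c1 where "c1 = 1 / (100000000 * (1 + M))"
  have k1: "0 < c1" "c1 * (1 + M) \<le> 1 / 100000000" "c1 \<le> 1 / 100000000"
    using M by (simp_all add: c1_def field_simps)
  define d where "d = c1 / (200000000 * (1 + M) * D)"
  have d0: "0 < d" unfolding d_def using k1 M D by simp
  have dD: "200000000 * (1 + M) * (D * d) = c1" using M D by (simp add: d_def)
  have dD': "0 \<le> D * d" "0 \<le> M * (D * d)" using d0 D M by simp_all
  have d1: "D * d \<le> 1 / 1000" "1000 * (4 * M * (1640 * (16 * (D * d)))) \<le> c1"
    using dD dD' k1 by (simp_all add: algebra_simps)
  have d2: "d \<le> 1 / 10" using d1(1) mult_right_mono[OF D, of d] d0 by linarith
  show ?thesis
  proof (rule that[OF d0])
    fix g :: "'a \<Rightarrow> real"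
    assume g: "smooth_positive_on_sphere g" and "Ck_dist 2 (\<lambda>_. 1) g < d"
    then have gd: "Ck_dist 2 (\<lambda>_. 1) g \<le> d" by simp
    define w where "w = radial_ext (\<lambda>x. 1 - g x)"
    define i where "i x = inverse (1 - w x)" for x
    \<comment> \<open>Off the origin \<open>i\<close> is the reciprocal of
      \<open>radial_ext g\<close> and \<open>1 + h\<close> is its square, so in the shell
      \<open>q\<close> turns half the squared norm into the 2-homogeneous function that defines the
      domain. The factor \<open>w\<close> in both terms makes the smallness of \<open>h\<close>
      visible.\<close>
    define h where "h x = w x * i x + w x * i x * i x" for x
    define q where "q x = B x * h x" for x
    have o: "open (- {0 :: 'a})" by (rule open_Compl[OF closed_singleton])
    have w1: "1 - w x = radial_ext g x" for x by (simp add: w_def radial_ext_def)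
    have Cw: "Cinf (- {0}) w" unfolding w_def by (rule Cinf_radial_ext_diff[OF g])
    have ws: "w (t *\<^sub>R x) = w x" if "0 < t" for t x unfolding w_def by (rule radial_ext_scale[OF that])
    have wd: "\<bar>w x\<bar> \<le> d" if "x \<noteq> 0" for x
    proof -
      have "\<bar>w (x /\<^sub>R norm x)\<bar> \<le> d"
        unfolding w_def by (rule Ck_dist_bounds(2)[OF g gd]) (use that in simp)
      moreover have "w (x /\<^sub>R norm x) = w x" using ws[of "inverse (norm x)" x] that by simp
      ultimately show ?thesis by simp
    qed
    have ne: "w x \<noteq> 1" if "x \<in> - {0}" for x using wd[of x] that d2 by auto
    define K where "K = {x :: 'a. 1 / 4 \<le> norm x}"
    have K: "K \<subseteq> - {0}" by (auto simp: K_def)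
    define m where "m = 16 * (D * d)"
    have m: "m \<le> 1 / 2" using d1 by (simp add: m_def)
    have "c2 K w (16 * (DIM('a) * DIM('a) * d))"
      unfolding K_def by (rule c2_homogeneous[OF Cw ws Ck_dist_bounds(1)[OF g gd, folded w_def]])
    then have cw: "c2 K w m" by (simp add: m_def D_def)
    have ci: "c2 K i 10" unfolding i_def[abs_def] by (rule c2_inverse[OF o K Cw cw m ne])
    have Ci: "Cinf (- {0}) i" unfolding i_def[abs_def]
      by (rule Cinf_inverse[OF o Cinf_diff[OF o Cinf_const Cw]]) (use ne in auto)
    note Cwi = Cinf_mult[OF o Cw Ci]
    note cwi = c2_mult[OF o K Cw cw Ci ci]
    note Cwii = Cinf_mult[OF o Cwi Ci]
    note cwii = c2_mult[OF o K Cwi cwi Ci ci]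
    have Ch: "Cinf (- {0}) h" unfolding h_def[abs_def] by (rule Cinf_add[OF o Cwi Cwii])
    \<comment> \<open>\<open>40 * m\<close> comes from \<open>w * i\<close> and
      \<open>4 * 40 * 10 * m\<close> from \<open>w * i * i\<close>.\<close>
    have ch: "c2 K h (1640 * m)"
      unfolding h_def[abs_def] by (rule c2_mono[OF c2_add[OF o K Cwi cwi Cwii cwii]]) simp
    have CB: "Cinf (- {0}) B" by (rule Cinf_subset[OF B]) simp
    have q0: "q x = 0" if "norm x < 1 / 4 \<or> 3 < norm x" for x using that B0 by (auto simp: q_def)
    have o1: "open {x :: 'a. norm x < 1 / 4}" by (intro open_Collect_less continuous_intros)
    have o2: "open {x :: 'a. 3 < norm x}" by (intro open_Collect_less continuous_intros)
    have Cq: "Cinf UNIV q"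
    proof (rule Cinf_local)
      fix x :: 'a
      show "\<exists>U. open U \<and> x \<in> U \<and> Cinf U q"
      proof (cases "x = 0")
        case True
        have "Cinf {x :: 'a. norm x < 1 / 4} q" by (rule Cinf_cong[OF o1 _ Cinf_const[of _ 0]]) (simp add: q0)
        then show ?thesis using o1 True by (intro exI[of _ "{x :: 'a. norm x < 1 / 4}"]) auto
      next
        case False
        have "Cinf (- {0}) q" unfolding q_def[abs_def] by (rule Cinf_mult[OF o CB Ch])
        then show ?thesis using o False by (intro exI[of _ "- {0}"]) auto
      qed
    qed
    define \<epsilon>0 where "\<epsilon>0 = 4 * M * (1640 * m)"
    have e0: "0 \<le> \<epsilon>0" using dD' by (simp add: \<epsilon>0_def m_def)
    have cq: "c2 UNIV q \<epsilon>0"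
    proof -
      have "c2 K q \<epsilon>0"
        unfolding q_def[abs_def] \<epsilon>0_def by (rule c2_mult[OF o K CB c2_subset[OF M(2) subset_UNIV] Ch ch])
      moreover have "c2 {x. norm x < 1 / 4} q \<epsilon>0" by (rule c2_zero[OF o1 _ e0]) (simp add: q0)
      ultimately have "c2 (K \<union> {x. norm x < 1 / 4}) q \<epsilon>0" by (rule c2_Un)
      then show ?thesis by (rule c2_subset) (auto simp: K_def)
    qed
    interpret hopf_family J B q M \<epsilon>0 c1
    proof (unfold_locales)
      show "Cinf UNIV B" "Cinf UNIV q" by (rule B Cq)+
      show "norm (grad B x - grad B y) \<le> M * norm (x - y)" for x y by (rule c2_grad_lip[OF B M(2)])
      show "norm (grad q x - grad q y) \<le> \<epsilon>0 * norm (x - y)" for x y by (rule c2_grad_lip[OF Cq cq])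
      show "grad B 0 = 0" by (rule grad_zero[OF o1]) (auto simp: B0)
      show "grad q 0 = 0" by (rule grad_zero[OF o1]) (auto simp: q0)
      show "B x = x \<bullet> x / 2" if "1 / 2 < norm x" "norm x < 2" for x by (rule Bs[OF that])
      show "q (t *\<^sub>R x) = t\<^sup>2 * q x" if "0 < t" "1 / 2 < norm x" "norm x < 2" "1 / 2 < t * norm x" "t * norm x < 2" for t x
      proof -
        have "B (t *\<^sub>R x) = (t *\<^sub>R x) \<bullet> (t *\<^sub>R x) / 2" by (rule Bs) (use that in simp_all)
        then show ?thesis by (simp add: q_def h_def i_def ws[OF that(1)] Bs[OF that(2,3)] power2_eq_square)
      qed
      show "0 \<le> M" "0 \<le> \<epsilon>0" "0 < c1" "c1 * (1 + M) \<le> 1 / 100000000" using M e0 k1 by simp_all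
      show "1000 * \<epsilon>0 \<le> c1" using d1(2) by (simp add: \<epsilon>0_def m_def)
    qed
    obtain c e F F' where c: "\<bar>c - 1\<bar> \<le> c1" and e: "cline J e" and F: "Cinf UNIV F" "Cinf UNIV F'" "\<And>y. F' (F y) = y" "\<And>y. F (F' y) = y"
      "\<And>y a b. J (dd F y a) \<bullet> dd F y b = J a \<bullet> b"
      and near: "\<And>y. norm (F y - y) \<le> 1 / 1000 * norm y"
      and lo: "\<And>y. 8 / 10 \<le> norm y \<Longrightarrow> norm y \<le> 13 / 10 \<Longrightarrow> (norm y)\<^sup>2 / 2 \<le> c * ((norm (F y))\<^sup>2 / 2 + q (F y))"
      and hi: "\<And>y. 8 / 10 \<le> norm y \<Longrightarrow> norm y \<le> 13 / 10 \<Longrightarrow>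
        c * ((norm (F y))\<^sup>2 / 2 + q (F y)) \<le> (norm y)\<^sup>2 / 2 + (norm (cline.N J e y))\<^sup>2 / 2"
      by (rule normal_form_family) (rule that)
    have cb: "99 / 100 \<le> c" "c \<le> 101 / 100" using c k1 by linarith+
    have Gb: "9 / 10 \<le> radial_ext g x" "radial_ext g x \<le> 11 / 10" if "x \<noteq> 0" for x
      using wd[OF that] d2 w1[of x] by linarith+
    have Nf: "(norm x)\<^sup>2 / 2 + q x = (norm x)\<^sup>2 / 2 * (1 / (radial_ext g x)\<^sup>2)" if "1 / 2 < norm x" "norm x < 2" for x
    proof -
      have x0: "x \<noteq> 0" using that by auto
      have "i x * (1 - w x) = 1" using ne[of x] x0 by (simp add: i_def)
      then have wi: "w x * i x = i x - 1" by (simp add: algebra_simps)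
      have "1 + h x = (i x)\<^sup>2" unfolding h_def wi by (simp add: power2_eq_square algebra_simps)
      moreover have "q x = (norm x)\<^sup>2 / 2 * h x" by (simp add: q_def Bs[OF that] power2_norm_eq_inner)
      ultimately have "(norm x)\<^sup>2 / 2 + q x = (norm x)\<^sup>2 / 2 * (i x)\<^sup>2" by (metis distrib_left mult.right_neutral)
      then show ?thesis by (simp add: i_def w1 power_inverse inverse_eq_divide power_divide)
    qed
    have lt: "norm x < radial_ext g x \<longleftrightarrow> (norm x)\<^sup>2 / 2 + q x < 1 / 2" if x: "1 / 2 < norm x" "norm x < 2" for x
    proof -
      have "x \<noteq> 0" using x by auto
      then have G: "0 < radial_ext g x" using Gb(1)[of x] by linarith
      have "(norm x)\<^sup>2 / 2 + q x < 1 / 2 \<longleftrightarrow> (norm x)\<^sup>2 < (radial_ext g x)\<^sup>2"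
        unfolding Nf[OF x] using zero_less_power[OF G, of 2] by (simp add: pos_divide_less_eq)
      also have "\<dots> \<longleftrightarrow> norm x < radial_ext g x"
      proof
        show "(norm x)\<^sup>2 < (radial_ext g x)\<^sup>2 \<Longrightarrow> norm x < radial_ext g x"
          by (rule power2_less_imp_less) (use G in simp_all)
        show "norm x < radial_ext g x \<Longrightarrow> (norm x)\<^sup>2 < (radial_ext g x)\<^sup>2"
          by (rule power_strict_mono) simp_all
      qed
      finally show ?thesis by simp
    qed
    have Fn: "\<bar>norm (F y) - norm y\<bar> \<le> 1 / 1000 * norm y" for y
      using near[of y] norm_triangle_ineq3[of "F y" y] by linarith
    \<comment> \<open>The energy bounds hold only for \<open>norm y \<ge> 8/10\<close>. Shorter
      vectors are sent into the ball of radius \<open>9/10\<close>, which lies in the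
      domain.\<close>
    have i: "F y \<in> radial_domain g" if y: "(norm y)\<^sup>2 + (norm (cline.N J e y))\<^sup>2 < c" for y
    proof (cases "8 / 10 \<le> norm y")
      case True
      have "(11 / 10 :: real)\<^sup>2 = 121 / 100" by (simp add: power2_eq_square)
      then have "(norm y)\<^sup>2 \<le> (11 / 10)\<^sup>2" using y cb zero_le_power2[of "norm (cline.N J e y)"] by linarith
      then have y2: "norm y \<le> 11 / 10" by (rule power2_le_imp_le) simp
      then have s: "1 / 2 < norm (F y)" "norm (F y) < 2" using True Fn[of y] by linarith+
      have "c * ((norm (F y))\<^sup>2 / 2 + q (F y)) < c * (1 / 2)"
        using hi[OF True] y2 y by simp
      then have "(norm (F y))\<^sup>2 / 2 + q (F y) < 1 / 2" using cb by (simp add: mult_less_cancel_left)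
      then show ?thesis using lt[OF s] by (simp add: mem_radial_domain[OF g])
    next
      case False
      have "norm (F y) < 9 / 10" using False Fn[of y] by linarith
      then have "F y = 0 \<or> norm (F y) < radial_ext g (F y)" using Gb(1)[of "F y"] by fastforce
      then show ?thesis by (simp add: mem_radial_domain[OF g])
    qed
    have ii: "(norm (F' x))\<^sup>2 < c" if x: "x \<in> radial_domain g" for x
    proof -
      define y where "y = F' x"
      have xy: "x = F y" by (simp add: y_def F)
      have nx: "norm x < 11 / 10" using x Gb(2)[of x] unfolding mem_radial_domain[OF g] by fastforce
      then have ny: "norm y \<le> 13 / 10" using Fn[of y] unfolding xy by linarith
      show ?thesis
      proof (cases "8 / 10 \<le> norm y")
        case True
        have s: "1 / 2 < norm x" "norm x < 2" using True Fn[of y] nx unfolding xy by linarith+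
        then have "x \<noteq> 0" by auto
        then have "(norm x)\<^sup>2 / 2 + q x < 1 / 2" using x lt[OF s] by (simp add: mem_radial_domain[OF g])
        then have "c * ((norm x)\<^sup>2 / 2 + q x) < c * (1 / 2)" using cb by (intro mult_strict_left_mono) auto
        then show ?thesis using lo[OF True ny] unfolding xy[symmetric] unfolding y_def by linarith
      next
        case False
        then have "(norm y)\<^sup>2 \<le> (8 / 10)\<^sup>2" by (intro power_mono) auto
        then show ?thesis using cb by (simp add: y_def power2_eq_square)
      qed
    qed
    show "\<exists>c e F F'. 0 < c \<and> cline J e \<and> Cinf UNIV F \<and> Cinf UNIV F' \<and> (\<forall>y. F' (F y) = y) \<and> (\<forall>y. F (F' y) = y) \<and>
      (\<forall>y a b. J (dd F y a) \<bullet> dd F y b = J a \<bullet> b) \<and>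
      (\<forall>y. (norm y)\<^sup>2 + (norm (cline.N J e y))\<^sup>2 < c \<longrightarrow> F y \<in> radial_domain g) \<and>
      (\<forall>x\<in>radial_domain g. (norm (F' x))\<^sup>2 < c)"
      by (intro exI[of _ c] exI[of _ e] exI[of _ F] exI[of _ F'] conjI) (use cb e F i ii in auto)
  qed
qed

end

section \<open>Moving a complex line to another one by a unitary map\<close>

context cplx begin

text \<open>A Householder reflection, after multiplying \<open>e\<close> by a phase that makes its Hermitian product with \<open>a\<close> real.\<close>

lemma unitary_to:
  assumes "norm e = 1" "norm a = 1"
  obtains U where "linear U" "\<And>x. U (J x) = J (U x)" "\<And>x y. U x \<bullet> U y = x \<bullet> y" "\<And>x. U (U x) = x"
    "\<And>x. norm (cline.N J e x) = norm (cline.N J a (U x))"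
proof -
  note goal = that
  interpret e: cline J e by unfold_locales (rule assms)
  interpret a: cline J a by unfold_locales (rule assms)
  obtain s where s: "J a \<bullet> R s e = 0"
  proof (cases "e \<bullet> a = 0 \<and> e \<bullet> J a = 0")
    case True
    then show ?thesis using that[of 0] by (simp add: inner_commute)
  next
    case False
    define m where "m = sqrt ((e \<bullet> a)\<^sup>2 + (e \<bullet> J a)\<^sup>2)"
    have m: "m\<^sup>2 = (e \<bullet> a)\<^sup>2 + (e \<bullet> J a)\<^sup>2" by (simp add: m_def)
    have "m \<noteq> 0" using False by (simp add: m_def)
    then have "((e \<bullet> a) / m)\<^sup>2 + (- (e \<bullet> J a) / m)\<^sup>2 = 1"
      by (simp add: power_divide add_divide_distrib[symmetric] m[symmetric])
    then obtain s where s: "e \<bullet> a / m = cos s" "- (e \<bullet> J a) / m = sin s" by (rule sincos_total_2pi) (rule that)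
    have "J a \<bullet> R s e = cos s * (e \<bullet> J a) + sin s * (e \<bullet> a)"
      by (simp add: R_def inner_add_right inner_commute)
    also have "\<dots> = 0" unfolding s[symmetric] by simp
    finally show ?thesis by (rule that)
  qed
  define b where "b = R s e"
  have nb: "norm b = 1" using assms by (simp add: b_def)
  have bb: "b \<bullet> b = 1" using nb by (simp add: norm_eq_1)
  have Pb: "e.P x = (x \<bullet> b) *\<^sub>R b + (x \<bullet> J b) *\<^sub>R J b" for x
  proof -
    have Jb: "J b = cos s *\<^sub>R J e - sin s *\<^sub>R e" by (simp add: b_def R_def J_add J_scale)
    have bs: "b = cos s *\<^sub>R e + sin s *\<^sub>R J e" by (simp add: b_def R_def)
    define p q where "p = x \<bullet> e" and "q = x \<bullet> J e"
    have xb: "x \<bullet> b = cos s * p + sin s * q" "x \<bullet> J b = cos s * q - sin s * p"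
      unfolding Jb unfolding bs p_def q_def by (simp_all add: inner_add_right inner_diff_right)
    have "(x \<bullet> b) *\<^sub>R b + (x \<bullet> J b) *\<^sub>R J b =
      ((cos s * p + sin s * q) * cos s - (cos s * q - sin s * p) * sin s) *\<^sub>R e +
      ((cos s * p + sin s * q) * sin s + (cos s * q - sin s * p) * cos s) *\<^sub>R J e"
      unfolding xb unfolding Jb unfolding bs by (simp add: algebra_simps)
    also have "(cos s * p + sin s * q) * cos s - (cos s * q - sin s * p) * sin s = p * ((sin s)\<^sup>2 + (cos s)\<^sup>2)" by algebra
    also have "(cos s * p + sin s * q) * sin s + (cos s * q - sin s * p) * cos s = q * ((sin s)\<^sup>2 + (cos s)\<^sup>2)" by algebra
    finally show ?thesis by (simp add: e.P_def p_def q_def)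
  qed
  \<comment> \<open>By \<open>Pb\<close> the line through \<open>e\<close> is also the line through
    its rotate \<open>b\<close>, so it is enough that \<open>U\<close> sends \<open>b\<close> to
    \<open>a\<close>.\<close>
  have fin: thesis if U: "linear U" "\<And>x. U (J x) = J (U x)" "\<And>x y. U x \<bullet> U y = x \<bullet> y" "\<And>x. U (U x) = x" "U b = a" for U
  proof (rule goal[OF U(1-4)])
    fix x
    have "U (e.P x) = (U x \<bullet> U b) *\<^sub>R U b + (U x \<bullet> U (J b)) *\<^sub>R U (J b)"
      unfolding Pb linear_add[OF U(1)] linear_scale[OF U(1)] U(3) ..
    then have "U (e.N x) = a.N (U x)"
      unfolding e.N_def a.N_def linear_diff[OF U(1)] by (simp add: U(2,5) a.P_def)
    moreover have "norm (U (e.N x)) = norm (e.N x)" unfolding norm_eq_sqrt_inner U(3) ..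
    ultimately show "norm (e.N x) = norm (a.N (U x))" by metis
  qed
  show thesis
  proof (cases "b = a")
    case True
    then show ?thesis by (intro fin[of "\<lambda>x. x"]) (auto intro: linear_ident)
  next
    case False
    define v where "v = b - a"
    have nv: "norm v \<noteq> 0" using False by (simp add: v_def)
    define f where "f = v /\<^sub>R norm v"
    have "norm f = 1" using nv by (simp add: f_def)
    then interpret f: cline J f by unfold_locales
    define U where "U x = f.N x - f.P x" for x
    have l: "linear U" unfolding U_def[abs_def] by (rule linear_compose_sub[OF f.N_linear f.P_linear])
    have PN: "f.P x \<bullet> f.N y = 0" "f.N y \<bullet> f.P x = 0" for x y
      using f.P_adj[of x "f.N y"] by (simp_all add: inner_commute)
    have NN: "f.N (f.N x) = f.N x" "f.N (f.P x) = 0" for x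
      unfolding f.N_def[of "f.N x"] f.N_def[of "f.P x"] by simp_all
    show ?thesis
    proof (rule fin[OF l])
      show "U (J x) = J (U x)" for x by (simp add: U_def f.N_J f.P_J J_diff)
      show "U x \<bullet> U y = x \<bullet> y" for x y
      proof -
        have "x \<bullet> y = (f.P x + f.N x) \<bullet> (f.P y + f.N y)" unfolding f.P_add_N ..
        then show ?thesis by (simp add: U_def inner_add_left inner_add_right inner_diff_left inner_diff_right PN)
      qed
      show "U (U x) = x" for x
        unfolding U_def linear_diff[OF f.N_linear] linear_diff[OF f.P_linear] using f.P_add_N[of x] by (simp add: NN add.commute[of "f.N x"])
      show "U b = a"
      proof -
        have bv: "b \<bullet> v = 1 - b \<bullet> a" by (simp add: v_def inner_diff_right bb)
        have vv: "norm v * norm v = 2 * (1 - b \<bullet> a)"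
          using bb a.norm_e by (simp add: power2_eq_square[symmetric] power2_norm_eq_inner v_def inner_diff_left inner_diff_right inner_commute norm_eq_1)
        have "b \<bullet> J v = 0" using s by (simp add: v_def J_diff inner_diff_right b_def[symmetric] inner_commute)
        then have "f.P b = ((b \<bullet> v) / (norm v * norm v)) *\<^sub>R v"
          unfolding f.P_def unfolding f_def J_scale by (simp add: divide_inverse mult_ac)
        also have "(b \<bullet> v) / (norm v * norm v) = 1 / 2" unfolding bv using vv nv by (simp add: field_simps)
        finally have "f.P b = (1 / 2) *\<^sub>R v" .
        then have "U b = b - ((1 / 2) *\<^sub>R v + (1 / 2) *\<^sub>R v)" by (simp add: U_def f.N_def)
        also have "(1 / 2) *\<^sub>R v + (1 / 2) *\<^sub>R v = v" by (simp add: scaleR_left_distrib[symmetric])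
        finally show ?thesis by (simp add: v_def)
      qed
    qed
  qed
qed

end

section \<open>Ellipsoids and capacities\<close>

text \<open>The pair \<open>(h, j)\<close> is encoded as \<open>h * w j * n\<close> plus the index of \<open>j\<close>; enumerating the codes in increasing order sorts the
  multiples, with ties broken by the index.\<close>

lemma ordered_multiples_count:
  fixes w :: "'n::finite \<Rightarrow> nat" and u :: real
  assumes w: "\<And>j. 1 \<le> w j" and u: "0 < u" and k: "1 \<le> k"
    and lo: "card {(h, j). 1 \<le> h \<and> h * w j < v} < k" and hi: "k \<le> card {(h, j). 1 \<le> h \<and> h * w j \<le> v}"
  obtains s where "ordered_multiples (\<lambda>j. u * w j) s" "s k = u * v"
proof -
  define n where "n = CARD('n)"
  have n: "0 < n" by (simp add: n_def)
  obtain ix :: "'n \<Rightarrow> nat" where ix: "bij_betw ix UNIV {0..<n}"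
    using ex_bij_betw_finite_nat[of "UNIV :: 'n set"] by (auto simp: n_def)
  have ixn: "ix j < n" for j using bij_betwE[OF ix] by auto
  have ix_inj: "ix i = ix j \<Longrightarrow> i = j" for i j using ix by (auto simp: bij_betw_def inj_def)
  define D :: "(nat \<times> 'n) set" where "D = {1..} \<times> UNIV"
  define code where "code = (\<lambda>(h, j). (h * w j) * n + ix j)"
  have cd: "code (h, j) div n = h * w j" "code (h, j) mod n = ix j" for h j
    using ixn[of j] n by (simp_all add: code_def)
  have inj: "inj_on code D"
  proof (rule inj_onI, clarify)
    fix h j h' j' assume "code (h, j) = code (h', j')"
    then have "h * w j = h' * w j'" "ix j = ix j'" by (metis cd)+
    then show "h = h' \<and> j = j'" using ix_inj[of j j'] w[of j'] by auto
  qed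
  define C where "C = code ` D"
  have infD: "infinite D"
    unfolding D_def using finite_cartesian_productD1[of "{1 :: nat..}" "UNIV :: 'n set"] infinite_Ici by auto
  then have inf: "infinite C" unfolding C_def using finite_image_iff[OF inj] by simp
  define en where "en = enumerate C"
  have en_bij: "bij_betw en UNIV C" unfolding en_def by (rule bij_enumerate[OF inf])
  have en_less: "en i < en j" if "i < j" for i j unfolding en_def by (rule enumerate_mono[OF that inf])
  have en_less_iff: "en i < en j \<longleftrightarrow> i < j" for i j using en_less by (metis linorder_neqE_nat order_less_asym)
  \<comment> \<open>\<open>enumerate\<close> starts at index 0 and \<open>ordered_multiples\<close>
    at 1, hence the shift by one throughout.\<close>
  have pred: "bij_betw (\<lambda>k :: nat. k - 1) {1..} UNIV" by (rule bij_betw_byWitness[where f' = Suc]) auto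
  define e where "e k = inv_into D code (en (k - 1))" for k
  have "bij_betw (inv_into D code) C D" unfolding C_def by (rule bij_betw_inv_into[OF inj_on_imp_bij_betw[OF inj]])
  from bij_betw_trans[OF pred bij_betw_trans[OF en_bij this]]
  have e: "bij_betw e {1..} ({1..} \<times> UNIV)" unfolding e_def[abs_def] D_def[symmetric] by (simp add: o_def)
  have code_e: "code (e k) = en (k - 1)" for k
  proof -
    have "en (k - 1) \<in> code ` D" using bij_betwE[OF en_bij] by (auto simp: C_def)
    then show ?thesis unfolding e_def by (rule f_inv_into_f)
  qed
  define s where "s k = u * real (en (k - 1) div n)" for k
  have om: "ordered_multiples (\<lambda>j. u * w j) s"
    unfolding ordered_multiples_def
  proof (intro conjI exI[of _ e] e allI impI)
    show "mono_on {1..} s"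
    proof (rule mono_onI)
      fix i j :: nat assume "i \<le> j"
      then have "i - 1 \<le> j - 1" by (rule diff_le_mono)
      then have "en (i - 1) \<le> en (j - 1)" using en_less[of "i - 1" "j - 1"] by (cases "i - 1 = j - 1") auto
      then show "s i \<le> s j" unfolding s_def using u by (simp add: div_le_mono)
    qed
    fix k :: nat
    have "en (k - 1) div n = fst (e k) * w (snd (e k))" using cd(1)[of "fst (e k)" "snd (e k)"] code_e[of k] by simp
    then show "s k = real (fst (e k)) * (u * real (w (snd (e k))))" by (simp add: s_def)
  qed
  let ?V = "\<lambda>x. x div n"
  have image_le: "card {x \<in> C. P (?V x)} = card {(h, j). 1 \<le> h \<and> P (h * w j)}" for P
  proof -
    have "{x \<in> C. P (?V x)} = code ` {(h, j). 1 \<le> h \<and> P (h * w j)}" by (auto simp: C_def D_def cd)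
    moreover have "inj_on code {(h, j). 1 \<le> h \<and> P (h * w j)}" by (rule inj_on_subset[OF inj]) (auto simp: D_def)
    ultimately show ?thesis by (simp add: card_image)
  qed
  have en_inj: "inj_on en A" for A using en_bij by (auto simp: bij_betw_def intro: inj_on_subset)
  have fin: "finite {x \<in> C. ?V x < m}" for m
    by (rule finite_subset[of _ "{..< m * n}"]) (auto simp: div_less_iff_less_mult[OF n])
  \<comment> \<open>The codes increase, so the first \<open>k\<close> of them have at most the value
    of the \<open>k\<close>-th. If that were below \<open>v\<close>, \<open>lo\<close> would fail;
    if it were above, fewer than \<open>k\<close> codes could have a value of at most
    \<open>v\<close>, against \<open>hi\<close>.\<close>
  have "?V (en (k - 1)) = v"
  proof (rule ccontr)
    assume "?V (en (k - 1)) \<noteq> v"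
    then consider "?V (en (k - 1)) < v" | "v < ?V (en (k - 1))" by linarith
    then show False
    proof cases
      case 1
      have "en ` {..k - 1} \<subseteq> {x \<in> C. ?V x < v}"
      proof clarify
        fix i assume "i \<le> k - 1"
        then have "en i \<le> en (k - 1)" using en_less[of i "k - 1"] by (cases "i = k - 1") auto
        then have "?V (en i) \<le> ?V (en (k - 1))" by (rule div_le_mono)
        then show "en i \<in> C \<and> ?V (en i) < v" using 1 bij_betwE[OF en_bij] by auto
      qed
      from card_mono[OF fin this] have "k \<le> card {x \<in> C. ?V x < v}" using k by (simp add: card_image[OF en_inj])
      then show False using lo unfolding image_le[of "\<lambda>y. y < v"] by linarith
    next
      case 2
      have "{x \<in> C. ?V x \<le> v} \<subseteq> en ` {..<k - 1}"
      proof clarify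
        fix x assume x: "x \<in> C" "?V x \<le> v"
        obtain i where i: "x = en i" using en_bij x(1) by (auto simp: bij_betw_def)
        have "\<not> en (k - 1) \<le> x" using 2 x(2) div_le_mono[of "en (k - 1)" x n] by linarith
        then have "i < k - 1" using i en_less_iff by (simp add: not_le)
        then show "x \<in> en ` {..<k - 1}" using i by auto
      qed
      from card_mono[OF _ this] have "card {x \<in> C. ?V x \<le> v} \<le> k - 1" by (simp add: card_image[OF en_inj])
      then show False using hi k unfolding image_le[of "\<lambda>y. y \<le> v"] by linarith
    qed
  qed
  then have "s k = u * v" by (simp add: s_def)
  with om show ?thesis by (rule that)
qed

section \<open>The standard complex structure on \<open>complex^'n\<close>\<close>

definition Ji :: "complex^'n \<Rightarrow> complex^'n" where "Ji z = (\<chi> j. \<i> * z $ j)"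

lemma cplx_Ji: "cplx (Ji :: complex^'n \<Rightarrow> complex^'n)"
proof (rule cplx.intro)
  show "linear (Ji :: complex^'n \<Rightarrow> complex^'n)"
    by (rule linearI) (simp_all add: Ji_def vec_eq_iff algebra_simps)
  show "Ji (Ji x) = - x" for x :: "complex^'n" by (simp add: Ji_def vec_eq_iff)
  show "Ji x \<bullet> Ji y = x \<bullet> y" for x y :: "complex^'n"
    by (simp add: Ji_def inner_vec_def inner_complex_def add.commute)
qed

lemma omega0_Ji: "omega0 v w = Ji v \<bullet> w"
  by (simp add: omega0_def Ji_def inner_vec_def inner_complex_def algebra_simps)

lemma norm_sq_vec: "(norm (z :: complex^'n))\<^sup>2 = (\<Sum>j\<in>UNIV. (cmod (z $ j))\<^sup>2)"
  unfolding power2_norm_eq_inner inner_vec_def by (simp add: dot_square_norm)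

lemma ellipsoid_std:
  fixes a :: "'n::finite \<Rightarrow> real"
  assumes a: "\<And>j. 0 < a j" and U: "linear U" "\<And>x. U (U x) = x"
  shows "ellipsoid (U ` std_ellipsoid a)"
proof -
  define D :: "complex^'n \<Rightarrow> complex^'n" where "D z = (\<chi> j. sqrt (a j / pi) *\<^sub>R z $ j)" for z
  define D' :: "complex^'n \<Rightarrow> complex^'n" where "D' z = (\<chi> j. sqrt (pi / a j) *\<^sub>R z $ j)" for z
  have sq: "sqrt (a j / pi) * sqrt (pi / a j) = 1" for j
    using a[of j] by (simp add: real_sqrt_mult[symmetric])
  have DD: "D' (D z) = z" "D (D' z) = z" for z
    using sq by (simp_all add: D_def D'_def vec_eq_iff mult.commute)
  have l: "linear D" by (rule linearI) (simp_all add: D_def vec_eq_iff algebra_simps)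
  have "bij D" by (rule bij_betw_byWitness[where f' = D']) (auto simp: DD)
  have "bij U" by (rule bij_betw_byWitness[where f' = U]) (auto simp: U)
  have "std_ellipsoid a = D ` ball 0 1"
  proof -
    have *: "z \<in> std_ellipsoid a \<longleftrightarrow> D' z \<in> ball 0 1" for z
    proof -
      have "(norm (D' z))\<^sup>2 = (\<Sum>j\<in>UNIV. pi / a j * (cmod (z $ j))\<^sup>2)"
        unfolding norm_sq_vec by (rule sum.cong) (use a in \<open>simp_all add: D'_def power_mult_distrib less_imp_le\<close>)
      moreover have "norm (D' z) < 1 \<longleftrightarrow> (norm (D' z))\<^sup>2 < 1" by (simp add: abs_square_less_1)
      ultimately show ?thesis by (simp add: std_ellipsoid_def)
    qed
    show ?thesis
    proof (intro equalityI subsetI)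
      fix z assume "z \<in> std_ellipsoid a"
      then have "z = D (D' z)" "D' z \<in> ball 0 1" using * DD by simp_all
      then show "z \<in> D ` ball 0 1" by (rule image_eqI)
    next
      fix z assume "z \<in> D ` ball 0 1" then show "z \<in> std_ellipsoid a" using * DD by auto
    qed
  qed
  then have "U ` std_ellipsoid a = (U \<circ> D) ` ball 0 1" by (simp add: image_comp)
  moreover have "linear (U \<circ> D)" by (rule linear_compose[OF l U(1)])
  moreover have "bij (U \<circ> D)" by (rule bij_comp[OF \<open>bij D\<close> \<open>bij U\<close>])
  ultimately show ?thesis unfolding ellipsoid_def by blast
qed

lemma symplectomorphismI:
  fixes F F' :: "complex^'n \<Rightarrow> complex^'n"
  assumes F: "Cinf UNIV F" "Cinf UNIV F'" "\<And>y. F' (F y) = y" "\<And>y. F (F' y) = y"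
    and s: "\<And>y a b. Ji (dd F y a) \<bullet> dd F y b = Ji a \<bullet> b"
  shows "symplectomorphism F"
proof -
  have b: "bij F" by (rule bij_betw_byWitness[where f' = F']) (auto simp: F)
  have "inv F = F'" by (rule inv_equality) (auto simp: F)
  then show ?thesis
    unfolding symplectomorphism_def diffeomorphism_def smooth_on_iff_Cinf[OF open_UNIV] omega0_Ji
    using b F s by simp
qed

lemma symplectomorphism_inverse:
  fixes F F' :: "complex^'n \<Rightarrow> complex^'n"
  assumes F: "Cinf UNIV F" "Cinf UNIV F'" "\<And>y. F' (F y) = y" "\<And>y. F (F' y) = y"
    and s: "\<And>y a b. Ji (dd F y a) \<bullet> dd F y b = Ji a \<bullet> b"
  shows "symplectomorphism F'"
proof (rule symplectomorphismI[OF F(2,1,4,3)])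
  fix y a b
  have "((\<lambda>y. F (F' y)) has_derivative (\<lambda>v. dd F (F' y) (dd F' y v))) (at y)"
    by (rule has_derivative_compose[OF Cinf_has_derivative[OF F(2) UNIV_I] Cinf_has_derivative[OF F(1) UNIV_I]])
  then have "((\<lambda>y. y) has_derivative (\<lambda>v. dd F (F' y) (dd F' y v))) (at y)" by (simp add: F)
  from fun_cong[OF has_derivative_unique[OF this has_derivative_ident]]
  have "dd F (F' y) (dd F' y v) = v" for v .
  then show "Ji (dd F' y a) \<bullet> dd F' y b = Ji a \<bullet> b" using s[of "F' y" "dd F' y a" "dd F' y b"] by simp
qed

text \<open>Near the origin, where the radial extension is in general discontinuous, openness comes
  from its positive minimum on the sphere.\<close>

lemma open_radial_domain:
  fixes g :: "'a::euclidean_space \<Rightarrow> real"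
  assumes g: "smooth_positive_on_sphere g"
  shows "open (radial_domain g)"
proof -
  have o: "open (- {0 :: 'a})" by (rule open_Compl[OF closed_singleton])
  have "Cinf (- {0}) (radial_ext g)"
    using g smooth_on_iff_Cinf[OF o] unfolding smooth_positive_on_sphere_def by blast
  then have c: "continuous_on (- {0}) (radial_ext g)" by (rule Cinf_continuous)
  obtain b :: 'a where b: "b \<in> Basis" using nonempty_Basis by blast
  have "continuous_on (sphere 0 1) (radial_ext g)" by (rule continuous_on_subset[OF c]) auto
  moreover have "sphere (0 :: 'a) 1 \<noteq> {}" using b by (auto intro!: exI[of _ b])
  ultimately obtain z where z: "z \<in> sphere 0 1" "\<forall>y\<in>sphere 0 1. radial_ext g z \<le> radial_ext g y"
    using continuous_attains_inf[OF compact_sphere] by blast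
  define m where "m = radial_ext g z"
  have m: "0 < m" using z g unfolding m_def smooth_positive_on_sphere_def radial_ext_def by simp
  have le: "m \<le> radial_ext g x" if "x \<noteq> 0" for x
    using z(2)[rule_format, of "x /\<^sub>R norm x"] that radial_ext_scale[of "inverse (norm x)" g x] by (simp add: m_def)
  have "open {x \<in> - {0}. 0 < radial_ext g x - norm x}"
    using continuous_open_preimage[OF continuous_on_diff[OF c continuous_on_norm_id] o open_greaterThan, of 0]
    by (simp add: vimage_def Int_def)
  moreover have "radial_domain g = ball 0 m \<union> {x \<in> - {0}. 0 < radial_ext g x - norm x}"
    using le m by (fastforce simp: mem_radial_domain[OF g])
  ultimately show ?thesis by (metis open_Un open_ball)
qed

lemma axis_N:
  fixes z :: "complex^'n"
  shows "cline Ji (axis j 1 :: complex^'n)"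
    and "(norm (cline.N Ji (axis j 1) z))\<^sup>2 = (norm z)\<^sup>2 - (cmod (z $ j))\<^sup>2"
proof -
  show 1: "cline Ji (axis j 1 :: complex^'n)" 
    by (rule cline.intro[OF cplx_Ji cline_axioms.intro]) simp
  interpret cline Ji "axis j 1 :: complex^'n" by (rule 1)
  have J: "Ji (axis j 1) = axis j \<i>" by (simp add: Ji_def axis_def vec_eq_iff)
  have i: "z \<bullet> axis j x = z $ j \<bullet> x" for x by (simp add: inner_axis)
  have "(norm (P z))\<^sup>2 = P z \<bullet> z"
    unfolding power2_norm_eq_inner by (metis P_P P_adj)
  also have "\<dots> = (z \<bullet> axis j 1)\<^sup>2 + (z \<bullet> axis j \<i>)\<^sup>2"
    by (simp add: P_def J inner_add_left inner_add_right inner_commute[of _ z] power2_eq_square del: inner_axis)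
  also have "\<dots> = (Re (z $ j))\<^sup>2 + (Im (z $ j))\<^sup>2"
    unfolding i by (simp add: inner_complex_def)
  finally show "(norm (N z))\<^sup>2 = (norm z)\<^sup>2 - (cmod (z $ j))\<^sup>2"
    using norm_P_N[of z] by (simp add: cmod_power2)
qed

section \<open>Values of the ball and of the ellipsoid of the normal form\<close>

lemma ball_value:
  fixes c :: "(complex^'n) set \<Rightarrow> ennreal"
  assumes c: "normalized CARD('n) c" and k: "0 < k"
  shows "c (ball 0 (sqrt k)) = ennreal (pi * k)"
proof -
  let ?a = "\<lambda>j :: 'n. pi * k * real 1"
  have "z \<in> ball 0 (sqrt k) \<longleftrightarrow> z \<in> std_ellipsoid ?a" for z :: "complex^'n"
  proof -
    have "(\<Sum>j\<in>UNIV. pi / ?a j * (cmod (z $ j))\<^sup>2) = (norm z)\<^sup>2 / k"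
      using k by (simp add: norm_sq_vec sum_divide_distrib)
    moreover have "norm z < sqrt k \<longleftrightarrow> (norm z)\<^sup>2 < k"
      using real_sqrt_less_iff[of "(norm z)\<^sup>2" k] by simp
    ultimately show ?thesis using k by (simp add: std_ellipsoid_def divide_less_eq)
  qed
  then have e: "ball 0 (sqrt k) = std_ellipsoid ?a" by blast
  have a: "0 < ?a j" for j using k by simp
  have "ellipsoid ((\<lambda>x. x) ` std_ellipsoid ?a)" by (rule ellipsoid_std[OF a linear_ident]) simp
  then have ell: "ellipsoid (std_ellipsoid ?a)" by simp
  \<comment> \<open>All weights are equal, so the \<open>n\<close> pairs with \<open>h = 1\<close>
    share the smallest value and the \<open>n\<close>-th entry is still
    \<open>pi * k\<close>.\<close>
  have "{(h :: nat, j :: 'n). 1 \<le> h \<and> h * 1 < 1} = {}" by auto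
  then have lo: "card {(h :: nat, j :: 'n). 1 \<le> h \<and> h * 1 < 1} < CARD('n)" by (simp only: card.empty zero_less_card_finite)
  have "{(h :: nat, j :: 'n). 1 \<le> h \<and> h * 1 \<le> 1} = {1} \<times> UNIV" by auto
  then have hi: "CARD('n) \<le> card {(h :: nat, j :: 'n). 1 \<le> h \<and> h * 1 \<le> 1}" by (simp only: card_cartesian_product) simp
  obtain s where s: "ordered_multiples ?a s" "s CARD('n) = pi * k * real 1"
    by (rule ordered_multiples_count[OF _ _ _ lo hi, of "pi * k"]) (use k in \<open>auto simp: Suc_le_eq\<close>)
  have "linear_symplectic (\<lambda>x :: complex^'n. x)" by (simp add: linear_symplectic_def linear_ident)
  then have "linearly_symplectically_equivalent (std_ellipsoid ?a) (std_ellipsoid ?a)"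
    unfolding linearly_symplectically_equivalent_def by (intro exI[of _ "\<lambda>x. x"]) simp
  then have "ellipsoid_value CARD('n) (std_ellipsoid ?a) (pi * k)"
    unfolding ellipsoid_value_def using a s by (intro exI[of _ ?a] exI[of _ s]) auto
  then show ?thesis using c ell unfolding normalized_def e by blast
qed

lemma weighted_ellipsoid:
  fixes c :: "(complex^'n) set \<Rightarrow> ennreal" and U :: "complex^'n \<Rightarrow> complex^'n" and j0 :: 'n
  assumes k: "0 < k"
    and U: "linear U" "\<And>x. U (Ji x) = Ji (U x)" "\<And>x y. U x \<bullet> U y = x \<bullet> y" "\<And>x. U (U x) = x"
  defines "E \<equiv> {y. (norm y)\<^sup>2 + (norm (cline.N Ji (axis j0 1) (U y)))\<^sup>2 < k}"
  shows "ellipsoid E" "normalized CARD('n) c \<Longrightarrow> c E = ennreal (pi * k)"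
proof -
  \<comment> \<open>In units of \<open>pi * k / 2\<close> the weight of the distinguished axis is 2
    and the others are 1. Values below 2 come only from the \<open>n - 1\<close> pairs with
    \<open>h = 1\<close> off that axis, while all \<open>n\<close> pairs with \<open>h = 1\<close>
    have values of at most 2.\<close>
  define w :: "'n \<Rightarrow> nat" where "w j = (if j = j0 then 2 else 1)" for j
  let ?a = "\<lambda>j. pi * k / 2 * real (w j)"
  have w1: "1 \<le> w j" for j by (simp add: w_def)
  have a: "0 < ?a j" for j using k w1[of j] by simp
  have std: "z \<in> std_ellipsoid ?a \<longleftrightarrow> 2 * (norm z)\<^sup>2 - (cmod (z $ j0))\<^sup>2 < k" for z
  proof -
    have "pi / ?a j * (cmod (z $ j))\<^sup>2 = (2 * (cmod (z $ j))\<^sup>2 - (if j = j0 then (cmod (z $ j))\<^sup>2 else 0)) / k" for j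
      using k by (simp add: w_def field_simps)
    then have "(\<Sum>j\<in>UNIV. pi / ?a j * (cmod (z $ j))\<^sup>2) = (2 * (norm z)\<^sup>2 - (cmod (z $ j0))\<^sup>2) / k"
      by (simp add: norm_sq_vec sum_divide_distrib[symmetric] sum_subtractf sum_distrib_left)
    then show ?thesis using k by (simp add: std_ellipsoid_def divide_less_eq)
  qed
  have nU: "norm (U y) = norm y" for y unfolding norm_eq_sqrt_inner U(3) ..
  have "y \<in> E \<longleftrightarrow> U y \<in> std_ellipsoid ?a" for y unfolding std E_def by (simp add: axis_N nU)
  note mem = this
  have UE: "E = U ` std_ellipsoid ?a"
  proof (intro equalityI subsetI)
    show "y \<in> U ` std_ellipsoid ?a" if "y \<in> E" for y using that mem[of y] image_eqI[of y U "U y"] by (simp add: U(4))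
    show "y \<in> E" if "y \<in> U ` std_ellipsoid ?a" for y using that by (auto simp: mem U(4))
  qed
  have UE': "U ` E = std_ellipsoid ?a" unfolding UE image_image U(4) by simp
  show ell: "ellipsoid E" unfolding UE by (rule ellipsoid_std[OF a U(1,4)])
  have f1: "finite ({1 :: nat} \<times> (UNIV - {j0}))" by simp
  have "{(h, j). 1 \<le> h \<and> h * w j < 2} \<subseteq> {1} \<times> (UNIV - {j0})" by (auto simp: w_def split: if_splits)
  from card_mono[OF f1 this] have "card {(h, j). 1 \<le> h \<and> h * w j < 2} \<le> CARD('n) - 1" by (simp add: card_Diff_singleton)
  then have lo: "card {(h, j). 1 \<le> h \<and> h * w j < 2} < CARD('n)"
    using zero_less_card_finite[where 'a = 'n] by linarith
  have "{(h, j). 1 \<le> h \<and> h * w j \<le> 2} \<subseteq> {1..2} \<times> UNIV" by (auto simp: w_def split: if_splits)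
  then have f2: "finite {(h, j). 1 \<le> h \<and> h * w j \<le> 2}" by (rule finite_subset) simp
  have "{1} \<times> UNIV \<subseteq> {(h, j). 1 \<le> h \<and> h * w j \<le> 2}" by (auto simp: w_def)
  from card_mono[OF f2 this] have hi: "CARD('n) \<le> card {(h, j). 1 \<le> h \<and> h * w j \<le> 2}" by simp
  obtain s where s: "ordered_multiples ?a s" "s CARD('n) = pi * k / 2 * real 2"
    by (rule ordered_multiples_count[OF w1 _ _ lo hi, of "pi * k / 2"]) (use k in \<open>auto simp: Suc_le_eq\<close>)
  have "linear_symplectic U" unfolding linear_symplectic_def omega0_Ji U(2)[symmetric] U(3) using U(1) by simp
  then have "linearly_symplectically_equivalent E (std_ellipsoid ?a)"
    unfolding linearly_symplectically_equivalent_def using UE' by blast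
  then have "ellipsoid_value CARD('n) E (pi * k)"
    unfolding ellipsoid_value_def using a s by (intro exI[of _ ?a] exI[of _ s]) auto
  then show "c E = ennreal (pi * k)" if "normalized CARD('n) c" using that ell unfolding normalized_def by blast
qed

text \<open>Monotonicity squeezes the capacity of the domain between those of the ellipsoid and of
  the ball, both equal to \<open>pi * k\<close>. The number \<open>k\<close>, the ellipsoid and the
  two maps are found before any capacity is considered.\<close>

lemma capacity_near_ball:
  obtains d where "0 < d" "\<And>g :: complex^'n \<Rightarrow> real. smooth_positive_on_sphere g \<Longrightarrow> Ck_dist 2 (\<lambda>_. 1) g < d \<Longrightarrow>
    \<exists>k E \<phi> \<psi>. 0 < k \<and> ellipsoid E \<and> symplectomorphism \<phi> \<and> \<phi> ` E \<subseteq> radial_domain g \<and>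
      symplectomorphism \<psi> \<and> \<psi> ` radial_domain g \<subseteq> ball 0 (sqrt k) \<and>
      (\<forall>c. symplectic_capacity c \<and> normalized CARD('n) c \<longrightarrow>
        c E = ennreal (pi * k) \<and> c (ball 0 (sqrt k)) = ennreal (pi * k) \<and> c (radial_domain g) = ennreal (pi * k))"
proof -
  obtain d where d: "0 < d" "\<And>g :: complex^'n \<Rightarrow> real. smooth_positive_on_sphere g \<Longrightarrow> Ck_dist 2 (\<lambda>_. 1) g < d \<Longrightarrow>
    \<exists>c (e :: complex^'n) F F'. 0 < c \<and> cline Ji e \<and> Cinf UNIV F \<and> Cinf UNIV F' \<and> (\<forall>y. F' (F y) = y) \<and> (\<forall>y. F (F' y) = y) \<and>
      (\<forall>y a b. Ji (dd F y a) \<bullet> dd F y b = Ji a \<bullet> b) \<and>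
      (\<forall>y. (norm y)\<^sup>2 + (norm (cline.N Ji e y))\<^sup>2 < c \<longrightarrow> F y \<in> radial_domain g) \<and>
      (\<forall>x\<in>radial_domain g. (norm (F' x))\<^sup>2 < c)"
    by (rule cplx.near_ball_normal_form[OF cplx_Ji]) (rule that)
  show ?thesis
  proof (rule that[OF d(1)])
    fix g :: "complex^'n \<Rightarrow> real"
    assume g: "smooth_positive_on_sphere g" "Ck_dist 2 (\<lambda>_. 1) g < d"
    obtain k and e :: "complex^'n" and F F' where k: "0 < k" and e: "cline Ji e" and F: "Cinf UNIV F" "Cinf UNIV F'" "\<And>y. F' (F y) = y" "\<And>y. F (F' y) = y"
      and sF: "\<And>y a b. Ji (dd F y a) \<bullet> dd F y b = Ji a \<bullet> b"
      and i: "\<And>y. (norm y)\<^sup>2 + (norm (cline.N Ji e y))\<^sup>2 < k \<Longrightarrow> F y \<in> radial_domain g"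
      and ii: "\<And>x. x \<in> radial_domain g \<Longrightarrow> (norm (F' x))\<^sup>2 < k"
      using d(2)[OF g] by blast
    \<comment> \<open>Any fixed axis serves as the target of the unitary map.\<close>
    define j0 :: 'n where "j0 = undefined"
    have ne: "norm e = 1" using e by (rule cline.norm_e)
    have na: "norm (axis j0 1 :: complex^'n) = 1" by simp
    obtain U :: "complex^'n \<Rightarrow> complex^'n" where U: "linear U" "\<And>x. U (Ji x) = Ji (U x)" "\<And>x y. U x \<bullet> U y = x \<bullet> y" "\<And>x. U (U x) = x"
      and UN: "\<And>x. norm (cline.N Ji e x) = norm (cline.N Ji (axis j0 1) (U x))"
      by (rule cplx.unitary_to[OF cplx_Ji ne na]) (rule that)
    define E where "E = {y. (norm y)\<^sup>2 + (norm (cline.N Ji (axis j0 1) (U y)))\<^sup>2 < k}"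
    have s1: "symplectomorphism F" by (rule symplectomorphismI[OF F sF])
    have s2: "symplectomorphism F'" by (rule symplectomorphism_inverse[OF F sF])
    have FE: "F ` E \<subseteq> radial_domain g" using i by (auto simp: E_def UN)
    have FB: "F' ` radial_domain g \<subseteq> ball 0 (sqrt k)"
    proof clarify
      fix x assume "x \<in> radial_domain g"
      from ii[OF this] have "sqrt ((norm (F' x))\<^sup>2) < sqrt k" by (simp only: real_sqrt_less_iff)
      then show "F' x \<in> ball 0 (sqrt k)" by simp
    qed
    have oA: "open (radial_domain g)" by (rule open_radial_domain[OF g(1)])
    have oE: "open E"
    proof -
      have "bounded_linear (\<lambda>y. cline.N Ji (axis j0 1) (U y))"
        using linear_compose[OF U(1) cline.N_linear[OF axis_N(1)]] by (simp add: o_def linear_conv_bounded_linear)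
      then have "continuous_on UNIV (\<lambda>y. cline.N Ji (axis j0 1) (U y))" by (rule linear_continuous_on)
      then show ?thesis unfolding E_def by (intro open_Collect_less continuous_intros)
    qed
    have val: "c E = ennreal (pi * k) \<and> c (ball 0 (sqrt k)) = ennreal (pi * k) \<and> c (radial_domain g) = ennreal (pi * k)"
      if c: "symplectic_capacity c" "normalized CARD('n) c" for c
    proof -
      have cE: "c E = ennreal (pi * k)" unfolding E_def by (rule weighted_ellipsoid(2)[OF k U c(2)])
      have cB: "c (ball 0 (sqrt k)) = ennreal (pi * k)" by (rule ball_value[OF c(2) k])
      have mono: "c A \<le> c A'" if "open A" "open A'" "symplectomorphism \<phi>" "\<phi> ` A \<subseteq> A'" for A A' \<phi>
        using c(1) that unfolding symplectic_capacity_def by blast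
      have "c E \<le> c (radial_domain g)" by (rule mono[OF oE oA s1 FE])
      moreover have "c (radial_domain g) \<le> c (ball 0 (sqrt k))" by (rule mono[OF oA open_ball s2 FB])
      ultimately show ?thesis using cE cB by simp
    qed
    have "ellipsoid E"
      unfolding E_def by (rule weighted_ellipsoid(1)[OF k U])
    show "\<exists>k E \<phi> \<psi>. 0 < k \<and> ellipsoid E \<and> symplectomorphism \<phi> \<and> \<phi> ` E \<subseteq> radial_domain g \<and>
      symplectomorphism \<psi> \<and> \<psi> ` radial_domain g \<subseteq> ball 0 (sqrt k) \<and>
      (\<forall>c. symplectic_capacity c \<and> normalized CARD('n) c \<longrightarrow>
        c E = ennreal (pi * k) \<and> c (ball 0 (sqrt k)) = ennreal (pi * k) \<and> c (radial_domain g) = ennreal (pi * k))"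
      using k \<open>ellipsoid E\<close> s1 FE s2 FB val by blast
  qed
qed

theorem theorem2:
  shows "\<exists>\<B> :: (complex^'n) set set. Ck_neighborhood 2 (ball 0 1) \<B> \<and>
    (\<forall>A\<in>\<B>. \<forall>c. symplectic_capacity c \<and> normalized CARD('n) c \<longrightarrow>
      (\<exists>E \<phi>. ellipsoid E \<and> c E = c A \<and> symplectomorphism \<phi> \<and> \<phi> ` E \<subseteq> A) \<and>
      (\<exists>\<psi> r. r > 0 \<and> symplectomorphism \<psi> \<and> \<psi> ` A \<subseteq> ball 0 r \<and> c (ball 0 r) = c A)) \<and>
    (\<forall>A\<in>\<B>. \<forall>c c'. symplectic_capacity c \<and> normalized CARD('n) c \<and>
      symplectic_capacity c' \<and> normalized CARD('n) c' \<longrightarrow> c A = c' A)"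
proof -
  obtain d where d: "0 < d" "\<And>g :: complex^'n \<Rightarrow> real. smooth_positive_on_sphere g \<Longrightarrow> Ck_dist 2 (\<lambda>_. 1) g < d \<Longrightarrow>
    \<exists>k E \<phi> \<psi>. 0 < k \<and> ellipsoid E \<and> symplectomorphism \<phi> \<and> \<phi> ` E \<subseteq> radial_domain g \<and>
      symplectomorphism \<psi> \<and> \<psi> ` radial_domain g \<subseteq> ball 0 (sqrt k) \<and>
      (\<forall>c. symplectic_capacity c \<and> normalized CARD('n) c \<longrightarrow>
        c E = ennreal (pi * k) \<and> c (ball 0 (sqrt k)) = ennreal (pi * k) \<and> c (radial_domain g) = ennreal (pi * k))"
    by (rule capacity_near_ball) (rule that)
  define \<B> where "\<B> = {radial_domain g | g :: complex^'n \<Rightarrow> real. smooth_positive_on_sphere g \<and> Ck_dist 2 (\<lambda>_. 1) g < d}"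
  have one: "smooth_positive_on_sphere (\<lambda>_ :: complex^'n. 1)"
  proof -
    have "Cinf (- {0}) (\<lambda>x :: complex^'n. 1 :: real)" by (rule Cinf_const)
    then show ?thesis
      unfolding smooth_positive_on_sphere_def radial_ext_def[abs_def] smooth_on_iff_Cinf[OF open_Compl[OF closed_singleton]] by simp
  qed
  have "x \<in> ball 0 1 \<longleftrightarrow> x \<in> radial_domain (\<lambda>_. 1)" for x :: "complex^'n"
    by (auto simp: mem_radial_domain[OF one] radial_ext_def)
  then have ball: "ball (0 :: complex^'n) 1 = radial_domain (\<lambda>_. 1)" by blast
  have nb: "Ck_neighborhood 2 (ball 0 1) \<B>"
    unfolding Ck_neighborhood_def
  proof (intro conjI)
    show "\<B> \<subseteq> smooth_star_domains" unfolding \<B>_def smooth_star_domains_def by blast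
    show "\<exists>f :: complex^'n \<Rightarrow> real. smooth_positive_on_sphere f \<and> ball 0 1 = radial_domain f \<and>
        (\<exists>\<delta>>0. \<forall>g. smooth_positive_on_sphere g \<and> Ck_dist 2 f g < \<delta> \<longrightarrow> radial_domain g \<in> \<B>)"
      by (intro exI[of _ "\<lambda>_. 1"] conjI exI[of _ d] one ball d(1)) (auto simp: \<B>_def)
  qed
  \<comment> \<open>Since \<open>k\<close> is quantified outside the capacity, the value
    \<open>pi * k\<close> is common to all \<open>n\<close>-normalized capacities, which gives their
    coincidence.\<close>
  have val: "\<exists>k E \<phi> \<psi>. 0 < k \<and> ellipsoid E \<and> symplectomorphism \<phi> \<and> \<phi> ` E \<subseteq> A \<and>
      symplectomorphism \<psi> \<and> \<psi> ` A \<subseteq> ball 0 (sqrt k) \<and>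
      (\<forall>c. symplectic_capacity c \<and> normalized CARD('n) c \<longrightarrow>
        c E = ennreal (pi * k) \<and> c (ball 0 (sqrt k)) = ennreal (pi * k) \<and> c A = ennreal (pi * k))"
    if "A \<in> \<B>" for A
    using that d(2) unfolding \<B>_def by blast
  show ?thesis
  proof (intro exI[of _ \<B>] conjI nb ballI allI impI)
    fix A and c :: "(complex^'n) set \<Rightarrow> ennreal"
    assume A: "A \<in> \<B>" and c: "symplectic_capacity c \<and> normalized CARD('n) c"
    obtain k E \<phi> \<psi> where k: "0 < k" and 1: "ellipsoid E" "symplectomorphism \<phi>" "\<phi> ` E \<subseteq> A"
      and 2: "symplectomorphism \<psi>" "\<psi> ` A \<subseteq> ball 0 (sqrt k)"
      and v: "c E = ennreal (pi * k)" "c (ball 0 (sqrt k)) = ennreal (pi * k)" "c A = ennreal (pi * k)"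
      using val[OF A] c by blast
    show "\<exists>E \<phi>. ellipsoid E \<and> c E = c A \<and> symplectomorphism \<phi> \<and> \<phi> ` E \<subseteq> A"
      using 1 v by metis
    show "\<exists>\<psi> r. r > 0 \<and> symplectomorphism \<psi> \<and> \<psi> ` A \<subseteq> ball 0 r \<and> c (ball 0 r) = c A"
      using 2 v k by (intro exI[of _ \<psi>] exI[of _ "sqrt k"]) simp
  next
    fix A and c c' :: "(complex^'n) set \<Rightarrow> ennreal"
    assume A: "A \<in> \<B>" and c: "symplectic_capacity c \<and> normalized CARD('n) c \<and>
      symplectic_capacity c' \<and> normalized CARD('n) c'"
    show "c A = c' A" using val[OF A] c by metis
  qed
qed

end
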